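(* Assume the setting and assumptions (A1)–(A4) described in the context. For each $x\in V$, the family $\{\mathbb P_x\circ(\mu^{(n)},Q^{(n)})^{-1}\}_{n\ge1}$ of probability measures on $\mathcal M_*$ satisfies a large deviation principle with speed $n$ and good convex rate functional $$I(\mu,Q)=\begin{cases}\int_0^{T_0}I_t(\mu_t,Q_t)\,dt&\text{if }(\mu,Q)\in\Lambda,\\ +\infty&\text{otherwise.}\end{cases}$$ That is, for every closed $\mathcal C\subset\mathcal M_*$ and open $\mathcal G\subset\mathcal M_*$, $\limsup_n\frac1n\log\mathbb P_x((\mu^{(n)},Q^{(n)})\in\mathcal C)\le-\inf_{\mathcal C}I$ and $\liminf_n\frac1n\log\mathbb P_x((\mu^{(n)},Q^{(n)})\in\mathcal G)\ge-\inf_{\mathcal G}I$.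
   Context: Let $V$ be a finite set and $T_0>0$; let $\mathcal S_{T_0}:=\mathbb R/T_0\mathbb Z$ (functions on $\mathcal S_{T_0}$ are identified with $T_0$-periodic functions; $C^1$ refers to the time variable). For $y,z\in V$ let $r(y,z;\cdot):[0,\infty)\to[0,\infty)$ be measurable, locally integrable and $T_0$-periodic, with $r(x,x;t)\equiv0$. Let $E$ be the set of ordered pairs $(y,z)$, $y\ne z$, with $r(y,z;t)>0$ for all $t>0$. Assumptions: (A1) if $r(y,z;t)>0$ for some $t>0$ then $r(y,z;t)>0$ for all $t>0$; (A2) the directed graph $(V,E)$ is strongly connected; (A3) $\max_{(y,z)\in E}\sup_{t\in[0,T_0]}r(y,z;t)<\infty$ and $\min_{(y,z)\in E}\inf_{t\in[0,T_0]}r(y,z;t)>0$; (A4) the set of points of $\mathcal S_{T_0}$ at which some map $t\mapsto r(y,z;t)$ is discontinuous has Lebesgue measure zero. $(\xi_t)_{t\ge0}$ is the time-inhomogeneous continuous-time Markov chain on $V$ with càdlàg paths and jump rate $r(y,z;t)$ from $y$ to $z$ at time $t$; $\mathbb P_x$ is its law when $\xi_0=x$. $\mathcal M_*:=\mathcal M_{+,T_0}(V\times\mathcal S_{T_0})\times\mathcal M_+(E\times\mathcal S_{T_0})$, where the first factor is the set of nonnegative measures on $V\times\mathcal S_{T_0}$ of total mass $T_0$ and the second the finite nonnegative measures on $E\times\mathcal S_{T_0}$, both with the weak topology. For a path $X$ and integer $n\ge1$, the extended empirical measure $\mu^{(n)}$ and flow $Q^{(n)}$ are given by $\mu^{(n)}(f)=\frac1n\int_0^{nT_0}f(X_t,t)\,dt$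 and $Q^{(n)}(g)=\frac1n\sum_{t\in(0,nT_0]:X_{t-}\ne X_t}g(X_{t-},X_t,t)$ for bounded measurable $f$ on $V\times\mathcal S_{T_0}$, $g$ on $E\times\mathcal S_{T_0}$. $\Phi(q,p)=q\log\frac qp-(q-p)$ if $q,p>0$; $\Phi(0,p)=p$; $\Phi(q,0)=+\infty$ for $q>0$. $I_t(\mu_t,Q_t)=\sum_{(y,z)\in E}\Phi(Q_t(y,z),\mu_t(y)r(y,z;t))$. $\mathrm{div}A(y)=\sum_zA(y,z)-\sum_zA(z,y)$ (with $A=0$ off $E$). $\Lambda$ is the set of $(\mu,Q)\in\mathcal M_*$ such that: (i) $\mu=\mu_t\,dt$ with $\mu_t(V)=1$ for a.e. $t$; (ii) $Q=Q_t\,dt$; (iii) $\partial_t\mu_t+\mathrm{div}\,Q_t=0$ weakly, i.e. $\int_0^{T_0}\sum_y\mu_s(y)\partial_sf(y,s)ds=\int_0^{T_0}\sum_y\mathrm{div}Q_s(y)f(y,s)ds$ for all $C^1$ $f:V\times\mathcal S_{T_0}\to\mathbb R$; (iv) for a.e. $t$, $\mu_t(y)=0$ implies $Q_t(y,z)=0$ for all $(y,z)\in E$. *)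

theory Defs
  imports "HOL-Probability.Probability"
begin

definition pmod :: "real \<Rightarrow> real \<Rightarrow> real" where
  "pmod t T0 = t - T0 * of_int \<lfloor>t / T0\<rfloor>"

definition Edges :: "('v \<Rightarrow> 'v \<Rightarrow> real \<Rightarrow> real) \<Rightarrow> ('v \<times> 'v) set" where
  "Edges r = {(y, z). y \<noteq> z \<and> (\<forall>t>0. r y z t > 0)}"

definition gen :: "('v::finite \<Rightarrow> 'v \<Rightarrow> real \<Rightarrow> real) \<Rightarrow> 'v \<Rightarrow> 'v \<Rightarrow> real \<Rightarrow> real" where
  "gen r w z u = (if w = z then - (\<Sum>z'\<in>UNIV - {w}. r w z' u) else r w z u)"

text \<open>p is the transition function of the time-inhomogeneous chain with rates r:
  the solution of the integrated Kolmogorov forward equation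
  p(s,t) = Id + int_s^t p(s,u) L(u) du.\<close>
definition kolmogorov_transition ::
  "('v::finite \<Rightarrow> 'v \<Rightarrow> real \<Rightarrow> real) \<Rightarrow> (real \<Rightarrow> real \<Rightarrow> 'v \<Rightarrow> 'v \<Rightarrow> real) \<Rightarrow> bool" where
  "kolmogorov_transition r p \<longleftrightarrow>
     (\<forall>s t y z. 0 \<le> s \<and> s \<le> t \<longrightarrow>
        (\<lambda>u. \<Sum>w\<in>UNIV. p s u y w * gen r w z u) integrable_on {s..t} \<and>
        p s t y z = (if y = z then 1 else 0)
                    + integral {s..t} (\<lambda>u. \<Sum>w\<in>UNIV. p s u y w * gen r w z u))"

text \<open>Finite-dimensional distributions of the chain started at y at time s,
  observed at the (sorted) times ts in the states ys.\<close>
fun fdd :: "(real \<Rightarrow> real \<Rightarrow> 'v \<Rightarrow> 'v \<Rightarrow> real) \<Rightarrow> real \<Rightarrow> 'v \<Rightarrow> real list \<Rightarrow> 'v list \<Rightarrow> real" where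
  "fdd p s y [] [] = 1"
| "fdd p s y (t # ts) (z # zs) = p s t y z * fdd p t z ts zs"
| "fdd p s y _ _ = 0"

text \<open>Cadlag paths with values in the (discrete) finite state space, on [0,infinity).\<close>
definition cadlag :: "(real \<Rightarrow> 'v) \<Rightarrow> bool" where
  "cadlag X \<longleftrightarrow>
     (\<forall>t\<ge>0. eventually (\<lambda>s. X s = X t) (at_right t)) \<and>
     (\<forall>t>0. \<exists>y. eventually (\<lambda>s. X s = y) (at_left t))"

definition left_lim :: "(real \<Rightarrow> 'v) \<Rightarrow> real \<Rightarrow> 'v" where
  "left_lim X t = (THE y. eventually (\<lambda>s. X s = y) (at_left t))"

definition jumps :: "(real \<Rightarrow> 'v) \<Rightarrow> real \<Rightarrow> real set" where
  "jumps X b = {t \<in> {0<..b}. left_lim X t \<noteq> X t}"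

definition markov_chain ::
  "'w measure \<Rightarrow> ('w \<Rightarrow> real \<Rightarrow> 'v::finite) \<Rightarrow> (real \<Rightarrow> real \<Rightarrow> 'v \<Rightarrow> 'v \<Rightarrow> real) \<Rightarrow> 'v \<Rightarrow> bool" where
  "markov_chain M X p x \<longleftrightarrow>
     prob_space M \<and>
     (\<forall>t\<ge>0. (\<lambda>\<omega>. X \<omega> t) \<in> measurable M (count_space UNIV)) \<and>
     (\<forall>\<omega>\<in>space M. cadlag (X \<omega>)) \<and>
     (\<forall>ts ys. length ts = length ys \<longrightarrow> sorted ts \<longrightarrow> (\<forall>t\<in>set ts. 0 \<le> t) \<longrightarrow>
        measure M {\<omega>\<in>space M. \<forall>i<length ts. X \<omega> (ts ! i) = ys ! i} = fdd p 0 x ts ys)"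

text \<open>The circle S_T0 is represented by [0,T0) inside the reals; measures on V x S_T0
  are measures on V x R (product of counting and Borel sigma-algebras) concentrated on V x [0,T0).\<close>
abbreviation SpV :: "('v \<times> real) measure" where
  "SpV \<equiv> count_space UNIV \<Otimes>\<^sub>M lborel"

definition Mstar :: "real \<Rightarrow> ('v \<times> 'v) set \<Rightarrow> (('v \<times> real) measure \<times> (('v \<times> 'v) \<times> real) measure) set" where
  "Mstar T0 E = {(\<mu>, Q).
      sets \<mu> = sets SpV \<and> emeasure \<mu> (space \<mu>) = ennreal T0 \<and>
      emeasure \<mu> (space \<mu> - UNIV \<times> {0..<T0}) = 0 \<and>
      sets Q = sets SpV \<and> emeasure Q (space Q) < \<infinity> \<and>
      emeasure Q (space Q - E \<times> {0..<T0}) = 0}"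

text \<open>Continuous functions on V x S_T0 = continuous T0-periodic functions of time.\<close>
definition cont_per :: "real \<Rightarrow> ('a \<Rightarrow> real \<Rightarrow> real) \<Rightarrow> bool" where
  "cont_per T0 f \<longleftrightarrow> (\<forall>y. continuous_on UNIV (f y) \<and> (\<forall>t. f y (t + T0) = f y t))"

definition weak_top :: "real \<Rightarrow> (('v \<times> real) measure \<times> (('v \<times> 'v) \<times> real) measure) topology" where
  "weak_top T0 = topology_generated_by
     ({{(\<mu>, Q). (\<integral>p. f (fst p) (snd p) \<partial>\<mu>) \<in> U} | f U. cont_per T0 f \<and> open U} \<union>
      {{(\<mu>, Q). (\<integral>p. g (fst p) (snd p) \<partial>Q) \<in> U} | g U. cont_per T0 g \<and> open U})"

definition Mstar_top :: "real \<Rightarrow> ('v \<times> 'v) set \<Rightarrow> (('v \<times> real) measure \<times> (('v \<times> 'v) \<times> real) measure) topology" where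
  "Mstar_top T0 E = subtopology (weak_top T0) (Mstar T0 E)"

definition emp_meas :: "real \<Rightarrow> nat \<Rightarrow> (real \<Rightarrow> 'v) \<Rightarrow> ('v \<times> real) measure" where
  "emp_meas T0 n X = scale_measure (ennreal (1 / real n))
     (distr (restrict_space lborel {0..real n * T0}) SpV (\<lambda>t. (X t, pmod t T0)))"

definition emp_flow :: "real \<Rightarrow> nat \<Rightarrow> (real \<Rightarrow> 'v) \<Rightarrow> (('v \<times> 'v) \<times> real) measure" where
  "emp_flow T0 n X = scale_measure (ennreal (1 / real n))
     (distr (count_space (jumps X (real n * T0))) SpV (\<lambda>t. ((left_lim X t, X t), pmod t T0)))"

definition Phi :: "real \<Rightarrow> real \<Rightarrow> ennreal" where
  "Phi q p = (if q = 0 then ennreal p else if p = 0 then \<infinity>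
              else ennreal (q * ln (q / p) - (q - p)))"

definition divg :: "('v \<times> 'v) set \<Rightarrow> ('v \<times> 'v \<Rightarrow> real) \<Rightarrow> 'v::finite \<Rightarrow> real" where
  "divg E A y = (\<Sum>z\<in>UNIV. if (y, z) \<in> E then A (y, z) else 0)
              - (\<Sum>z\<in>UNIV. if (z, y) \<in> E then A (z, y) else 0)"

definition Lambda_wit :: "real \<Rightarrow> ('v::finite \<times> 'v) set \<Rightarrow> ('v \<times> real) measure \<Rightarrow> (('v \<times> 'v) \<times> real) measure
    \<Rightarrow> (real \<Rightarrow> 'v \<Rightarrow> real) \<Rightarrow> (real \<Rightarrow> 'v \<times> 'v \<Rightarrow> real) \<Rightarrow> bool" where
  "Lambda_wit T0 E \<mu> Q m q \<longleftrightarrow>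
     (\<lambda>p. m (snd p) (fst p)) \<in> borel_measurable SpV \<and> (\<forall>t y. 0 \<le> m t y) \<and>
     (\<lambda>p. q (snd p) (fst p)) \<in> borel_measurable SpV \<and> (\<forall>t e. 0 \<le> q t e) \<and>
     \<mu> = density SpV (\<lambda>p. ennreal (m (snd p) (fst p)) * indicator {0..<T0} (snd p)) \<and>
     Q = density SpV (\<lambda>p. ennreal (q (snd p) (fst p)) * indicator {0..<T0} (snd p)) \<and>
     (AE t in lborel. t \<in> {0..<T0} \<longrightarrow> (\<Sum>y\<in>UNIV. m t y) = 1) \<and>
     (\<forall>f :: 'v \<Rightarrow> real \<Rightarrow> real.
        (\<forall>y. f y C1_differentiable_on UNIV \<and> (\<forall>t. f y (t + T0) = f y t)) \<longrightarrow>
        (LINT s:{0..T0}|lborel. \<Sum>y\<in>UNIV. m s y * deriv (f y) s)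
          = (LINT s:{0..T0}|lborel. \<Sum>y\<in>UNIV. divg E (q s) y * f y s)) \<and>
     (AE t in lborel. t \<in> {0..<T0} \<longrightarrow> (\<forall>y z. (y, z) \<in> E \<longrightarrow> m t y = 0 \<longrightarrow> q t (y, z) = 0))"

definition Lambda :: "real \<Rightarrow> ('v::finite \<times> 'v) set \<Rightarrow> (('v \<times> real) measure \<times> (('v \<times> 'v) \<times> real) measure) set" where
  "Lambda T0 E = {(\<mu>, Q). (\<mu>, Q) \<in> Mstar T0 E \<and> (\<exists>m q. Lambda_wit T0 E \<mu> Q m q)}"

definition rate_int :: "('v \<Rightarrow> 'v \<Rightarrow> real \<Rightarrow> real) \<Rightarrow> real \<Rightarrow> ('v \<times> 'v) set
    \<Rightarrow> (real \<Rightarrow> 'v \<Rightarrow> real) \<Rightarrow> (real \<Rightarrow> 'v \<times> 'v \<Rightarrow> real) \<Rightarrow> ennreal" where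
  "rate_int r T0 E m q = (\<integral>\<^sup>+ t. indicator {0..<T0} t *
       (\<Sum>e\<in>E. Phi (q t e) (m t (fst e) * r (fst e) (snd e) t)) \<partial>lborel)"

text \<open>I(mu,Q) = int_0^T0 I_t(mu_t,Q_t) dt on Lambda (independent of the chosen densities), +infinity otherwise.\<close>
definition rate :: "('v::finite \<Rightarrow> 'v \<Rightarrow> real \<Rightarrow> real) \<Rightarrow> real
    \<Rightarrow> ('v \<times> real) measure \<times> (('v \<times> 'v) \<times> real) measure \<Rightarrow> ennreal" where
  "rate r T0 PQ = (if PQ \<in> Lambda T0 (Edges r)
      then (let mq = (SOME mq. Lambda_wit T0 (Edges r) (fst PQ) (snd PQ) (fst mq) (snd mq))
            in rate_int r T0 (Edges r) (fst mq) (snd mq))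
      else \<infinity>)"

definition eln :: "real \<Rightarrow> ereal" where
  "eln p = (if p \<le> 0 then -\<infinity> else ereal (ln p))"

end

theory Submission
 imports Defs
begin

text \<open>For continuous periodic \<open>f\<close>, \<open>g\<close> put \<open>S\<^sub>n = n (\<mu>\<^sup>(\<^sup>n\<^sup>)(f) + Q\<^sup>(\<^sup>n\<^sup>)(g))\<close>.
The Feynman--Kac formula, applied to a positive periodic solution \<open>h\<close> of the backward equation (which
exists by Brouwer's theorem), gives a number \<open>lam f g\<close> with \<open>E exp S\<^sub>n\<close> comparable to
\<open>exp (n lam f g)\<close>. The rate function is the conjugate of \<open>lam\<close>: it dominates
\<open>\<mu>(f) + Q(g) - lam f g\<close> because \<open>log h\<close> may be inserted into the continuity equation, where (A4)
is used, and it is attained by the functions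
\<open>f = - d\<phi>/dt - sum r (exp (g + grad \<phi>) - 1)\<close>, for which \<open>h = exp \<phi>\<close> and \<open>lam f g = 0\<close>.
Hence the rate function is convex and lower semicontinuous, and the upper bound follows from
Chebyshev's inequality on half-spaces and the compactness of the sets \<open>Q(1) \<le> b\<close>.
For the lower bound near \<open>v\<close>, almost minimise \<open>lam(\<theta> F) - \<theta> v + \<eta> |\<theta>|\<^sup>2\<close> over \<open>\<theta>\<close>: a second-order
bound on \<open>lam\<close>, obtained from the Poisson equation, shows that under the exponential tilt by \<open>\<theta> F\<close> the
empirical values of \<open>F\<close> concentrate near \<open>v\<close>.\<close>

text \<open>The rates are only measurable in time, so solutions are Lipschitz rather than C^1: all
  calculus is done on integrated equations, with product and logarithm rules obtained from quadratic
  error bounds. The chain is known through its transition function and cadlag paths alone;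
  expectations are computed on a mesh, as finite sums over finite-dimensional distributions, and the
  limit is dominated by exponential moments of the number of jumps.

  The large deviation part uses nothing of the rate function but the duality: rate at most
  \<open>a\<close> iff \<open>ev f g - lam f g <= a\<close> for all continuous periodic
  \<open>f\<close>, \<open>g\<close>. The potential that makes \<open>lam\<close> vanish contains
  the rates and need not be continuous, so it is replaced by an L^1-close continuous one before the
  duality is tested.

  In the lower bound \<open>lam\<close> is not known to be differentiable, and the infimum need not
  be attained. A one-sided quadratic bound at an almost minimiser replaces both; its constants must
  be uniform over all \<open>f\<close>, \<open>g\<close> with a common bound, which is why Perron
  and Poisson solutions are estimated through the Harnack constant of a whole class of
  matrices.\<close>

type_synonym 'a tfun = "'a => real => real"

section \<open>Indefinite integrals of bounded measurable functions\<close>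

text \<open>The bound is required at every point of the line, not almost everywhere: the class is
  then closed under the pointwise operations below and integrable on every compact interval in both
  integration theories.\<close>

definition bdd_borel :: "(real => real) => bool" where
 "bdd_borel k \<longleftrightarrow> k : borel_measurable borel & (EX K. ALL t. abs (k t) <= K)"

lemma bdd_borelI: "k : borel_measurable borel ==> (!!t. abs (k t) <= K) ==> bdd_borel k"
 unfolding bdd_borel_def by blast

lemma bdd_borel_measurable: "bdd_borel k ==> k : borel_measurable borel"
 unfolding bdd_borel_def by blast

lemma bdd_borel_bound:
 assumes "bdd_borel k"
 obtains K where "K >= 0" "!!t. abs (k t) <= K"
proof -
 obtain K where K: "!!t. abs (k t) <= K" using assms unfolding bdd_borel_def by blast
 have "0 <= K" using K[of 0] by linarith
 thus ?thesis using that K by blast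
qed

lemma bdd_borel_const [simp]: "bdd_borel (%_. c)"
 by (rule bdd_borelI[where K = "abs c"]) auto

lemma bdd_borel_add:
 assumes "bdd_borel k" "bdd_borel l" shows "bdd_borel (%t. k t + l t)"
proof -
 obtain K L where "!!t. abs (k t) <= K" "!!t. abs (l t) <= L"
  using assms unfolding bdd_borel_def by blast
 hence "abs (k t + l t) <= K + L" for t
  using abs_triangle_ineq[of "k t" "l t"] add_mono[of "abs (k t)" K "abs (l t)" L] by fastforce
 thus ?thesis
  using assms[THEN bdd_borel_measurable] by (intro bdd_borelI) auto
qed

lemma bdd_borel_mult:
 assumes "bdd_borel k" "bdd_borel l" shows "bdd_borel (%t. k t * l t)"
proof -
 obtain K L where "K >= 0" "L >= 0" "!!t. abs (k t) <= K" "!!t. abs (l t) <= L"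
  using assms by (metis bdd_borel_bound)
 hence "abs (k t * l t) <= K * L" for t
  by (simp add: abs_mult mult_mono)
 thus ?thesis
  using assms[THEN bdd_borel_measurable] by (intro bdd_borelI) auto
qed

lemma bdd_borel_uminus: "bdd_borel k ==> bdd_borel (%t. - k t)"
 using bdd_borel_mult[of "%_. -1" k] by simp

lemma bdd_borel_diff: "bdd_borel k ==> bdd_borel l ==> bdd_borel (%t. k t - l t)"
 using bdd_borel_add[of k "%t. - l t"] bdd_borel_uminus by simp

lemma bdd_borel_exp:
 assumes "bdd_borel k" shows "bdd_borel (%t. exp (k t))"
proof -
 obtain K where "!!t. abs (k t) <= K" using assms unfolding bdd_borel_def by blast
 hence "abs (exp (k t)) <= exp K" for t by (simp add: abs_le_D1)
 thus ?thesis
  using assms[THEN bdd_borel_measurable] by (intro bdd_borelI) auto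
qed

lemma bdd_borel_divide:
 assumes "bdd_borel k" "bdd_borel l" "c > 0" "!!t. c <= l t"
 shows "bdd_borel (%t. k t / l t)"
proof -
 have "abs (inverse (l t)) <= inverse c" for t
  using assms(3) assms(4)[of t] by (simp add: le_imp_inverse_le)
 hence "bdd_borel (%t. inverse (l t))"
  using assms(2)[THEN bdd_borel_measurable] by (intro bdd_borelI) auto
 thus ?thesis
  using bdd_borel_mult[OF assms(1)] by (simp add: divide_inverse)
qed

lemma bdd_borel_ln:
 assumes "bdd_borel k" "c > 0" "!!t. c <= k t" shows "bdd_borel (%t. ln (k t))"
proof -
 obtain K where "!!t. abs (k t) <= K" using assms unfolding bdd_borel_def by blast
 hence "abs (ln (k t)) <= abs (ln c) + abs (ln K)" for t
 proof -
  have "ln c <= ln (k t)" "ln (k t) <= ln K"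
   using assms(2) assms(3)[of t] \<open>\<bar>k t\<bar> <= K\<close> by auto
  thus ?thesis by linarith
 qed
 thus ?thesis
  using assms(1)[THEN bdd_borel_measurable] by (intro bdd_borelI) auto
qed

lemma bdd_borel_sum:
 "(!!i. i : I ==> bdd_borel (k i)) ==> bdd_borel (%t. SUM i:I. k i t)"
 by (induction I rule: infinite_finite_induct) (auto intro: bdd_borel_add)

lemmas bdd_borel_intros = bdd_borel_const bdd_borel_add bdd_borel_mult bdd_borel_uminus
 bdd_borel_diff bdd_borel_exp bdd_borel_sum

lemma bdd_borel_set_integrable:
 assumes "bdd_borel k" shows "set_integrable lborel {a..b} k"
proof -
 obtain K where "!!t. abs (k t) <= K" using assms unfolding bdd_borel_def by blast
 thus ?thesis
  unfolding set_integrable_def using assms[THEN bdd_borel_measurable]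
  by (intro integrableI_bounded_set_indicator[where B = K])
   (auto simp: emeasure_lborel_Icc_eq)
qed

lemma bdd_borel_integrable: "bdd_borel k ==> k integrable_on {a..b}"
 using bdd_borel_set_integrable set_borel_integral_eq_integral(1) by blast

lemma bdd_borel_LINT: "bdd_borel k ==> (LINT t:{a..b}|lborel. k t) = integral {a..b} k"
 using bdd_borel_set_integrable set_borel_integral_eq_integral(2) by blast

lemma integral_bdd_add:
 "bdd_borel k ==> bdd_borel l ==> integral {a..b} (%t. k t + l t) = integral {a..b} k + integral {a..b} l"
 by (intro Henstock_Kurzweil_Integration.integral_add bdd_borel_integrable)

lemma integral_bdd_diff:
 "bdd_borel k ==> bdd_borel l ==> integral {a..b} (%t. k t - l t) = integral {a..b} k - integral {a..b} l"
 by (intro Henstock_Kurzweil_Integration.integral_diff bdd_borel_integrable)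

lemma integral_bdd_sum:
 assumes "!!i. i : I ==> bdd_borel (k i)" "finite I"
 shows "integral {a..b} (%t. SUM i:I. k i t) = (SUM i:I. integral {a..b} (k i))"
 using assms by (intro Henstock_Kurzweil_Integration.integral_sum bdd_borel_integrable)

lemma integral_bdd_mono:
 assumes "bdd_borel k" "bdd_borel l" "!!t. t : {a..b} ==> k t <= l t"
 shows "integral {a..b} k <= integral {a..b} l"
 using assms by (intro integral_le bdd_borel_integrable)

lemma abs_integral_le:
 assumes "bdd_borel k" "!!t. t : {a..b} ==> abs (k t) <= K" "a <= b"
 shows "abs (integral {a..b} k) <= K * (b - a)"
proof -
 have "abs (integral {a..b} k) <= integral {a..b} (%_. K)"
  using integral_norm_bound_integral[OF bdd_borel_integrable[OF assms(1), of a b], of "%_. K"] assms(2)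
  by (auto simp: integrable_const_ivl)
 thus ?thesis using assms(3) by (simp add: mult.commute)
qed

text \<open>Difference quotients of \<open>D\<close> are at most \<open>C\<close> times the step, so
  the derivative is zero. This stands in for differentiating integrals of merely measurable
  functions: a calculus rule holds as soon as its defect over an interval is of second order in the
  length.\<close>

lemma eq_of_quadratic_increments:
 fixes D :: "real => real"
 assumes D: "!!s t. a <= s ==> s <= t ==> t <= b ==> abs (D t - D s) <= C * (t - s)\<^sup>2" and "a <= b"
 shows "D a = D b"
proof -
 have "(D has_field_derivative 0) (at x within {a..b})" if x: "x : {a..b}" for x
 proof -
  have "((%y. (D y - D x) / (y - x)) \<longlongrightarrow> 0) (at x within {a..b})"
  proof (rule Lim_null_comparison)
   have "norm ((D y - D x) / (y - x)) <= C * abs (y - x)" if "y : {a..b}" "y ~= x" for y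
   proof -
    have "abs (D y - D x) <= C * (y - x)\<^sup>2"
     using D[of x y] D[of y x] x that
     by (cases "x <= y") (auto simp: abs_minus_commute power2_commute)
    hence "abs (D y - D x) <= (C * abs (y - x)) * abs (y - x)"
     by (metis abs_mult_self_eq mult.assoc power2_eq_square)
    thus ?thesis
     using that by (simp add: abs_divide divide_le_eq)
   qed
   thus "\<forall>\<^sub>F y in at x within {a..b}. norm ((D y - D x) / (y - x)) <= C * abs (y - x)"
    by (auto simp: eventually_at_filter)
   have "((%y. C * abs (y - x)) \<longlongrightarrow> C * abs (x - x)) (at x within {a..b})"
    by (intro tendsto_intros)
   thus "((%y. C * abs (y - x)) \<longlongrightarrow> 0) (at x within {a..b})" by simp
  qed
  thus ?thesis by (simp add: has_field_derivative_iff)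
 qed
 then obtain c where "!!x. x : {a..b} ==> D x = c"
  using has_field_derivative_zero_constant[of "{a..b}" D] by auto
 thus ?thesis using \<open>a <= b\<close> by auto
qed

text \<open>The sign convention is that of backward equations: \<open>h' = - k\<close>.\<close>

definition indef :: "real => real => (real => real) => (real => real) => bool" where
 "indef a b h k \<longleftrightarrow> (ALL s t. a <= s --> s <= t --> t <= b --> h s = h t + integral {s..t} k)"

lemma indefD: "indef a b h k ==> a <= s ==> s <= t ==> t <= b ==> h s = h t + integral {s..t} k"
 unfolding indef_def by blast

lemma integral_split:
 fixes k :: "real => real"
 assumes "bdd_borel k" "s <= u" "u <= t"
 shows "integral {s..t} k = integral {s..u} k + integral {u..t} k"
 using Henstock_Kurzweil_Integration.integral_combine[OF assms(2,3) bdd_borel_integrable[OF assms(1)]] by simp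

lemma indefI_terminal:
 assumes "bdd_borel k" "!!t. a <= t ==> t <= b ==> h t = xi + integral {t..b} k"
 shows "indef a b h k"
 unfolding indef_def
proof (intro allI impI)
 fix s t assume "a <= s" "s <= t" "t <= b"
 thus "h s = h t + integral {s..t} k"
  using assms(2)[of s] assms(2)[of t] integral_split[OF assms(1), of s t b] by simp
qed

lemma indef_lipschitz:
 assumes "indef a b h k" "bdd_borel k" "!!t. abs (k t) <= K" "s : {a..b}" "t : {a..b}"
 shows "abs (h t - h s) <= K * abs (t - s)"
proof -
 have "abs (h t - h s) <= K * (t - s)" if "a <= s" "s <= t" "t <= b" for s t
  using indefD[OF assms(1) that] abs_integral_le[OF assms(2) assms(3) that(2)] by simp
 from this[of s t] this[of t s] show ?thesis
  using assms(4,5) by (cases "s <= t") (auto simp: abs_minus_commute)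
qed

lemma indef_add:
 assumes "indef a b h k" "indef a b h' k'" "bdd_borel k" "bdd_borel k'"
 shows "indef a b (%t. h t + h' t) (%t. k t + k' t)"
 unfolding indef_def
proof (intro allI impI)
 fix s t assume *: "a <= s" "s <= t" "t <= b"
 have "integral {s..t} (%t. k t + k' t) = integral {s..t} k + integral {s..t} k'"
  by (intro Henstock_Kurzweil_Integration.integral_add bdd_borel_integrable assms)
 thus "h s + h' s = h t + h' t + integral {s..t} (%t. k t + k' t)"
  using indefD[OF assms(1) *] indefD[OF assms(2) *] by simp
qed

lemma indef_cmult:
 assumes "indef a b h k"
 shows "indef a b (%t. c * h t) (%t. c * k t)"
 using assms unfolding indef_def by (simp add: distrib_left)

lemma indef_const: "indef a b (%t. c) (%t. 0)"
 unfolding indef_def by simp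

lemma indef_cong:
 assumes "!!t. t : {a..b} ==> h t = h' t" "!!t. t : {a..b} ==> k t = k' t"
 shows "indef a b h k \<longleftrightarrow> indef a b h' k'"
proof -
 have "integral {s..t} k = integral {s..t} k'" if "a <= s" "t <= b" for s t
  using that assms(2) by (intro Henstock_Kurzweil_Integration.integral_cong) auto
 thus ?thesis unfolding indef_def using assms(1) by auto
qed

lemma indef_C1:
 assumes "!!t. (h has_real_derivative - k t) (at t)"
 shows "indef a b h k"
 unfolding indef_def
proof (intro allI impI)
 fix s t assume *: "a <= s" "s <= t" "t <= b"
 have "((%u. - k u) has_integral (h t - h s)) {s..t}"
  using assms
  by (intro fundamental_theorem_of_calculus *)
   (auto simp: has_real_derivative_iff_has_vector_derivative[symmetric] intro: has_field_derivative_at_within)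
 hence "(k has_integral (h s - h t)) {s..t}"
  using has_integral_neg[of "%u. - k u" "h t - h s" "{s..t}"] by simp
 thus "h s = h t + integral {s..t} k"
  by (simp add: integral_unique)
qed

lemma indef_mult:
 assumes h: "indef a b h k" "bdd_borel k" "bdd_borel h"
  and h': "indef a b h' k'" "bdd_borel k'" "bdd_borel h'"
 shows "indef a b (%t. h t * h' t) (%t. k t * h' t + h t * k' t)"
 unfolding indef_def
proof (intro allI impI)
 fix s t assume st: "a <= s" "s <= t" "t <= b"
 let ?k = "%t. k t * h' t + h t * k' t"
 have bk: "bdd_borel ?k" using h h' by (intro bdd_borel_intros)
 obtain K where K: "K >= 0" "!!t. abs (k t) <= K" using h(2) by (metis bdd_borel_bound)
 obtain K' where K': "K' >= 0" "!!t. abs (k' t) <= K'" using h'(2) by (metis bdd_borel_bound)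
 define D where "D u = h u * h' u + integral {s..u} ?k" for u
 have "D s = D t"
 proof (rule eq_of_quadratic_increments[where D = D and a = s and b = t])
  show "s <= t" by fact
  fix u v assume uv: "s <= u" "u <= v" "v <= t"
  have k: "integral {u..v} k = h u - h v" "integral {u..v} k' = h' u - h' v"
   using indefD[OF h(1), of u v] indefD[OF h'(1), of u v] uv st by auto
  \<comment> \<open>With \<open>h'\<close> frozen at \<open>u\<close> and \<open>h\<close> at
    \<open>v\<close> the two integrals telescope exactly to the increment of the product. The
    remaining integrand is a bounded function times an increment, so its integral is quadratic in
    \<open>v - u\<close>.\<close>
  have "integral {u..v} ?k = integral {u..v} (%w. (h' u * k w + h v * k' w) +
    (k w * (h' w - h' u) + (h w - h v) * k' w))"
   by (intro arg_cong[where f = "integral {u..v}"] ext) (simp add: algebra_simps)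
  also have "... = (h' u * integral {u..v} k + h v * integral {u..v} k') +
    integral {u..v} (%w. k w * (h' w - h' u) + (h w - h v) * k' w)"
   using h h' by (simp add: integral_bdd_add bdd_borel_intros)
  finally have eq: "D v - D u = integral {u..v} (%w. k w * (h' w - h' u) + (h w - h v) * k' w)"
   using integral_split[OF bk uv(1,2)] k by (simp add: D_def algebra_simps)
  have "abs (k w * (h' w - h' u) + (h w - h v) * k' w) <= 2 * K * K' * (v - u)" if w: "w : {u..v}" for w
  proof -
   have 1: "abs (h' w - h' u) <= K' * (v - u)"
    using indef_lipschitz[OF h'(1,2) K'(2), of u w] w uv st mult_left_mono[OF _ K'(1), of "w - u" "v - u"] by auto
   have 2: "abs (h w - h v) <= K * (v - u)"
    using indef_lipschitz[OF h(1,2) K(2), of v w] w uv st mult_left_mono[OF _ K(1), of "v - w" "v - u"] by auto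
   have "abs (k w * (h' w - h' u)) <= K * (K' * (v - u))"
    unfolding abs_mult using 1 K by (intro mult_mono) auto
   moreover have "abs ((h w - h v) * k' w) <= (K * (v - u)) * K'"
    unfolding abs_mult using 2 K' K uv by (intro mult_mono) auto
   moreover have "K * (K' * (v - u)) + (K * (v - u)) * K' = 2 * K * K' * (v - u)"
    by (simp add: algebra_simps)
   ultimately show ?thesis
    by linarith
  qed
  hence "abs (D v - D u) <= (2 * K * K' * (v - u)) * (v - u)"
   unfolding eq using h h' uv
   by (intro abs_integral_le bdd_borel_add bdd_borel_mult bdd_borel_diff bdd_borel_const) auto
  thus "abs (D v - D u) <= (2 * K * K') * (v - u)\<^sup>2"
   by (simp add: power2_eq_square algebra_simps)
 qed
 thus "h s * h' s = h t * h' t + integral {s..t} ?k"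
  by (simp add: D_def)
qed

text \<open>The inequality \<open>ln x <= x - 1\<close>, used for \<open>y / x\<close> and for
  \<open>x / y\<close>, encloses \<open>ln (y / x)\<close> in an interval of length
  \<open>(y - x)\<^sup>2 / (x * y)\<close>.\<close>

lemma ln_linear_error:
 assumes "0 < c" "c <= x" "c <= (y::real)"
 shows "abs (ln y - ln x - (y - x) / x) <= (y - x)\<^sup>2 / c\<^sup>2"
proof -
 have pos: "x > 0" "y > 0" using assms by auto
 have 1: "ln (y / x) <= y / x - 1" using pos by (intro ln_le_minus_one) auto
 have "ln (x / y) <= x / y - 1" using pos by (intro ln_le_minus_one) auto
 hence 2: "ln (y / x) >= 1 - x / y" using pos by (simp add: ln_div)
 have "(y - x)\<^sup>2 / (x * y) <= (y - x)\<^sup>2 / c\<^sup>2"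
  using assms by (intro divide_left_mono) (auto simp: power2_eq_square intro: mult_mono)
 moreover have "y / x - 1 - (1 - x / y) = (y - x)\<^sup>2 / (x * y)"
  using pos by (simp add: field_simps power2_eq_square)
 moreover have "ln y - ln x = ln (y / x)" "(y - x) / x = y / x - 1"
  using pos by (auto simp: ln_div diff_divide_distrib)
 ultimately show ?thesis using 1 2 by linarith
qed

lemma indef_ln:
 assumes h: "indef a b h k" "bdd_borel k" "bdd_borel h" and c: "c > 0" "!!t. c <= h t"
 shows "indef a b (%t. ln (h t)) (%t. k t / h t)"
 unfolding indef_def
proof (intro allI impI)
 fix s t assume st: "a <= s" "s <= t" "t <= b"
 have bk: "bdd_borel (%t. k t / h t)" using h c by (intro bdd_borel_divide[where c = c])
 obtain K where K: "K >= 0" "!!t. abs (k t) <= K" using h(2) by (metis bdd_borel_bound)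
 define D where "D u = ln (h u) + integral {s..u} (%t. k t / h t)" for u
 have "D s = D t"
 proof (rule eq_of_quadratic_increments[where D = D and a = s and b = t])
  show "s <= t" by fact
  fix u v assume uv: "s <= u" "u <= v" "v <= t"
  have hp: "h w > 0" for w using c(1) c(2)[of w] by linarith
  have k: "integral {u..v} k = h u - h v"
   using indefD[OF h(1), of u v] uv st by auto
  have b2: "bdd_borel (%w. k w * (1 / h w - 1 / h u))"
   using h c by (intro bdd_borel_intros bdd_borel_divide[where c = c])
  \<comment> \<open>Freezing the denominator at \<open>u\<close> turns the integral into the
    linearisation of \<open>ln\<close> at \<open>h u\<close>; the error of that linearisation and
    the variation of \<open>1 / h\<close> are both of second order.\<close>
  have "integral {u..v} (%t. k t / h t) = integral {u..v} (%w. (1 / h u) * k w + k w * (1 / h w - 1 / h u))"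
   by (intro arg_cong[where f = "integral {u..v}"] ext) (simp add: algebra_simps)
  also have "... = (1 / h u) * integral {u..v} k + integral {u..v} (%w. k w * (1 / h w - 1 / h u))"
   by (simp only: integral_bdd_add[OF bdd_borel_mult[OF bdd_borel_const h(2)] b2] integral_mult_right)
  finally have "D v - D u = (ln (h v) - ln (h u) - (h v - h u) / h u)
    + integral {u..v} (%w. k w * (1 / h w - 1 / h u))"
   using integral_split[OF bk uv(1,2)] k by (simp add: D_def diff_divide_distrib)
  moreover have lip: "abs (h w - h u) <= K * (v - u)" if "w : {u..v}" for w
   using indef_lipschitz[OF h(1,2) K(2), of u w] that uv st
    mult_left_mono[OF _ K(1), of "w - u" "v - u"] by auto
  moreover have "abs (ln (h v) - ln (h u) - (h v - h u) / h u) <= (K * (v - u))\<^sup>2 / c\<^sup>2"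
  proof -
   have "(h v - h u)\<^sup>2 <= (K * (v - u))\<^sup>2"
    using lip[of v] uv by (simp add: abs_le_square_iff[symmetric])
   thus ?thesis
    using ln_linear_error[OF c(1) c(2)[of u] c(2)[of v]]
    by (meson divide_right_mono order_trans zero_le_power2)
  qed
  moreover have "abs (integral {u..v} (%w. k w * (1 / h w - 1 / h u))) <= (K * (K * (v - u) / c\<^sup>2)) * (v - u)"
  proof (rule abs_integral_le[OF b2 _ uv(2)])
   fix w assume w: "w : {u..v}"
   have "abs (1 / h w - 1 / h u) = abs (h w - h u) / (h w * h u)"
    using hp[of w] hp[of u] by (simp add: field_simps abs_divide abs_minus_commute)
   also have "... <= (K * (v - u)) / (c * c)"
    using lip[OF w] c hp by (intro frac_le mult_mono) (auto intro: less_imp_le)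
   finally show "abs (k w * (1 / h w - 1 / h u)) <= K * (K * (v - u) / c\<^sup>2)"
    unfolding abs_mult power2_eq_square using K by (intro mult_mono) auto
  qed
  ultimately have "abs (D v - D u) <= (K * (v - u))\<^sup>2 / c\<^sup>2 + (K * (K * (v - u) / c\<^sup>2)) * (v - u)"
   by linarith
  thus "abs (D v - D u) <= (2 * K\<^sup>2 / c\<^sup>2) * (v - u)\<^sup>2"
   by (simp add: power2_eq_square mult_ac)
 qed
 thus "ln (h s) = ln (h t) + integral {s..t} (%t. k t / h t)"
  by (simp add: D_def)
qed

section \<open>Periodic functions\<close>

lemma pmod_bounds:
 assumes "T0 > 0" shows "0 <= pmod t T0" "pmod t T0 < T0"
proof -
 have "of_int \<lfloor>t / T0\<rfloor> * T0 <= t / T0 * T0" "t / T0 * T0 < (of_int \<lfloor>t / T0\<rfloor> + 1) * T0"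
  using assms by (auto intro!: mult_right_mono mult_strict_right_mono simp del: times_divide_eq_left)
 thus "0 <= pmod t T0" "pmod t T0 < T0"
  using assms by (auto simp: pmod_def algebra_simps)
qed

lemma pmod_add_of_int [simp]:
 assumes "T0 > 0" shows "pmod (t + of_int n * T0) T0 = pmod t T0"
proof -
 have "(t + of_int n * T0) / T0 = t / T0 + of_int n" using assms by (simp add: field_simps)
 thus ?thesis by (simp add: pmod_def algebra_simps)
qed

lemma pmod_add_period [simp]: "T0 > 0 ==> pmod (t + T0) T0 = pmod t T0"
 using pmod_add_of_int[of T0 t 1] by simp

lemma pmod_id: "0 <= t ==> t < T0 ==> pmod t T0 = t"
 by (simp add: pmod_def floor_eq_iff)

lemma pmod_decomp: "t = pmod t T0 + of_int \<lfloor>t / T0\<rfloor> * T0"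
 by (simp add: pmod_def)

lemma pmod_measurable [measurable]: "(%t. pmod t T0) : borel_measurable borel"
 unfolding pmod_def by measurable

lemma periodic_add_nat:
 fixes k :: "real => 'b"
 assumes "!!t. k (t + T0) = (k t :: 'b)" shows "k (t + real n * T0) = k t"
proof (induction n)
 case (Suc n)
 have "k (t + real (Suc n) * T0) = k ((t + real n * T0) + T0)" by (simp add: algebra_simps)
 thus ?case using assms Suc by simp
qed simp

lemma periodic_add_int:
 fixes k :: "real => 'b"
 assumes "!!t. k (t + T0) = (k t :: 'b)" shows "k (t + of_int n * T0) = k t"
proof (cases "n >= 0")
 case True
 thus ?thesis using periodic_add_nat[of k T0 t "nat n", OF assms] by simp
next
 case False
 thus ?thesis
  using periodic_add_nat[of k T0 "t + of_int n * T0" "nat (- n)", OF assms] by (simp add: algebra_simps)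
qed

lemma periodic_pmod:
 fixes k :: "real => 'b"
 assumes "!!t. k (t + T0) = (k t :: 'b)" shows "k (pmod t T0) = k t"
 using periodic_add_int[of k T0 "pmod t T0" "\<lfloor>t / T0\<rfloor>", OF assms] pmod_decomp[of t T0] by simp

lemma integral_shift_real:
 fixes k :: "real => real"
 shows "integral {a..b} (%t. k (t + c)) = integral {a + c..b + c} k"
proof -
 have "((%t. k (t + c)) has_integral I) {a..b}" if "(k has_integral I) {a + c..b + c}" for a b c I :: real and k :: "real => real"
  using has_integral_affinity'[of k I "a + c" "b + c" 1 c] that by (simp add: cbox_interval)
 from this[of k _ a c b] this[of "%t. k (t + c)" _ "a + c" "-c" "b + c"]
 have "((%t. k (t + c)) has_integral I) {a..b} \<longleftrightarrow> (k has_integral I) {a + c..b + c}" for I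
  by (auto simp: o_def)
 thus ?thesis
  unfolding integral_def integrable_on_def by simp
qed

lemma integral_shift_periodic:
 fixes k :: "real => real"
 assumes "!!t. k (t + T0) = k t"
 shows "integral {a + of_int n * T0..b + of_int n * T0} k = integral {a..b} k"
 using integral_shift_real[of a b k "of_int n * T0"] periodic_add_int[of k T0, OF assms] by simp

lemma indef_periodic:
 assumes T0: "T0 > 0" and ind: "indef 0 T0 h k" and k: "bdd_borel k"
  and per: "!!t. h (t + T0) = h t" "!!t. k (t + T0) = k t"
 shows "indef a b h k"
 unfolding indef_def
proof (intro allI impI)
 fix s t :: real assume "s <= t"
 \<comment> \<open>Inside one closed period the equation is a translate of the one on {0..T0}; the
   Bolzano principle then glues periods.\<close>
 have cell: "h u = h v + integral {u..v} k"
  if "of_int n * T0 <= u" "u <= v" "v <= of_int n * T0 + T0" for u v n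
 proof -
  have "h (u - of_int n * T0) = h (v - of_int n * T0) + integral {u - of_int n * T0..v - of_int n * T0} k"
   using that by (intro indefD[OF ind]) auto
  thus ?thesis
   using periodic_add_int[of h T0 _ n, OF per(1)] integral_shift_periodic[of k T0, OF per(2)]
   by (metis diff_add_cancel)
 qed
 show "h s = h t + integral {s..t} k"
  using \<open>s <= t\<close>
 proof (induction rule: Bolzano)
  case (trans a b c)
  thus ?case using integral_split[OF k, of a b c] by simp
 next
  case (local x)
  define n where "n = \<lfloor>x / T0\<rfloor>"
  have x: "x = pmod x T0 + of_int n * T0" unfolding n_def by (rule pmod_decomp)
  define d where "d = T0 - pmod x T0"
  have d: "d > 0" "d <= T0" using pmod_bounds[OF T0, of x] by (auto simp: d_def)
  \<comment> \<open>Intervals around \<open>x\<close> shorter than \<open>d'\<close> stay within the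
    period of \<open>x\<close>, except that for \<open>x\<close> a multiple of \<open>T0\<close>
    their left part lies in the previous period.\<close>
  define d' where "d' = (if pmod x T0 = 0 then d else min d (pmod x T0))"
  have d': "d' > 0" "d' <= d" using d pmod_bounds[OF T0, of x] by (auto simp: d'_def)
  have "h u = h v + integral {u..v} k" if uv: "u <= x" "x <= v" "v - u < d'" for u v
  proof -
   have "h x = h v + integral {x..v} k"
    using uv d' d x pmod_bounds[OF T0, of x] by (intro cell[of n]) (auto simp: d_def)
   moreover have "h u = h x + integral {u..x} k"
   proof (cases "pmod x T0 = 0")
    case True
    thus ?thesis
     using uv d' d x by (intro cell[of "n - 1"]) (auto simp: algebra_simps)
   next
    case False
    thus ?thesis
     using uv d' d x pmod_bounds[OF T0, of x] by (intro cell[of n]) (auto simp: d'_def)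
   qed
   ultimately show ?thesis using integral_split[OF k uv(1,2)] by simp
  qed
  thus ?case using d' by blast
 qed
qed

text \<open>On each closed period the extension is a translate of \<open>v\<close>, matching at both
  ends, and every point is interior to the union of two adjacent periods.\<close>

lemma continuous_pmod_extension:
 fixes v :: "real => real"
 assumes T0: "T0 > 0" and v: "continuous_on {0..T0} v" "v 0 = v T0"
 shows "continuous_on UNIV (%t. v (pmod t T0))"
proof -
 have cell: "continuous_on {of_int n * T0..of_int n * T0 + T0} (%t. v (pmod t T0))" for n
 proof -
  have "continuous_on {of_int n * T0..of_int n * T0 + T0} (%t. v (t - of_int n * T0))"
   by (intro continuous_on_compose2[OF v(1)]) (auto intro!: continuous_intros)
  moreover have "v (t - of_int n * T0) = v (pmod t T0)" if t: "t : {of_int n * T0..of_int n * T0 + T0}" for t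
  proof (cases "t = of_int n * T0 + T0")
   case True
   hence "pmod t T0 = 0" using pmod_add_of_int[OF T0, of 0 "n + 1"] pmod_id[of 0 T0] T0
    by (simp add: algebra_simps)
   thus ?thesis using True v by simp
  next
   case False
   hence "pmod (t - of_int n * T0) T0 = t - of_int n * T0" using t by (intro pmod_id) auto
   thus ?thesis using pmod_add_of_int[OF T0, of "t - of_int n * T0" n] by simp
  qed
  ultimately show ?thesis using continuous_on_cong[OF refl] by (metis (no_types, lifting))
 qed
 have "isCont (%t. v (pmod t T0)) x" for x
 proof -
  define n where "n = \<lfloor>x / T0\<rfloor>"
  have x: "x = pmod x T0 + of_int n * T0" unfolding n_def by (rule pmod_decomp)
  have "continuous_on ({of_int (n - 1) * T0..of_int (n - 1) * T0 + T0} \<union> {of_int n * T0..of_int n * T0 + T0})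
    (%t. v (pmod t T0))"
   by (intro continuous_on_closed_Un cell) auto
  moreover have "{of_int (n - 1) * T0..of_int (n - 1) * T0 + T0} \<union> {of_int n * T0..of_int n * T0 + T0}
    = {of_int (n - 1) * T0..of_int n * T0 + T0}"
   using T0 by (auto simp: algebra_simps)
  ultimately have "continuous_on {of_int (n - 1) * T0..of_int n * T0 + T0} (%t. v (pmod t T0))" by simp
  moreover have "x : interior {of_int (n - 1) * T0..of_int n * T0 + T0}"
   using x pmod_bounds[OF T0, of x] T0 by (auto simp: interior_atLeastAtMost_real algebra_simps)
  ultimately show ?thesis
   by (meson continuous_on_interior)
 qed
 thus ?thesis by (simp add: continuous_at_imp_continuous_on)
qed

section \<open>Linear backward equations\<close>

text \<open>Composition with \<open>clip T\<close> extends a function on {0..T} by constants, which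
  makes continuous functions on the interval members of \<open>bdd_borel\<close>.\<close>

definition clip :: "real => real => real" where
 "clip T t = max 0 (min T t)"

lemma clip_mem: "0 <= T ==> clip T t : {0..T}"
 by (auto simp: clip_def)

lemma clip_id: "t : {0..T} ==> clip T t = t"
 by (auto simp: clip_def)

lemma bdd_borel_clip:
 assumes "0 <= T" "continuous_on {0..T} h" shows "bdd_borel (%t. h (clip T t))"
proof -
 have "continuous_on UNIV (%t. h (clip T t))"
  unfolding clip_def
  by (rule continuous_on_compose2[OF assms(2)]) (use assms(1) in \<open>auto intro!: continuous_intros\<close>)
 moreover have "compact (h ` {0..T})" using assms(2) by (intro compact_continuous_image) auto
 then obtain K where "!!x. x : h ` {0..T} ==> abs x <= K"
  by (metis bounded_iff compact_imp_bounded real_norm_def)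
 ultimately show ?thesis
  using clip_mem[OF assms(1)] by (intro bdd_borelI[where K = K] borel_measurable_continuous_onI) blast+
qed

lemma continuous_on_integral_upto:
 assumes "bdd_borel k" shows "continuous_on {0..T} (%t. integral {t..T} k)"
 using indefinite_integral_continuous_1'[OF bdd_borel_integrable[OF assms]] .

lemma abs_integral_bound:
 fixes k l :: "real => real"
 assumes "k integrable_on {a..b}" "l integrable_on {a..b}" "!!u. u : {a..b} ==> abs (k u) <= l u"
 shows "abs (integral {a..b} k) <= integral {a..b} l"
 using integral_norm_bound_integral[OF assms(1,2)] assms(3) by simp

lemma bdd_borel_family_bound:
 fixes k :: "'i::finite => real => real"
 assumes "!!i. bdd_borel (k i)"
 obtains K where "K >= 0" "!!i t. abs (k i t) <= K"
proof -
 obtain K where K: "!!i. K i >= 0" "!!i t. abs (k i t) <= K i"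
  using assms unfolding bdd_borel_def by (metis abs_ge_zero order_trans)
 have "abs (k i t) <= (SUM i:UNIV. K i)" for i t
  using K member_le_sum[of i UNIV K] by (meson UNIV_I finite order_trans)
 moreover have "(SUM i:UNIV. K i) >= 0" using K by (simp add: sum_nonneg)
 ultimately show ?thesis using that by blast
qed

lemma bdd_borel_family_bound2:
 fixes k :: "'i::finite => 'j::finite => real => real"
 assumes "!!i j. bdd_borel (k i j)"
 obtains K where "K >= 0" "!!i j t. abs (k i j t) <= K"
proof -
 obtain K where K: "K >= 0" "!!p t. abs (k (fst p) (snd p) t) <= K"
  using bdd_borel_family_bound[of "%p. k (fst p) (snd p)"] assms by blast
 show ?thesis
  using that[OF K(1)] K(2)[of "(_, _)"] by simp
qed

definition lin_sol :: "('a::finite => 'a tfun) => ('a tfun) => real => ('a tfun) => bool" where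
 "lin_sol a b T h \<longleftrightarrow> (ALL y. bdd_borel (h y) &
  indef 0 T (h y) (%u. (SUM z:UNIV. a y z u * h z u) + b y u))"

lemma lin_sol_bdd: "lin_sol a b T h ==> bdd_borel (h y)"
 by (simp add: lin_sol_def)

lemma lin_sol_indef: "lin_sol a b T h ==> indef 0 T (h y) (%u. (SUM z:UNIV. a y z u * h z u) + b y u)"
 by (simp add: lin_sol_def)

lemma lin_sol_eq:
 "lin_sol a b T h ==> t : {0..T} ==> h y t = h y T + integral {t..T} (%u. (SUM z:UNIV. a y z u * h z u) + b y u)"
 using indefD[OF lin_sol_indef] by fastforce

text \<open>Terms of the Picard-Dyson series. Terminal value and inhomogeneity both sit in term 0,
  so that every later term is an iterated integral of it.\<close>

fun dyson :: "('a::finite => 'a tfun) => ('a tfun) => real => ('a => real) => nat => 'a tfun" where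
 "dyson a b T xi 0 y t = xi y + integral {clip T t..T} (b y)"
| "dyson a b T xi (Suc k) y t = integral {clip T t..T} (%u. SUM z:UNIV. a y z u * dyson a b T xi k z u)"

lemma integral_power_upto:
 assumes "t <= T" shows "integral {t..T} (%u. (T - u) ^ k) = (T - t) ^ Suc k / real (Suc k)"
proof -
 have "((%u. (- 1 / real (Suc k)) * (T - u) ^ Suc k) has_real_derivative (T - u) ^ k) (at u within S)" for u S
 proof -
  have "((%u. (T - u) ^ Suc k) has_real_derivative (1 + real k) * (- 1 * (T - u) ^ k)) (at u within S)"
   by (rule DERIV_power_Suc) (auto intro!: derivative_eq_intros)
  from DERIV_cmult[OF this, of "- 1 / real (Suc k)"] show ?thesis by (simp add: add.commute)
 qed
 hence "((%u. (T - u) ^ k) has_integral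
   ((- 1 / real (Suc k)) * (T - T) ^ Suc k - (- 1 / real (Suc k)) * (T - t) ^ Suc k)) {t..T}"
  by (intro fundamental_theorem_of_calculus[OF assms])
   (simp only: has_real_derivative_iff_has_vector_derivative[symmetric])
 thus ?thesis by (simp add: integral_unique)
qed

lemma dyson_bdd_borel:
 assumes "0 <= T" "!!y z. bdd_borel (a y z)" "!!y. bdd_borel (b y)"
 shows "bdd_borel (dyson a b T xi k y)"
proof (induction k arbitrary: y)
 case 0
 have "bdd_borel (%t. xi y + integral {clip T t..T} (b y))"
  using assms by (intro bdd_borel_intros bdd_borel_clip[where h = "%t. integral {t..T} (b y)"] continuous_on_integral_upto)
 moreover have "dyson a b T xi 0 y = (%t. xi y + integral {clip T t..T} (b y))" by (rule ext) simp
 ultimately show ?case by (simp only:)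
next
 case (Suc k)
 have "bdd_borel (%t. integral {clip T t..T} (%u. SUM z:UNIV. a y z u * dyson a b T xi k z u))"
  using assms Suc
  by (intro bdd_borel_clip[where h = "%t. integral {t..T} (%u. SUM z:UNIV. a y z u * dyson a b T xi k z u)"]
    continuous_on_integral_upto bdd_borel_intros)
 moreover have "dyson a b T xi (Suc k) y = (%t. integral {clip T t..T} (%u. SUM z:UNIV. a y z u * dyson a b T xi k z u))"
  by (rule ext) simp
 ultimately show ?case by (simp only:)
qed

text \<open>Each iteration contributes a row of \<open>CARD('a)\<close> entries of size at most
  \<open>C\<close> and one integration of a power of \<open>T - u\<close>, which produces the
  factorial.\<close>

lemma dyson_bound:
 fixes a :: "'a::finite => 'a tfun"
 assumes T: "0 <= T" and a: "!!y z. bdd_borel (a y z)" and b: "!!y. bdd_borel (b y)"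
  and C: "C >= 0" "!!y z t. abs (a y z t) <= C" and M: "!!y t. abs (dyson a b T xi 0 y t) <= M"
 shows "t : {0..T} ==> abs (dyson a b T xi k y t) <= M * (real CARD('a) * C) ^ k * (T - t) ^ k / fact k"
proof (induction k arbitrary: y t)
 case 0
 thus ?case using M by simp
next
 case (Suc k)
 let ?n = "real CARD('a)"
 have bd: "bdd_borel (dyson a b T xi k y)" for k y by (rule dyson_bdd_borel) (use T a b in auto)
 have "M >= 0" using M by (meson abs_ge_zero order_trans)
 have "abs (dyson a b T xi (Suc k) y t) = abs (integral {t..T} (%u. SUM z:UNIV. a y z u * dyson a b T xi k z u))"
  using Suc.prems by (simp add: clip_id)
 also have "... <= integral {t..T} (%u. (M * (?n * C) ^ Suc k / fact k) * (T - u) ^ k)"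
 proof (rule abs_integral_bound)
  show "(%u. SUM z:UNIV. a y z u * dyson a b T xi k z u) integrable_on {t..T}"
   using a by (intro bdd_borel_integrable bdd_borel_intros bd)
  show "(%u. (M * (?n * C) ^ Suc k / fact k) * (T - u) ^ k) integrable_on {t..T}"
   by (intro integrable_continuous_real continuous_intros)
  fix u assume "u : {t..T}"
  hence u: "u : {0..T}" using Suc.prems by auto
  have "abs (SUM z:UNIV. a y z u * dyson a b T xi k z u) <= (SUM z:(UNIV::'a set). C * (M * (?n * C) ^ k * (T - u) ^ k / fact k))"
   by (rule order_trans[OF sum_abs], rule sum_mono)
    (unfold abs_mult, intro mult_mono Suc.IH u C abs_ge_zero)
  also have "... = (M * (?n * C) ^ Suc k / fact k) * (T - u) ^ k"
   by simp
  finally show "abs (SUM z:UNIV. a y z u * dyson a b T xi k z u) <= (M * (?n * C) ^ Suc k / fact k) * (T - u) ^ k" .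
 qed
 also have "... = (M * (?n * C) ^ Suc k / fact k) * ((T - t) ^ Suc k / real (Suc k))"
  using Suc.prems integral_power_upto[of t T k] by (simp only: integral_mult_right) auto
 also have "... = M * (?n * C) ^ Suc k * (T - t) ^ Suc k / fact (Suc k)"
  by (simp add: field_simps)
 finally show ?case .
qed

lemma lin_sol_exists:
 fixes a :: "'a::finite => 'a tfun"
 assumes T: "0 <= T" and a: "!!y z. bdd_borel (a y z)" and b: "!!y. bdd_borel (b y)"
 shows "EX h. lin_sol a b T h & (ALL y. h y T = xi y)"
proof -
 let ?n = "real CARD('a)"
 let ?D = "dyson a b T xi"
 obtain C where C: "C >= 0" "!!y z t. abs (a y z t) <= C"
  using bdd_borel_family_bound2[of a] a by blast
 have bd: "bdd_borel (dyson a b T xi k y)" for k y by (rule dyson_bdd_borel) (use T a b in auto)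
 obtain M where M: "M >= 0" "!!y t. abs (?D 0 y t) <= M"
  using bdd_borel_family_bound[of "?D 0"] bd by blast
 have clip_eq: "?D k y t = ?D k y (clip T t)" for k y t
  using clip_id[OF clip_mem[OF T]] by (cases k) auto
 define B where "B k = M * ((?n * C * T) ^ k /\<^sub>R fact k)" for k
 have B: "abs (?D k y t) <= B k" for k y t
 proof -
  have "(T - clip T t) ^ k <= T ^ k"
   using clip_mem[OF T, of t] by (intro power_mono) auto
  hence "M * (?n * C) ^ k * (T - clip T t) ^ k / fact k <= M * (?n * C) ^ k * T ^ k / fact k"
   using M C by (intro divide_right_mono mult_left_mono) auto
  also have "... = B k" by (simp add: B_def power_mult_distrib field_simps)
  finally show ?thesis
   using dyson_bound[OF T a b C M(2) clip_mem[OF T], where k = k and y = y] clip_eq[of k y t] by (metis order_trans)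
 qed
 have sB: "summable B"
  unfolding B_def by (intro summable_mult summable_exp_generic)
 have B0: "B k >= 0" for k using B[of k undefined 0] by (meson abs_ge_zero order_trans)
 have sD: "summable (%k. ?D k y t)" for y t
  by (rule summable_comparison_test'[OF sB]) (use B in auto)
 define h where "h y t = (\<Sum>k. ?D k y t)" for y t
 have hb: "abs (h y t) <= suminf B" for y t
 proof -
  have s: "summable (%k. abs (?D k y t))"
   by (rule summable_comparison_test'[OF sB]) (use B in auto)
  have "abs (h y t) <= (\<Sum>k. abs (?D k y t))" unfolding h_def by (rule summable_rabs[OF s])
  also have "... <= suminf B" by (rule suminf_le[OF B s sB])
  finally show ?thesis .
 qed
 have hm: "bdd_borel (h y)" for y
 proof (rule bdd_borelI[OF _ hb])
  have "(%t. \<Sum>k. ?D k y t) : borel_measurable borel"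
   using bd[THEN bdd_borel_measurable] by (intro borel_measurable_suminf)
  thus "h y : borel_measurable borel" unfolding h_def .
 qed
 let ?k = "%y u. (SUM z:UNIV. a y z u * h z u) + b y u"
 have eq: "h y t = xi y + integral {t..T} (?k y)" if t: "t : {0..T}" for y t
 proof -
  have "(%N. integral {t..T} (%u. SUM k<N. SUM z:UNIV. a y z u * ?D k z u)) \<longlonglongrightarrow>
    integral {t..T} (%u. SUM z:UNIV. a y z u * h z u)"
  proof (rule dominated_convergence(2))
   show "(%u. SUM k<N. SUM z:UNIV. a y z u * ?D k z u) integrable_on {t..T}" for N
    using a bd by (intro bdd_borel_integrable bdd_borel_intros)
   show "(%u. ?n * (C * suminf B)) integrable_on {t..T}" by (simp add: integrable_const_ivl)
   show "norm (SUM k<N. SUM z:UNIV. a y z u * ?D k z u) <= ?n * (C * suminf B)" for N u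
   proof -
    have "(SUM k<N. SUM z:UNIV. a y z u * ?D k z u) = (SUM z:UNIV. a y z u * (SUM k<N. ?D k z u))"
     by (subst sum.swap) (simp add: sum_distrib_left)
    moreover have "abs (SUM k<N. ?D k z u) <= suminf B" for z
    proof -
     have "abs (SUM k<N. ?D k z u) <= (SUM k<N. B k)"
      by (rule order_trans[OF sum_abs sum_mono]) (rule B)
     also have "... <= suminf B" by (rule sum_le_suminf[OF sB]) (auto simp: B0)
     finally show ?thesis .
    qed
    hence "abs (SUM z:UNIV. a y z u * (SUM k<N. ?D k z u)) <= (SUM z:(UNIV::'a set). C * suminf B)"
     using C by (intro order_trans[OF sum_abs sum_mono]) (auto simp: abs_mult intro!: mult_mono)
    ultimately show ?thesis by simp
   qed
   show "(%N. SUM k<N. SUM z:UNIV. a y z u * ?D k z u) \<longlonglongrightarrow> (SUM z:UNIV. a y z u * h z u)" for u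
   proof -
    have "(%N. SUM z:UNIV. a y z u * (SUM k<N. ?D k z u)) \<longlonglongrightarrow> (SUM z:UNIV. a y z u * h z u)"
     unfolding h_def by (intro tendsto_intros summable_LIMSEQ sD)
    moreover have "(SUM k<N. SUM z:UNIV. a y z u * ?D k z u) = (SUM z:UNIV. a y z u * (SUM k<N. ?D k z u))" for N
     by (subst sum.swap) (simp add: sum_distrib_left)
    ultimately show ?thesis by simp
   qed
  qed
  moreover have "integral {t..T} (%u. SUM k<N. SUM z:UNIV. a y z u * ?D k z u) = (SUM k<N. ?D (Suc k) y t)" for N
   using a bd t by (subst integral_bdd_sum) (auto intro!: bdd_borel_intros simp: clip_id)
  \<comment> \<open>Integrating the series termwise shifts it by one index; the missing head is term
    0, which carries \<open>xi\<close> and \<open>b\<close>.\<close>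
  ultimately have "(%k. ?D (Suc k) y t) sums integral {t..T} (%u. SUM z:UNIV. a y z u * h z u)"
   unfolding sums_def by simp
  hence "h y t = ?D 0 y t + integral {t..T} (%u. SUM z:UNIV. a y z u * h z u)"
   unfolding h_def using suminf_split_head[OF sD, of y t] by (simp add: sums_iff)
  moreover have "integral {t..T} (?k y) = integral {t..T} (%u. SUM z:UNIV. a y z u * h z u) + integral {t..T} (b y)"
   using a b hm by (intro integral_bdd_add bdd_borel_intros)
  ultimately show ?thesis using t by (simp add: clip_id)
 qed
 have "lin_sol a b T h"
  unfolding lin_sol_def
 proof (intro allI conjI hm)
  fix y show "indef 0 T (h y) (?k y)"
   using a b hm eq[of _ y] by (intro indefI_terminal[where xi = "xi y"] bdd_borel_intros) auto
 qed
 moreover have "h y T = xi y" for y using eq[of T y] T by simp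
 ultimately show ?thesis by blast
qed

lemma integral_exp_weight:
 fixes t T ga :: real
 assumes "t <= T" "ga > 0"
 shows "integral {t..T} (%u. exp (ga * (T - u))) = (exp (ga * (T - t)) - 1) / ga"
proof -
 have "((%u. exp (ga * (T - u))) has_integral (- inverse ga * exp (ga * (T - T)) - (- inverse ga * exp (ga * (T - t))))) {t..T}"
  by (rule fundamental_theorem_of_calculus[OF assms(1)])
   (use assms(2) in \<open>auto simp: has_real_derivative_iff_has_vector_derivative[symmetric] intro!: derivative_eq_intros\<close>)
 from integral_unique[OF this] show ?thesis by (simp add: diff_divide_distrib inverse_eq_divide)
qed

text \<open>Comparison in the norm weighted by \<open>exp (- ga (T - t))\<close>, in which the integral operator contracts by \<open>1 / 2\<close>.\<close>

lemma weighted_comparison: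
 fixes w :: "'a::finite => real => real"
 assumes T: "0 <= T" and L: "L >= 0" and m: "m >= 0"
  and w0: "!!y t. t : {0..T} ==> 0 <= w y t" and wb: "!!y t. t : {0..T} ==> w y t <= W"
  and step: "!!y t S. t : {0..T} ==> S >= 0 ==> (!!z u. u : {t..T} ==> w z u <= S * exp ((2 * L + 1) * (T - u))) ==>
    w y t <= m + L * S * integral {t..T} (%u. exp ((2 * L + 1) * (T - u)))"
  and t: "t : {0..T}"
 shows "w y t <= 2 * m * exp ((2 * L + 1) * T)"
proof -
 define g where "g = 2 * L + 1"
 have g: "g > 0" "L / g <= 1 / 2" using L by (auto simp: g_def field_simps)
 let ?v = "%(y, t). w y t * exp (- g * (T - t))"
 \<comment> \<open>The supremum is finite because of \<open>wb\<close>; only therefore can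
   \<open>S / 2\<close> be absorbed into the left side at the end.\<close>
 define S where "S = (SUP p\<in>UNIV \<times> {0..T}. ?v p)"
 have bdd: "bdd_above (?v ` (UNIV \<times> {0..T}))"
 proof (rule bdd_aboveI2)
  fix p :: "'a * real" assume p: "p : UNIV \<times> {0..T}"
  have "w (fst p) (snd p) * exp (- g * (T - snd p)) <= W * 1"
   using p wb w0 g by (intro mult_mono) (auto intro: order_trans[OF w0 wb])
  thus "?v p <= W" by (simp add: split_beta)
 qed
 have le_S: "w z u * exp (- g * (T - u)) <= S" if "u : {0..T}" for z u
  unfolding S_def using that by (intro cSUP_upper2[OF bdd, of "(z, u)"]) auto
 have S0: "S >= 0"
  using le_S[of 0] w0[of 0] T by (meson atLeastAtMost_iff exp_ge_zero mult_nonneg_nonneg order_refl order_trans)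
 have le_S': "w z u <= S * exp (g * (T - u))" if "u : {0..T}" for z u
  using mult_right_mono[OF le_S[OF that, of z], of "exp (g * (T - u))"]
  by (simp add: mult.assoc mult_exp_exp)
 have "S <= m + S / 2"
  unfolding S_def
 proof (rule cSUP_least)
  show "(UNIV :: 'a set) \<times> {0..T} ~= {}" using T by auto
  fix p :: "'a * real" assume "p : UNIV \<times> {0..T}"
  then obtain y t where p: "p = (y, t)" and t: "t : {0..T}" by auto
  have "w y t <= m + L * S * integral {t..T} (%u. exp (g * (T - u)))"
   using t le_S' unfolding g_def by (intro step S0) auto
  also have "... <= m + L * S * (exp (g * (T - t)) / g)"
   using t L S0 g by (subst integral_exp_weight) (auto intro!: mult_left_mono divide_right_mono)
  finally have "w y t * exp (- g * (T - t)) <= (m + L * S * (exp (g * (T - t)) / g)) * exp (- g * (T - t))"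
   by (intro mult_right_mono) auto
  also have "... = m * exp (- g * (T - t)) + L * S / g"
   using g by (simp add: distrib_right mult_exp_exp)
  also have "... <= m * 1 + S / 2"
  proof (intro add_mono mult_left_mono m)
   show "exp (- g * (T - t)) <= 1" using t g by simp
   show "L * S / g <= S / 2" using mult_right_mono[OF g(2) S0] by simp
  qed
  finally show "?v p <= m + (SUP p\<in>UNIV \<times> {0..T}. ?v p) / 2" by (simp add: p S_def)
 qed
 hence "S <= 2 * m" by simp
 have "w y t <= S * exp (g * (T - t))" by (rule le_S'[OF t])
 also have "... <= 2 * m * exp (g * T)"
  using t g \<open>S <= 2 * m\<close> S0 by (intro mult_mono) (auto intro: mult_left_mono)
 finally show ?thesis unfolding g_def .
qed

lemma lin_sol_indef_bdd:
 assumes "lin_sol a b T h" "!!y z. bdd_borel (a y z)" "!!y. bdd_borel (b y)"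
 shows "bdd_borel (%u. (SUM z:UNIV. a y z u * h z u) + b y u)"
 using assms unfolding lin_sol_def by (intro bdd_borel_intros) auto

text \<open>A Gronwall estimate that is linear in the data. Applied to differences of solutions it
  makes the solution map Lipschitz in the terminal value.\<close>

lemma lin_sol_bound:
 fixes a :: "'a::finite => 'a tfun"
 assumes sol: "lin_sol a b T h" and T: "0 <= T" and a: "!!y z. bdd_borel (a y z)" and b: "!!y. bdd_borel (b y)"
  and C: "!!y z t. abs (a y z t) <= C" and D: "!!y t. abs (b y t) <= D" and m: "!!y. abs (h y T) <= m"
  and t: "t : {0..T}"
 shows "abs (h y t) <= 2 * (m + D * T) * exp ((2 * (real CARD('a) * C) + 1) * T)"
proof -
 let ?n = "real CARD('a)"
 have C0: "C >= 0" "D >= 0" "m >= 0" using C D m by (meson abs_ge_zero order_trans)+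
 obtain W where W: "!!y t. abs (h y t) <= W"
  using lin_sol_bdd[OF sol] by (metis bdd_borel_family_bound)
 note bk = lin_sol_indef_bdd[OF sol a b]
 show ?thesis
 proof (rule weighted_comparison[where w = "%y t. abs (h y t)" and W = W and L = "?n * C" and m = "m + D * T", OF T])
  fix y t S
  assume t: "t : {0..T}" and S: "S >= 0"
   and le: "!!z u. u : {t..T} ==> abs (h z u) <= S * exp ((2 * (?n * C) + 1) * (T - u))"
  have "h y t = h y T + integral {t..T} (%u. (SUM z:UNIV. a y z u * h z u) + b y u)"
   by (rule lin_sol_eq[OF sol t])
  moreover have "abs (integral {t..T} (%u. (SUM z:UNIV. a y z u * h z u) + b y u))
   <= integral {t..T} (%u. (?n * C * S) * exp ((2 * (?n * C) + 1) * (T - u)) + D)"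
  proof (rule abs_integral_bound[OF bdd_borel_integrable[OF bk]])
   show "(%u. (?n * C * S) * exp ((2 * (?n * C) + 1) * (T - u)) + D) integrable_on {t..T}"
    by (intro integrable_continuous_real continuous_intros)
   fix u assume u: "u : {t..T}"
   have "abs (SUM z:UNIV. a y z u * h z u) <= (SUM z:(UNIV::'a set). C * (S * exp ((2 * (?n * C) + 1) * (T - u))))"
    using C le[OF u] C0 by (intro order_trans[OF sum_abs sum_mono]) (auto simp: abs_mult intro!: mult_mono)
   also have "... = (?n * C * S) * exp ((2 * (?n * C) + 1) * (T - u))" by simp
   finally show "abs ((SUM z:UNIV. a y z u * h z u) + b y u) <= (?n * C * S) * exp ((2 * (?n * C) + 1) * (T - u)) + D"
    using D[of y u] by linarith
  qed
  moreover have "integral {t..T} (%u. (?n * C * S) * exp ((2 * (?n * C) + 1) * (T - u)) + D)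
   = (?n * C * S) * integral {t..T} (%u. exp ((2 * (?n * C) + 1) * (T - u))) + D * (T - t)"
   using t by (subst Henstock_Kurzweil_Integration.integral_add)
    (auto intro!: integrable_continuous_real continuous_intros simp: integrable_const_ivl)
  moreover have "D * (T - t) <= D * T" using t C0 by (intro mult_left_mono) auto
  ultimately show "abs (h y t) <= m + D * T + ?n * C * S * integral {t..T} (%u. exp ((2 * (?n * C) + 1) * (T - u)))"
   using m[of y] by linarith
 qed (use C0 W T t in auto)
qed

text \<open>With \<open>m = 0\<close> the comparison principle forces its argument to be
  nonpositive; it is applied to the negative part of \<open>h\<close>. Diagonal entries must be
  nonnegative too, which is arranged by an exponential weight before the lemma is used.\<close>

lemma lin_sol_nonneg:
 fixes a :: "'a::finite => 'a tfun"
 assumes sol: "lin_sol a (%_ _. 0) T h" and T: "0 <= T" and a: "!!y z. bdd_borel (a y z)"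
  and a0: "!!y z t. 0 <= a y z t" and h0: "!!y. 0 <= h y T" and t: "t : {0..T}"
 shows "0 <= h y t"
proof -
 let ?n = "real CARD('a)"
 obtain C where C: "C >= 0" "!!y z t. abs (a y z t) <= C"
  using bdd_borel_family_bound2[of a] a by blast
 obtain W where W: "!!y t. abs (h y t) <= W"
  using lin_sol_bdd[OF sol] by (metis bdd_borel_family_bound)
 have W0: "W >= 0" using W by (meson abs_ge_zero order_trans)
 note bk = lin_sol_indef_bdd[OF sol a bdd_borel_const]
 have "max 0 (- h y t) <= 2 * 0 * exp ((2 * (?n * C) + 1) * T)"
 proof (rule weighted_comparison[where w = "%y t. max 0 (- h y t)" and W = W and L = "?n * C" and m = 0, OF T])
  fix y t S
  assume t: "t : {0..T}" and S: "S >= 0"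
   and le: "!!z u. u : {t..T} ==> max 0 (- h z u) <= S * exp ((2 * (?n * C) + 1) * (T - u))"
  have eq: "h y t = h y T + integral {t..T} (%u. (SUM z:UNIV. a y z u * h z u) + 0)"
   by (rule lin_sol_eq[OF sol t])
  have "integral {t..T} (%u. - (?n * C * S) * exp ((2 * (?n * C) + 1) * (T - u)))
   <= integral {t..T} (%u. (SUM z:UNIV. a y z u * h z u) + 0)"
  proof (rule integral_le[OF _ bdd_borel_integrable[OF bk]])
   show "(%u. - (?n * C * S) * exp ((2 * (?n * C) + 1) * (T - u))) integrable_on {t..T}"
    by (intro integrable_continuous_real continuous_intros)
   fix u assume u: "u : {t..T}"
   have "(SUM z:UNIV. a y z u * (- h z u)) <= (SUM z:(UNIV::'a set). C * (S * exp ((2 * (?n * C) + 1) * (T - u))))"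
   proof (rule sum_mono)
    fix z
    have "a y z u * (- h z u) <= a y z u * max 0 (- h z u)" using a0 by (intro mult_left_mono) auto
    also have "... <= C * (S * exp ((2 * (?n * C) + 1) * (T - u)))"
     using C(2)[of y z u] a0[of y z u] le[OF u, of z] C(1) by (intro mult_mono) auto
    finally show "a y z u * (- h z u) <= C * (S * exp ((2 * (?n * C) + 1) * (T - u)))" .
   qed
   thus "- (?n * C * S) * exp ((2 * (?n * C) + 1) * (T - u)) <= (SUM z:UNIV. a y z u * h z u) + 0"
    by (simp add: sum_negf)
  qed
  hence "- (?n * C * S) * integral {t..T} (%u. exp ((2 * (?n * C) + 1) * (T - u))) <= h y t"
   using eq h0[of y] by (simp only: integral_mult_right)
  moreover have "0 <= ?n * C * S * integral {t..T} (%u. exp ((2 * (?n * C) + 1) * (T - u)))"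
   using C S by (intro mult_nonneg_nonneg integral_nonneg integrable_continuous_real continuous_intros of_nat_0_le_iff exp_ge_zero)
  ultimately show "max 0 (- h y t) <= 0 + ?n * C * S * integral {t..T} (%u. exp ((2 * (?n * C) + 1) * (T - u)))"
   by simp
 qed (use C W0 W T t in \<open>auto simp: abs_le_iff\<close>)
 thus ?thesis by simp
qed

section \<open>Positivity and the Harnack inequality\<close>

definition exp_weight :: "real => real => real => real" where
 "exp_weight ga T t = exp (ga * (T - clip T t))"

lemma exp_weight_eq: "t : {0..T} ==> exp_weight ga T t = exp (ga * (T - t))"
 by (simp add: exp_weight_def clip_id)

lemma bdd_borel_exp_weight: "0 <= T ==> bdd_borel (exp_weight ga T)"
 unfolding exp_weight_def[abs_def]
 by (rule bdd_borel_clip[where h = "%t. exp (ga * (T - t))"]) (auto intro!: continuous_intros)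

lemma indef_exp_weight: "indef 0 T (exp_weight ga T) (%t. ga * exp_weight ga T t)"
proof -
 have "indef 0 T (%t. exp (ga * (T - t))) (%t. ga * exp (ga * (T - t)))"
  by (rule indef_C1) (auto intro!: derivative_eq_intros)
 thus ?thesis
  by (subst indef_cong[of _ _ _ "%t. exp (ga * (T - t))" _ "%t. ga * exp (ga * (T - t))"])
   (auto simp: exp_weight_eq)
qed

text \<open>The integrating factor adds \<open>ga\<close> to the diagonal. It serves twice: with a
  large \<open>ga\<close> to make all entries nonnegative, and with minus the logarithm of the
  eigenvalue per unit time to make an eigenfunction periodic.\<close>

lemma lin_sol_exp_weight:
 fixes a :: "'a::finite => 'a tfun"
 assumes sol: "lin_sol a (%_ _. 0) T h" and T: "0 <= T" and a: "!!y z. bdd_borel (a y z)"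
 shows "lin_sol (%y z t. a y z t + (if y = z then ga else 0)) (%_ _. 0) T (%y t. exp_weight ga T t * h y t)"
 unfolding lin_sol_def
proof (intro allI conjI)
 fix y
 have h: "bdd_borel (h y)" "indef 0 T (h y) (%u. (SUM z:UNIV. a y z u * h z u) + 0)" for y
  using sol unfolding lin_sol_def by auto
 show "bdd_borel (%t. exp_weight ga T t * h y t)"
  by (intro bdd_borel_intros bdd_borel_exp_weight T h)
 have "indef 0 T (%t. exp_weight ga T t * h y t)
  (%t. (ga * exp_weight ga T t) * h y t + exp_weight ga T t * ((SUM z:UNIV. a y z t * h z t) + 0))"
  by (rule indef_mult) (intro indef_exp_weight bdd_borel_intros bdd_borel_exp_weight T h a)+
 moreover have "(ga * exp_weight ga T t) * h y t + exp_weight ga T t * ((SUM z:UNIV. a y z t * h z t) + 0)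
  = (SUM z:UNIV. (a y z t + (if y = z then ga else 0)) * (exp_weight ga T t * h z t)) + 0" for t
 proof -
  have "(SUM z:UNIV. (a y z t + (if y = z then ga else 0)) * (exp_weight ga T t * h z t))
   = (SUM z:UNIV. exp_weight ga T t * (a y z t * h z t) + (if y = z then ga * exp_weight ga T t * h z t else 0))"
   by (intro sum.cong) (auto simp: algebra_simps)
  also have "... = exp_weight ga T t * (SUM z:UNIV. a y z t * h z t) + ga * exp_weight ga T t * h y t"
   by (simp add: sum.distrib sum_distrib_left)
  finally show ?thesis by simp
 qed
 ultimately show "indef 0 T (%t. exp_weight ga T t * h y t)
   (%u. (SUM z:UNIV. (a y z u + (if y = z then ga else 0)) * (exp_weight ga T u * h z u)) + 0)"
  by simp
qed

text \<open>Exactly the features of a coefficient matrix that enter the Harnack constant; that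
  constant is therefore uniform over the class, in particular over all tilts with a common
  bound.\<close>

definition coupled :: "('a * 'a) set => real => real => ('a::finite => 'a tfun) => bool" where
 "coupled E c C a \<longleftrightarrow> (ALL y z. bdd_borel (a y z)) & (ALL y z t. abs (a y z t) <= C) &
  (ALL y z t. y ~= z --> 0 <= a y z t) & (ALL y z t. (y, z) : E --> c <= a y z t)"

text \<open>After the shift by \<open>C\<close> all entries are nonnegative, so every summand under
  the integral in the equation is nonnegative. Dropping all of them gives the second claim, keeping
  the summand of one edge the third.\<close>

lemma coupled_weighted:
 fixes a :: "'a::finite => 'a tfun"
 assumes cp: "coupled E c C a" and sol: "lin_sol a (%_ _. 0) T h" and T: "0 <= T" and h0: "!!y. 0 <= h y T"
  and t: "t : {0..T}"
 shows "0 <= exp_weight C T t * h y t" and "h y T <= exp_weight C T t * h y t"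
  and "(y, z) : E ==> y ~= z ==> integral {t..T} (%u. c * (exp_weight C T u * h z u)) <= exp_weight C T t * h y t"
proof -
 let ?a = "%y z t. a y z t + (if y = z then C else 0)"
 let ?h = "%y t. exp_weight C T t * h y t"
 have a: "!!y z. bdd_borel (a y z)" using cp unfolding coupled_def by blast
 have ab: "bdd_borel (?a y z)" for y z using a by (intro bdd_borel_intros)
 have a0: "0 <= ?a y z t" for y z t
 proof -
  have "abs (a y z t) <= C" "y ~= z ==> 0 <= a y z t" using cp unfolding coupled_def by blast+
  thus ?thesis by (cases "y = z") (auto simp: abs_le_iff)
 qed
 note sol' = lin_sol_exp_weight[OF sol T a, of C]
 have hT: "?h y T = h y T" for y using T by (simp add: exp_weight_eq)
 have nn: "0 <= ?h y t" if "t : {0..T}" for y t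
  using lin_sol_nonneg[OF sol' T ab a0 _ that] h0 hT by simp
 show "0 <= ?h y t" by (rule nn[OF t])
 have eq: "?h y t = h y T + integral {t..T} (%u. (SUM z:UNIV. ?a y z u * ?h z u) + 0)"
  using lin_sol_eq[OF sol' t] hT by simp
 note bk = lin_sol_indef_bdd[OF sol' ab bdd_borel_const]
 have "0 <= integral {t..T} (%u. (SUM z:UNIV. ?a y z u * ?h z u) + 0)"
  using t nn a0 by (intro integral_nonneg bdd_borel_integrable bk) (auto intro!: sum_nonneg intro: mult_nonneg_nonneg[OF a0 nn])
 thus "h y T <= ?h y t" using eq by simp
 assume E: "(y, z) : E" "y ~= z"
 have "integral {t..T} (%u. c * ?h z u) <= integral {t..T} (%u. (SUM z:UNIV. ?a y z u * ?h z u) + 0)"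
 proof (rule integral_bdd_mono[OF _ bk])
  have "bdd_borel (h z)" using sol unfolding lin_sol_def by blast
  thus "bdd_borel (%u. c * ?h z u)"
   by (intro bdd_borel_intros bdd_borel_exp_weight T)
  fix u assume u: "u : {t..T}"
  have "c * ?h z u <= ?a y z u * ?h z u"
   using cp E nn[of u z] u t unfolding coupled_def by (intro mult_right_mono) auto
  also have "... <= (SUM z:UNIV. ?a y z u * ?h z u)"
  proof (rule member_le_sum)
   fix x show "0 <= ?a y x u * ?h x u" using u t by (intro mult_nonneg_nonneg a0 nn) auto
  qed auto
  finally show "c * ?h z u <= (SUM z:UNIV. ?a y z u * ?h z u) + 0" by simp
 qed
 thus "integral {t..T} (%u. c * ?h z u) <= ?h y t"
  using eq h0[of y] by linarith
qed

text \<open>Mass at \<open>z\<close> is carried back to \<open>y\<close> along a path: each edge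
  costs a factor \<open>c\<close> and one integration in time, so the exponent of
  \<open>T - t\<close> is the length of the path.\<close>

lemma harnack_path:
 fixes E :: "('a::finite * 'a) set"
 assumes yz: "(y, z) : E\<^sup>*" and c: "c > 0" and T: "0 <= T" and irr: "!!y. (y, y) ~: E"
 shows "EX K>0. EX k. ALL a h t. coupled E c C a --> lin_sol a (%_ _. 0) T h --> (ALL y. 0 <= h y T) --> t : {0..T} -->
  K * (T - t) ^ k * h z T <= exp_weight C T t * h y t"
 using yz
proof (induction rule: converse_rtrancl_induct)
 case base
 show ?case
  using coupled_weighted(2)[OF _ _ T] by (intro exI[of _ 1] conjI exI[of _ 0]) (auto, blast)
next
 case (step y y')
 then obtain K k where K: "K > 0"
  and le: "!!a h t. coupled E c C a ==> lin_sol a (%_ _. 0) T h ==> (ALL y. 0 <= h y T) ==> t : {0..T} ==>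
   K * (T - t) ^ k * h z T <= exp_weight C T t * h y' t" by blast
 have "c * K / real (Suc k) * (T - t) ^ Suc k * h z T <= exp_weight C T t * h y t"
  if *: "coupled E c C a" "lin_sol a (%_ _. 0) T h" "ALL y. 0 <= h y T" "t : {0..T}" for a h t
 proof -
  have "c * K / real (Suc k) * (T - t) ^ Suc k * h z T = (c * K * h z T) * integral {t..T} (%u. (T - u) ^ k)"
   using *(4) by (subst integral_power_upto) auto
  also have "... = integral {t..T} (%u. (c * K * h z T) * (T - u) ^ k)"
   by (simp only: integral_mult_right)
  also have "... <= integral {t..T} (%u. c * (exp_weight C T u * h y' u))"
  proof (rule integral_le)
   show "(%u. (c * K * h z T) * (T - u) ^ k) integrable_on {t..T}"
    by (intro integrable_continuous_real continuous_intros)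
   have "bdd_borel (h y')" using *(2) unfolding lin_sol_def by blast
   thus "(%u. c * (exp_weight C T u * h y' u)) integrable_on {t..T}"
    by (intro bdd_borel_integrable bdd_borel_intros bdd_borel_exp_weight T)
   fix u assume "u : {t..T}"
   thus "(c * K * h z T) * (T - u) ^ k <= c * (exp_weight C T u * h y' u)"
    using le[OF *(1-3), of u] *(4) c by (auto simp: mult_ac)
  qed
  also have "... <= exp_weight C T t * h y t"
   using * step.hyps(1) irr by (intro coupled_weighted(3)[of E c C a]) (auto intro: T)
  finally show ?thesis .
 qed
 thus ?case
  using K c by (intro exI[of _ "c * K / real (Suc k)"] conjI exI[of _ "Suc k"]) auto
qed

lemma harnack:
 fixes E :: "('a::finite * 'a) set"
 assumes conn: "!!y z. (y, z) : E\<^sup>*" and c: "c > 0" and T: "0 < T" and irr: "!!y. (y, y) ~: E"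
 obtains ka where "ka > 0" "!!a h y z. coupled E c C a ==> lin_sol a (%_ _. 0) T h ==> ALL y. 0 <= h y T ==>
  ka * h z T <= h y 0"
proof -
 have "ALL y z. EX K k. K > 0 & (ALL a h t. coupled E c C a --> lin_sol a (%_ _. 0) T h --> (ALL y. 0 <= h y T) --> t : {0..T} -->
  K * (T - t) ^ k * h z T <= exp_weight C T t * h y t)"
  using harnack_path[OF conn c less_imp_le[OF T] irr] by blast
 then obtain K k where K: "!!y z. K y z > 0"
  and le: "!!y z a h t. coupled E c C a ==> lin_sol a (%_ _. 0) T h ==> (ALL y. 0 <= h y T) ==> t : {0..T} ==>
  K y z * (T - t) ^ (k y z) * h z T <= exp_weight C T t * h y t" by metis
 \<comment> \<open>There are finitely many pairs, so the path constants have a positive minimum; the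
   factor \<open>exp (- C * T)\<close> removes the weight at time 0.\<close>
 define ka where "ka = Min (range (%(y, z). exp (- C * T) * (K y z * T ^ k y z)))"
 have "ka > 0" unfolding ka_def using K T by (subst Min_gr_iff) auto
 moreover have "ka * h z T <= h y 0"
  if *: "coupled E c C a" "lin_sol a (%_ _. 0) T h" "ALL y. 0 <= h y T" for a h y z
 proof -
  have "ka * h z T <= (exp (- C * T) * (K y z * T ^ k y z)) * h z T"
   unfolding ka_def using *(3) by (intro mult_right_mono Min_le) (auto intro!: image_eqI[of _ _ "(y, z)"])
  also have "... = exp (- C * T) * (K y z * (T - 0) ^ k y z * h z T)" by simp
  also have "... <= exp (- C * T) * (exp_weight C T 0 * h y 0)"
   using * T by (intro mult_left_mono le[where a = a and h = h]) auto
  also have "... = h y 0"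
   using T by (simp add: exp_weight_eq mult.assoc[symmetric] mult_exp_exp)
  finally show ?thesis .
 qed
 ultimately show ?thesis using that by blast
qed

section \<open>Additive functionals of step paths\<close>

lemma left_lim_eqI:
 assumes "eventually (%s. X s = y) (at_left t)" shows "left_lim X t = y"
 unfolding left_lim_def
proof (rule the_equality[where P = "%y. eventually (%s. X s = y) (at_left t)", OF assms])
 fix z assume "eventually (%s. X s = z) (at_left t)"
 with assms have "eventually (%s. y = z) (at_left t)" by eventually_elim simp
 thus "z = y" by (simp add: eventually_const_iff trivial_limit_at_left_real)
qed

lemma left_lim_const:
 fixes t :: real
 assumes "u < t" "!!s. s : {u<..<t} ==> X s = y" shows "left_lim X t = y"
 by (rule left_lim_eqI) (use assms in \<open>auto simp: eventually_at_left_field\<close>)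

lemma cadlag_left:
 assumes "cadlag X" "t > 0"
 obtains u where "u < t" "!!s. s : {u<..<t} ==> X s = left_lim X t"
proof -
 obtain y where y: "eventually (%s. X s = y) (at_left t)" using assms unfolding cadlag_def by blast
 thus ?thesis
  using that left_lim_eqI[OF y] unfolding eventually_at_left_field by auto
qed

lemma cadlag_right:
 assumes "cadlag X" "t >= 0"
 obtains v where "v > t" "!!s. s : {t..<v} ==> X s = X t"
proof -
 obtain b where "b > t" "ALL y>t. y < b --> X y = X t"
  using assms unfolding cadlag_def eventually_at_right_field by blast
 thus ?thesis
  by (intro that[of b]) (auto simp: less_eq_real_def)
qed

text \<open>One-sided limits make the path constant on each side of any point, the absence of a jump
  glues the two sides, and the Bolzano principle passes from local to global.\<close>

lemma cadlag_no_jump_const: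
 assumes X: "cadlag X" and ab: "0 <= a" "a <= b" and nj: "!!t. a < t ==> t <= b ==> left_lim X t = X t"
 shows "X b = X a"
proof -
 define P where "P u v \<longleftrightarrow> (a <= u --> v <= b --> X v = X u)" for u v
 have "P a b"
 proof (rule Bolzano[OF ab(2)])
  show "P u w" if "P u v" "P v w" "u <= v" "v <= w" for u v w
   using that unfolding P_def by auto
  fix x assume x: "a <= x" "x <= b"
  obtain v where v: "v > x" "!!s. s : {x..<v} ==> X s = X x"
   using cadlag_right[OF X, of x] x ab by auto
  have "EX u<x. x > a --> (ALL s:{u<..<x}. X s = X x)"
  proof (cases "x > a")
   case True
   then obtain u where "u < x" "!!s. s : {u<..<x} ==> X s = left_lim X x"
    using cadlag_left[OF X, of x] ab by auto
   thus ?thesis using nj[OF True] x by auto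
  next
   case False
   thus ?thesis by (intro exI[of _ "x - 1"]) auto
  qed
  then obtain u where u: "u < x" "x > a --> (ALL s:{u<..<x}. X s = X x)" by blast
  have "P c d" if cd: "c <= x" "x <= d" "d - c < min (v - x) (x - u)" for c d
   unfolding P_def
  proof (intro impI)
   assume "a <= c" "d <= b"
   have "X d = X x" by (rule v(2)) (use cd in auto)
   moreover have "X c = X x" using cd u \<open>a <= c\<close> by (cases "c = x") auto
   ultimately show "X d = X c" by simp
  qed
  moreover have "0 < min (v - x) (x - u)" using v(1) u(1) by simp
  ultimately show "EX d>0. ALL a b. a <= x & x <= b & b - a < d --> P a b"
   by blast
 qed
 thus ?thesis by (simp add: P_def)
qed

text \<open>Every point has a neighbourhood in which it is the only possible jump time; the Bolzano
  principle plays the role of compactness.\<close>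

lemma cadlag_finite_jumps:
 assumes X: "cadlag X" shows "finite (jumps X b)"
proof (cases "0 <= b")
 case True
 define J where "J u v = {t : {u<..v}. 0 < t & left_lim X t ~= X t}" for u v
 have "finite (J 0 b)"
 proof (rule Bolzano[OF True])
  fix u v w assume "finite (J u v)" "finite (J v w)"
  moreover have "J u w \<subseteq> J u v \<union> J v w" unfolding J_def by auto
  ultimately show "finite (J u w)" using finite_subset by blast
 next
  fix x :: real assume x: "0 <= x" "x <= b"
  obtain v where v: "v > x" "!!s. s : {x..<v} ==> X s = X x"
   using cadlag_right[OF X, of x] x by auto
  have "EX u<x. x > 0 --> (ALL s:{u<..<x}. X s = left_lim X x)"
  proof (cases "x > 0")
   case True
   thus ?thesis using cadlag_left[OF X, of x] by metis
  next
   case False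
   thus ?thesis by (intro exI[of _ "x - 1"]) auto
  qed
  then obtain u where u: "u < x" "x > 0 --> (ALL s:{u<..<x}. X s = left_lim X x)" by blast
  have "J c d \<subseteq> {x}" if cd: "c <= x" "x <= d" "d - c < min (v - x) (x - u)" for c d
  proof
   fix t assume "t : J c d"
   hence t: "c < t" "t <= d" "0 < t" "left_lim X t ~= X t" unfolding J_def by auto
   have "left_lim X t = X t" if "t < x"
   proof -
    have *: "ALL s:{u<..<x}. X s = left_lim X x" "u < t" using t cd u that by auto
    thus ?thesis using that by (intro left_lim_const[of u]) auto
   qed
   moreover have "left_lim X t = X t" if "t > x"
   proof (rule left_lim_const[OF that])
    have "X t = X x" by (rule v(2)) (use t cd that in auto)
    thus "X s = X t" if "s : {x<..<t}" for s
     using v(2)[of s] that t cd by auto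
   qed
   ultimately show "t : {x}" using t by force
  qed
  hence "ALL c d. c <= x & x <= d & d - c < min (v - x) (x - u) --> finite (J c d)"
   by (meson finite.emptyI finite.insertI finite_subset)
  moreover have "0 < min (v - x) (x - u)" using v(1) u(1) by simp
  ultimately show "EX d>0. ALL a b. a <= x & x <= b & b - a < d --> finite (J a b)"
   by blast
 qed
 thus ?thesis unfolding jumps_def J_def by (rule finite_subset[rotated]) auto
qed (auto simp: jumps_def)

lemma cadlag_level_set_borel:
 fixes X :: "real => 'v"
 assumes X: "cadlag X" shows "{u. 0 <= u & X u = y} : sets borel"
proof -
 \<comment> \<open>The first grid point strictly to the right of \<open>u\<close>. Right continuity
   alone gives \<open>X (sg n u) = X u\<close> for large \<open>n\<close>, and \<open>sg n\<close>
   takes only countably many values, so its level sets are Borel.\<close>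
 define sg where "sg n u = (of_int \<lfloor>u * real (Suc n)\<rfloor> + 1) / real (Suc n)" for n u
 have meas: "{u. X (sg n u) = y} : sets borel" for n
 proof -
  have "{u. X (sg n u) = y} = (%u. \<lfloor>u * real (Suc n)\<rfloor>) -` {j. X ((of_int j + 1) / real (Suc n)) = y} \<inter> space borel"
   by (auto simp: sg_def)
  also have "... : sets borel"
   by (intro measurable_sets[where A = "count_space UNIV"]) measurable
  finally show ?thesis .
 qed
 have lim: "\<forall>\<^sub>F n in sequentially. X (sg n u) = X u" if u0: "u >= 0" for u
 proof -
  obtain v where v: "v > u" "!!s. s : {u..<v} ==> X s = X u" using cadlag_right[OF X u0] by blast
  have "(%n. inverse (real (Suc n))) \<longlonglongrightarrow> 0" by (rule LIMSEQ_inverse_real_of_nat)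
  hence "\<forall>\<^sub>F n in sequentially. inverse (real (Suc n)) < v - u"
   using v(1) by (intro order_tendstoD) auto
  thus ?thesis
  proof eventually_elim
   case (elim n)
   have 1: "of_int \<lfloor>u * real (Suc n)\<rfloor> <= u * real (Suc n)" "u * real (Suc n) < of_int \<lfloor>u * real (Suc n)\<rfloor> + 1"
    by linarith+
   hence "u < sg n u" unfolding sg_def by (simp add: pos_less_divide_eq)
   moreover have "sg n u <= (u * real (Suc n) + 1) / real (Suc n)"
    unfolding sg_def using 1 by (intro divide_right_mono) auto
   hence "sg n u <= u + inverse (real (Suc n))" by (simp add: add_divide_distrib inverse_eq_divide)
   ultimately show ?case by (intro v(2)) (use elim in auto)
  qed
 qed
 have "{u. 0 <= u & X u = y} = {0..} \<inter> (\<Union>m. INT n:{m..}. {u. X (sg n u) = y})"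
 proof (intro set_eqI iffI)
  fix u assume "u : {u. 0 <= u & X u = y}"
  hence "0 <= u" "EX m. ALL n>=m. X (sg n u) = y"
   using lim[of u] unfolding eventually_sequentially by auto
  thus "u : {0..} \<inter> (\<Union>m. INT n:{m..}. {u. X (sg n u) = y})"
   by blast
 next
  fix u assume u: "u : {0..} \<inter> (\<Union>m. INT n:{m..}. {u. X (sg n u) = y})"
  hence "EX m. ALL n>=m. X (sg n u) = y" by blast
  hence "\<forall>\<^sub>F n in sequentially. X (sg n u) = y" unfolding eventually_sequentially .
  moreover have "\<forall>\<^sub>F n in sequentially. X (sg n u) = X u" using u lim by auto
  ultimately have "\<forall>\<^sub>F n::nat in sequentially. X u = y" by eventually_elim simp
  thus "u : {u. 0 <= u & X u = y}" using u by simp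
 qed
 also have "... : sets borel" using meas by auto
 finally show ?thesis .
qed

text \<open>Equal to \<open>f (X u) u\<close> for \<open>u >= 0\<close>. The indicator form makes
  measurability visible and gives the value 0 at negative times, where nothing is known of the
  path.\<close>

definition along :: "('v::finite => real => real) => (real => 'v) => real => real" where
 "along f X u = (SUM y:UNIV. indicator {u. 0 <= u & X u = y} u * f y u)"

lemma along_eq: "0 <= u ==> along f X u = f (X u) u"
proof -
 assume "0 <= u"
 hence "along f X u = (SUM y:UNIV. if y = X u then f y u else 0)"
  unfolding along_def by (intro sum.cong) (auto simp: indicator_def)
 thus ?thesis by simp
qed

lemma along_bdd:
 assumes "cadlag X" "!!y. bdd_borel (f y)" shows "bdd_borel (along f X)"
 unfolding along_def[abs_def]
proof (intro bdd_borel_sum bdd_borel_mult assms(2))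
 show "bdd_borel (indicator {u. 0 <= u & X u = y})" for y
  using cadlag_level_set_borel[OF assms(1)] by (intro bdd_borelI[where K = 1]) (auto simp: indicator_def)
qed

definition path_fun :: "real => ('v::finite => real => real) => (('v * 'v) tfun) => (real => 'v) => real" where
 "path_fun T f g X = integral {0..T} (along f X) + (SUM t:jumps X T. g (left_lim X t, X t) t)"

section \<open>Discretisation of path functionals on a mesh\<close>

definition mesh :: "real => nat => nat => real" where
 "mesh T N k = real k * T / real N"

text \<open>The state is frozen at the left end of the cell, and a change of state counts as one
  jump at the left end. The sum over cells thus depends on the path at mesh points only, and
  finite-dimensional distributions determine its law.\<close>

definition mesh_term :: "real => nat => ('v::finite => real => real) => (('v * 'v) tfun) => nat => 'v => 'v => real" where
 "mesh_term T N f g k y z = integral {mesh T N k..mesh T N (Suc k)} (f y) + (if y = z then 0 else g (y, z) (mesh T N k))"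

definition mesh_fun :: "real => nat => ('v::finite => real => real) => (('v * 'v) tfun) => (real => 'v) => real" where
 "mesh_fun T N f g X = (SUM k<N. mesh_term T N f g k (X (mesh T N k)) (X (mesh T N (Suc k))))"

lemma mesh_0 [simp]: "mesh T N 0 = 0" by (simp add: mesh_def)

lemma mesh_N: "N > 0 ==> mesh T N N = T" by (simp add: mesh_def)

lemma mesh_nonneg: "0 <= T ==> 0 <= mesh T N k" by (simp add: mesh_def)

lemma mesh_mono: "0 <= T ==> j <= k ==> mesh T N j <= mesh T N k"
 by (auto simp: mesh_def intro!: divide_right_mono mult_right_mono)

lemma mesh_Suc: "mesh T N (Suc k) = mesh T N k + T / real N"
 by (simp add: mesh_def add_divide_distrib distrib_right)

lemma mesh_le: "0 <= T ==> k <= N ==> N > 0 ==> mesh T N k <= T"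
 using mesh_mono[of T k N N] by (simp add: mesh_N)

lemma mesh_cell:
 assumes T: "T > 0" and N: "N > 0" and t: "0 < t" "t <= T"
 shows "EX! k. k < N & mesh T N k < t & t <= mesh T N (Suc k)"
proof (rule ex_ex1I)
 \<comment> \<open>Cells are open on the left and closed on the right, like the time interval over
   which jumps are summed; hence the ceiling minus one.\<close>
 define k where "k = nat (\<lceil>t * real N / T\<rceil> - 1)"
 have "t * real N / T > 0" using assms by simp
 hence c: "\<lceil>t * real N / T\<rceil> >= 1" by linarith
 hence k: "real k = of_int \<lceil>t * real N / T\<rceil> - 1" unfolding k_def by simp
 hence 1: "real k < t * real N / T" "t * real N / T <= real (Suc k)" by linarith+
 have "t * real N / T <= real N" using mult_right_mono[OF t(2), of "real N"] T by (simp add: divide_le_eq mult.commute)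
 hence "k < N" using 1 by linarith
 moreover have "mesh T N k < t" "t <= mesh T N (Suc k)"
  using 1 T N unfolding mesh_def by (auto simp: field_simps)
 ultimately show "EX k. k < N & mesh T N k < t & t <= mesh T N (Suc k)" by blast
next
 fix j k assume j: "j < N & mesh T N j < t & t <= mesh T N (Suc j)" and k: "k < N & mesh T N k < t & t <= mesh T N (Suc k)"
 show "j = k"
 proof (rule ccontr)
  assume "j ~= k"
  hence "Suc j <= k | Suc k <= j" by auto
  thus False
   using j k mesh_mono[of T "Suc j" k N] mesh_mono[of T "Suc k" j N] T by auto
 qed
qed

lemma integral_mesh:
 assumes "bdd_borel k" "0 <= T"
 shows "integral {0..mesh T N n} k = (SUM i<n. integral {mesh T N i..mesh T N (Suc i)} k)"
proof (induction n)
 case (Suc n)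
 thus ?case
  using integral_split[OF assms(1) mesh_nonneg[OF assms(2)] mesh_mono[OF assms(2), of n "Suc n" N]] by simp
qed simp

lemma mesh_change_has_jump:
 assumes X: "cadlag X" and T: "T >= 0" and "k < N" and ne: "EX u:{mesh T N k..mesh T N (Suc k)}. X u ~= X (mesh T N k)"
 shows "EX t:jumps X T. mesh T N k < t & t <= mesh T N (Suc k)"
proof (rule ccontr)
 assume no: "~ ?thesis"
 from ne obtain u where u: "u : {mesh T N k..mesh T N (Suc k)}" "X u ~= X (mesh T N k)" by blast
 have "X u = X (mesh T N k)"
 proof (rule cadlag_no_jump_const[OF X])
  show "0 <= mesh T N k" by (rule mesh_nonneg[OF T])
  show "mesh T N k <= u" using u by simp
  fix t assume t: "mesh T N k < t" "t <= u"
  hence "t <= mesh T N (Suc k)" using u by simp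
  moreover have "mesh T N (Suc k) <= T" using assms by (intro mesh_le) auto
  moreover have "0 < t" using t mesh_nonneg[OF T, of N k] by linarith
  ultimately show "left_lim X t = X t" using no t unfolding jumps_def by force
 qed
 thus False using u by simp
qed

text \<open>An observed change of state needs a jump inside its cell, and disjoint cells have
  different jumps. The bound does not depend on the mesh.\<close>

lemma mesh_count_le:
 fixes X :: "real => 'v::finite"
 assumes X: "cadlag X" and T: "T > 0"
 shows "mesh_fun T N (%_ _. 0) (%_ _. 1) X <= real (card (jumps X T))"
proof -
 let ?K = "{k:{..<N}. X (mesh T N k) ~= X (mesh T N (Suc k))}"
 have "mesh_fun T N (%_ _. 0) (%_ _. 1) X = (SUM k<N. if X (mesh T N k) ~= X (mesh T N (Suc k)) then 1 else 0)"
  unfolding mesh_fun_def mesh_term_def by (intro sum.cong) auto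
 also have "... = real (card ?K)" by (simp add: sum.If_cases Int_def)
 also have "card ?K <= card (jumps X T)"
 proof -
  have "ALL k:?K. EX t. t : jumps X T & mesh T N k < t & t <= mesh T N (Suc k)"
  proof
   fix k assume k: "k : ?K"
   have "EX t:jumps X T. mesh T N k < t & t <= mesh T N (Suc k)"
    using k T mesh_mono[of T k "Suc k" N]
    by (intro mesh_change_has_jump[OF X]) (auto intro!: bexI[of _ "mesh T N (Suc k)"])
   thus "EX t. t : jumps X T & mesh T N k < t & t <= mesh T N (Suc k)" by blast
  qed
  then obtain ta where ta: "!!k. k : ?K ==> ta k : jumps X T & mesh T N k < ta k & ta k <= mesh T N (Suc k)"
   by metis
  have "inj_on ta ?K"
  proof (rule inj_onI)
   fix j k assume jk: "j : ?K" "k : ?K" "ta j = ta k"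
   have "0 < ta j" "ta j <= T" using ta[OF jk(1)] unfolding jumps_def by auto
   thus "j = k"
    using mesh_cell[OF T, of N "ta j"] ta[OF jk(1)] ta[OF jk(2)] jk by (auto simp: Ex1_def)
  qed
  thus ?thesis
   using ta cadlag_finite_jumps[OF X] by (intro card_inj_on_le[of ta]) auto
 qed
 finally show ?thesis by simp
qed

text \<open>Uniform in \<open>N\<close>: exponentiated, the right side is the dominating function in
  the passage to the limit of the Feynman-Kac formula.\<close>

lemma mesh_fun_bound:
 fixes X :: "real => 'v::finite"
 assumes X: "cadlag X" and T: "T > 0" and f: "!!y. bdd_borel (f y)" "!!y t. abs (f y t) <= L" and g: "!!e t. abs (g e t) <= L" and N: "N > 0"
 shows "abs (mesh_fun T N f g X) <= L * T + L * real (card (jumps X T))"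
proof -
 have L: "L >= 0" using g by (meson abs_ge_zero order_trans)
 have "abs (mesh_term T N f g k y z) <= L * (T / real N) + L * mesh_term T N (%_ _. 0) (%_ _. 1) k y z" for k y z
 proof -
  have "abs (integral {mesh T N k..mesh T N (Suc k)} (f y)) <= L * (mesh T N (Suc k) - mesh T N k)"
   using T by (intro abs_integral_le f mesh_mono) auto
  thus ?thesis
   using g[of "(y, z)" "mesh T N k"] unfolding mesh_term_def by (auto simp: mesh_Suc)
 qed
 hence "abs (mesh_fun T N f g X) <= (SUM k<N. L * (T / real N) + L * mesh_term T N (%_ _. 0) (%_ _. 1) k (X (mesh T N k)) (X (mesh T N (Suc k))))"
  unfolding mesh_fun_def by (intro order_trans[OF sum_abs sum_mono])
 also have "... = L * T + L * mesh_fun T N (%_ _. 0) (%_ _. 1) X"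
  using N by (simp add: sum.distrib sum_distrib_left[symmetric] mesh_fun_def)
 also have "... <= L * T + L * real (card (jumps X T))"
  using mesh_count_le[OF X T] L by (intro add_left_mono mult_left_mono) auto
 finally show ?thesis .
qed

lemma finite_gap:
 fixes J :: "real set" assumes "finite J"
 obtains d where "d > 0" "!!s t. s : J ==> t : J ==> s ~= t ==> d <= abs (s - t)"
proof -
 let ?P = "{p : J \<times> J. fst p ~= snd p}"
 let ?D = "insert 1 ((%p. abs (fst p - snd p)) ` ?P)"
 have fin: "finite ?D" using assms by (intro finite.insertI finite_imageI) auto
 show ?thesis
 proof (rule that[of "Min ?D"])
  show "0 < Min ?D" using fin by (subst Min_gr_iff) auto
  fix s t assume "s : J" "t : J" "s ~= t"
  thus "Min ?D <= abs (s - t)" using fin by (intro Min_le) (auto intro!: image_eqI[of _ _ "(s, t)"])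
 qed
qed

text \<open>Once the mesh is finer than the smallest gap between jumps, a cell contains at most one
  jump. Then each jump is recorded with its correct states, only the time argument of
  \<open>g\<close> is displaced, and freezing the state is wrong on at most \<open>card J\<close>
  cells, whose total length vanishes.\<close>

lemma mesh_fun_tendsto:
 fixes X :: "real => 'v::finite"
 assumes X: "cadlag X" and T: "T > 0" and f: "!!y. bdd_borel (f y)" and g: "!!e. continuous_on UNIV (g e)"
 shows "(%N. mesh_fun T N f g X) \<longlonglongrightarrow> path_fun T f g X"
proof -
 define J where "J = jumps X T"
 have J: "finite J" unfolding J_def by (rule cadlag_finite_jumps[OF X])
 have Jpos: "0 < t" "t <= T" "left_lim X t ~= X t" if "t : J" for t using that by (auto simp: J_def jumps_def)
 obtain d where d: "d > 0" "!!s t. s : J ==> t : J ==> s ~= t ==> d <= abs (s - t)" using finite_gap[OF J] by metis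
 obtain L where L: "L >= 0" "!!y t. abs (f y t) <= L" using bdd_borel_family_bound[of f] f by metis
 define ka where "ka N t = (THE k. k < N & mesh T N k < t & t <= mesh T N (Suc k))" for N t
 have ka: "ka N t < N & mesh T N (ka N t) < t & t <= mesh T N (Suc (ka N t))" if "N > 0" "t : J" for N t
  unfolding ka_def using mesh_cell[OF T that(1) Jpos(1,2)[OF that(2)]] by (rule theI')
 have step: "(%N. T / real N) \<longlonglongrightarrow> 0" by real_asymp
 have ev: "\<forall>\<^sub>F N in sequentially. N > 0 & T / real N < d"
  using order_tendstoD(2)[OF step d(1)] eventually_gt_at_top[of 0] by eventually_elim auto
 have jump_part: "(SUM k<N. if X (mesh T N k) = X (mesh T N (Suc k)) then 0 else
    g (X (mesh T N k), X (mesh T N (Suc k))) (mesh T N k))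
   = (SUM t:J. g (left_lim X t, X t) (mesh T N (ka N t)))"
  and int_part: "abs (integral {0..T} (along f X) - (SUM k<N. integral {mesh T N k..mesh T N (Suc k)} (f (X (mesh T N k)))))
   <= real (card J) * (2 * L * (T / real N))"
  if N: "N > 0" "T / real N < d" for N
 proof -
  have inj: "inj_on (ka N) J"
  proof (rule inj_onI, rule ccontr)
   fix s t assume st: "s : J" "t : J" "ka N s = ka N t" "s ~= t"
   have "abs (s - t) <= T / real N"
    using ka[OF N(1) st(1)] ka[OF N(1) st(2)] st(3) by (auto simp: mesh_Suc abs_if)
   thus False using d(2)[OF st(1,2,4)] N by simp
  qed
  have cell: "X (mesh T N (ka N t)) = left_lim X t" "X (mesh T N (Suc (ka N t))) = X t" if t: "t : J" for t
  proof -
   note k = ka[OF N(1) t]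
   have nj: "left_lim X s = X s" if "mesh T N (ka N t) < s" "s <= mesh T N (Suc (ka N t))" "s ~= t" for s
   proof (rule ccontr)
    assume "left_lim X s ~= X s"
    moreover have "mesh T N (Suc (ka N t)) <= T" using k T N by (intro mesh_le) auto
    ultimately have "s : J"
     using that mesh_nonneg[of T N "ka N t"] T by (auto simp: J_def jumps_def)
    hence "d <= abs (s - t)" using d(2) t that by blast
    moreover have "abs (s - t) <= T / real N" using that k by (auto simp: mesh_Suc abs_if)
    ultimately show False using N by simp
   qed
   show "X (mesh T N (Suc (ka N t))) = X t"
    using k nj Jpos[OF t] by (intro cadlag_no_jump_const[OF X]) auto
   obtain u where u: "u < t" "!!s. s : {u<..<t} ==> X s = left_lim X t"
    using cadlag_left[OF X Jpos(1)[OF t]] by metis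
   define s where "s = (max u (mesh T N (ka N t)) + t) / 2"
   have s: "u < s" "mesh T N (ka N t) < s" "s < t" using u k by (auto simp: s_def)
   have "X s = X (mesh T N (ka N t))"
    using s k nj mesh_nonneg[of T N "ka N t"] T by (intro cadlag_no_jump_const[OF X]) auto
   thus "X (mesh T N (ka N t)) = left_lim X t" using u s by auto
  qed
  have out: "X u = X (mesh T N k)" if k: "k < N" "k ~: ka N ` J" "u : {mesh T N k..mesh T N (Suc k)}" for k u
  proof (rule ccontr)
   assume "X u ~= X (mesh T N k)"
   hence "EX t:J. mesh T N k < t & t <= mesh T N (Suc k)"
    using mesh_change_has_jump[OF X less_imp_le[OF T] k(1)] k(3) unfolding J_def by blast
   then obtain t where t: "t : J" "mesh T N k < t" "t <= mesh T N (Suc k)" by blast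
   hence "k = ka N t"
    using mesh_cell[OF T N(1) Jpos(1,2)[OF t(1)]] ka[OF N(1) t(1)] k(1) t by (auto simp: Ex1_def)
   thus False using k t by auto
  qed
  have sub: "ka N ` J \<subseteq> {..<N}" using ka[OF N(1)] by auto
  let ?G = "%k. if X (mesh T N k) = X (mesh T N (Suc k)) then 0 else g (X (mesh T N k), X (mesh T N (Suc k))) (mesh T N k)"
  have "(SUM k<N. ?G k) = (SUM k:ka N ` J. ?G k)"
  proof (rule sum.mono_neutral_right)
   show "ALL k:{..<N} - ka N ` J. ?G k = 0"
    using out[where u = "mesh T N (Suc _)"] mesh_mono[of T _ "Suc _" N] T by (auto simp: less_imp_le)
  qed (use sub in auto)
  also have "... = (SUM t:J. ?G (ka N t))" by (simp add: sum.reindex[OF inj])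
  also have "... = (SUM t:J. g (left_lim X t, X t) (mesh T N (ka N t)))"
   using cell Jpos(3) by (intro sum.cong) auto
  finally show "(SUM k<N. ?G k) = (SUM t:J. g (left_lim X t, X t) (mesh T N (ka N t)))" .
  let ?D = "%k. integral {mesh T N k..mesh T N (Suc k)} (along f X) - integral {mesh T N k..mesh T N (Suc k)} (f (X (mesh T N k)))"
  have Dz: "?D k = 0" if "k < N" "k ~: ka N ` J" for k
  proof -
   have "integral {mesh T N k..mesh T N (Suc k)} (along f X) = integral {mesh T N k..mesh T N (Suc k)} (f (X (mesh T N k)))"
   proof (rule Henstock_Kurzweil_Integration.integral_cong)
    fix u assume u: "u : {mesh T N k..mesh T N (Suc k)}"
    hence "0 <= u" using mesh_nonneg[of T N k] T by auto
    thus "along f X u = f (X (mesh T N k)) u" using out[OF that u] by (simp add: along_eq)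
   qed
   thus ?thesis by simp
  qed
  have Dle: "abs (?D k) <= 2 * L * (T / real N)" for k
  proof -
   have m: "mesh T N k <= mesh T N (Suc k)" using T by (intro mesh_mono) auto
   have "abs (along f X u) <= L" if "u : {mesh T N k..mesh T N (Suc k)}" for u
    using that mesh_nonneg[of T N k] T L by (auto simp: along_eq)
   hence "abs (integral {mesh T N k..mesh T N (Suc k)} (along f X)) <= L * (mesh T N (Suc k) - mesh T N k)"
    by (intro abs_integral_le along_bdd X f m)
   moreover have "abs (integral {mesh T N k..mesh T N (Suc k)} (f (X (mesh T N k)))) <= L * (mesh T N (Suc k) - mesh T N k)"
    by (intro abs_integral_le f m L)
   ultimately show ?thesis by (simp add: mesh_Suc)
  qed
  have "integral {0..T} (along f X) - (SUM k<N. integral {mesh T N k..mesh T N (Suc k)} (f (X (mesh T N k)))) = (SUM k<N. ?D k)"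
   using integral_mesh[OF along_bdd[where f = f, OF X f] less_imp_le[OF T], of N N] N by (simp add: mesh_N sum_subtractf)
  also have "... = (SUM k:ka N ` J. ?D k)"
   using sub Dz by (intro sum.mono_neutral_right) auto
  finally have "abs (integral {0..T} (along f X) - (SUM k<N. integral {mesh T N k..mesh T N (Suc k)} (f (X (mesh T N k)))))
    <= (SUM k:ka N ` J. 2 * L * (T / real N))"
   using Dle by (simp only:) (intro order_trans[OF sum_abs sum_mono])
  also have "... = real (card J) * (2 * L * (T / real N))"
   by (simp add: card_image[OF inj])
  finally show "abs (integral {0..T} (along f X) - (SUM k<N. integral {mesh T N k..mesh T N (Suc k)} (f (X (mesh T N k)))))
   <= real (card J) * (2 * L * (T / real N))" .
 qed
 have "(%N. SUM t:J. g (left_lim X t, X t) (mesh T N (ka N t))) \<longlonglongrightarrow> (SUM t:J. g (left_lim X t, X t) t)"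
 proof (intro tendsto_sum)
  fix t assume t: "t : J"
  have "(%N. mesh T N (ka N t)) \<longlonglongrightarrow> t"
  proof (rule tendsto_sandwich)
   have "t - T / real N <= mesh T N (ka N t) & mesh T N (ka N t) <= t" if "N > 0" for N
    using ka[OF that t] mesh_Suc[of T N "ka N t"] by linarith
   thus "\<forall>\<^sub>F N in sequentially. t - T / real N <= mesh T N (ka N t)"
    "\<forall>\<^sub>F N in sequentially. mesh T N (ka N t) <= t"
    by (auto intro!: eventually_mono[OF eventually_gt_at_top[of "0::nat"]])
   show "(%N. t - T / real N) \<longlonglongrightarrow> t" using tendsto_diff[OF tendsto_const step, of t] by simp
  qed simp
  thus "(%N. g (left_lim X t, X t) (mesh T N (ka N t))) \<longlonglongrightarrow> g (left_lim X t, X t) t"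
   using g by (intro continuous_on_tendsto_compose[OF g]) auto
 qed
 hence 1: "(%N. SUM k<N. if X (mesh T N k) = X (mesh T N (Suc k)) then 0 else
    g (X (mesh T N k), X (mesh T N (Suc k))) (mesh T N k)) \<longlonglongrightarrow> (SUM t:J. g (left_lim X t, X t) t)"
  by (rule Lim_transform_eventually) (use ev in eventually_elim, simp add: jump_part)
 have "(%N. integral {0..T} (along f X) - (SUM k<N. integral {mesh T N k..mesh T N (Suc k)} (f (X (mesh T N k))))) \<longlonglongrightarrow> 0"
 proof (rule Lim_null_comparison)
  show "\<forall>\<^sub>F N in sequentially. norm (integral {0..T} (along f X) - (SUM k<N. integral {mesh T N k..mesh T N (Suc k)} (f (X (mesh T N k)))))
    <= real (card J) * (2 * L * (T / real N))"
   using ev by eventually_elim (use int_part in auto)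
  show "(%N. real (card J) * (2 * L * (T / real N))) \<longlonglongrightarrow> 0"
   using tendsto_mult_right_zero[OF tendsto_mult_right_zero[OF step, of "2 * L"], of "real (card J)"] .
 qed
 hence "(%N. integral {0..T} (along f X) - (integral {0..T} (along f X) - (SUM k<N. integral {mesh T N k..mesh T N (Suc k)} (f (X (mesh T N k))))))
   \<longlonglongrightarrow> integral {0..T} (along f X) - 0"
  by (intro tendsto_intros)
 hence 2: "(%N. SUM k<N. integral {mesh T N k..mesh T N (Suc k)} (f (X (mesh T N k)))) \<longlonglongrightarrow> integral {0..T} (along f X)"
  by simp
 show ?thesis
  using tendsto_add[OF 2 1] unfolding mesh_fun_def mesh_term_def path_fun_def J_def by (simp add: sum.distrib)
qed

section \<open>The Feynman--Kac formula\<close>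

text \<open>The rates live on the whole line, as a periodic extension, so that translations by
  periods and forward averages never leave their domain.\<close>

locale periodic_rates =
 fixes R :: "'v::finite => 'v tfun" and T0 B c :: real and E :: "('v * 'v) set"
 assumes T0: "T0 > 0" and R_bdd: "!!y z. bdd_borel (R y z)" and R_nonneg: "!!y z t. 0 <= R y z t"
  and R_le: "!!y z t. R y z t <= B" and R_per: "!!y z t. R y z (t + T0) = R y z t"
  and R_off: "!!y z t. (y, z) ~: E ==> R y z t = 0" and c: "c > 0"
  and R_lo: "!!y z t. (y, z) : E ==> c <= R y z t"
  and irr: "!!y. (y, y) ~: E" and conn: "!!y z. (y, z) : E\<^sup>*"
begin

lemma B_nonneg: "0 <= B"
 using R_nonneg R_le by (meson order_trans)

lemma R_diag: "R y y t = 0"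
 using R_off irr by blast

lemma R_abs: "abs (R y z t) <= B"
 using R_nonneg R_le by simp

text \<open>Right side of the backward equation \<open>- h' = bw f g h\<close>: the generator whose
  jumps carry the weight \<open>exp g\<close>, while the loss term keeps the original rates, plus
  the potential \<open>f\<close>.\<close>

definition bw :: "('v tfun) => (('v * 'v) tfun) => ('v tfun) => 'v tfun" where
 "bw f g h y u = (SUM z:UNIV. R y z u * (exp (g (y, z) u) * h z u - h y u)) + f y u * h y u"

lemma bw_bdd:
 assumes "!!y. bdd_borel (f y)" "!!e. bdd_borel (g e)" "!!y. bdd_borel (h y)"
 shows "bdd_borel (bw f g h y)"
 unfolding bw_def[abs_def] using assms R_bdd by (intro bdd_borel_intros)

lemma bw_bound:
 assumes f: "!!y t. abs (f y t) <= L" and g: "!!e t. abs (g e t) <= L" and h: "!!y t. abs (h y t) <= H"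
 shows "abs (bw f g h y u) <= real CARD('v) * (B * (exp L * H + H)) + L * H"
proof -
 have L: "0 <= L" "0 <= H" using g h by (meson abs_ge_zero order_trans)+
 have "abs (exp (g (y, z) u) * h z u - h y u) <= exp L * H + H" for z
 proof -
  have "abs (exp (g (y, z) u) * h z u) <= exp L * H"
   unfolding abs_mult using g[of "(y, z)" u] h L by (intro mult_mono) auto
  thus ?thesis using h[of y u] by linarith
 qed
 hence "abs (R y z u * (exp (g (y, z) u) * h z u - h y u)) <= B * (exp L * H + H)" for z
  unfolding abs_mult using R_abs B_nonneg by (intro mult_mono) auto
 hence "abs (SUM z:UNIV. R y z u * (exp (g (y, z) u) * h z u - h y u)) <= (SUM z:(UNIV::'v set). B * (exp L * H + H))"
  by (intro order_trans[OF sum_abs sum_mono])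
 moreover have "abs (f y u * h y u) <= L * H" unfolding abs_mult using f h L by (intro mult_mono) auto
 ultimately show ?thesis unfolding bw_def by simp
qed

lemma gen_bdd: "bdd_borel (gen R w z)"
proof (cases "w = z")
 case True
 have "bdd_borel (%u. - (SUM z':UNIV - {w}. R w z' u))" using R_bdd by (intro bdd_borel_intros)
 thus ?thesis using True by (simp add: gen_def[abs_def])
next
 case False
 thus ?thesis using R_bdd[of w z] by (simp add: gen_def[abs_def])
qed

lemma gen_bound: "abs (gen R w z u) <= real CARD('v) * B"
proof (cases "w = z")
 case True
 have "abs (SUM z':UNIV - {w}. R w z' u) <= (SUM z':UNIV - {w}. B)"
  using R_abs by (intro order_trans[OF sum_abs sum_mono])
 also have "... <= (SUM z':(UNIV::'v set). B)" using B_nonneg by (intro sum_mono2) auto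
 finally show ?thesis using True by (simp add: gen_def)
next
 case False
 have "B = 1 * B" by simp
 also have "... <= real CARD('v) * B" using B_nonneg by (intro mult_right_mono) (auto simp: Suc_leI)
 finally show ?thesis using False R_abs[of w z u] by (simp add: gen_def)
qed

end

locale periodic_chain = periodic_rates R T0 B c E
 for R :: "'v::finite => 'v tfun" and T0 B c and E +
 fixes p :: "real => real => 'v => 'v => real" and M :: "'w measure" and X :: "'w => real => 'v" and x :: 'v
 assumes kol: "!!s t y z. 0 <= s ==> s <= t ==>
   (%u. SUM w:UNIV. p s u y w * gen R w z u) integrable_on {s..t} &
   p s t y z = (if y = z then 1 else 0) + integral {s..t} (%u. SUM w:UNIV. p s u y w * gen R w z u)"
  and chain: "markov_chain M X p x"
begin

sublocale prob_space M
 using chain unfolding markov_chain_def by blast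

lemma X_cadlag: "om : space M ==> cadlag (X om)"
 using chain unfolding markov_chain_def by blast

lemma X_measurable: "0 <= t ==> (%om. X om t) : measurable M (count_space UNIV)"
 using chain unfolding markov_chain_def by blast

section \<open>Short-time expansion of the transition function\<close>

definition Ga :: real where "Ga = real CARD('v) * (real CARD('v) * B)"

lemma Ga_nonneg: "0 <= Ga"
 using B_nonneg by (simp add: Ga_def)

lemma p_cont: "0 <= s ==> continuous_on {s..t} (%u. p s u y z)"
proof (cases "s <= t")
 case True
 assume s: "0 <= s"
 have "continuous_on {s..t} (%u. (if y = z then 1 else 0) + integral {s..u} (%u. SUM w:UNIV. p s u y w * gen R w z u))"
  using kol[OF s True] by (intro continuous_intros indefinite_integral_continuous_1) auto
 moreover have "(if y = z then 1 else 0) + integral {s..u} (%u. SUM w:UNIV. p s u y w * gen R w z u) = p s u y z"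
  if "u : {s..t}" for u
  using kol[OF s, of u y z] that by simp
 ultimately show ?thesis by (subst continuous_on_cong[OF refl]) (auto simp del: if_split_asm dest: sym)
qed simp

lemma p_increment:
 assumes s: "0 <= s" "s <= t" and S: "!!u w. u : {s..t} ==> abs (p s u y w) <= S"
 shows "abs (p s t y z - (if y = z then 1 else 0)) <= Ga * S * (t - s)"
proof -
 have "abs (integral {s..t} (%u. SUM w:UNIV. p s u y w * gen R w z u)) <= integral {s..t} (%u. Ga * S)"
 proof (rule abs_integral_bound)
  show "(%u. SUM w:UNIV. p s u y w * gen R w z u) integrable_on {s..t}" using kol[OF s] by blast
  fix u assume u: "u : {s..t}"
  have "abs (p s u y w * gen R w z u) <= S * (real CARD('v) * B)" for w
   unfolding abs_mult using S[OF u, of w] gen_bound[of w z u] by (intro mult_mono) (auto intro: order_trans[OF abs_ge_zero])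
  hence "abs (SUM w:UNIV. p s u y w * gen R w z u) <= (SUM w:(UNIV::'v set). S * (real CARD('v) * B))"
   by (intro order_trans[OF sum_abs sum_mono])
  thus "abs (SUM w:UNIV. p s u y w * gen R w z u) <= Ga * S" by (simp add: Ga_def mult_ac)
 qed (simp add: integrable_const_ivl)
 thus ?thesis using kol[OF s, of y z] s by (simp add: mult_ac)
qed

text \<open>A time span on which the forward equation is a contraction:
  \<open>Ga * step <= 1 / 2\<close>, where \<open>Ga\<close> bounds a full row-times-column sum of
  the generator.\<close>

definition step :: real where "step = 1 / (2 * (Ga + 1))"

lemma step_pos: "step > 0" "Ga * step <= 1 / 2" "step <= 1"
 using Ga_nonneg by (auto simp: step_def field_simps)

text \<open>The estimates on \<open>p\<close> rest on the forward equation alone, with neither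
  positivity nor row sums at hand. Continuity makes the supremum \<open>S\<close> over a short
  interval finite, and the equation bounds it by \<open>1 + S / 2\<close>.\<close>

lemma p_le_2:
 assumes s: "0 <= s" "s <= t" "t - s <= step" shows "abs (p s t y z) <= 2"
proof -
 define S where "S = (SUP q\<in>UNIV \<times> {s..s + step}. abs (p s (snd q) y (fst q)))"
 have "bdd_above ((%u. abs (p s u y z)) ` {s..s + step})" for z
  using p_cont[OF s(1), of "s + step" y z]
  by (intro bounded_imp_bdd_above compact_imp_bounded compact_continuous_image continuous_intros) auto
 hence "ALL z. EX K. ALL u:{s..s + step}. abs (p s u y z) <= K" unfolding bdd_above_def by fastforce
 then obtain K where K: "!!z u. u : {s..s + step} ==> abs (p s u y z) <= K z" by metis
 have K0: "0 <= K z" for z using K[of s z] step_pos(1) by (meson abs_ge_zero atLeastAtMost_iff less_eq_real_def order_refl order_trans add_increasing2 less_imp_le)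
 have bdd: "bdd_above ((%q. abs (p s (snd q) y (fst q))) ` (UNIV \<times> {s..s + step}))"
 proof (rule bdd_aboveI2)
  fix q assume "q : (UNIV :: 'v set) \<times> {s..s + step}"
  hence "abs (p s (snd q) y (fst q)) <= K (fst q)" using K by auto
  also have "... <= (SUM z:UNIV. K z)" using K0 by (intro member_le_sum) auto
  finally show "abs (p s (snd q) y (fst q)) <= (SUM z:UNIV. K z)" .
 qed
 have le_S: "abs (p s u y z) <= S" if "u : {s..s + step}" for u z
  unfolding S_def using that by (intro cSUP_upper2[OF bdd, of "(z, u)"]) auto
 have S0: "S >= 0" using le_S[of s] step_pos(1) by (meson abs_ge_zero atLeastAtMost_iff le_add_same_cancel1 less_imp_le order_refl order_trans)
 have "S <= 1 + S / 2"
  unfolding S_def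
 proof (rule cSUP_least)
  show "(UNIV :: 'v set) \<times> {s..s + step} ~= {}" using step_pos by auto
  fix q assume "q : (UNIV :: 'v set) \<times> {s..s + step}"
  then obtain z u where q: "q = (z, u)" and u: "s <= u" "u <= s + step" by auto
  have "abs (p s u y z - (if y = z then 1 else 0)) <= Ga * S * (u - s)"
   using u le_S by (intro p_increment s) auto
  also have "... <= Ga * S * step" using u Ga_nonneg S0 by (intro mult_left_mono) auto
  also have "... <= S / 2" using mult_right_mono[OF step_pos(2) S0] by (simp add: mult_ac)
  finally show "abs (p s (snd q) y (fst q)) <= 1 + (SUP q\<in>UNIV \<times> {s..s + step}. abs (p s (snd q) y (fst q))) / 2"
   unfolding S_def[symmetric] q using abs_triangle_ineq[of "p s u y z - (if y = z then 1 else 0)" "if y = z then 1 else 0"]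
   by (cases "y = z") auto
 qed
 hence "S <= 2" by simp
 thus ?thesis using le_S[of t z] s by auto
qed

lemma p_lin:
 assumes s: "0 <= s" "s <= t" "t - s <= step"
 shows "abs (p s t y z - (if y = z then 1 else 0)) <= 2 * Ga * (t - s)"
 using p_increment[OF s(1,2), of y 2 z] p_le_2[OF s(1)] s by (auto simp: mult_ac)

text \<open>The first-order bound is inserted into the forward equation. The main term stays an
  integral of the rates, which have no value at a point that could represent it.\<close>

lemma p_quad:
 assumes s: "0 <= s" "s <= t" "t - s <= step"
 shows "abs (p s t y z - ((if y = z then 1 else 0) + integral {s..t} (gen R y z))) <= 2 * Ga\<^sup>2 * (t - s)\<^sup>2"
proof -
 let ?d = "%w. if y = w then 1 else (0::real)"
 have int: "(%u. SUM w:UNIV. p s u y w * gen R w z u) integrable_on {s..t}" using kol[OF s(1,2)] by blast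
 have "gen R y z = (%u. SUM w:UNIV. ?d w * gen R w z u)" by (simp add: if_distrib[of "%x. x * _"] cong: if_cong)
 hence "p s t y z - (?d z + integral {s..t} (gen R y z))
   = integral {s..t} (%u. SUM w:UNIV. p s u y w * gen R w z u) - integral {s..t} (%u. SUM w:UNIV. ?d w * gen R w z u)"
  using kol[OF s(1,2), of y z] by simp
 also have "... = integral {s..t} (%u. (SUM w:UNIV. p s u y w * gen R w z u) - (SUM w:UNIV. ?d w * gen R w z u))"
  using gen_bdd by (intro Henstock_Kurzweil_Integration.integral_diff[symmetric] int bdd_borel_integrable bdd_borel_intros)
 finally have eq: "p s t y z - (?d z + integral {s..t} (gen R y z))
   = integral {s..t} (%u. (SUM w:UNIV. p s u y w * gen R w z u) - (SUM w:UNIV. ?d w * gen R w z u))" .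
 have "abs (integral {s..t} (%u. (SUM w:UNIV. p s u y w * gen R w z u) - (SUM w:UNIV. ?d w * gen R w z u)))
   <= integral {s..t} (%u. 2 * Ga\<^sup>2 * (t - s))"
 proof (rule abs_integral_bound)
  show "(%u. (SUM w:UNIV. p s u y w * gen R w z u) - (SUM w:UNIV. ?d w * gen R w z u)) integrable_on {s..t}"
   using gen_bdd by (intro integrable_diff int bdd_borel_integrable bdd_borel_intros)
  fix u assume u: "u : {s..t}"
  have "abs ((p s u y w - ?d w) * gen R w z u) <= (2 * Ga * (t - s)) * (real CARD('v) * B)" for w
   unfolding abs_mult
  proof (rule mult_mono)
   have "abs (p s u y w - ?d w) <= 2 * Ga * (u - s)" using u s by (intro p_lin) auto
   also have "... <= 2 * Ga * (t - s)" using u Ga_nonneg by (intro mult_left_mono) auto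
   finally show "abs (p s u y w - ?d w) <= 2 * Ga * (t - s)" .
  qed (use gen_bound Ga_nonneg s in auto)
  hence "abs (SUM w:UNIV. (p s u y w - ?d w) * gen R w z u) <= (SUM w:(UNIV::'v set). (2 * Ga * (t - s)) * (real CARD('v) * B))"
   by (intro order_trans[OF sum_abs sum_mono])
  also have "... = 2 * Ga\<^sup>2 * (t - s)" by (simp add: Ga_def power2_eq_square mult_ac)
  finally show "abs ((SUM w:UNIV. p s u y w * gen R w z u) - (SUM w:UNIV. ?d w * gen R w z u)) <= 2 * Ga\<^sup>2 * (t - s)"
   by (simp add: sum_subtractf left_diff_distrib)
 qed (simp add: integrable_const_ivl)
 thus ?thesis unfolding eq using s by (simp add: power2_eq_square mult_ac)
qed

end

lemma exp_linear_errors: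
 fixes a b :: real
 assumes "abs a <= b" "b <= L" "0 <= b"
 shows "abs (exp a - 1) <= exp L * b" "abs (exp a - 1 - a) <= exp L * b\<^sup>2"
proof -
 have e: "abs (exp v - 1) <= exp L * abs v" if "abs v <= L" for v :: real
 proof (cases "v >= 0")
  case True
  have "1 - v <= exp (- v)" using exp_ge_add_one_self[of "- v"] by simp
  hence "(1 - v) * exp v <= 1" using mult_right_mono[of "1 - v" "exp (- v)" "exp v"] by (simp add: mult_exp_exp)
  hence "exp v - 1 <= v * exp v" by (simp add: algebra_simps)
  also have "... <= v * exp L" using True that by (intro mult_left_mono) auto
  finally show ?thesis using True by (simp add: mult.commute)
 next
  case False
  have "1 - exp v <= - v" using exp_ge_add_one_self[of v] by linarith
  also have "... <= exp L * abs v" using False that mult_right_mono[of 1 "exp L" "- v"] by simp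
  finally show ?thesis using False by simp
 qed
 have "abs (exp a - 1) <= exp L * abs a" using e assms by simp
 also have "... <= exp L * b" using assms by simp
 finally show "abs (exp a - 1) <= exp L * b" .
 have "abs (exp a - 1 - a) <= exp L * abs a * abs a"
 proof -
  have low: "0 <= exp a - 1 - a" using exp_ge_add_one_self[of a] by linarith
  have "1 - a <= exp (- a)" using exp_ge_add_one_self[of "- a"] by simp
  hence "(1 - a) * exp a <= 1" using mult_right_mono[of "1 - a" "exp (- a)" "exp a"] by (simp add: mult_exp_exp)
  hence "exp a - 1 - a <= a * (exp a - 1)" by (simp add: algebra_simps)
  also have "... <= abs a * abs (exp a - 1)" by (metis abs_ge_self abs_mult)
  also have "... <= abs a * (exp L * abs a)" using e assms by (intro mult_left_mono) auto
  finally show ?thesis using low by (simp add: mult_ac)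
 qed
 also have "... <= exp L * b * b" using assms by (intro mult_mono) auto
 finally show "abs (exp a - 1 - a) <= exp L * b\<^sup>2" by (simp add: power2_eq_square mult.assoc)
qed

lemma exp_diff_le:
 fixes a b :: real assumes "a <= L" "b <= L" shows "abs (exp a - exp b) <= exp L * abs (a - b)"
proof -
 have *: "exp a - exp b <= exp L * (a - b)" if "b <= a" "a <= L" for a b :: real
 proof -
  have "1 - (a - b) <= exp (b - a)" using exp_ge_add_one_self[of "b - a"] by linarith
  hence "(1 - (a - b)) * exp a <= exp (b - a) * exp a" by (intro mult_right_mono) auto
  hence "exp a - exp b <= (a - b) * exp a" by (simp add: mult_exp_exp algebra_simps)
  also have "... <= (a - b) * exp L" using that by (intro mult_left_mono) auto
  finally show ?thesis by (simp add: mult.commute)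
 qed
 show ?thesis using *[of a b] *[of b a] assms by (cases "b <= a") (auto simp: abs_minus_commute)
qed

context periodic_chain
begin

text \<open>Consistency of one step of the discretised recursion with the backward equation. The
  error is the step times (step plus oscillation of \<open>g\<close>), so the sum over all cells
  vanishes with the mesh by continuity of \<open>g\<close> alone.\<close>

lemma local_error:
 assumes f: "!!y. bdd_borel (f y)" "!!y t. abs (f y t) <= L" and g: "!!e. bdd_borel (g e)" "!!e t. abs (g e t) <= L"
  and h: "!!y. bdd_borel (h y)" "!!y t. abs (h y t) <= H"
  and sol: "!!y. indef 0 T (h y) (bw f g h y)"
 obtains K where "K >= 0" "!!s t y et. 0 <= s ==> s <= t ==> t <= T ==> t - s <= step ==>
  (ALL e. ALL u:{s..t}. abs (g e u - g e s) <= et) ==>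
  abs ((SUM z:UNIV. p s t y z * exp (integral {s..t} (f y) + (if y = z then 0 else g (y, z) s)) * h z t) - h y s)
   <= K * (t - s) * ((t - s) + et)"
proof -
 have L: "0 <= L" "0 <= H" using g(2) h(2) by (meson abs_ge_zero order_trans)+
 define K4 where "K4 = real CARD('v) * (B * (exp L * H + H)) + L * H"
 define K3 where "K3 = real CARD('v) * (B * (exp L * H + H))"
 define K where "K = exp L * L\<^sup>2 * H + exp L * L * K3 + exp L * (real CARD('v) * (2 * Ga\<^sup>2 * exp L * H))
   + (real CARD('v) * (B * (exp L * H + exp L * K4 + K4)) + L * K4)"
 have K34: "K3 >= 0" "K4 >= 0" using L B_nonneg by (auto simp: K3_def K4_def)
 have K0: "K >= 0" unfolding K_def using L B_nonneg K34 by (intro add_nonneg_nonneg mult_nonneg_nonneg) auto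
 show ?thesis
 proof (rule that[OF K0])
  fix s t y et
  assume st: "0 <= s" "s <= t" "t <= T" "t - s <= step" and "ALL e. ALL u:{s..t}. abs (g e u - g e s) <= et"
  hence et: "!!e u. u : {s..t} ==> abs (g e u - g e s) <= et" by blast
  define d where "d = t - s"
  have d: "0 <= d" "d <= 1" using st step_pos by (auto simp: d_def)
  have et0: "et >= 0" using et[of s undefined] st by auto
  define ph where "ph = integral {s..t} (f y)"
  define a where "a z = integral {s..t} (R y z)" for z
  define e where "e z = p s t y z - ((if y = z then 1 else 0) + integral {s..t} (gen R y z))" for z
  define G where "G z = exp (if y = z then 0 else g (y, z) s)" for z
  \<comment> \<open>The first-order effect of a jump, with \<open>g\<close> frozen at
    \<open>s\<close> and \<open>h\<close> at \<open>t\<close>. It appears both in the one-step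
    expectation and in the backward equation and cancels in their difference.\<close>
  define Y where "Y = (SUM z:UNIV. a z * (exp (g (y, z) s) * h z t - h y t))"
  define Er where "Er = (SUM z:UNIV. e z * G z * h z t)"
  have ph: "abs ph <= L * d" unfolding ph_def d_def using st by (intro abs_integral_le f)
  have a: "abs (a z) <= B * d" for z unfolding a_def d_def using st R_abs by (intro abs_integral_le R_bdd) auto
  have ay: "a y = 0" unfolding a_def using R_diag[of y] by (subst integral_cong[of _ _ "%_. 0"]) auto
  have e: "abs (e z) <= 2 * Ga\<^sup>2 * d\<^sup>2" for z unfolding e_def d_def using st by (intro p_quad)
  have genint: "integral {s..t} (gen R y z) = (if y = z then - (SUM w:UNIV. a w) else a z)" for z
  proof (cases "y = z")
   case True
   have "integral {s..t} (gen R y y) = - integral {s..t} (%u. SUM w:UNIV - {y}. R y w u)"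
    by (simp add: gen_def[abs_def])
   also have "... = - (SUM w:UNIV - {y}. a w)" unfolding a_def using R_bdd by (subst integral_bdd_sum) auto
   also have "(SUM w:UNIV - {y}. a w) = (SUM w:UNIV. a w)" using ay by (simp add: sum.remove[of UNIV y])
   finally show ?thesis using True by simp
  qed (simp add: gen_def[abs_def] a_def)
  have Pz: "p s t y z = (if y = z then 1 - (SUM w:UNIV. a w) else 0) + a z + e z" for z
   using ay genint[of z] unfolding e_def by auto
  have "(SUM z:UNIV. p s t y z * exp (ph + (if y = z then 0 else g (y, z) s)) * h z t)
    = exp ph * (SUM z:UNIV. (if y = z then (1 - (SUM w:UNIV. a w)) * h y t else 0) + a z * exp (g (y, z) s) * h z t + e z * G z * h z t)"
   unfolding sum_distrib_left
   by (intro sum.cong) (auto simp: Pz G_def exp_add ay algebra_simps)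
  also have "... = exp ph * (h y t + Y + Er)"
   unfolding Y_def Er_def by (simp add: sum.distrib sum_subtractf sum_distrib_right[symmetric] right_diff_distrib algebra_simps)
  finally have lhs: "(SUM z:UNIV. p s t y z * exp (ph + (if y = z then 0 else g (y, z) s)) * h z t) = exp ph * (h y t + Y + Er)" .
  have G: "abs (G z) <= exp L" for z unfolding G_def using g(2)[of "(y, z)" s] L by auto
  have Y: "abs Y <= K3 * d"
  proof -
   have "abs (a z * (exp (g (y, z) s) * h z t - h y t)) <= (B * d) * (exp L * H + H)" for z
    unfolding abs_mult
   proof (rule mult_mono[OF a])
    have "abs (exp (g (y, z) s) * h z t) <= exp L * H"
     unfolding abs_mult using g(2)[of "(y, z)" s] h(2) L by (intro mult_mono) auto
    thus "abs (exp (g (y, z) s) * h z t - h y t) <= exp L * H + H" using h(2)[of y t] by linarith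
   qed (use B_nonneg d in auto)
   hence "abs Y <= (SUM z:(UNIV::'v set). (B * d) * (exp L * H + H))"
    unfolding Y_def by (intro order_trans[OF sum_abs sum_mono])
   thus ?thesis by (simp add: K3_def mult_ac)
  qed
  have Er: "abs Er <= real CARD('v) * (2 * Ga\<^sup>2 * exp L * H) * d\<^sup>2"
  proof -
   have "abs (e z * G z * h z t) <= (2 * Ga\<^sup>2 * d\<^sup>2) * exp L * H" for z
    unfolding abs_mult using e[of z] G[of z] h(2)[of z t] L by (intro mult_mono) auto
   hence "abs Er <= (SUM z:(UNIV::'v set). (2 * Ga\<^sup>2 * d\<^sup>2) * exp L * H)"
    unfolding Er_def by (intro order_trans[OF sum_abs sum_mono])
   thus ?thesis by (simp add: mult_ac)
  qed
  have bk: "bdd_borel (bw f g h y)" for y using f g h by (intro bw_bdd)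
  have kb: "abs (bw f g h y u) <= K4" for y u unfolding K4_def by (rule bw_bound[OF f(2) g(2) h(2)])
  have lip: "abs (h z u - h z t) <= K4 * d" if "u : {s..t}" for z u
  proof -
   have "abs (h z u - h z t) <= K4 * abs (u - t)"
    using that st by (intro indef_lipschitz[OF sol bk kb]) auto
   also have "... <= K4 * d" using that K34 by (intro mult_left_mono) (auto simp: d_def)
   finally show ?thesis .
  qed
  \<comment> \<open>The error made in the integrand of the backward equation when \<open>g\<close>
    is frozen at \<open>s\<close> and \<open>h\<close> at \<open>t\<close>.\<close>
  define er where "er u = (SUM z:UNIV. R y z u * ((exp (g (y, z) u) * h z u - exp (g (y, z) s) * h z t) - (h y u - h y t)))
    + f y u * (h y u - h y t)" for u
  have erb: "bdd_borel er" unfolding er_def[abs_def] using R_bdd f g h by (intro bdd_borel_intros)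
  have "h y s = h y t + integral {s..t} (bw f g h y)" using st by (intro indefD[OF sol]) auto
  also have "integral {s..t} (bw f g h y) = integral {s..t} (%u. ((SUM z:UNIV. (exp (g (y, z) s) * h z t - h y t) * R y z u) + h y t * f y u) + er u)"
   unfolding bw_def[abs_def] er_def
   by (intro arg_cong[where f = "integral {s..t}"] ext) (simp add: sum.distrib[symmetric] algebra_simps)
  also have "... = ((SUM z:UNIV. (exp (g (y, z) s) * h z t - h y t) * a z) + h y t * ph) + integral {s..t} er"
   unfolding a_def ph_def using R_bdd f erb
   by (simp add: integral_bdd_add integral_bdd_sum bdd_borel_intros)
  finally have rhs: "h y s = h y t + Y + ph * h y t + integral {s..t} er" unfolding Y_def by (simp add: mult_ac)
  have "abs (integral {s..t} er) <= (real CARD('v) * (B * (exp L * H * et + exp L * K4 * d + K4 * d)) + L * (K4 * d)) * (t - s)"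
  proof (rule abs_integral_le[OF erb _ st(2)])
   fix u assume u: "u : {s..t}"
   have "abs (R y z u * ((exp (g (y, z) u) * h z u - exp (g (y, z) s) * h z t) - (h y u - h y t)))
     <= B * (exp L * H * et + exp L * K4 * d + K4 * d)" for z
    unfolding abs_mult
   proof (rule mult_mono[OF R_abs])
    have ge: "exp (g (y, z) s) <= exp L" "g (y, z) u <= L" "g (y, z) s <= L"
     using g(2)[of "(y, z)" s] g(2)[of "(y, z)" u] by auto
    have "exp (g (y, z) u) * h z u - exp (g (y, z) s) * h z t
      = (exp (g (y, z) u) - exp (g (y, z) s)) * h z u + exp (g (y, z) s) * (h z u - h z t)"
     by (simp add: algebra_simps)
    moreover have "abs ((exp (g (y, z) u) - exp (g (y, z) s)) * h z u) <= (exp L * et) * H"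
     unfolding abs_mult
    proof (rule mult_mono[OF _ h(2)])
     have "abs (exp (g (y, z) u) - exp (g (y, z) s)) <= exp L * abs (g (y, z) u - g (y, z) s)"
      using ge by (intro exp_diff_le)
     also have "... <= exp L * et" using et[OF u] by (intro mult_left_mono) auto
     finally show "abs (exp (g (y, z) u) - exp (g (y, z) s)) <= exp L * et" .
    qed (use et0 in auto)
    moreover have "abs (exp (g (y, z) s) * (h z u - h z t)) <= exp L * (K4 * d)"
     unfolding abs_mult using ge lip[OF u] by (intro mult_mono) auto
    ultimately show "abs ((exp (g (y, z) u) * h z u - exp (g (y, z) s) * h z t) - (h y u - h y t))
      <= exp L * H * et + exp L * K4 * d + K4 * d"
     using lip[OF u, of y] by (simp add: mult_ac)
   qed (use B_nonneg in auto)
   hence "abs (SUM z:UNIV. R y z u * ((exp (g (y, z) u) * h z u - exp (g (y, z) s) * h z t) - (h y u - h y t)))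
    <= (SUM z:(UNIV::'v set). B * (exp L * H * et + exp L * K4 * d + K4 * d))"
    by (intro order_trans[OF sum_abs sum_mono])
   moreover have "abs (f y u * (h y u - h y t)) <= L * (K4 * d)"
    unfolding abs_mult using f(2) lip[OF u] L by (intro mult_mono) auto
   ultimately show "abs (er u) <= real CARD('v) * (B * (exp L * H * et + exp L * K4 * d + K4 * d)) + L * (K4 * d)"
    unfolding er_def by simp
  qed
  hence er: "abs (integral {s..t} er) <= (real CARD('v) * (B * (exp L * H + exp L * K4 + K4)) + L * K4) * (d * (d + et))"
  proof (rule order_trans)
   have "exp L * H * et + exp L * K4 * d + K4 * d <= (exp L * H + exp L * K4 + K4) * (d + et)"
    using L K34 d et0 by (simp add: algebra_simps)
   hence "real CARD('v) * (B * (exp L * H * et + exp L * K4 * d + K4 * d)) + L * (K4 * d)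
     <= real CARD('v) * (B * ((exp L * H + exp L * K4 + K4) * (d + et))) + L * (K4 * (d + et))"
    using L K34 d et0 B_nonneg by (intro add_mono mult_left_mono) auto
   hence "(real CARD('v) * (B * (exp L * H * et + exp L * K4 * d + K4 * d)) + L * (K4 * d)) * d
     <= (real CARD('v) * (B * ((exp L * H + exp L * K4 + K4) * (d + et))) + L * (K4 * (d + et))) * d"
    using d by (intro mult_right_mono)
   thus "(real CARD('v) * (B * (exp L * H * et + exp L * K4 * d + K4 * d)) + L * (K4 * d)) * (t - s)
     <= (real CARD('v) * (B * (exp L * H + exp L * K4 + K4)) + L * K4) * (d * (d + et))"
    unfolding d_def[symmetric] by (simp add: algebra_simps)
  qed
  have ex: "abs (exp ph - 1) <= exp L * (L * d)" "abs (exp ph - 1 - ph) <= exp L * (L * d)\<^sup>2"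
   using exp_linear_errors[OF ph, of L] L d by (auto simp: mult_left_le)
  have "ph <= L" using ph L d mult_left_le[of d L] by linarith
  hence eph: "abs (exp ph) <= exp L" by simp
  have "exp ph * (h y t + Y + Er) - h y s = (exp ph - 1 - ph) * h y t + (exp ph - 1) * Y + exp ph * Er - integral {s..t} er"
   unfolding rhs by (simp add: algebra_simps)
  moreover have "abs ((exp ph - 1 - ph) * h y t) <= (exp L * (L * d)\<^sup>2) * H"
   unfolding abs_mult using ex h(2) by (intro mult_mono) auto
  moreover have "abs ((exp ph - 1) * Y) <= (exp L * (L * d)) * (K3 * d)"
   unfolding abs_mult using ex Y L d by (intro mult_mono) auto
  moreover have "abs (exp ph * Er) <= exp L * (real CARD('v) * (2 * Ga\<^sup>2 * exp L * H) * d\<^sup>2)"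
   unfolding abs_mult using eph Er by (intro mult_mono) auto
  ultimately have "abs (exp ph * (h y t + Y + Er) - h y s) <= (exp L * (L * d)\<^sup>2) * H + (exp L * (L * d)) * (K3 * d)
    + exp L * (real CARD('v) * (2 * Ga\<^sup>2 * exp L * H) * d\<^sup>2) + (real CARD('v) * (B * (exp L * H + exp L * K4 + K4)) + L * K4) * (d * (d + et))"
   using er by linarith
  also have "... = (exp L * L\<^sup>2 * H + exp L * L * K3 + exp L * (real CARD('v) * (2 * Ga\<^sup>2 * exp L * H))) * (d * d)
    + (real CARD('v) * (B * (exp L * H + exp L * K4 + K4)) + L * K4) * (d * (d + et))"
   by (simp add: power2_eq_square algebra_simps)
  also have "... <= (exp L * L\<^sup>2 * H + exp L * L * K3 + exp L * (real CARD('v) * (2 * Ga\<^sup>2 * exp L * H))) * (d * (d + et))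
    + (real CARD('v) * (B * (exp L * H + exp L * K4 + K4)) + L * K4) * (d * (d + et))"
   using L K34 d et0 by (intro add_mono mult_left_mono order_refl add_nonneg_nonneg mult_nonneg_nonneg) auto
  also have "... = K * d * (d + et)" unfolding K_def by (simp add: algebra_simps)
  finally show "abs ((SUM z:UNIV. p s t y z * exp (integral {s..t} (f y) + (if y = z then 0 else g (y, z) s)) * h z t) - h y s)
   <= K * (t - s) * ((t - s) + et)"
   using lhs unfolding ph_def d_def by simp
 qed
qed

end

section \<open>The discretised expectation as a matrix recursion\<close>

fun chain_val :: "(nat => 'v => 'v => real) => (nat => 'v => 'v => real) => ('v::finite => real) => nat => nat => 'v => real" where
 "chain_val P w q 0 k y = q y"
| "chain_val P w q (Suc j) k y = (SUM z:UNIV. P k y z * w k y z * chain_val P w q j (Suc k) z)"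

fun list_weight :: "(nat => 'v => 'v => real) => ('v => real) => nat => 'v => 'v list => real" where
 "list_weight w q k y [] = q y"
| "list_weight w q k y (z # zs) = w k y z * list_weight w q (Suc k) z zs"

lemma sum_lists_Suc:
 fixes G :: "'v::finite list => real"
 shows "(SUM zs:{zs. length zs = Suc j}. G zs) = (SUM z:UNIV. SUM zs:{zs. length zs = j}. G (z # zs))"
proof -
 have eq: "{zs. length zs = Suc j} = (%(z, zs). z # zs) ` (UNIV \<times> {zs. length zs = j})"
  by (auto simp: length_Suc_conv image_iff)
 have "inj_on (%(z, zs). z # zs) (UNIV \<times> {zs :: 'v list. length zs = j})"
  by (auto simp: inj_on_def)
 hence "(SUM zs:{zs. length zs = Suc j}. G zs) = (SUM (z, zs):UNIV \<times> {zs. length zs = j}. G (z # zs))"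
  unfolding eq by (subst sum.reindex) (auto simp: case_prod_unfold intro!: sum.cong)
 thus ?thesis by (simp add: sum.cartesian_product)
qed

text \<open>A sum over all state sequences of products of transition probabilities and weights is a
  product of weighted transition matrices, evaluated from the last step to the first by
  \<open>chain_val\<close>.\<close>

lemma sum_fdd_list_weight:
 fixes p :: "real => real => 'v::finite => 'v => real"
 shows "(SUM zs:{zs. length zs = j}. list_weight w q k y zs * fdd p (ta k) y (map ta [Suc k..<Suc k + j]) zs)
  = chain_val (%k. p (ta k) (ta (Suc k))) w q j k y"
proof (induction j arbitrary: k y)
 case (Suc j)
 have u: "[Suc k..<Suc k + Suc j] = Suc k # [Suc (Suc k)..<Suc (Suc k) + j]" by (simp add: upt_conv_Cons)
 have "(SUM zs:{zs. length zs = Suc j}. list_weight w q k y zs * fdd p (ta k) y (map ta [Suc k..<Suc k + Suc j]) zs)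
  = (SUM z:UNIV. p (ta k) (ta (Suc k)) y z * w k y z *
    (SUM zs:{zs. length zs = j}. list_weight w q (Suc k) z zs * fdd p (ta (Suc k)) z (map ta [Suc (Suc k)..<Suc (Suc k) + j]) zs))"
  unfolding sum_lists_Suc u sum_distrib_left list.map fdd.simps list_weight.simps by (intro sum.cong refl) (simp add: mult_ac)
 thus ?case unfolding Suc.IH by simp
qed simp

lemma list_weight_exp:
 "list_weight (%k y z. exp (m k y z)) q k (Y k) (map Y [Suc k..<Suc k + j])
  = exp (SUM i:{k..<k + j}. m i (Y i) (Y (Suc i))) * q (Y (k + j))"
proof (induction j arbitrary: k)
 case (Suc j)
 have u: "[Suc k..<Suc k + Suc j] = Suc k # [Suc (Suc k)..<Suc (Suc k) + j]" by (simp add: upt_conv_Cons)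
 have s: "{k..<k + Suc j} = insert k {Suc k..<Suc k + j}" by auto
 show ?case unfolding u list.map list_weight.simps Suc.IH s by (simp add: exp_add)
qed simp

text \<open>Stability and consistency give convergence: \<open>et\<close> satisfies the recursion up
  to \<open>ep\<close> per step, the errors add up over \<open>j\<close> steps, and each is
  amplified by at most \<open>rh\<close> per step.\<close>

lemma chain_val_close:
 fixes P w :: "nat => 'v::finite => 'v => real"
 assumes w: "!!k y z. 0 <= w k y z" and rh: "1 <= rh" and ep: "0 <= ep"
  and row: "!!k y. k < N ==> (SUM z:UNIV. abs (P k y z) * w k y z) <= rh"
  and err: "!!k y. k < N ==> abs ((SUM z:UNIV. P k y z * w k y z * et (Suc k) z) - et k y) <= ep"
  and q: "q = et N"
 shows "j <= N ==> abs (chain_val P w q j (N - j) y - et (N - j) y) <= real j * ep * rh ^ j"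
proof (induction j arbitrary: y)
 case 0
 thus ?case by (simp add: q)
next
 case (Suc j)
 define k where "k = N - Suc j"
 have k: "Suc k = N - j" "k < N" using Suc.prems by (auto simp: k_def)
 have "abs (SUM z:UNIV. P k y z * w k y z * (chain_val P w q j (Suc k) z - et (Suc k) z))
   <= (SUM z:UNIV. abs (P k y z) * w k y z * (real j * ep * rh ^ j))"
 proof (rule order_trans[OF sum_abs sum_mono])
  fix z
  have "abs (chain_val P w q j (Suc k) z - et (Suc k) z) <= real j * ep * rh ^ j"
   unfolding k(1) using Suc by simp
  thus "abs (P k y z * w k y z * (chain_val P w q j (Suc k) z - et (Suc k) z)) <= abs (P k y z) * w k y z * (real j * ep * rh ^ j)"
   unfolding abs_mult using w[of k y z] by (simp add: mult_left_mono)
 qed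
 also have "... = (SUM z:UNIV. abs (P k y z) * w k y z) * (real j * ep * rh ^ j)" by (simp add: sum_distrib_right)
 also have "... <= rh * (real j * ep * rh ^ j)" using row[OF k(2)] ep rh by (intro mult_right_mono) auto
 finally have 1: "abs (SUM z:UNIV. P k y z * w k y z * (chain_val P w q j (Suc k) z - et (Suc k) z)) <= real j * ep * rh ^ Suc j"
  by (simp add: mult_ac)
 have "chain_val P w q (Suc j) k y - et k y = (SUM z:UNIV. P k y z * w k y z * (chain_val P w q j (Suc k) z - et (Suc k) z))
   + ((SUM z:UNIV. P k y z * w k y z * et (Suc k) z) - et k y)"
  by (simp add: right_diff_distrib sum_subtractf)
 hence "abs (chain_val P w q (Suc j) k y - et k y) <= real j * ep * rh ^ Suc j + ep"
  using 1 err[OF k(2), of y] by linarith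
 also have "... <= real j * ep * rh ^ Suc j + ep * rh ^ Suc j"
  using ep rh mult_left_mono[OF one_le_power[OF rh, of "Suc j"] ep] by simp
 also have "... = real (Suc j) * ep * rh ^ Suc j" by (simp add: algebra_simps)
 finally show ?case unfolding k_def .
qed

lemma chain_val_bound:
 fixes P w :: "nat => 'v::finite => 'v => real"
 assumes w: "!!k y z. 0 <= w k y z" and rh: "0 <= rh"
  and row: "!!k y. k < N ==> (SUM z:UNIV. abs (P k y z) * w k y z) <= rh"
 shows "j + k <= N ==> abs (chain_val P w (%_. 1) j k y) <= rh ^ j"
proof (induction j arbitrary: k y)
 case (Suc j)
 have "abs (chain_val P w (%_. 1) (Suc j) k y) <= (SUM z:UNIV. abs (P k y z) * w k y z * rh ^ j)"
  unfolding chain_val.simps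
 proof (rule order_trans[OF sum_abs sum_mono])
  fix z
  show "abs (P k y z * w k y z * chain_val P w (%_. 1) j (Suc k) z) <= abs (P k y z) * w k y z * rh ^ j"
   unfolding abs_mult using w[of k y z] Suc by (simp add: mult_left_mono)
 qed
 also have "... = (SUM z:UNIV. abs (P k y z) * w k y z) * rh ^ j" by (simp add: sum_distrib_right)
 also have "... <= rh * rh ^ j" using row[of k y] Suc.prems rh by (intro mult_right_mono) auto
 finally show ?case by simp
qed simp

lemma sorted_mesh: "0 <= T ==> sorted (map (mesh T N) [a..<b])"
 unfolding sorted_map by (rule sorted_wrt_mono_rel[OF _ sorted_upt]) (rule mesh_mono)

context periodic_chain
begin

lemma list_event_measurable:
 assumes "!!t. t : set ts ==> 0 <= t"
 shows "{om : space M. ALL i<length ts. X om (ts ! i) = zs ! i} : sets M"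
proof -
 have "{om : space M. ALL i:{..<length ts}. X om (ts ! i) = zs ! i} : sets M"
 proof (rule sets.sets_Collect_finite_All)
  fix i assume "i : {..<length ts}"
  hence "(%om. X om (ts ! i)) : measurable M (count_space UNIV)" using assms by (intro X_measurable) auto
  hence "(%om. X om (ts ! i)) -` {zs ! i} \<inter> space M : sets M" by (rule measurable_sets) auto
  moreover have "(%om. X om (ts ! i)) -` {zs ! i} \<inter> space M = {om : space M. X om (ts ! i) = zs ! i}" by auto
  ultimately show "{om : space M. X om (ts ! i) = zs ! i} : sets M" by simp
 qed auto
 thus ?thesis by (simp only: Ball_def lessThan_iff)
qed

lemma chain_fdd:
 "length ts = length ys ==> sorted ts ==> (!!t. t : set ts ==> 0 <= t) ==>
  prob {om : space M. ALL i<length ts. X om (ts ! i) = ys ! i} = fdd p 0 x ts ys"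
 using chain unfolding markov_chain_def by blast

lemma expectation_list:
 assumes ts: "sorted ts" "!!t. t : set ts ==> 0 <= t"
 shows "integrable M (%om. G (map (X om) ts))"
  and "expectation (%om. G (map (X om) ts)) = (SUM zs:{zs. length zs = length ts}. G zs * fdd p 0 x ts zs)"
proof -
 let ?Z = "{zs :: 'v list. length zs = length ts}"
 define A where "A zs = {om : space M. ALL i<length ts. X om (ts ! i) = zs ! i}" for zs
 have A: "A zs : sets M" for zs unfolding A_def by (rule list_event_measurable) (rule ts(2))
 have fin: "finite ?Z" using finite_lists_length_eq[of "UNIV :: 'v set" "length ts"] by simp
 have eq: "G (map (X om) ts) = (SUM zs:?Z. G zs * indicator (A zs) om)" if "om : space M" for om
 proof -
  have "(SUM zs:?Z. G zs * indicator (A zs) om) = (SUM zs:?Z. if zs = map (X om) ts then G zs else 0)"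
   using that by (intro sum.cong) (auto simp: A_def indicator_def list_eq_iff_nth_eq)
  thus ?thesis using fin by simp
 qed
 have int: "integrable M (%om. G zs * indicator (A zs) om)" for zs
  using A[of zs] by (intro integrable_mult_right integrable_real_indicator) (auto simp: emeasure_eq_measure)
 hence "integrable M (%om. SUM zs:?Z. G zs * indicator (A zs) om)" by (intro Bochner_Integration.integrable_sum)
 thus "integrable M (%om. G (map (X om) ts))"
  by (subst Bochner_Integration.integrable_cong[OF refl eq]) assumption+
 have "expectation (%om. G (map (X om) ts)) = expectation (%om. SUM zs:?Z. G zs * indicator (A zs) om)"
  by (intro Bochner_Integration.integral_cong refl eq)
 also have "... = (SUM zs:?Z. expectation (%om. G zs * indicator (A zs) om))"
  by (rule Bochner_Integration.integral_sum) (rule int)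
 also have "... = (SUM zs:?Z. G zs * measure M (A zs))"
  using A by (simp add: sets.Int_space_eq2)
 also have "... = (SUM zs:?Z. G zs * fdd p 0 x ts zs)"
 proof (intro sum.cong refl arg_cong2[where f = "(*)"])
  fix zs assume "zs : ?Z"
  thus "measure M (A zs) = fdd p 0 x ts zs"
   unfolding A_def using ts by (intro chain_fdd) auto
 qed
 finally show "expectation (%om. G (map (X om) ts)) = (SUM zs:?Z. G zs * fdd p 0 x ts zs)" .
qed

text \<open>The starting point is encoded in the finite-dimensional distribution at time 0, where
  the forward equation makes \<open>p 0 0\<close> the identity.\<close>

lemma X_0_AE: "AE om in M. X om 0 = x"
proof -
 have "measure M {om : space M. ALL i<length [0::real]. X om ([0::real] ! i) = [x] ! i} = fdd p 0 x [0] [x]"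
  by (rule chain_fdd) auto
 also have "... = 1" using kol[of 0 0 x x] by simp
 finally have "prob {om : space M. X om 0 = x} = 1" by simp
 moreover have "{om : space M. X om 0 = x} : sets M" using list_event_measurable[of "[0]" "[x]"] by simp
 ultimately show ?thesis using prob_Collect_eq_1 by auto
qed

lemma mesh_expectation:
 assumes T: "T > 0" and N: "N > 0"
 shows "integrable M (%om. exp (mesh_fun T N f g (X om)) * q (X om T))"
  and "expectation (%om. exp (mesh_fun T N f g (X om)) * q (X om T))
   = chain_val (%k. p (mesh T N k) (mesh T N (Suc k))) (%k y z. exp (mesh_term T N f g k y z)) q N 0 x"
proof -
 let ?w = "%k y z. exp (mesh_term T N f g k y z)"
 let ?ts = "map (mesh T N) [Suc 0..<Suc 0 + N]"
 let ?G = "list_weight ?w q 0 x"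
 have ts: "sorted ?ts" "!!t. t : set ?ts ==> 0 <= t"
  using T mesh_nonneg by (auto intro!: sorted_mesh simp del: upt_Suc)
 have len: "length ?ts = N" by simp
 have eq: "exp (mesh_fun T N f g (X om)) * q (X om T) = ?G (map (X om) ?ts)" if "X om 0 = x" for om
  using list_weight_exp[of "mesh_term T N f g" q 0 "%i. X om (mesh T N i)" N] that N
  by (simp add: mesh_N mesh_fun_def lessThan_atLeast0 o_def)
 have AEeq: "AE om in M. ?G (map (X om) ?ts) = exp (mesh_fun T N f g (X om)) * q (X om T)"
  using X_0_AE by eventually_elim (simp only: eq)
 \<comment> \<open>The identity with \<open>?G\<close> holds only almost surely, since
   \<open>?G\<close> starts from \<open>x\<close>, and \<open>M\<close> need not be complete.
   Measurability is read off from the list of states that includes time 0.\<close>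
 have fmeas: "(%om. exp (mesh_fun T N f g (X om)) * q (X om T)) : borel_measurable M"
 proof -
  let ?ts' = "map (mesh T N) [0..<Suc N]"
  have ts': "sorted ?ts'" "!!t. t : set ?ts' ==> 0 <= t"
   using T mesh_nonneg by (auto intro!: sorted_mesh simp del: upt_Suc)
  let ?G' = "%zs. exp (SUM k<N. mesh_term T N f g k (zs ! k) (zs ! Suc k)) * q (zs ! N)"
  have nth: "map (X om) ?ts' ! k = X om (mesh T N k)" if "k <= N" for k om
   using that by (simp del: upt_Suc)
  have "exp (mesh_fun T N f g (X om)) * q (X om T) = ?G' (map (X om) ?ts')" for om
  proof (intro arg_cong2[where f = "(*)"] arg_cong[where f = exp] arg_cong[where f = q])
   show "mesh_fun T N f g (X om) = (SUM k<N. mesh_term T N f g k (map (X om) ?ts' ! k) (map (X om) ?ts' ! Suc k))"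
    unfolding mesh_fun_def by (intro sum.cong refl) (simp only: nth lessThan_iff less_imp_le Suc_leI)
   show "X om T = map (X om) ?ts' ! N" using N by (simp only: nth order_refl mesh_N)
  qed
  hence "(%om. exp (mesh_fun T N f g (X om)) * q (X om T)) = (%om. ?G' (map (X om) ?ts'))" by (rule ext)
  thus ?thesis using borel_measurable_integrable[OF expectation_list(1)[OF ts', of ?G']] by (simp only:)
 qed
 show "integrable M (%om. exp (mesh_fun T N f g (X om)) * q (X om T))"
  by (rule integrable_cong_AE_imp[OF expectation_list(1)[OF ts] fmeas AEeq])
 have "expectation (%om. exp (mesh_fun T N f g (X om)) * q (X om T)) = expectation (%om. ?G (map (X om) ?ts))"
  using AEeq borel_measurable_integrable[OF expectation_list(1)[OF ts]] fmeas
  by (intro integral_cong_AE) (auto elim: eventually_mono)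
 also have "... = (SUM zs:{zs. length zs = N}. ?G zs * fdd p (mesh T N 0) x ?ts zs)"
  using expectation_list(2)[OF ts, of ?G] len by simp
 also have "... = chain_val (%k. p (mesh T N k) (mesh T N (Suc k))) ?w q N 0 x"
  by (rule sum_fdd_list_weight)
 finally show "expectation (%om. exp (mesh_fun T N f g (X om)) * q (X om T))
   = chain_val (%k. p (mesh T N k) (mesh T N (Suc k))) ?w q N 0 x" .
qed

lemma mesh_fun_measurable:
 assumes "T > 0" "N > 0" shows "(%om. mesh_fun T N f g (X om)) : borel_measurable M"
proof -
 have "(%om. ln (exp (mesh_fun T N f g (X om)) * 1)) : borel_measurable M"
  using borel_measurable_integrable[OF mesh_expectation(1)[OF assms, of f g "%_. 1"]] by measurable
 thus ?thesis by simp
qed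

lemma path_fun_measurable:
 assumes T: "T > 0" and f: "!!y. bdd_borel (f y)" and g: "!!e. continuous_on UNIV (g e)"
 shows "(%om. path_fun T f g (X om)) : borel_measurable M"
proof (rule borel_measurable_LIMSEQ_real)
 show "(%N. mesh_fun T (Suc N) f g (X om)) \<longlonglongrightarrow> path_fun T f g (X om)" if "om : space M" for om
  by (rule LIMSEQ_Suc[OF mesh_fun_tendsto[OF X_cadlag[OF that] T f g]])
qed (use mesh_fun_measurable[OF T] in auto)

text \<open>The amplification per step has the form 1 plus a constant times the length, so its
  \<open>N\<close>-th power stays bounded. Absolute values are taken because the sign of
  \<open>p\<close> has not been established.\<close>

lemma row_bound:
 assumes f: "!!y. bdd_borel (f y)" "!!y t. abs (f y t) <= L" and g: "!!e t. abs (g e t) <= L"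
  and s: "0 <= s" "s <= t" "t - s <= step"
 shows "(SUM z:UNIV. abs (p s t y z) * exp (integral {s..t} (f y) + (if y = z then 0 else g (y, z) s)))
  <= 1 + (exp L * L + 2 * Ga * real CARD('v) * exp (2 * L)) * (t - s)"
proof -
 have L: "0 <= L" using g by (meson abs_ge_zero order_trans)
 define ph where "ph = integral {s..t} (f y)"
 define w where "w z = exp (ph + (if y = z then 0 else g (y, z) s))" for z
 have d: "t - s <= 1" using s step_pos by linarith
 have ph: "abs ph <= L * (t - s)" unfolding ph_def using s by (intro abs_integral_le f)
 have Ld: "L * (t - s) <= L" using L d mult_left_le[of "t - s" L] by simp
 have w0: "w z >= 0" for z by (simp add: w_def)
 have w2: "w z <= exp (2 * L)" for z
  unfolding w_def using ph Ld g[of "(y, z)" s] L by auto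
 have wy: "w y <= 1 + exp L * (L * (t - s))"
  using exp_linear_errors(1)[OF ph Ld] s L by (simp add: w_def abs_le_iff)
 have "(SUM z:UNIV. abs (p s t y z) * w z) <= (SUM z:UNIV. ((if y = z then 1 else 0) + 2 * Ga * (t - s)) * w z)"
 proof (intro sum_mono mult_right_mono w0)
  fix z show "abs (p s t y z) <= (if y = z then 1 else 0) + 2 * Ga * (t - s)"
   using p_lin[OF s, of y z] by (cases "y = z") auto
 qed
 also have "... = (SUM z:UNIV. if y = z then w z else 0) + 2 * Ga * (t - s) * (SUM z:UNIV. w z)"
  by (simp add: distrib_right sum.distrib sum_distrib_left if_distrib[of "%x. x * _"] cong: if_cong)
 also have "(SUM z:UNIV. if y = z then w z else 0) = w y" by simp
 also have "w y + 2 * Ga * (t - s) * (SUM z:UNIV. w z) <= (1 + exp L * (L * (t - s))) + 2 * Ga * (t - s) * (SUM z:(UNIV::'v set). exp (2 * L))"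
  using wy w2 Ga_nonneg s by (intro add_mono mult_left_mono sum_mono) auto
 also have "... = 1 + (exp L * L + 2 * Ga * real CARD('v) * exp (2 * L)) * (t - s)" by (simp add: algebra_simps)
 finally show ?thesis unfolding w_def ph_def .
qed

lemma mesh_row_bound:
 assumes T: "T > 0" and f: "!!y. bdd_borel (f y)" "!!y t. abs (f y t) <= L" and g: "!!e t. abs (g e t) <= L"
  and N: "N > 0" "T / real N <= step"
 shows "(SUM z:UNIV. abs (p (mesh T N k) (mesh T N (Suc k)) y z) * exp (mesh_term T N f g k y z))
  <= 1 + (exp L * L + 2 * Ga * real CARD('v) * exp (2 * L)) * (T / real N)"
 using row_bound[where f = f and g = g and s = "mesh T N k" and t = "mesh T N (Suc k)" and y = y, OF f g] T N mesh_nonneg[of T N k]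
 unfolding mesh_term_def by (simp add: mesh_Suc)

lemma one_plus_power_le: "0 <= a ==> N > 0 ==> (1 + a / real N) ^ N <= exp a"
 using exp_ge_one_plus_x_over_n_power_n[of "N" a] by simp

text \<open>Fatou's lemma along the meshes: the discretised jump counts converge to \<open>L\<close>
  times the number of jumps, and their exponential moments are at most \<open>exp (Kw * T)\<close>
  for all fine meshes.\<close>

lemma exp_jumps_integrable:
 assumes T: "T > 0" and L: "0 <= L"
 shows "integrable M (%om. exp (L * real (card (jumps (X om) T))))"
proof -
 define Kw where "Kw = exp L * L + 2 * Ga * real CARD('v) * exp (2 * L)"
 have Kw: "Kw >= 0" using L Ga_nonneg by (simp add: Kw_def)
 have eq: "path_fun T (%_ _. 0) (%_ _. L) (X om) = L * real (card (jumps (X om) T))" for om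
  by (simp add: path_fun_def along_def[abs_def])
 let ?Z = "%N om. exp (mesh_fun T N (%_ _. 0) (%_ _. L) (X om)) * 1"
 have meas: "(%om. exp (L * real (card (jumps (X om) T)))) : borel_measurable M"
  using path_fun_measurable[OF T, of "%_ _. 0" "%_ _. L"] unfolding eq by auto
 have step: "(%N. T / real N) \<longlonglongrightarrow> 0" by real_asymp
 have ev: "\<forall>\<^sub>F N in sequentially. N > 0 & T / real N <= step"
  using order_tendstoD(2)[OF step step_pos(1)] eventually_gt_at_top[of 0] by eventually_elim auto
 have bound: "(\<integral>\<^sup>+om. ennreal (?Z N om) \<partial>M) <= ennreal (exp (Kw * T))" if N: "N > 0" "T / real N <= step" for N
 proof -
  have "expectation (?Z N) = chain_val (%k. p (mesh T N k) (mesh T N (Suc k)))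
   (%k y z. exp (mesh_term T N (%_ _. 0) (%_ _. L) k y z)) (%_. 1) N 0 x"
   by (rule mesh_expectation(2)[OF T N(1), where q = "%_. 1"])
  also have "... <= (1 + Kw * (T / real N)) ^ N"
  proof (rule order_trans[OF abs_ge_self chain_val_bound[where N = N]])
   show "(SUM z:UNIV. abs (p (mesh T N k) (mesh T N (Suc k)) y z) * exp (mesh_term T N (%_ _. 0) (%_ _. L) k y z)) <= 1 + Kw * (T / real N)" for k y
    unfolding Kw_def using L by (intro mesh_row_bound T N) auto
  qed (use Kw T in auto)
  also have "... <= exp (Kw * T)" using one_plus_power_le[of "Kw * T" N] Kw T N by simp
  finally show ?thesis
   using mesh_expectation(1)[OF T N(1), of "%_ _. 0" "%_ _. L" "%_. 1"]
   by (subst nn_integral_eq_integral) (auto intro: ennreal_leI)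
 qed
 have "(\<integral>\<^sup>+om. ennreal (exp (L * real (card (jumps (X om) T)))) \<partial>M) = (\<integral>\<^sup>+om. liminf (%N. ennreal (?Z (Suc N) om)) \<partial>M)"
 proof (rule nn_integral_cong)
  fix om assume "om : space M"
  hence "(%N. mesh_fun T N (%_ _. 0) (%_ _. L) (X om)) \<longlonglongrightarrow> L * real (card (jumps (X om) T))"
   using mesh_fun_tendsto[OF X_cadlag T, of om "%_ _. 0" "%_ _. L"] eq by simp
  hence "(%N. ennreal (?Z (Suc N) om)) \<longlonglongrightarrow> ennreal (exp (L * real (card (jumps (X om) T))) * 1)"
   by (intro tendsto_ennrealI tendsto_intros LIMSEQ_Suc)
  from lim_imp_Liminf[OF trivial_limit_sequentially this]
  show "ennreal (exp (L * real (card (jumps (X om) T)))) = liminf (%N. ennreal (?Z (Suc N) om))"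
   by (simp only: mult_1_right)
 qed
 also have "... <= liminf (%N. \<integral>\<^sup>+om. ennreal (?Z (Suc N) om) \<partial>M)"
  using mesh_fun_measurable[OF T] by (intro nn_integral_liminf) auto
 also have "... <= ennreal (exp (Kw * T))"
 proof -
  have "\<forall>\<^sub>F N in sequentially. (\<integral>\<^sup>+om. ennreal (?Z (Suc N) om) \<partial>M) <= ennreal (exp (Kw * T))"
   using eventually_sequentially_Suc[THEN iffD2, OF ev] by eventually_elim (rule bound, auto)
  hence "liminf (%N. \<integral>\<^sup>+om. ennreal (?Z (Suc N) om) \<partial>M) <= liminf (%N. ennreal (exp (Kw * T)))" by (rule Liminf_mono)
  thus ?thesis by (simp add: Liminf_const)
 qed
 finally have "(\<integral>\<^sup>+om. ennreal (exp (L * real (card (jumps (X om) T)))) \<partial>M) < \<infinity>"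
  by (rule order_le_less_trans) simp
 thus ?thesis using meas by (intro integrableI_bounded) auto
qed

text \<open>On a mesh the expectation is a matrix recursion, which the solution \<open>h\<close>
  satisfies up to the one-step error; so its limit is \<open>h x 0\<close>. Pointwise convergence of
  the path functionals, dominated by the exponential of the jump count, identifies the same limit as
  the expectation in question.\<close>

theorem feynman_kac:
 assumes T: "T > 0" and f: "!!y. bdd_borel (f y)" and g: "!!e. continuous_on UNIV (g e)" "!!e. bdd_borel (g e)"
  and h: "!!y. bdd_borel (h y)" "!!y. indef 0 T (h y) (bw f g h y)"
 shows "integrable M (%om. exp (path_fun T f g (X om)) * h (X om T) T)"
  and "expectation (%om. exp (path_fun T f g (X om)) * h (X om T) T) = h x 0"
proof -
 obtain Lf where Lf: "!!y t. abs (f y t) <= Lf" using bdd_borel_family_bound[of f] f by metis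
 obtain Lg where Lg: "!!e t. abs (g e t) <= Lg" using bdd_borel_family_bound[of g] g by metis
 define L where "L = max Lf Lg"
 have fL: "abs (f y t) <= L" and gL: "abs (g e t) <= L" for y t e using Lf[of y t] Lg[of e t] by (auto simp: L_def)
 obtain H where H: "H >= 0" "!!y t. abs (h y t) <= H" using bdd_borel_family_bound[of h] h by metis
 have L0: "0 <= L" using gL by (meson abs_ge_zero order_trans)
 obtain K where K: "K >= 0" and loc: "!!s t y et. 0 <= s ==> s <= t ==> t <= T ==> t - s <= step ==>
  (ALL e. ALL u:{s..t}. abs (g e u - g e s) <= et) ==>
  abs ((SUM z:UNIV. p s t y z * exp (integral {s..t} (f y) + (if y = z then 0 else g (y, z) s)) * h z t) - h y s)
   <= K * (t - s) * ((t - s) + et)"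
  using that by (rule local_error[OF f fL g(2) gL h(1) H(2) h(2)])
 define Kw where "Kw = exp L * L + 2 * Ga * real CARD('v) * exp (2 * L)"
 have Kw: "Kw >= 0" using L0 Ga_nonneg by (simp add: Kw_def)
 let ?Z = "%N om. exp (mesh_fun T N f g (X om)) * h (X om T) T"
 have step: "(%N. T / real N) \<longlonglongrightarrow> 0" by real_asymp
 have close: "abs (expectation (?Z N) - h x 0) <= (K * T * exp (Kw * T)) * (T / real N + et)"
  if N: "N > 0" "T / real N <= step" and et: "!!e s u. s : {0..T} ==> u : {0..T} ==> abs (u - s) <= T / real N ==> abs (g e u - g e s) <= et" for N et
 proof -
  have et0: "et >= 0" using et[of 0 0] T by auto
  let ?P = "%k. p (mesh T N k) (mesh T N (Suc k))" and ?w = "%k y z. exp (mesh_term T N f g k y z)"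
  have E: "expectation (?Z N) = chain_val ?P ?w (%y. h y T) N 0 x"
   by (rule mesh_expectation(2)[OF T N(1), where q = "%y. h y T"])
  define ep where "ep = K * (T / real N) * (T / real N + et)"
  have "abs (chain_val ?P ?w (%y. h y T) N (N - N) x - h x (mesh T N (N - N))) <= real N * ep * (1 + Kw * (T / real N)) ^ N"
  proof (rule chain_val_close[where N = N and et = "%k y. h y (mesh T N k)"])
   show "1 <= 1 + Kw * (T / real N)" using Kw T by simp
   show "0 <= ep" unfolding ep_def using K T et0 by simp
   show "(SUM z:UNIV. abs (?P k y z) * ?w k y z) <= 1 + Kw * (T / real N)" for k y
    unfolding Kw_def by (rule mesh_row_bound[OF T f fL gL N])
   show "(%y. h y T) = (%y. h y (mesh T N N))" using N by (simp add: mesh_N)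
   show "abs ((SUM z:UNIV. ?P k y z * ?w k y z * h z (mesh T N (Suc k))) - h y (mesh T N k)) <= ep" if k: "k < N" for k y
   proof -
    have m: "0 <= mesh T N k" "mesh T N k <= mesh T N (Suc k)" "mesh T N (Suc k) <= T"
     "mesh T N (Suc k) - mesh T N k = T / real N"
     using T k by (auto simp: mesh_nonneg mesh_mono intro!: mesh_le) (simp add: mesh_Suc)
    have "abs ((SUM z:UNIV. ?P k y z * ?w k y z * h z (mesh T N (Suc k))) - h y (mesh T N k))
     <= K * (mesh T N (Suc k) - mesh T N k) * ((mesh T N (Suc k) - mesh T N k) + et)"
     unfolding mesh_term_def
    proof (rule loc)
     show "ALL e. ALL u:{mesh T N k..mesh T N (Suc k)}. abs (g e u - g e (mesh T N k)) <= et"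
      using m by (intro allI ballI et) auto
    qed (use m N in auto)
    thus ?thesis unfolding ep_def m(4) .
   qed
  qed auto
  hence "abs (expectation (?Z N) - h x 0) <= real N * ep * (1 + Kw * (T / real N)) ^ N" unfolding E by simp
  also have "... <= real N * ep * exp (Kw * T)"
   using one_plus_power_le[of "Kw * T" N] Kw T N K et0 by (intro mult_left_mono) (auto simp: ep_def)
  also have "... = (K * T * exp (Kw * T)) * (T / real N + et)" using N by (simp add: ep_def)
  finally show ?thesis .
 qed
 have lim1: "(%N. expectation (?Z N)) \<longlonglongrightarrow> h x 0"
 proof (rule LIMSEQ_I)
  fix r :: real assume r: "r > 0"
  define C where "C = K * T * exp (Kw * T) + 1"
  have C: "C > 0" using K T by (simp add: C_def add_nonneg_pos)
  define et where "et = r / (4 * C)"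
  have et: "et > 0" using r C by (simp add: et_def)
  have "ALL e. EX d>0. ALL s:{0..T}. ALL u:{0..T}. dist u s < d --> dist (g e u) (g e s) < et"
   using compact_uniformly_continuous[OF continuous_on_subset[OF g(1)], of "{0..T}"] et
   unfolding uniformly_continuous_on_def by auto
  then obtain d where d: "!!e. d e > 0" "!!e s u. s : {0..T} ==> u : {0..T} ==> dist u s < d e ==> dist (g e u) (g e s) < et"
   by metis
  define dm where "dm = Min (range d)"
  have dm: "dm > 0" "!!e. dm <= d e" using d(1) by (auto simp: dm_def)
  have "\<forall>\<^sub>F N in sequentially. N > 0 & T / real N <= step & T / real N < dm & T / real N < et"
   using order_tendstoD(2)[OF step step_pos(1)] order_tendstoD(2)[OF step dm(1)] order_tendstoD(2)[OF step et]
    eventually_gt_at_top[of 0] by eventually_elim auto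
  then obtain N0 where N0: "!!N. N >= N0 ==> N > 0 & T / real N <= step & T / real N < dm & T / real N < et"
   unfolding eventually_sequentially by blast
  have "norm (expectation (?Z N) - h x 0) < r" if "N >= N0" for N
  proof -
   note N = N0[OF that]
   have "abs (expectation (?Z N) - h x 0) <= (K * T * exp (Kw * T)) * (T / real N + et)"
   proof (rule close)
    fix e s u assume "s : {0..T}" "u : {0..T}" "abs (u - s) <= T / real N"
    hence "dist (g e u) (g e s) < et" using N dm(2)[of e] by (intro d(2)) (auto simp: dist_real_def)
    thus "abs (g e u - g e s) <= et" by (simp add: dist_real_def)
   qed (use N in auto)
   also have "... <= C * (et + et)" using N K T et by (intro mult_mono) (auto simp: C_def)
   also have "... = r / 2" using C by (simp add: et_def field_simps)
   finally show ?thesis using r by simp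
  qed
  thus "EX N0. ALL N>=N0. norm (expectation (?Z N) - h x 0) < r" by blast
 qed
 let ?W = "%om. exp (path_fun T f g (X om)) * h (X om T) T"
 let ?D = "%om. exp (L * T) * H * exp (L * real (card (jumps (X om) T)))"
 have qmeas: "(%om. h (X om T) T) : borel_measurable M"
  by (rule measurable_compose[where g = "%v. h v T" and N = "count_space UNIV", OF X_measurable]) (use T in auto)
 have Wm: "?W : borel_measurable M" using path_fun_measurable[OF T f g(1)] qmeas by measurable
 have Zm: "?Z (Suc N) : borel_measurable M" for N using mesh_fun_measurable[OF T] qmeas by measurable
 have Dint: "integrable M ?D" using exp_jumps_integrable[OF T L0] by (intro integrable_mult_right)
 have tend: "AE om in M. (%N. ?Z (Suc N) om) \<longlonglongrightarrow> ?W om"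
  using mesh_fun_tendsto[OF X_cadlag T f g(1)] by (intro AE_I2 tendsto_intros LIMSEQ_Suc)
 have dom: "AE om in M. norm (?Z (Suc N) om) <= ?D om" for N
 proof (rule AE_I2)
  fix om assume "om : space M"
  hence "abs (mesh_fun T (Suc N) f g (X om)) <= L * T + L * real (card (jumps (X om) T))"
   by (intro mesh_fun_bound X_cadlag T f fL gL) auto
  hence "exp (mesh_fun T (Suc N) f g (X om)) <= exp (L * T) * exp (L * real (card (jumps (X om) T)))"
   by (simp add: mult_exp_exp)
  hence "abs (?Z (Suc N) om) <= (exp (L * T) * exp (L * real (card (jumps (X om) T)))) * H"
   unfolding abs_mult using H by (intro mult_mono) auto
  thus "norm (?Z (Suc N) om) <= ?D om" by (simp add: mult_ac)
 qed
 show "integrable M ?W" by (rule integrable_dominated_convergence[OF Wm Zm Dint tend dom])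
 have "(%N. expectation (?Z (Suc N))) \<longlonglongrightarrow> expectation ?W"
  by (rule integral_dominated_convergence[OF Wm Zm Dint tend dom])
 moreover have "(%N. expectation (?Z (Suc N))) \<longlonglongrightarrow> h x 0" by (rule LIMSEQ_Suc[OF lim1])
 ultimately show "expectation ?W = h x 0" by (rule LIMSEQ_unique)
qed

end

section \<open>The principal eigenvalue\<close>

lemma lin_sol_diff:
 assumes h: "lin_sol a b T h" "lin_sol a b' T h'" and a: "!!y z. bdd_borel (a y z)" and b: "!!y. bdd_borel (b y)" "!!y. bdd_borel (b' y)"
 shows "lin_sol a (%y t. b y t - b' y t) T (%y t. h y t - h' y t)"
 unfolding lin_sol_def
proof (intro allI conjI)
 fix y
 show "bdd_borel (%t. h y t - h' y t)" using h by (intro bdd_borel_diff lin_sol_bdd)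
 have "indef 0 T (%t. h y t + (-1) * h' y t)
  (%t. ((SUM z:UNIV. a y z t * h z t) + b y t) + (-1) * ((SUM z:UNIV. a y z t * h' z t) + b' y t))"
  using h a b by (intro indef_add indef_cmult lin_sol_indef lin_sol_indef_bdd bdd_borel_mult[OF bdd_borel_const])
 thus "indef 0 T (%t. h y t - h' y t) (%u. (SUM z:UNIV. a y z u * (h z u - h' z u)) + (b y u - b' y u))"
  by (simp add: right_diff_distrib sum_subtractf algebra_simps)
qed

text \<open>Solutions are picked by choice; the Gronwall bound on differences makes the choice
  Lipschitz in \<open>xi\<close>, hence continuous, as Brouwer's theorem requires.\<close>

lemma lin_sol_solution_map:
 fixes a :: "'v::finite => 'v tfun"
 assumes T: "0 <= T" and a: "!!y z. bdd_borel (a y z)" "!!y z t. abs (a y z t) <= C" and b: "!!y. bdd_borel (b y)"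
 obtains hs :: "real^'v => 'v tfun" where
  "!!xi. lin_sol a b T (hs xi)" "!!xi y. hs xi y T = xi $ y"
  "!!S. continuous_on S (%xi. \<chi> y. hs xi y 0)"
proof -
 let ?U = "2 * exp ((2 * (real CARD('v) * C) + 1) * T)"
 have "ALL xi::real^'v. EX h. lin_sol a b T h & (ALL y. h y T = xi $ y)"
  by (intro allI lin_sol_exists T a b)
 then obtain hs :: "real^'v => 'v tfun" where hs: "!!xi. lin_sol a b T (hs xi)" "!!xi y. hs xi y T = xi $ y" by metis
 have lip: "abs (hs xi y 0 - hs xi' y 0) <= ?U * norm (xi - xi')" for xi xi' y
 proof -
  have "abs (hs xi y 0 - hs xi' y 0) <= 2 * (norm (xi - xi') + 0 * T) * exp ((2 * (real CARD('v) * C) + 1) * T)"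
  proof (rule lin_sol_bound[OF lin_sol_diff[OF hs(1) hs(1) a(1) b b] T a(1) _ a(2)])
   show "abs (hs xi y T - hs xi' y T) <= norm (xi - xi')" for y
    using component_le_norm_cart[of "xi - xi'" y] by (simp add: hs)
  qed (use T in auto)
  thus ?thesis by (simp add: mult_ac)
 qed
 have "continuous_on S (%xi. hs xi y 0)" for S y
 proof (rule continuous_on_subset[OF _ subset_UNIV], rule lipschitz_on_continuous_on[of ?U], rule lipschitz_onI)
  show "dist (hs xi y 0) (hs xi' y 0) <= ?U * dist xi xi'" for xi xi'
   using lip[of xi y xi'] by (simp add: dist_norm)
 qed auto
 hence "continuous_on S (%xi. \<chi> y. hs xi y 0)" for S by (intro continuous_on_vec_lambda)
 thus ?thesis using that hs by blast
qed

text \<open>Brouwer's theorem for the map \<open>F\<close> divided by its total mass; strict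
  positivity keeps that mass away from zero and the image in the simplex.\<close>

lemma prob_simplex_brouwer:
 fixes F :: "real^'v::finite => real^'v"
 assumes F: "continuous_on {xi. (ALL y. 0 <= xi $ y) & (SUM y:UNIV. xi $ y) = 1} F"
  and pos: "!!xi y. (ALL y. 0 <= xi $ y) ==> (SUM y:UNIV. xi $ y) = 1 ==> 0 < F xi $ y"
 obtains xi where "!!y. 0 <= xi $ y" "(SUM y:UNIV. xi $ y) = 1" "F xi = (SUM y:UNIV. F xi $ y) *\<^sub>R xi"
proof -
 let ?S = "{xi::real^'v. (ALL y. 0 <= xi $ y) & (SUM y:UNIV. xi $ y) = 1}"
 have "closed ?S"
  by (intro closed_Collect_conj closed_Collect_all closed_Collect_le closed_Collect_eq continuous_intros)
 moreover have "bounded ?S"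
  unfolding bounded_iff
 proof (intro exI ballI)
  fix xi assume "xi : ?S"
  thus "norm xi <= 1" using norm_le_l1_cart[of xi] by simp
 qed
 ultimately have comp: "compact ?S" by (simp add: compact_eq_bounded_closed)
 have conv: "convex ?S"
  unfolding convex_def
  by (auto simp: sum.distrib sum_distrib_left[symmetric] intro!: add_nonneg_nonneg mult_nonneg_nonneg)
 have "axis undefined 1 : ?S" by (auto simp: axis_def)
 hence ne: "?S ~= {}" by blast
 have sp: "(SUM y:UNIV. F xi $ y) > 0" if "xi : ?S" for xi using that pos by (intro sum_pos) auto
 obtain xi where xi: "xi : ?S" "(1 / (SUM y:UNIV. F xi $ y)) *\<^sub>R F xi = xi"
 proof (rule brouwer[OF comp conv ne])
  show "continuous_on ?S (%xi. (1 / (SUM y:UNIV. F xi $ y)) *\<^sub>R F xi)"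
   using sp by (intro continuous_intros F) (auto simp: less_imp_neq[symmetric] dest: sp)
  show "(%xi. (1 / (SUM y:UNIV. F xi $ y)) *\<^sub>R F xi) : ?S \<rightarrow> ?S"
  proof
   fix xi assume xi: "xi : ?S"
   thus "(1 / (SUM y:UNIV. F xi $ y)) *\<^sub>R F xi : ?S"
    using sp[OF xi] pos[of xi] by (auto simp: sum_divide_distrib[symmetric] less_imp_le)
  qed
 qed
 have "F xi = (SUM y:UNIV. F xi $ y) *\<^sub>R ((1 / (SUM y:UNIV. F xi $ y)) *\<^sub>R F xi)" using sp[OF xi(1)] by simp
 thus ?thesis using that xi by auto
qed

lemma periodic_extension:
 assumes T0: "T0 > 0" and h: "bdd_borel h" "h 0 = h T0"
 shows "bdd_borel (%t. h (pmod t T0))" "!!t. t : {0..T0} ==> h (pmod t T0) = h t"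
proof -
 obtain K where "!!t. abs (h t) <= K" using h(1) unfolding bdd_borel_def by blast
 thus "bdd_borel (%t. h (pmod t T0))"
  using bdd_borel_measurable[OF h(1)] by (intro bdd_borelI[where K = K]) auto
 fix t assume t: "t : {0..T0}"
 show "h (pmod t T0) = h t"
 proof (cases "t = T0")
  case True
  hence "pmod t T0 = 0" using pmod_add_period[OF T0, of 0] pmod_id[of 0 T0] T0 by simp
  thus ?thesis using True h by simp
 qed (use t pmod_id in auto)
qed

context periodic_rates
begin

text \<open>Measurability of \<open>f\<close> is enough because it is integrated in time, whereas
  \<open>g\<close> is evaluated at jump times and must be continuous for the mesh limit. The
  explicit bound \<open>L\<close> carries the uniformity of all later constants.\<close>

definition test_pair :: "real => ('v tfun) => (('v * 'v) tfun) => bool" where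
 "test_pair L f g \<longleftrightarrow> (ALL y. f y : borel_measurable borel) & (ALL y t. abs (f y t) <= L) & (ALL y t. f y (t + T0) = f y t) &
  (ALL e. continuous_on UNIV (g e)) & (ALL e t. abs (g e t) <= L) & (ALL e t. g e (t + T0) = g e t)"

lemma test_pairD:
 assumes "test_pair L f g"
 shows "f y : borel_measurable borel" "abs (f y t) <= L" "f y (t + T0) = f y t"
  "continuous_on UNIV (g e)" "abs (g e t) <= L" "g e (t + T0) = g e t"
 using assms unfolding test_pair_def by blast+

lemma test_pair_bdd:
 assumes "test_pair L f g" shows "bdd_borel (f y)" "bdd_borel (g e)"
 by (rule bdd_borelI[OF test_pairD(1,2)[OF assms]])
  (rule bdd_borelI[OF borel_measurable_continuous_onI[OF test_pairD(4)[OF assms]] test_pairD(5)[OF assms]])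

definition bw_mat :: "('v tfun) => (('v * 'v) tfun) => 'v => 'v tfun" where
 "bw_mat f g y z u = R y z u * exp (g (y, z) u) + (if y = z then f y u - (SUM w:UNIV. R y w u) else 0)"

lemma bw_eq: "bw f g h y u = (SUM z:UNIV. bw_mat f g y z u * h z u)"
proof -
 have "(SUM z:UNIV. bw_mat f g y z u * h z u)
  = (SUM z:UNIV. R y z u * exp (g (y, z) u) * h z u + (if y = z then (f y u - (SUM w:UNIV. R y w u)) * h y u else 0))"
  unfolding bw_mat_def by (intro sum.cong) (auto simp: algebra_simps)
 thus ?thesis
  unfolding bw_def by (simp add: sum.distrib sum_subtractf right_diff_distrib left_diff_distrib sum_distrib_right[symmetric] mult.assoc)
qed

lemma bw_mat_coupled:
 assumes "test_pair L f g"
 shows "coupled E (c * exp (- L)) (B * exp L + (L + real CARD('v) * B)) (bw_mat f g)"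
 unfolding coupled_def
proof (intro conjI allI impI)
 have g: "abs (g e u) <= L" and f: "abs (f y u) <= L" for e y u by (rule test_pairD[OF assms])+
 have L: "0 <= L" using g by (meson abs_ge_zero order_trans)
 fix y z
 show "bdd_borel (bw_mat f g y z)"
 proof (cases "y = z")
  case True
  thus ?thesis unfolding bw_mat_def[abs_def] using test_pair_bdd[OF assms] R_bdd
   by (simp, intro bdd_borel_intros)
 next
  case False
  thus ?thesis unfolding bw_mat_def[abs_def] using test_pair_bdd[OF assms] R_bdd
   by (simp, intro bdd_borel_intros)
 qed
 fix u
 have 1: "0 <= R y z u * exp (g (y, z) u)" "R y z u * exp (g (y, z) u) <= B * exp L"
  using R_nonneg R_le B_nonneg g[of "(y, z)" u] by (auto intro!: mult_mono)
 have "(SUM w:UNIV. R y w u) <= (SUM w:(UNIV::'v set). B)" by (intro sum_mono R_le)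
 moreover have "0 <= (SUM w:UNIV. R y w u)" by (intro sum_nonneg R_nonneg)
 ultimately have "abs (f y u - (SUM w:UNIV. R y w u)) <= L + real CARD('v) * B"
  using f[of y u] by (simp add: abs_le_iff)
 thus "abs (bw_mat f g y z u) <= B * exp L + (L + real CARD('v) * B)"
  using 1 L B_nonneg unfolding bw_mat_def by (auto simp: abs_le_iff)
 show "0 <= bw_mat f g y z u" if "y ~= z" using that 1 by (simp add: bw_mat_def)
 show "c * exp (- L) <= bw_mat f g y z u" if "(y, z) : E"
 proof -
  have "y ~= z" using that irr by blast
  moreover have "c * exp (- L) <= R y z u * exp (g (y, z) u)"
   using R_lo[OF that] R_nonneg g[of "(y, z)" u] by (intro mult_mono) auto
  ultimately show ?thesis by (simp add: bw_mat_def)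
 qed
qed

text \<open>Brouwer's theorem gives an eigenvector of the solution map over one period. The weight
  \<open>exp (- l * (T0 - t) / T0)\<close> distributes its eigenvalue \<open>exp l\<close> evenly
  over the period and makes the solution periodic. The Harnack inequality compares all entries with
  the largest, so \<open>k1\<close>, \<open>k2\<close>, \<open>K\<close> depend on \<open>L\<close>
  only.\<close>

lemma perron:
 assumes L: "0 <= L"
 obtains k1 k2 K where "k1 > 0" "k2 > 0" "K >= 0"
  "!!f g. test_pair L f g ==> EX l h. abs l <= K & (ALL y. bdd_borel (h y)) & (ALL y t. k1 <= h y t) & (ALL y t. h y t <= k2) &
   (ALL y t. h y (t + T0) = h y t) & (ALL y a b. indef a b (h y) (bw (%y u. f y u - l / T0) g h y))"
proof -
 let ?n = "real CARD('v)"
 define C where "C = B * exp L + (L + ?n * B)"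
 have C: "C >= 0" using L B_nonneg by (simp add: C_def)
 have cL: "c * exp (- L) > 0" using c by simp
 obtain ka where ka: "ka > 0" and har: "!!a h y z. coupled E (c * exp (- L)) C a ==> lin_sol a (%_ _. 0) T0 h ==> ALL y. 0 <= h y T0 ==>
  ka * h z T0 <= h y 0"
  using harnack[OF conn cL T0 irr, of C] by blast
 define U where "U = 2 * exp ((2 * (?n * C) + 1) * T0)"
 have U: "U > 0" by (simp add: U_def)
 have n: "?n >= 1" by (simp add: Suc_leI)
 define K where "K = abs (ln ka) + abs (ln U)"
 define k1 where "k1 = exp (- K) * (exp (- C * T0) * (ka / (U * ?n)))"
 define k2 where "k2 = exp K * U"
 have "EX l h. abs l <= K & (ALL y. bdd_borel (h y)) & (ALL y t. k1 <= h y t) & (ALL y t. h y t <= k2) &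
   (ALL y t. h y (t + T0) = h y t) & (ALL y a b. indef a b (h y) (bw (%y u. f y u - l / T0) g h y))"
  if tp: "test_pair L f g" for f g
 proof -
  let ?a = "bw_mat f g"
  have cp: "coupled E (c * exp (- L)) C ?a" unfolding C_def by (rule bw_mat_coupled[OF tp])
  hence a: "bdd_borel (?a y z)" "abs (?a y z t) <= C" for y z t unfolding coupled_def by blast+
  obtain hs :: "real^'v => 'v tfun" where hs: "!!xi. lin_sol ?a (%_ _. 0) T0 (hs xi)" "!!xi y. hs xi y T0 = xi $ y"
   and cont: "!!S. continuous_on S (%xi. \<chi> y. hs xi y 0)"
   using that by (rule lin_sol_solution_map[OF less_imp_le[OF T0] a bdd_borel_const])
  have low: "ka * xi $ z <= hs xi y 0" if "!!y. 0 <= xi $ y" for xi y z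
   using har[OF cp hs(1), of xi z y] that by (simp add: hs(2))
  obtain xi where xi: "!!y. 0 <= xi $ y" "(SUM y:UNIV. xi $ y) = 1"
   and eig: "(\<chi> y. hs xi y 0) = (SUM y:UNIV. (\<chi> y. hs xi y 0) $ y) *\<^sub>R xi"
  proof (rule prob_simplex_brouwer[OF cont])
   fix xi :: "real^'v" and y assume xi: "ALL y. 0 <= xi $ y" "(SUM y:UNIV. xi $ y) = 1"
   have "EX z. xi $ z > 0"
   proof (rule ccontr)
    assume "~ ?thesis"
    hence "xi $ z = 0" for z using xi(1) by (meson less_eq_real_def not_less)
    thus False using xi(2) by simp
   qed
   then obtain z where "xi $ z > 0" by blast
   hence "0 < ka * xi $ z" using ka by simp
   thus "0 < (\<chi> y. hs xi y 0) $ y" using low[of xi z y] xi by simp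
  qed auto
  define \<Lambda> where "\<Lambda> = (SUM y:UNIV. hs xi y 0)"
  have eig: "hs xi y 0 = \<Lambda> * xi $ y" for y
   using arg_cong[OF eig, of "%v. v $ y"] by (simp add: \<Lambda>_def)
  define m where "m = Max (range (%y. xi $ y))"
  have m: "xi $ y <= m" for y unfolding m_def by (intro Max_ge) auto
  have "m : range (%y. xi $ y)" unfolding m_def by (intro Max_in) auto
  then obtain z0 where z0: "xi $ z0 = m" by auto
  have "1 <= (SUM y:(UNIV::'v set). m)" unfolding xi(2)[symmetric] by (intro sum_mono m)
  hence nm: "1 <= ?n * m" by simp
  hence m0: "m > 0" using n by (metis less_le_trans mult_le_0_iff not_le of_nat_0_le_iff zero_less_one)
  have m1: "m <= 1" using member_le_sum[of z0 UNIV "%y. xi $ y"] xi z0 by simp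
  have up: "abs (hs xi y t) <= U * m" if "t : {0..T0}" for y t
  proof -
   have "abs (hs xi y t) <= 2 * (m + 0 * T0) * exp ((2 * (?n * C) + 1) * T0)"
    using m xi(1) that T0 by (intro lin_sol_bound[OF hs(1) _ a(1) bdd_borel_const a(2)]) (auto simp: hs(2))
   thus ?thesis by (simp add: U_def mult_ac)
  qed
  have "ka * m <= \<Lambda> * m" using low[OF xi(1), of z0 z0] z0 eig by simp
  hence ka\<Lambda>: "ka <= \<Lambda>" using m0 by simp
  have "\<Lambda> * m <= U * m" using up[of 0 z0] T0 z0 eig[of z0] by auto
  hence \<Lambda>U: "\<Lambda> <= U" using m0 by simp
  have \<Lambda>0: "\<Lambda> > 0" using ka ka\<Lambda> by simp
  \<comment> \<open>The entries sum to 1, so the largest is at least \<open>1 / CARD('v)\<close>;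
    the Harnack inequality passes this lower bound on to every entry, at the cost of the eigenvalue,
    which is at most \<open>U\<close>.\<close>
  have xilow: "ka / (U * ?n) <= xi $ y" for y
  proof -
   have "ka * m <= \<Lambda> * xi $ y" using low[OF xi(1), of z0 y] z0 eig by simp
   also have "... <= U * xi $ y" using \<Lambda>U xi(1) by (intro mult_right_mono) auto
   finally have 1: "ka * m * ?n <= U * xi $ y * ?n" by (intro mult_right_mono) auto
   have "ka * 1 <= ka * (?n * m)" using nm ka by (intro mult_left_mono) auto
   also have "... = ka * m * ?n" by simp
   also note 1
   also have "U * xi $ y * ?n = xi $ y * (U * ?n)" by simp
   finally have "ka <= xi $ y * (U * ?n)" by simp
   thus ?thesis using U n by (simp add: divide_le_eq)
  qed
  define l where "l = ln \<Lambda>"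
  have l: "abs l <= K"
  proof -
   have "ln ka <= l" "l <= ln U" unfolding l_def using ka ka\<Lambda> \<Lambda>U \<Lambda>0 by auto
   thus ?thesis unfolding K_def by linarith
  qed
  define h0 where "h0 y t = exp_weight (- l / T0) T0 t * hs xi y t" for y t
  have sol0: "lin_sol (%y z t. ?a y z t + (if y = z then - l / T0 else 0)) (%_ _. 0) T0 h0"
   unfolding h0_def by (rule lin_sol_exp_weight[OF hs(1) less_imp_le[OF T0] a(1)])
  have ab: "?a y z t + (if y = z then - l / T0 else 0) = bw_mat (%y u. f y u - l / T0) g y z t" for y z t
   by (simp add: bw_mat_def)
  have h0T: "h0 y 0 = h0 y T0" for y
  proof -
   have "h0 y 0 = exp (- l) * (\<Lambda> * xi $ y)" unfolding h0_def using T0 eig by (simp add: exp_weight_eq)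
   also have "... = xi $ y" unfolding l_def using \<Lambda>0 by (simp add: exp_minus)
   finally show ?thesis unfolding h0_def using T0 by (simp add: exp_weight_eq hs(2))
  qed
  have lt: "exp (- K) <= exp_weight (- l / T0) T0 t" "exp_weight (- l / T0) T0 t <= exp K" if t: "t : {0..T0}" for t
  proof -
   define v where "v = - l / T0 * (T0 - t)"
   have "abs v = abs l * ((T0 - t) / T0)" using T0 t by (simp add: v_def abs_mult)
   also have "... <= K * 1" using l T0 t by (intro mult_mono) auto
   finally have "- K <= v" "v <= K" by auto
   thus "exp (- K) <= exp_weight (- l / T0) T0 t" "exp_weight (- l / T0) T0 t <= exp K"
    unfolding exp_weight_eq[OF t] v_def by simp_all
  qed
  have h0_low: "k1 <= h0 y t" if t: "t : {0..T0}" for y t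
  proof -
   have "hs xi y T0 <= exp_weight C T0 t * hs xi y t"
    using xi(1) t T0 by (intro coupled_weighted(2)[OF cp hs(1)]) (auto simp: hs(2))
   moreover have "0 <= exp_weight C T0 t * hs xi y t"
    using xi(1) t T0 by (intro coupled_weighted(1)[OF cp hs(1)]) (auto simp: hs(2))
   hence h0: "0 <= hs xi y t" using t by (simp add: exp_weight_eq zero_le_mult_iff)
   moreover have "exp_weight C T0 t <= exp (C * T0)" using t C by (auto simp: exp_weight_eq intro!: mult_left_mono)
   ultimately have "xi $ y <= exp (C * T0) * hs xi y t"
    using mult_right_mono[of "exp_weight C T0 t" "exp (C * T0)" "hs xi y t"] by (simp add: hs(2))
   hence "ka / (U * ?n) <= exp (C * T0) * hs xi y t" using xilow[of y] by linarith
   hence "exp (- C * T0) * (ka / (U * ?n)) <= exp (- C * T0) * (exp (C * T0) * hs xi y t)" by (intro mult_left_mono) auto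
   hence "exp (- C * T0) * (ka / (U * ?n)) <= hs xi y t" by (simp add: mult.assoc[symmetric] mult_exp_exp)
   thus ?thesis unfolding k1_def h0_def using lt[OF t] ka U by (intro mult_mono) (auto simp: exp_weight_def)
  qed
  have h0_up: "h0 y t <= k2" if t: "t : {0..T0}" for y t
  proof -
   have "abs (hs xi y t) <= U * 1" using up[OF t, of y] m1 U by (meson mult_left_mono order_trans less_imp_le)
   have "h0 y t <= exp_weight (- l / T0) T0 t * abs (hs xi y t)"
    unfolding h0_def by (intro mult_left_mono) (auto simp: exp_weight_def)
   also have "... <= exp K * (U * 1)" using lt[OF t] \<open>\<bar>hs xi y t\<bar> <= U * 1\<close> by (intro mult_mono) auto
   finally show ?thesis unfolding k2_def by simp
  qed
  define h where "h y t = h0 y (pmod t T0)" for y t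
  have pm: "pmod t T0 : {0..T0}" for t using pmod_bounds[OF T0, of t] by auto
  note ext = periodic_extension[OF T0 lin_sol_bdd[OF sol0] h0T]
  have hb: "bdd_borel (h y)" for y unfolding h_def[abs_def] by (rule ext(1))
  have heq: "h y t = h0 y t" if "t : {0..T0}" for y t unfolding h_def by (rule ext(2)[OF that])
  have hp: "h y (t + T0) = h y t" for y t unfolding h_def using T0 by simp
  have fb: "bdd_borel (%u. f y u - l / T0)" for y using test_pair_bdd(1)[OF tp] by (intro bdd_borel_intros)
  have "indef a b (h y) (bw (%y u. f y u - l / T0) g h y)" for y a b
  proof (rule indef_periodic[OF T0])
   show "bdd_borel (bw (%y u. f y u - l / T0) g h y)" using fb test_pair_bdd(2)[OF tp] hb by (intro bw_bdd)
   show "h y (t + T0) = h y t" for t by (rule hp)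
   show "bw (%y u. f y u - l / T0) g h y (t + T0) = bw (%y u. f y u - l / T0) g h y t" for t
    unfolding bw_def by (simp add: R_per hp test_pairD(3,6)[OF tp])
   have "indef 0 T0 (h0 y) (%u. (SUM z:UNIV. bw_mat (%y u. f y u - l / T0) g y z u * h0 z u) + 0)"
    using lin_sol_indef[OF sol0, of y] by (simp only: ab)
   thus "indef 0 T0 (h y) (bw (%y u. f y u - l / T0) g h y)"
    by (subst indef_cong[where h' = "h0 y" and k' = "%u. (SUM z:UNIV. bw_mat (%y u. f y u - l / T0) g y z u * h0 z u) + 0"])
     (auto simp: heq bw_eq)
  qed
  thus ?thesis
   using l hb hp h0_low[OF pm] h0_up[OF pm]
   by (intro exI[of _ l] exI[of _ h]) (auto simp: h_def)
 qed
 moreover have "k1 > 0" "k2 > 0" "K >= 0" using ka U n by (auto simp: k1_def k2_def K_def)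
 ultimately show ?thesis using that by blast
qed

end

section \<open>Growth rates of exponential moments\<close>

lemma path_fun_lin:
 assumes X: "cadlag X" and f: "!!y. bdd_borel (f y)" "!!y. bdd_borel (f1 y)"
 shows "path_fun T (%y u. f y u + s * f1 y u) (%e u. g e u + s * g1 e u) X = path_fun T f g X + s * path_fun T f1 g1 X"
proof -
 have "along (%y u. f y u + s * f1 y u) X = (%u. along f X u + s * along f1 X u)"
  by (rule ext) (simp add: along_def distrib_left sum.distrib sum_distrib_left mult_ac)
 moreover have "integral {0..T} (%u. along f X u + s * along f1 X u) = integral {0..T} (along f X) + s * integral {0..T} (along f1 X)"
  using along_bdd[OF X, of f] along_bdd[OF X, of f1] f by (simp add: integral_bdd_add bdd_borel_intros)
 ultimately show ?thesis
  by (simp add: path_fun_def sum.distrib sum_distrib_left distrib_left)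
qed

lemma path_fun_shift:
 assumes X: "cadlag X" and f: "!!y. bdd_borel (f y)" and T: "0 <= T"
 shows "path_fun T (%y u. f y u - d) g X = path_fun T f g X - d * T"
proof -
 have "integral {0..T} (along (%y u. f y u - d) X) = integral {0..T} (%u. along f X u - d)"
  by (rule Henstock_Kurzweil_Integration.integral_cong) (auto simp: along_eq)
 also have "... = integral {0..T} (along f X) - d * T"
  using along_bdd[OF X, of f] f T by (simp add: integral_bdd_diff bdd_borel_intros mult.commute)
 finally show ?thesis by (simp add: path_fun_def)
qed

lemma path_fun_mono:
 assumes X: "cadlag X" and f: "!!y. bdd_borel (f y)" "!!y. bdd_borel (f' y)" and le: "!!y t. 0 <= t ==> f y t <= f' y t"
 shows "path_fun T f g X <= path_fun T f' g X"
proof -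
 have "integral {0..T} (along f X) <= integral {0..T} (along f' X)"
  using f le by (intro integral_bdd_mono along_bdd X) (auto simp: along_eq)
 thus ?thesis by (simp add: path_fun_def)
qed

lemma exp_growth_le:
 assumes k: "k > 0" and le: "!!n. n >= 1 ==> k * exp (real n * l) <= K * exp (real n * l')"
 shows "l <= l'"
proof (rule ccontr)
 assume "~ l <= l'"
 hence d: "l - l' > 0" by simp
 have "k * (1 + real n * (l - l')) <= K" if n: "n >= 1" for n
 proof -
  have "k * exp (real n * (l - l')) = k * exp (real n * l) * exp (- (real n * l'))"
   by (simp add: right_diff_distrib exp_diff exp_minus field_simps)
  also have "... <= K * exp (real n * l') * exp (- (real n * l'))" using le[OF n] by (intro mult_right_mono) auto
  also have "... = K" by (simp add: exp_minus)
  finally have "k * exp (real n * (l - l')) <= K" .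
  moreover have "k * (1 + real n * (l - l')) <= k * exp (real n * (l - l'))" using k by (intro mult_left_mono) auto
  ultimately show ?thesis by linarith
 qed
 moreover obtain n :: nat where "K / k < real n * (l - l')" using reals_Archimedean3[OF d] by blast
 hence "K < k * (real n * (l - l'))" using k by (simp add: divide_less_eq mult_ac)
 moreover have "k * (real n * (l - l')) <= k * (1 + real (max 1 n) * (l - l'))"
  using k d by (intro mult_left_mono) (auto simp: mult_right_mono add_increasing)
 ultimately show False by (smt (verit, best) max.cobounded1)
qed

context periodic_chain
begin

abbreviation psum :: "nat => ('v tfun) => (('v * 'v) tfun) => 'w => real" where
 "psum n f g om \<equiv> path_fun (real n * T0) f g (X om)"

definition part_fun :: "nat => ('v tfun) => (('v * 'v) tfun) => real" where
 "part_fun n f g = expectation (%om. exp (psum n f g om))"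

text \<open>The terminal factor in the Feynman-Kac formula lies between \<open>k1\<close> and
  \<open>k2\<close>, and so does the value \<open>h x 0\<close>. This is the case of eigenvalue 0;
  other eigenvalues are reduced to it by subtracting a constant from \<open>f\<close>.\<close>

lemma fk_bounds:
 assumes f: "!!y. bdd_borel (f y)" and g: "!!e. continuous_on UNIV (g e)" "!!e. bdd_borel (g e)"
  and h: "!!y. bdd_borel (h y)" "!!y a b. indef a b (h y) (bw f g h y)"
  and k: "k1 > 0" "!!y t. k1 <= h y t" "!!y t. h y t <= k2" and n: "n >= 1"
 shows "integrable M (%om. exp (psum n f g om))" "k1 / k2 <= part_fun n f g" "part_fun n f g <= k2 / k1"
proof -
 let ?T = "real n * T0"
 let ?W = "%om. exp (path_fun ?T f g (X om)) * h (X om ?T) ?T"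
 let ?Z = "%om. exp (path_fun ?T f g (X om))"
 have T: "?T > 0" using n T0 by simp
 have k2: "k2 > 0" using k(1) order_trans[OF k(2) k(3)] by linarith
 note fk = feynman_kac[OF T f g h(1) h(2)]
 have m: "?Z : borel_measurable M" using path_fun_measurable[OF T f g(1)] by measurable
 have le: "k1 * ?Z om <= ?W om" "?W om <= k2 * ?Z om" for om
  using k(2,3) by (auto simp: mult.commute intro: mult_left_mono)
 have i1: "integrable M (%om. k1 * ?Z om)"
  using m k by (intro Bochner_Integration.integrable_bound[OF fk(1)]) (auto simp: abs_mult intro!: AE_I2 order_trans[OF k(2) abs_ge_self])
 thus i: "integrable M ?Z" using k by simp
 have "k1 * part_fun n f g <= h x 0"
  unfolding part_fun_def using integral_mono[OF i1 fk(1) le(1)] fk(2) by simp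
 also have "... <= k2" by (rule k)
 finally show "part_fun n f g <= k2 / k1" using k by (simp add: pos_le_divide_eq mult.commute)
 have "k1 <= h x 0" by (rule k)
 also have "h x 0 <= k2 * part_fun n f g"
  unfolding part_fun_def using integral_mono[OF fk(1) integrable_mult_right[OF i, of k2] le(2)] fk(2) by simp
 finally show "k1 / k2 <= part_fun n f g" using k2 by (simp add: pos_divide_le_eq mult.commute)
qed

text \<open>A two-sided bound up to constants for every \<open>n >= 1\<close>, stronger than a limit
  of normalised logarithms. It determines \<open>l\<close>, and one-sided bounds on the partition
  functions become inequalities between growth rates.\<close>

definition growth :: "('v tfun) => (('v * 'v) tfun) => real => bool" where
 "growth f g l \<longleftrightarrow> (EX k1>0. EX k2>0. ALL n>=1. k1 * exp (real n * l) <= part_fun n f g & part_fun n f g <= k2 * exp (real n * l))"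

definition lam :: "('v tfun) => (('v * 'v) tfun) => real" where
 "lam f g = (THE l. growth f g l)"

lemma growth_le:
 assumes "growth f g l" "!!n. n >= 1 ==> part_fun n f g <= K * exp (real n * l')"
 shows "l <= l'"
proof -
 obtain k where k: "k > 0" "!!n. n >= 1 ==> k * exp (real n * l) <= part_fun n f g" using assms(1) unfolding growth_def by blast
 thus ?thesis using exp_growth_le[of k l K l'] assms(2) by (meson order_trans)
qed

lemma growth_ge:
 assumes "growth f g l" "k > 0" "!!n. n >= 1 ==> k * exp (real n * l') <= part_fun n f g"
 shows "l' <= l"
proof -
 obtain K where K: "!!n. n >= 1 ==> part_fun n f g <= K * exp (real n * l)" using assms(1) unfolding growth_def by blast
 thus ?thesis using exp_growth_le[of k l' K l] assms(2,3) by (meson order_trans)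
qed

lemma lam_eqI:
 assumes "growth f g l" shows "lam f g = l"
 unfolding lam_def
proof (rule the_equality[where P = "growth f g", OF assms])
 fix l' assume l': "growth f g l'"
 obtain k K where "k > 0" "!!n. n >= 1 ==> k * exp (real n * l) <= part_fun n f g"
   "!!n. n >= 1 ==> part_fun n f g <= K * exp (real n * l)"
  using assms unfolding growth_def by blast
 thus "l' = l" using growth_le[OF l'] growth_ge[OF l'] by (meson order_antisym)
qed

lemma part_fun_shift:
 assumes f: "!!y. bdd_borel (f y)"
 shows "part_fun n (%y u. f y u - l / T0) g = exp (- (real n * l)) * part_fun n f g"
proof -
 have "part_fun n (%y u. f y u - l / T0) g = expectation (%om. exp (- (real n * l)) * exp (psum n f g om))"
  unfolding part_fun_def
 proof (rule Bochner_Integration.integral_cong[OF refl])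
  fix om assume "om : space M"
  hence "psum n (%y u. f y u - l / T0) g om = psum n f g om - l / T0 * (real n * T0)"
   using T0 f by (intro path_fun_shift X_cadlag) auto
  also have "l / T0 * (real n * T0) = real n * l" using T0 by simp
  finally show "exp (psum n (%y u. f y u - l / T0) g om) = exp (- (real n * l)) * exp (psum n f g om)"
   by (simp add: mult_exp_exp)
 qed
 thus ?thesis by (simp add: part_fun_def)
qed

lemma eigen_growth:
 assumes f: "!!y. bdd_borel (f y)" and g: "!!e. continuous_on UNIV (g e)" "!!e. bdd_borel (g e)"
  and h: "!!y. bdd_borel (h y)" "!!y a b. indef a b (h y) (bw (%y u. f y u - l / T0) g h y)"
  and k: "k1 > 0" "!!y t. k1 <= h y t" "!!y t. h y t <= k2"
 shows "growth f g l" and "lam f g = l" and "!!n. n >= 1 ==> integrable M (%om. exp (psum n f g om))"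
proof -
 have k2: "k2 > 0" using k(1) order_trans[OF k(2) k(3)] by linarith
 have fb: "bdd_borel (%u. f y u - l / T0)" for y using f by (intro bdd_borel_intros)
 note b = fk_bounds[where f = "%y u. f y u - l / T0" and g = g and h = h, OF fb g h k]
 have "k1 / k2 * exp (real n * l) <= part_fun n f g & part_fun n f g <= k2 / k1 * exp (real n * l)" if n: "n >= 1" for n
 proof -
  have "part_fun n f g = exp (real n * l) * part_fun n (%y u. f y u - l / T0) g"
   using f by (simp add: part_fun_shift mult.assoc[symmetric] mult_exp_exp)
  thus ?thesis using mult_left_mono[OF b(2)[OF n], of "exp (real n * l)"] mult_left_mono[OF b(3)[OF n], of "exp (real n * l)"]
   by (simp add: mult.commute)
 qed
 thus gr: "growth f g l"
  unfolding growth_def using k k2 by (intro exI[of _ "k1 / k2"] exI[of _ "k2 / k1"] conjI) auto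
 show "lam f g = l" by (rule lam_eqI[OF gr])
 fix n :: nat assume n: "n >= 1"
 have "integrable M (%om. exp (real n * l) * exp (psum n (%y u. f y u - l / T0) g om))"
  using b(1)[OF n] by (intro integrable_mult_right)
 also have "?this \<longleftrightarrow> integrable M (%om. exp (psum n f g om))"
 proof (rule Bochner_Integration.integrable_cong[OF refl])
  fix om assume "om : space M"
  thus "exp (real n * l) * exp (psum n (%y u. f y u - l / T0) g om) = exp (psum n f g om)"
   using T0 f path_fun_shift[OF X_cadlag, of om f "real n * T0" "l / T0" g] by (simp add: mult_exp_exp)
 qed
 finally show "integrable M (%om. exp (psum n f g om))" .
qed

lemma perron_lam:
 assumes L: "0 <= L"
 obtains k1 k2 K where "k1 > 0" "k2 > 0" "K >= 0"
  "!!f g. test_pair L f g ==> abs (lam f g) <= K & growth f g (lam f g) &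
   (ALL n>=1. integrable M (%om. exp (psum n f g om))) &
   (EX h. (ALL y. bdd_borel (h y)) & (ALL y t. k1 <= h y t) & (ALL y t. h y t <= k2) &
   (ALL y t. h y (t + T0) = h y t) & (ALL y a b. indef a b (h y) (bw (%y u. f y u - lam f g / T0) g h y)))"
proof -
 obtain k1 k2 K where k: "k1 > 0" "k2 > 0" "K >= 0"
  and ex: "!!f g. test_pair L f g ==> EX l h. abs l <= K & (ALL y. bdd_borel (h y)) & (ALL y t. k1 <= h y t) & (ALL y t. h y t <= k2) &
   (ALL y t. h y (t + T0) = h y t) & (ALL y a b. indef a b (h y) (bw (%y u. f y u - l / T0) g h y))"
  using perron[OF L] by blast
 show ?thesis
 proof (rule that[OF k])
  fix f g assume tp: "test_pair L f g"
  obtain l h where lh: "abs l <= K" "!!y. bdd_borel (h y)" "!!y t. k1 <= h y t" "!!y t. h y t <= k2"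
   "!!y t. h y (t + T0) = h y t" "!!y a b. indef a b (h y) (bw (%y u. f y u - l / T0) g h y)"
   using ex[OF tp] by blast
  note eg = eigen_growth[OF test_pair_bdd(1)[OF tp] test_pairD(4)[OF tp] test_pair_bdd(2)[OF tp] lh(2) lh(6) k(1) lh(3) lh(4)]
  show "abs (lam f g) <= K & growth f g (lam f g) &
   (ALL n>=1. integrable M (%om. exp (psum n f g om))) &
   (EX h. (ALL y. bdd_borel (h y)) & (ALL y t. k1 <= h y t) & (ALL y t. h y t <= k2) &
   (ALL y t. h y (t + T0) = h y t) & (ALL y a b. indef a b (h y) (bw (%y u. f y u - lam f g / T0) g h y)))"
   using lh eg by (intro conjI exI[of _ h]) auto
 qed
qed

lemma test_pair_lam:
 assumes tp: "test_pair L f g"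
 shows "growth f g (lam f g)" "!!n. n >= 1 ==> integrable M (%om. exp (psum n f g om))"
proof -
 have "0 <= L" using test_pairD(2)[OF tp] by (meson abs_ge_zero order_trans)
 hence "growth f g (lam f g) & (ALL n>=1. integrable M (%om. exp (psum n f g om)))"
  by (rule perron_lam) (use tp in metis)
 thus "growth f g (lam f g)" "!!n. n >= 1 ==> integrable M (%om. exp (psum n f g om))"
  by auto
qed

lemma test_pair_add:
 assumes "test_pair L f g" "test_pair L f1 g1" "abs s <= 1"
 shows "test_pair (2 * L) (%y u. f y u + s * f1 y u) (%e u. g e u + s * g1 e u)"
proof -
 have b: "abs (a + s * b) <= 2 * L" if "abs a <= L" "abs b <= L" for a b :: real
 proof -
  have "abs (s * b) <= 1 * L" unfolding abs_mult using assms(3) that by (intro mult_mono) auto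
  thus ?thesis using that by linarith
 qed
 note d = test_pairD[OF assms(1)] test_pairD[OF assms(2)]
 show ?thesis
  unfolding test_pair_def
  by (intro conjI allI b d continuous_intros borel_measurable_add borel_measurable_times borel_measurable_const) (simp_all add: d)
qed

end

section \<open>The Poisson equation and the second-order bound\<close>

lemma osc_brouwer:
 fixes G :: "real^'v::finite => real^'v"
 assumes G: "!!S. continuous_on S G" and be: "0 <= be"
  and osc: "!!ze y z. ALL y z. ze $ y - ze $ z <= be ==> G ze $ y - G ze $ z <= be"
 obtains ze a where "!!y. abs (ze $ y) <= be" "!!y. G ze $ y = ze $ y + a"
proof -
 \<comment> \<open>Normalising at \<open>y0\<close> divides out additive constants: the vectors of
   oscillation at most \<open>be\<close> that vanish at \<open>y0\<close> form a compact convex set,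
   and a fixed point of the normalised map is one of \<open>G\<close> up to a constant.\<close>
 define y0 :: 'v where "y0 = undefined"
 let ?S = "{ze::real^'v. ze $ y0 = 0 & (ALL y z. ze $ y - ze $ z <= be)}"
 have bd: "abs (ze $ y) <= be" if "ze : ?S" for ze y
 proof -
  have "ze $ y - ze $ y0 <= be" "ze $ y0 - ze $ y <= be" "ze $ y0 = 0" using that by blast+
  thus ?thesis by linarith
 qed
 have "closed ?S"
  by (intro closed_Collect_conj closed_Collect_all closed_Collect_le closed_Collect_eq continuous_intros)
 moreover have "bounded ?S"
  unfolding bounded_iff
 proof (intro exI ballI)
  fix ze assume "ze : ?S"
  hence "(SUM y:UNIV. abs (ze $ y)) <= (SUM y:(UNIV::'v set). be)" by (intro sum_mono bd)
  thus "norm ze <= (SUM y:(UNIV::'v set). be)" using norm_le_l1_cart[of ze] by linarith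
 qed
 ultimately have comp: "compact ?S" by (simp add: compact_eq_bounded_closed)
 have conv: "convex ?S"
  unfolding convex_def
 proof (intro ballI allI impI)
  fix ze ze' :: "real^'v" and u v :: real
  assume ze: "ze : ?S" "ze' : ?S" and uv: "0 <= u" "0 <= v" "u + v = 1"
  have "(u *\<^sub>R ze + v *\<^sub>R ze') $ y - (u *\<^sub>R ze + v *\<^sub>R ze') $ z <= be" for y z
  proof -
   have "(u *\<^sub>R ze + v *\<^sub>R ze') $ y - (u *\<^sub>R ze + v *\<^sub>R ze') $ z = u * (ze $ y - ze $ z) + v * (ze' $ y - ze' $ z)"
    by (simp add: algebra_simps)
   also have "... <= u * be + v * be" using ze uv by (intro add_mono mult_left_mono) auto
   also have "... = be" using uv by (metis distrib_right mult_1)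
   finally show ?thesis .
  qed
  thus "u *\<^sub>R ze + v *\<^sub>R ze' : ?S" using ze by simp
 qed
 have "0 : ?S" using be by simp
 hence ne: "?S ~= {}" by blast
 obtain ze where ze: "ze : ?S" "(\<chi> y. G ze $ y - G ze $ y0) = ze"
 proof (rule brouwer[OF comp conv ne])
  show "continuous_on ?S (%ze. \<chi> y. G ze $ y - G ze $ y0)"
   using G by (intro continuous_on_vec_lambda continuous_intros)
  show "(%ze. \<chi> y. G ze $ y - G ze $ y0) : ?S \<rightarrow> ?S"
   using osc by auto
 qed
 show ?thesis
 proof (rule that)
  show "abs (ze $ y) <= be" for y by (rule bd[OF ze(1)])
  show "G ze $ y = ze $ y + G ze $ y0" for y
   using arg_cong[OF ze(2), of "%v. v $ y"] by simp
 qed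
qed

context periodic_rates
begin

definition markov_mat :: "('v => 'v tfun) => 'v => 'v tfun" where
 "markov_mat S y z u = S y z u - (if y = z then (SUM w:UNIV. S y w u) else 0)"

lemma markov_mat_sum: "(SUM z:UNIV. markov_mat S y z u * h z) = (SUM z:UNIV. S y z u * (h z - h y))"
proof -
 have "(SUM z:UNIV. markov_mat S y z u * h z) = (SUM z:UNIV. S y z u * h z - (if y = z then (SUM w:UNIV. S y w u) * h y else 0))"
  unfolding markov_mat_def by (intro sum.cong) (auto simp: algebra_simps)
 thus ?thesis by (simp add: sum_subtractf right_diff_distrib sum_distrib_right)
qed

text \<open>Periodic solutions of the Poisson equation, with bounds that depend on the rates only through \<open>ch\<close> and \<open>Rm\<close>.\<close>

lemma poisson:
 assumes ch: "ch > 0" and Rm: "Rm >= 0" and D: "D >= 0"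
 obtains P where "P >= 0" "!!S b. (ALL y z. bdd_borel (S y z)) ==> (ALL y z t. 0 <= S y z t & S y z t <= Rm) ==>
   (ALL y z t. (y, z) : E --> ch <= S y z t) ==> (ALL y z t. S y z (t + T0) = S y z t) ==>
   (ALL y. bdd_borel (b y)) ==> (ALL y t. abs (b y t) <= D) ==> (ALL y t. b y (t + T0) = b y t) ==> (ALL y t. S y y t = 0) ==>
   EX a psi. abs a <= P & (ALL y. bdd_borel (psi y)) & (ALL y t. abs (psi y t) <= P) & (ALL y t. psi y (t + T0) = psi y t) &
   (ALL y r t. indef r t (psi y) (%u. (SUM z:UNIV. S y z u * (psi z u - psi y u)) + b y u - a / T0))"
proof -
 let ?n = "real CARD('v)"
 define C where "C = Rm + ?n * Rm"
 obtain ka where ka: "ka > 0" and har: "!!a h y z. coupled E ch C a ==> lin_sol a (%_ _. 0) T0 h ==> ALL y. 0 <= h y T0 ==>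
  ka * h z T0 <= h y 0"
  using harnack[OF conn ch T0 irr, of C] by blast
 define U where "U = 2 * exp ((2 * (?n * C) + 1) * T0)"
 have U: "U > 0" by (simp add: U_def)
 define ka' where "ka' = min ka 1"
 have ka': "0 < ka'" "ka' <= 1" "ka' <= ka" using ka by (auto simp: ka'_def)
 define D' where "D' = U * (D * T0)"
 have D': "D' >= 0" using U D T0 by (simp add: D'_def)
 \<comment> \<open>The solution map sends oscillation \<open>be\<close> to at most
   \<open>(1 - ka') * be + 2 * D'\<close>; \<open>be\<close> is the fixed point of this bound. The
   minimum with 1 in \<open>ka'\<close> makes \<open>1 - ka'\<close> nonnegative.\<close>
 define be where "be = 2 * D' / ka'"
 have be: "be >= 0" "(1 - ka') * be + 2 * D' = be" using D' ka' by (auto simp: be_def field_simps)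
 define P0 where "P0 = U * (be + D * T0) + be"
 have P0: "P0 >= 0" using U be D T0 by (simp add: P0_def)
 have "EX a psi. abs a <= 2 * P0 & (ALL y. bdd_borel (psi y)) & (ALL y t. abs (psi y t) <= 2 * P0) & (ALL y t. psi y (t + T0) = psi y t) &
   (ALL y r t. indef r t (psi y) (%u. (SUM z:UNIV. S y z u * (psi z u - psi y u)) + b y u - a / T0))"
  if Sb: "ALL y z. bdd_borel (S y z)" and S0: "ALL y z t. 0 <= S y z t & S y z t <= Rm" and Slo: "ALL y z t. (y, z) : E --> ch <= S y z t"
   and Sper: "ALL y z t. S y z (t + T0) = S y z t" and bb: "ALL y. bdd_borel (b y)" and bD: "ALL y t. abs (b y t) <= D" and bper: "ALL y t. b y (t + T0) = b y t"
   and Sd: "ALL y t. S y y t = 0"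
  for S b
 proof -
  let ?a = "markov_mat S"
  have a: "bdd_borel (?a y z)" for y z
   unfolding markov_mat_def[abs_def] using Sb by (cases "y = z") (auto intro!: bdd_borel_intros)
  have Ssum: "0 <= (SUM w:UNIV. S y w u)" "(SUM w:UNIV. S y w u) <= ?n * Rm" for y u
  proof -
   show "0 <= (SUM w:UNIV. S y w u)" using S0 by (intro sum_nonneg) auto
   have "(SUM w:UNIV. S y w u) <= (SUM w:(UNIV::'v set). Rm)" using S0 by (intro sum_mono) auto
   thus "(SUM w:UNIV. S y w u) <= ?n * Rm" by simp
  qed
  have aC: "abs (?a y z u) <= C" for y z u
  proof -
   have "0 <= S y z u" "S y z u <= Rm" using S0 by blast+
   thus ?thesis using Ssum[of y u] Rm unfolding markov_mat_def C_def by (auto simp: abs_le_iff)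
  qed
  have cp: "coupled E ch C ?a"
   unfolding coupled_def
  proof (intro conjI allI impI a aC)
   show "0 <= ?a y z t" if "y ~= z" for y z t using that S0 by (simp add: markov_mat_def)
   show "ch <= ?a y z t" if "(y, z) : E" for y z t
   proof -
    have "y ~= z" using that irr by blast
    thus ?thesis using Slo that by (simp add: markov_mat_def)
   qed
  qed
  obtain hs :: "real^'v => 'v tfun" where hs: "!!xi. lin_sol ?a b T0 (hs xi)" "!!xi y. hs xi y T0 = xi $ y"
   and cont: "!!S. continuous_on S (%xi. \<chi> y. hs xi y 0)"
   using that by (rule lin_sol_solution_map[OF less_imp_le[OF T0] a aC bb[rule_format]])
  have bnd: "abs (hs xi y t) <= U * (m + D * T0)" if "!!y. abs (xi $ y) <= m" "t : {0..T0}" for xi y t m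
  proof -
   have "abs (hs xi y t) <= 2 * (m + D * T0) * exp ((2 * (?n * C) + 1) * T0)"
    using that T0 bb bD by (intro lin_sol_bound[OF hs(1) _ a _ aC]) (auto simp: hs(2))
   thus ?thesis unfolding U_def by (simp only: mult_ac)
  qed
  have const_sol: "lin_sol ?a (%_ _. 0) T0 (%_ _. k)" for k :: real
  proof -
   have "(SUM z:UNIV. ?a y z u * k) = 0" for y u using markov_mat_sum[of S y u "%_. k"] by simp
   thus ?thesis unfolding lin_sol_def by (simp add: indef_const)
  qed
  \<comment> \<open>Subtracting the solution with terminal value 0 leaves a homogeneous one, of
    which constants are also solutions. Harnack for its excess over the minimum raises the lower
    bound by \<open>ka\<close> times the oscillation, while the excess below the maximum stays
    nonnegative.\<close>
  have osc: "hs ze y 0 - hs ze z 0 <= be" if ze: "ALL y z. ze $ y - ze $ z <= be" for ze y z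
  proof -
   have h1: "lin_sol ?a (%y t. b y t - b y t) T0 (%y t. hs ze y t - hs 0 y t)"
    using bb by (intro lin_sol_diff hs a) auto
   hence h1: "lin_sol ?a (%_ _. 0) T0 (%y t. hs ze y t - hs 0 y t)" by simp
   have h2: "lin_sol ?a (%_ _. 0) T0 (%y t. (hs ze y t - hs 0 y t) - k)" for k
    using lin_sol_diff[OF h1 const_sol[of k] a bdd_borel_const bdd_borel_const] by simp
   have h3: "lin_sol ?a (%_ _. 0) T0 (%y t. k - (hs ze y t - hs 0 y t))" for k
    using lin_sol_diff[OF const_sol[of k] h1 a bdd_borel_const bdd_borel_const] by simp
   define mx where "mx = Max (range (%y. ze $ y))"
   define mn where "mn = Min (range (%y. ze $ y))"
   have mx: "ze $ y <= mx" "mn <= ze $ y" for y unfolding mx_def mn_def by auto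
   have "mx : range (%y. ze $ y)" "mn : range (%y. ze $ y)" unfolding mx_def mn_def by (intro Max_in Min_in; auto)+
   then obtain z1 z2 where z1: "ze $ z1 = mx" "ze $ z2 = mn" by auto
   have "ka * (mx - mn) <= (hs ze z 0 - hs 0 z 0) - mn"
    using har[OF cp h2[of mn], of z1 z] mx z1 by (simp add: hs(2))
   moreover have "0 <= mx - (hs ze y 0 - hs 0 y 0)"
   proof -
    have "ka * (mx - mn) <= mx - (hs ze y 0 - hs 0 y 0)"
     using har[OF cp h3[of mx], of z2 y] mx z1 by (simp add: hs(2))
    moreover have "0 <= ka * (mx - mn)" using ka mx[of z1] z1 by simp
    ultimately show ?thesis by linarith
   qed
   moreover have "abs (hs 0 y 0) <= D'" for y using bnd[of 0 0 0 y] T0 by (simp add: D'_def)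
   hence "abs (hs 0 y 0) <= D'" "abs (hs 0 z 0) <= D'" by blast+
   moreover have "ka' * (mx - mn) <= ka * (mx - mn)" using ka' mx[of z1] z1 by (intro mult_right_mono) auto
   moreover have "(1 - ka') * (mx - mn) <= (1 - ka') * be"
    using ze[rule_format, of z1 z2] z1 ka' by (intro mult_left_mono) auto
   ultimately show ?thesis using be(2) by (simp add: algebra_simps)
  qed
  obtain ze a where ze: "!!y. abs (ze $ y) <= be" and a0: "!!y. hs ze y 0 = ze $ y + a"
  proof (rule osc_brouwer[OF cont be(1)])
   show "(\<chi> y. hs ze y 0) $ y - (\<chi> y. hs ze y 0) $ z <= be" if "ALL y z. ze $ y - ze $ z <= be" for ze y z
    using osc[OF that] by simp
  qed auto
  have hb: "abs (hs ze y t) <= P0" if "t : {0..T0}" for y t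
   using bnd[OF ze that, of y] be by (simp add: P0_def)
  have aP: "abs a <= P0"
  proof -
   have "abs (hs ze undefined 0) <= U * (be + D * T0)" using bnd[OF ze, of 0] T0 by simp
   thus ?thesis using a0[of undefined] ze[of undefined] by (simp add: P0_def)
  qed
  \<comment> \<open>Over one period the solution changes by the constant \<open>a\<close>; a linear
    function of time removes the change, which puts \<open>- a / T0\<close> into the
    equation.\<close>
  define psi0 where "psi0 y t = hs ze y t + (- a / T0) * (T0 - clip T0 t)" for y t
  have lin: "indef 0 T0 (%t. T0 - clip T0 t) (%t. 1)"
  proof -
   have "indef 0 T0 (%t. T0 - t) (%t. 1)" by (rule indef_C1) (auto intro!: derivative_eq_intros)
   thus ?thesis by (subst indef_cong[where h' = "%t. T0 - t" and k' = "%t. 1"]) (auto simp: clip_id)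
  qed
  have clipb: "bdd_borel (%t. T0 - clip T0 t)"
   using T0 by (intro bdd_borel_clip[where h = "%t. T0 - t"]) (auto intro!: continuous_intros)
  have psi0b: "bdd_borel (psi0 y)" for y
   unfolding psi0_def[abs_def] by (intro bdd_borel_intros lin_sol_bdd[OF hs(1)] clipb)
  have psi0P: "psi0 y 0 = psi0 y T0" for y using T0 a0[of y] by (simp add: psi0_def clip_id hs(2))
  have psi0le: "abs (psi0 y t) <= 2 * P0" if t: "t : {0..T0}" for y t
  proof -
   define v where "v = (- a / T0) * (T0 - t)"
   have "abs v = abs a * ((T0 - t) / T0)" using T0 t by (simp add: v_def abs_mult)
   also have "... <= P0 * 1" using aP T0 t by (intro mult_mono) auto
   finally show ?thesis using hb[OF t, of y] unfolding psi0_def clip_id[OF t] v_def[symmetric] by linarith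
  qed
  define psi where "psi y t = psi0 y (pmod t T0)" for y t
  note ext = periodic_extension[OF T0 psi0b psi0P]
  have psib: "bdd_borel (psi y)" for y unfolding psi_def[abs_def] by (rule ext(1))
  have psieq: "psi y t = psi0 y t" if "t : {0..T0}" for y t unfolding psi_def by (rule ext(2)[OF that])
  have psiper: "psi y (t + T0) = psi y t" for y t unfolding psi_def using T0 by simp
  have pm: "pmod t T0 : {0..T0}" for t using pmod_bounds[OF T0, of t] by auto
  let ?k = "%y u. (SUM z:UNIV. S y z u * (psi z u - psi y u)) + b y u - a / T0"
  have ind: "indef r t (psi y) (?k y)" for y r t
  proof (rule indef_periodic[OF T0])
   show "bdd_borel (?k y)" using Sb bb psib by (intro bdd_borel_intros) auto
   show "psi y (t + T0) = psi y t" for t by (rule psiper)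
   show "?k y (t + T0) = ?k y t" for t using Sper bper by (simp add: psiper)
   have "indef 0 T0 (psi0 y) (%u. ((SUM z:UNIV. ?a y z u * hs ze z u) + b y u) + (- a / T0) * 1)"
    unfolding psi0_def[abs_def] using bb
    by (intro indef_add indef_cmult lin lin_sol_indef[OF hs(1)] lin_sol_indef_bdd[OF hs(1) a] bdd_borel_const bdd_borel_mult) auto
   moreover have "((SUM z:UNIV. ?a y z u * hs ze z u) + b y u) + (- a / T0) * 1 = ?k y u" if "u : {0..T0}" for u
    unfolding markov_mat_sum using that by (simp add: psieq psi0_def)
   ultimately show "indef 0 T0 (psi y) (?k y)"
    by (subst indef_cong[where h' = "psi0 y" and k' = "%u. ((SUM z:UNIV. ?a y z u * hs ze z u) + b y u) + (- a / T0) * 1"]) (auto simp: psieq)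
  qed
  show ?thesis
  proof (intro exI conjI allI)
   show "abs a <= 2 * P0" using aP P0 by linarith
   show "abs (psi y t) <= 2 * P0" for y t unfolding psi_def by (rule psi0le[OF pm])
  qed (rule psib psiper ind)+
 qed
 thus ?thesis using that[of "2 * P0"] P0 by simp
qed

end

context periodic_chain
begin

lemma bw_add_potential: "bw (%y u. f y u + d y u) g h y u = bw f g h y u + d y u * h y u"
 unfolding bw_def by (simp add: distrib_right)

text \<open>For the chain tilted by the eigenfunction \<open>h\<close>, let \<open>psi\<close> solve
  the Poisson equation with source \<open>f1\<close> plus the mean of \<open>g1\<close> over jumps,
  and let \<open>a\<close> be its mean. Then \<open>h * (1 + s * psi)\<close> solves the perturbed
  equation with eigenvalue \<open>l + s * a\<close> up to an error of order
  \<open>s\<^sup>2\<close>, and such an error moves the growth rate by the same order. Only this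
  upper bound on \<open>lam\<close> is needed.\<close>

theorem lam_second_order:
 assumes L: "0 <= L"
 obtains C2 s0 where "C2 >= 0" "s0 > 0" "s0 <= 1"
  "!!f g f1 g1. test_pair L f g ==> test_pair L f1 g1 ==> EX a. ALL s. abs s <= s0 -->
   lam (%y u. f y u + s * f1 y u) (%e u. g e u + s * g1 e u) <= lam f g + s * a + C2 * s\<^sup>2"
proof -
 let ?n = "real CARD('v)"
 obtain k1 k2 K where k: "k1 > 0" "k2 > 0" "K >= 0"
  and per: "!!f g. test_pair L f g ==> abs (lam f g) <= K & growth f g (lam f g) &
   (ALL n>=1. integrable M (%om. exp (psum n f g om))) &
   (EX h. (ALL y. bdd_borel (h y)) & (ALL y t. k1 <= h y t) & (ALL y t. h y t <= k2) &
   (ALL y t. h y (t + T0) = h y t) & (ALL y a b. indef a b (h y) (bw (%y u. f y u - lam f g / T0) g h y)))"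
  using perron_lam[OF L] by blast
 define ch where "ch = c * exp (- L) * k1 / k2"
 define Rm where "Rm = B * exp L * k2 / k1"
 define D where "D = L + ?n * (Rm * L)"
 have pos: "ch > 0" "Rm >= 0" "D >= 0" using c k B_nonneg L by (auto simp: ch_def Rm_def D_def)
 obtain P where P: "P >= 0" and poi: "!!S b. (ALL y z. bdd_borel (S y z)) ==> (ALL y z t. 0 <= S y z t & S y z t <= Rm) ==>
   (ALL y z t. (y, z) : E --> ch <= S y z t) ==> (ALL y z t. S y z (t + T0) = S y z t) ==>
   (ALL y. bdd_borel (b y)) ==> (ALL y t. abs (b y t) <= D) ==> (ALL y t. b y (t + T0) = b y t) ==> (ALL y t. S y y t = 0) ==>
   EX a psi. abs a <= P & (ALL y. bdd_borel (psi y)) & (ALL y t. abs (psi y t) <= P) & (ALL y t. psi y (t + T0) = psi y t) &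
   (ALL y r t. indef r t (psi y) (%u. (SUM z:UNIV. S y z u * (psi z u - psi y u)) + b y u - a / T0))"
  using that by (rule poisson[OF pos])
 \<comment> \<open>Keeps \<open>s * psi\<close> below 1/2 in absolute value, so that the approximate
   eigenfunction stays between \<open>k1 / 2\<close> and \<open>2 * k2\<close>.\<close>
 define s0 where "s0 = 1 / (2 * (P + 1))"
 have s0: "s0 > 0" "s0 <= 1" "s0 * P <= 1 / 2" using P by (auto simp: s0_def field_simps)
 define Cz where "Cz = B * exp L * k2 * (exp L * L\<^sup>2 + exp L * L * P)"
 define Ce where "Ce = ?n * Cz + P * k2 * (L + P / T0)"
 have Cz0: "Cz >= 0" using B_nonneg k L P by (simp add: Cz_def)
 have Ce0: "Ce >= 0" using Cz0 k L P T0 by (simp add: Ce_def)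
 define C2 where "C2 = T0 * (Ce / (k1 / 2))"
 have "EX a. ALL s. abs s <= s0 -->
   lam (%y u. f y u + s * f1 y u) (%e u. g e u + s * g1 e u) <= lam f g + s * a + C2 * s\<^sup>2"
  if tp: "test_pair L f g" "test_pair L f1 g1" for f g f1 g1
 proof -
  define l where "l = lam f g"
  obtain h where hb: "!!y. bdd_borel (h y)" and hk1: "!!y t. k1 <= h y t" and hk2: "!!y t. h y t <= k2"
   and hper: "!!y t. h y (t + T0) = h y t" and hind: "!!y a b. indef a b (h y) (bw (%y u. f y u - l / T0) g h y)"
   using per[OF tp(1)] unfolding l_def by blast
  have hpos: "h y t > 0" for y t using k(1) hk1[of y t] by linarith
  \<comment> \<open>Rates of the Doob transform by \<open>h\<close> of the chain with jump weights
    \<open>exp g\<close>; the uniform bounds on \<open>h\<close> keep them in the range of the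
    Poisson lemma.\<close>
  define S where "S y z u = R y z u * exp (g (y, z) u) * h z u / h y u" for y z u
  define b where "b y u = f1 y u + (SUM z:UNIV. S y z u * g1 (y, z) u)" for y u
  have Sb: "bdd_borel (S y z)" for y z
   unfolding S_def[abs_def] using R_bdd test_pair_bdd(2)[OF tp(1)] hb
   by (intro bdd_borel_divide[where c = k1] bdd_borel_intros k hk1)
  have S0: "0 <= S y z t & S y z t <= Rm" for y z t
  proof
   show "0 <= S y z t" unfolding S_def using R_nonneg hpos by (simp add: less_imp_le)
   have "R y z t * exp (g (y, z) t) * h z t <= B * exp L * k2"
    using R_le R_nonneg B_nonneg hk2 hpos[of z t] test_pairD(5)[OF tp(1), of "(y, z)" t] by (intro mult_mono) (auto simp: abs_le_iff)
   thus "S y z t <= Rm" unfolding S_def Rm_def using k B_nonneg hk1 by (intro frac_le) auto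
  qed
  have Slo: "ch <= S y z t" if "(y, z) : E" for y z t
  proof -
   have "c * exp (- L) * k1 <= R y z t * exp (g (y, z) t) * h z t"
    using R_lo[OF that] R_nonneg c k hk1 test_pairD(5)[OF tp(1), of "(y, z)" t] by (intro mult_mono) (auto simp: abs_le_iff)
   thus ?thesis unfolding S_def ch_def using k c hk2[of y t] hpos[of y t]
    by (intro frac_le) (auto intro!: mult_nonneg_nonneg simp: R_nonneg less_imp_le[OF hpos])
  qed
  have bb: "bdd_borel (b y)" for y
   unfolding b_def[abs_def] using Sb test_pair_bdd[OF tp(2)] by (intro bdd_borel_intros)
  have bD: "abs (b y t) <= D" for y t
  proof -
   have "abs (S y z t * g1 (y, z) t) <= Rm * L" for z
    unfolding abs_mult using S0[of y z t] test_pairD(5)[OF tp(2)] L pos by (intro mult_mono) auto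
   hence "abs (SUM z:UNIV. S y z t * g1 (y, z) t) <= (SUM z:(UNIV::'v set). Rm * L)" by (intro order_trans[OF sum_abs sum_mono])
   thus ?thesis unfolding b_def D_def using test_pairD(2)[OF tp(2), of y t] by simp
  qed
  obtain a psi where aP: "abs a <= P" and psib: "!!y. bdd_borel (psi y)" and psiP: "!!y t. abs (psi y t) <= P"
   and psiind: "!!y r t. indef r t (psi y) (%u. (SUM z:UNIV. S y z u * (psi z u - psi y u)) + b y u - a / T0)"
  proof -
   have "EX a psi. abs a <= P & (ALL y. bdd_borel (psi y)) & (ALL y t. abs (psi y t) <= P) & (ALL y t. psi y (t + T0) = psi y t) &
   (ALL y r t. indef r t (psi y) (%u. (SUM z:UNIV. S y z u * (psi z u - psi y u)) + b y u - a / T0))"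
   proof (rule poi)
    show "ALL y z t. S y z (t + T0) = S y z t" unfolding S_def by (simp add: R_per hper test_pairD(6)[OF tp(1)])
    thus "ALL y t. b y (t + T0) = b y t" unfolding b_def by (simp add: test_pairD(3,6)[OF tp(2)])
    show "ALL y t. S y y t = 0" unfolding S_def by (simp add: R_diag)
   qed (use Sb S0 Slo bb bD in blast)+
   thus ?thesis using that by blast
  qed
  have "lam (%y u. f y u + s * f1 y u) (%e u. g e u + s * g1 e u) <= l + s * a + C2 * s\<^sup>2" if s: "abs s <= s0" for s
  proof -
   have s1: "abs s <= 1" using s s0 by linarith
   have ss: "s\<^sup>2 = abs s * abs s" by (simp add: power2_eq_square)
   have spsi: "abs (s * psi y u) <= 1 / 2" for y u
   proof -
    have "abs (s * psi y u) <= s0 * P" unfolding abs_mult using s psiP s0 by (intro mult_mono) auto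
    thus ?thesis using s0 by linarith
   qed
   define hs where "hs y u = h y u * (1 + s * psi y u)" for y u
   define gs where "gs e u = g e u + s * g1 e u" for e u
   define f0 where "f0 y u = f y u + s * f1 y u - (l + s * a) / T0" for y u
   define kk where "kk y u = bw (%y u. f y u - l / T0) g h y u * (1 + s * psi y u)
     + h y u * (0 + s * ((SUM z:UNIV. S y z u * (psi z u - psi y u)) + b y u - a / T0))" for y u
   define err where "err y u = kk y u - bw f0 gs hs y u" for y u
   \<comment> \<open>The potential for which \<open>hs\<close> is an exact solution with eigenvalue
     0: the defect divided by \<open>hs\<close> is moved into the potential.\<close>
   define fs where "fs y u = f0 y u + err y u / hs y u" for y u
   have hsk: "k1 / 2 <= hs y u" "hs y u <= k2 * 2" for y u
   proof -
    have r: "1 / 2 <= 1 + s * psi y u" "1 + s * psi y u <= 2" using spsi[of y u] by (auto simp: abs_le_iff)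
    have "k1 * (1 / 2) <= hs y u" unfolding hs_def using r hk1[of y u] k by (intro mult_mono) auto
    thus "k1 / 2 <= hs y u" by simp
    show "hs y u <= k2 * 2" unfolding hs_def using r hk2[of y u] k by (intro mult_mono) auto
   qed
   have hsb: "bdd_borel (hs y)" for y unfolding hs_def[abs_def] using hb psib by (intro bdd_borel_intros)
   have gsb: "bdd_borel (gs e)" for e unfolding gs_def[abs_def] using test_pair_bdd(2)[OF tp(1)] test_pair_bdd(2)[OF tp(2)] by (intro bdd_borel_intros)
   have gsc: "continuous_on UNIV (gs e)" for e unfolding gs_def[abs_def] using test_pairD(4)[OF tp(1)] test_pairD(4)[OF tp(2)] by (intro continuous_intros)
   have f0b: "bdd_borel (f0 y)" for y unfolding f0_def[abs_def] using test_pair_bdd(1)[OF tp(1)] test_pair_bdd(1)[OF tp(2)] by (intro bdd_borel_intros)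
   have flb: "bdd_borel (%u. f y u - l / T0)" for y using test_pair_bdd(1)[OF tp(1)] by (intro bdd_borel_intros)
   have bwb: "bdd_borel (bw (%y u. f y u - l / T0) g h y)" for y by (intro bw_bdd flb test_pair_bdd(2)[OF tp(1)] hb)
   have kpsib: "bdd_borel (%u. (SUM z:UNIV. S y z u * (psi z u - psi y u)) + b y u - a / T0)" for y
    using Sb psib bb by (intro bdd_borel_intros)
   have kkb: "bdd_borel (kk y)" for y unfolding kk_def[abs_def] using bwb psib hb Sb bb by (intro bdd_borel_intros)
   have errb: "bdd_borel (err y)" for y unfolding err_def[abs_def] using kkb f0b gsb hsb by (intro bdd_borel_intros bw_bdd)
   have fsb: "bdd_borel (fs y)" for y
    unfolding fs_def[abs_def] using f0b errb hsb k hsk by (intro bdd_borel_intros bdd_borel_divide[where c = "k1 / 2"]) auto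
   have "indef r t (hs y) (kk y)" for r t y
    unfolding hs_def[abs_def] kk_def[abs_def]
    by (rule indef_mult[OF hind bwb hb])
     (intro indef_add indef_const indef_cmult psiind bdd_borel_intros kpsib psib)+
   moreover have "kk y = bw fs gs hs y" for y
   proof
    fix u
    have "hs y u ~= 0" using hsk(1)[of y u] k by auto
    thus "kk y u = bw fs gs hs y u" unfolding fs_def bw_add_potential err_def by simp
   qed
   ultimately have hsind: "indef r t (hs y) (bw fs gs hs y)" for r t y by simp
   have k12: "k1 / 2 > 0" using k by simp
   note fkb = fk_bounds[OF fsb gsc gsb hsb hsind k12 hsk]
   have errC: "abs (err y u) <= Ce * s\<^sup>2" for y u
   proof -
    define A where "A z = R y z u * exp (g (y, z) u) * h z u" for z
    let ?v = "%z. s * g1 (y, z) u"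
    let ?X = "%z. (exp (?v z) - 1 - ?v z) + (exp (?v z) - 1) * (s * psi z u)"
    let ?T = "%z. (A z - R y z u * h y u) * (1 + s * psi y u) + s * A z * (psi z u - psi y u) + s * A z * g1 (y, z) u
      - (A z * exp (?v z) * (1 + s * psi z u) - R y z u * h y u * (1 + s * psi y u))"
    have hS: "h y u * S y z u = A z" for z unfolding S_def A_def using hpos[of y u] by simp
    have e1: "bw (%y u. f y u - l / T0) g h y u * (1 + s * psi y u)
      = (SUM z:UNIV. (A z - R y z u * h y u) * (1 + s * psi y u)) + (f y u - l / T0) * h y u * (1 + s * psi y u)"
     unfolding bw_def A_def by (simp add: distrib_right sum_distrib_right right_diff_distrib mult.assoc)
    have e2: "h y u * (0 + s * ((SUM z:UNIV. S y z u * (psi z u - psi y u)) + b y u - a / T0))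
      = (SUM z:UNIV. s * A z * (psi z u - psi y u)) + (SUM z:UNIV. s * A z * g1 (y, z) u) + s * h y u * (f1 y u - a / T0)"
     unfolding b_def hS[symmetric] by (simp add: algebra_simps sum_distrib_left)
    have e3: "bw f0 gs hs y u = (SUM z:UNIV. A z * exp (s * g1 (y, z) u) * (1 + s * psi z u) - R y z u * h y u * (1 + s * psi y u))
      + f0 y u * (h y u * (1 + s * psi y u))"
     unfolding bw_def A_def gs_def hs_def by (simp add: exp_add right_diff_distrib mult_ac)
    have comb: "(SUM z:UNIV. p z) + P1 + ((SUM z:UNIV. q z) + (SUM z:UNIV. r z) + P2) - ((SUM z:UNIV. t z) + P3)
      = (SUM z:UNIV. p z + q z + r z - t z) + (P1 + P2 - P3)" for p q r t :: "'v => real" and P1 P2 P3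
     by (simp add: sum.distrib sum_subtractf)
    have "err y u = (SUM z:UNIV. ?T z)
      + ((f y u - l / T0) * h y u * (1 + s * psi y u) + s * h y u * (f1 y u - a / T0) - f0 y u * (h y u * (1 + s * psi y u)))"
     unfolding err_def kk_def e1 e2 e3 by (rule comb)
    \<comment> \<open>Terms of order 0 and 1 in \<open>s\<close> cancel edge by edge. What survives
      in \<open>?X\<close> is the second-order remainder of the exponential and a product of two
      first-order quantities.\<close>
    also have "(SUM z:UNIV. ?T z)
      = (SUM z:UNIV. - (A z * ?X z))"
     by (intro sum.cong refl) (simp add: algebra_simps)
    also have "(f y u - l / T0) * h y u * (1 + s * psi y u) + s * h y u * (f1 y u - a / T0) - f0 y u * (h y u * (1 + s * psi y u))
      = - (s\<^sup>2 * (psi y u * h y u * (f1 y u - a / T0)))"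
     unfolding f0_def by (simp add: power2_eq_square algebra_simps add_divide_distrib)
    finally have eq: "err y u = (SUM z:UNIV. - (A z * ?X z))
      + - (s\<^sup>2 * (psi y u * h y u * (f1 y u - a / T0)))" .
    have Ab: "abs (A z) <= B * exp L * k2" for z
     unfolding A_def abs_mult using R_abs[of y z u] B_nonneg hk2[of z u] hpos[of z u] test_pairD(5)[OF tp(1), of "(y, z)" u]
     by (intro mult_mono) (auto simp: abs_le_iff)
    have "abs (- (A z * ?X z)) <= Cz * s\<^sup>2" for z
    proof -
     have v: "abs (?v z) <= abs s * L" unfolding abs_mult using test_pairD(5)[OF tp(2)] by (intro mult_left_mono) auto
     have vL: "abs s * L <= L" using s1 L mult_right_mono[of "abs s" 1 L] by simp
     have x: "abs (exp (?v z) - 1) <= exp L * (abs s * L)" "abs (exp (?v z) - 1 - ?v z) <= exp L * (abs s * L)\<^sup>2"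
      using exp_linear_errors[OF v vL] L by auto
     have "abs ((exp (?v z) - 1) * (s * psi z u)) <= (exp L * (abs s * L)) * (abs s * P)"
      unfolding abs_mult[of "exp (?v z) - 1"] using x(1) L psiP[of z u] by (intro mult_mono) (auto simp: abs_mult mult_left_mono)
     hence "abs (?X z) <= exp L * (abs s * L)\<^sup>2 + (exp L * (abs s * L)) * (abs s * P)"
      using x(2) by linarith
     also have "... = (exp L * L\<^sup>2 + exp L * L * P) * s\<^sup>2" by (simp add: ss power2_eq_square algebra_simps)
     finally have "abs (A z) * abs (?X z) <= (B * exp L * k2) * ((exp L * L\<^sup>2 + exp L * L * P) * s\<^sup>2)"
      using Ab B_nonneg k by (intro mult_mono) auto
     thus ?thesis by (simp add: abs_mult Cz_def mult_ac)
    qed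
    hence "abs (SUM z:UNIV. - (A z * ?X z))
      <= (SUM z:(UNIV::'v set). Cz * s\<^sup>2)"
     by (intro order_trans[OF sum_abs sum_mono])
    moreover have "abs (- (s\<^sup>2 * (psi y u * h y u * (f1 y u - a / T0)))) <= s\<^sup>2 * (P * k2 * (L + P / T0))"
    proof -
     have "abs (a / T0) <= P / T0" using aP T0 by (simp add: abs_divide divide_right_mono)
     hence "abs (f1 y u - a / T0) <= L + P / T0" using test_pairD(2)[OF tp(2), of y u] by linarith
     hence "abs (psi y u) * abs (h y u) * abs (f1 y u - a / T0) <= P * k2 * (L + P / T0)"
      using psiP[of y u] hk2[of y u] hpos[of y u] P k by (intro mult_mono) auto
     hence "s\<^sup>2 * (abs (psi y u) * abs (h y u) * abs (f1 y u - a / T0)) <= s\<^sup>2 * (P * k2 * (L + P / T0))" by (intro mult_left_mono) auto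
     thus ?thesis by (simp add: abs_mult)
    qed
    ultimately have "abs (err y u) <= (SUM z:(UNIV::'v set). Cz * s\<^sup>2) + s\<^sup>2 * (P * k2 * (L + P / T0))"
     unfolding eq by (rule order_trans[OF abs_triangle_ineq add_mono])
    thus ?thesis by (simp add: Ce_def algebra_simps)
   qed
   \<comment> \<open>A pointwise bound for the correction of the potential. Lowering a potential by
     \<open>d\<close> lowers the growth rate by \<open>T0 * d\<close>, which is
     \<open>C2 * s\<^sup>2\<close>.\<close>
   define d where "d = Ce * s\<^sup>2 / (k1 / 2)"
   define l' where "l' = l + s * a + C2 * s\<^sup>2"
   have low: "f0 y u - d <= fs y u" for y u
   proof -
    have "abs (err y u / hs y u) <= Ce * s\<^sup>2 / (k1 / 2)"
     unfolding abs_divide using errC hsk[of y u] k Ce0 by (intro frac_le) auto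
    thus ?thesis unfolding fs_def d_def by linarith
   qed
   have fl': "f0 y u - d = f y u + s * f1 y u - l' / T0" for y u
    unfolding f0_def d_def l'_def C2_def using T0 by (simp add: add_divide_distrib)
   have ffb: "bdd_borel (%u. f y u + s * f1 y u)" for y
    using test_pair_bdd(1)[OF tp(1)] test_pair_bdd(1)[OF tp(2)] by (intro bdd_borel_intros)
   have "part_fun n (%y u. f y u + s * f1 y u) gs <= (k2 * 2 / (k1 / 2)) * exp (real n * l')" if n: "n >= 1" for n
   proof -
    have "part_fun n (%y u. f y u + s * f1 y u - l' / T0) gs <= part_fun n fs gs"
     unfolding part_fun_def
    proof (rule integral_mono'[OF fkb(1)[OF n]])
     fix om assume "om : space M"
     thus "exp (psum n (%y u. f y u + s * f1 y u - l' / T0) gs om) <= exp (psum n fs gs om)"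
      unfolding exp_le_cancel_iff using fsb ffb low fl'
      by (intro path_fun_mono X_cadlag) (auto intro!: bdd_borel_diff)
    qed simp
    also have "... <= k2 * 2 / (k1 / 2)" by (rule fkb(3)[OF n])
    finally have "exp (real n * l') * part_fun n (%y u. f y u + s * f1 y u - l' / T0) gs <= exp (real n * l') * (k2 * 2 / (k1 / 2))"
     by (intro mult_left_mono) auto
    moreover have "exp (real n * l') * part_fun n (%y u. f y u + s * f1 y u - l' / T0) gs = part_fun n (%y u. f y u + s * f1 y u) gs"
     unfolding part_fun_shift[where f = "%y u. f y u + s * f1 y u", OF ffb] by (simp add: mult.assoc[symmetric] mult_exp_exp)
    ultimately show ?thesis by (simp only: mult.commute)
   qed
   hence "lam (%y u. f y u + s * f1 y u) gs <= l'"
    using test_pair_lam(1)[OF test_pair_add[OF tp s1]] unfolding gs_def by (rule growth_le[rotated])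
   thus ?thesis unfolding gs_def[abs_def] l'_def .
  qed
  thus ?thesis unfolding l_def by blast
 qed
 moreover have "C2 >= 0" using T0 Ce0 k by (simp add: C2_def)
 ultimately show ?thesis using that s0 by blast
qed

end

section \<open>Measures on finitely many circles\<close>

lemma SpV_space [simp]: "space (SpV :: ('a * real) measure) = UNIV"
 by (simp add: space_pair_measure)

lemma SpV_measurable:
 fixes f :: "'a::finite => real => 'b::topological_space"
 assumes "!!y. f y : borel_measurable borel"
 shows "(%p. f (fst p) (snd p)) : borel_measurable SpV"
 by (rule measurable_pair_measure_countable1) (use assms in \<open>auto simp: countable_finite\<close>)

lemma SpV_slice_measurable:
 assumes "(%p. f (fst p) (snd p)) : borel_measurable (SpV :: ('a * real) measure)"
 shows "f y : borel_measurable borel"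
proof -
 have "(%t. (y, t)) : measurable lborel (SpV :: ('a * real) measure)" by measurable
 from measurable_compose[OF this assms] show ?thesis by simp
qed

lemma SpV_times_sets: "A : sets borel ==> Y \<times> A : sets (SpV :: ('a::finite * real) measure)"
 by (intro pair_measureI) auto

lemma SpV_sets:
 "UNIV : sets (SpV :: ('a::finite * real) measure)" "UNIV - UNIV \<times> {0..<T0} : sets (SpV :: ('a * real) measure)"
 using SpV_times_sets[of UNIV "UNIV :: 'a set"] SpV_times_sets[of "{0..<T0}" "UNIV :: 'a set"] sets.compl_sets[of _ "SpV :: ('a * real) measure"] by force+

lemma nn_integral_SpV:
 fixes F :: "'a::finite * real => ennreal"
 assumes "F : borel_measurable SpV"
 shows "(\<integral>\<^sup>+p. F p \<partial>SpV) = (SUM y:UNIV. \<integral>\<^sup>+t. F (y, t) \<partial>lborel)"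
 by (subst lborel.nn_integral_fst[symmetric, OF assms]) (simp add: nn_integral_count_space_finite)

lemma integral_SpV:
 fixes F :: "'a::finite * real => real"
 assumes F: "integrable SpV F"
 shows "!!y. integrable lborel (%t. F (y, t))" and "(LINT p|SpV. F p) = (SUM y:UNIV. \<integral>t. F (y, t) \<partial>lborel)"
proof -
 interpret pair_sigma_finite "count_space (UNIV :: 'a set)" lborel
  by (intro pair_sigma_finite.intro lborel.sigma_finite_measure_axioms sigma_finite_measure_count_space_finite) auto
 show "integrable lborel (%t. F (y, t))" for y using AE_integrable_fst'[OF F] by (simp add: AE_count_space)
 show "(LINT p|SpV. F p) = (SUM y:UNIV. \<integral>t. F (y, t) \<partial>lborel)"
  using integral_fst'[OF F] by (simp add: lebesgue_integral_count_space_finite)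
qed

definition circle_measure :: "real => ('a::finite * real) measure => bool" where
 "circle_measure T0 nu \<longleftrightarrow> sets nu = sets SpV & emeasure nu (space nu) < \<infinity> & emeasure nu (space nu - UNIV \<times> {0..<T0}) = 0"

lemma circle_measureD:
 assumes "circle_measure T0 nu"
 shows "finite_measure nu" "sets nu = sets SpV" "space nu = UNIV" "AE p in nu. snd p : {0..<T0}"
proof -
 show fm: "finite_measure nu" using assms unfolding circle_measure_def by (intro finite_measureI) auto
 show s: "sets nu = sets SpV" using assms by (simp add: circle_measure_def)
 show sp: "space nu = UNIV" using sets_eq_imp_space_eq[OF s] by simp
 have "UNIV - UNIV \<times> {0..<T0} = (UNIV :: 'a set) \<times> (- {0..<T0})" by auto
 hence "UNIV - UNIV \<times> {0..<T0} : null_sets nu"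
  using assms sp s unfolding circle_measure_def null_sets_def by (auto intro!: SpV_times_sets)
 thus "AE p in nu. snd p : {0..<T0}" by (rule AE_I') (auto simp: sp)
qed

lemma circle_measurable: "circle_measure T0 nu ==> f : borel_measurable SpV ==> f : borel_measurable nu"
 by (simp only: measurable_cong_sets[OF circle_measureD(2) refl])

abbreviation itg :: "('a * real) measure => ('a tfun) => real" where
 "itg nu f \<equiv> \<integral>p. f (fst p) (snd p) \<partial>nu"

lemma cont_perD: "cont_per T0 u ==> continuous_on UNIV (u y)" "cont_per T0 u ==> u y (t + T0) = u y t"
 unfolding cont_per_def by blast+

lemma cont_per_bounded:
 fixes u :: "'a::finite => real => real"
 assumes u: "cont_per T0 u" and T0: "T0 > 0"
 obtains K where "K >= 0" "!!y t. abs (u y t) <= K"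
proof -
 have "bdd_borel (u y)" for y
 proof -
  note c = cont_perD(1)[OF u, of y] cont_perD(2)[OF u, of y]
  hence "compact (u y ` {0..T0})" by (intro compact_continuous_image continuous_on_subset[OF c(1)]) auto
  then obtain K where "!!v. v : u y ` {0..T0} ==> abs v <= K" by (metis bounded_iff compact_imp_bounded real_norm_def)
  hence "abs (u y t) <= K" for t
   using periodic_pmod[of "u y" T0 t, OF c(2)] pmod_bounds[OF T0, of t] by (metis atLeastAtMost_iff imageI less_imp_le)
  thus ?thesis using c by (intro bdd_borelI borel_measurable_continuous_onI)
 qed
 thus ?thesis using bdd_borel_family_bound[of u] that by blast
qed

lemma cont_per_bdd:
 fixes u :: "'a::finite => real => real"
 assumes "cont_per T0 u" "T0 > 0" shows "bdd_borel (u y)"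
 using cont_per_bounded[OF assms] cont_perD(1)[OF assms(1)] by (metis bdd_borelI borel_measurable_continuous_onI)

lemma cont_per_measurable:
 fixes u :: "'a::finite => real => real"
 assumes "cont_per T0 u" shows "(%p. u (fst p) (snd p)) : borel_measurable SpV"
 by (rule SpV_measurable, rule borel_measurable_continuous_onI, rule cont_perD(1)[OF assms])

lemma circle_integrable_bounded:
 fixes f :: "'a::finite * real => real"
 assumes nu: "circle_measure T0 nu" and f: "f : borel_measurable SpV" "!!p. abs (f p) <= K"
 shows "integrable nu f"
proof -
 interpret finite_measure nu by (rule circle_measureD(1)[OF nu])
 have "f : borel_measurable nu" by (rule circle_measurable[OF nu f(1)])
 thus ?thesis using f(2) by (intro integrable_const_bound[where B = K]) auto
qed

lemma cont_per_integrable: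
 fixes u :: "'a::finite => real => real"
 assumes nu: "circle_measure T0 nu" and T0: "T0 > 0" and u: "cont_per T0 u"
 shows "integrable nu (%p. u (fst p) (snd p))"
proof -
 obtain K where "!!y t. abs (u y t) <= K" using cont_per_bounded[OF u T0] by blast
 thus ?thesis by (intro circle_integrable_bounded[OF nu cont_per_measurable[OF u]])
qed

lemma cont_per_add: "cont_per T0 u ==> cont_per T0 v ==> cont_per T0 (%y t. u y t + v y t)"
 unfolding cont_per_def by (simp add: continuous_on_add)

lemma cont_per_cmult: "cont_per T0 u ==> cont_per T0 (%y t. k * u y t)"
 unfolding cont_per_def by (simp add: continuous_on_mult_left)

lemma cont_per_const: "cont_per T0 (%y t. k y)"
 unfolding cont_per_def by auto

lemma cont_per_mult: "cont_per T0 u ==> cont_per T0 v ==> cont_per T0 (%y t. u y t * v y t)"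
 unfolding cont_per_def by (simp add: continuous_on_mult)

section \<open>Density of continuous periodic functions in L^1\<close>

context
 fixes T0 :: real and nu :: "('a::finite * real) measure"
 assumes T0: "T0 > 0" and nu: "circle_measure T0 nu"
begin

definition approximable :: "('a * real => real) => bool" where
 "approximable f \<longleftrightarrow> integrable nu f & (ALL ep>0. EX u. cont_per T0 u & (LINT p|nu. abs (f p - u (fst p) (snd p))) < ep)"

lemma approximable_cont: "cont_per T0 u ==> approximable (%p. u (fst p) (snd p))"
 unfolding approximable_def using cont_per_integrable[OF nu T0, of u] by (auto intro!: exI[of _ u])

lemma approximable_add:
 assumes "approximable f" "approximable g" shows "approximable (%p. f p + g p)"
 unfolding approximable_def
proof (intro conjI allI impI)
 have i: "integrable nu f" "integrable nu g" using assms unfolding approximable_def by auto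
 thus "integrable nu (%p. f p + g p)" by simp
 fix ep :: real assume "ep > 0"
 then obtain u v where u: "cont_per T0 u" "(LINT p|nu. abs (f p - u (fst p) (snd p))) < ep / 2"
  and v: "cont_per T0 v" "(LINT p|nu. abs (g p - v (fst p) (snd p))) < ep / 2"
  using assms unfolding approximable_def by (meson half_gt_zero)
 note cu = cont_per_integrable[OF nu T0 u(1)] and cv = cont_per_integrable[OF nu T0 v(1)]
 have "(LINT p|nu. abs (f p + g p - (u (fst p) (snd p) + v (fst p) (snd p))))
  <= (LINT p|nu. abs (f p - u (fst p) (snd p)) + abs (g p - v (fst p) (snd p)))"
  using i cu cv by (intro integral_mono) auto
 also have "... = (LINT p|nu. abs (f p - u (fst p) (snd p))) + (LINT p|nu. abs (g p - v (fst p) (snd p)))"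
  using i cu cv by (intro Bochner_Integration.integral_add) auto
 also have "... < ep" using u v by simp
 finally show "EX w. cont_per T0 w & (LINT p|nu. abs (f p + g p - w (fst p) (snd p))) < ep"
  using cont_per_add[OF u(1) v(1)] by (intro exI[of _ "%y t. u y t + v y t"]) auto
qed

lemma approximable_mult:
 assumes f: "approximable f" and w: "cont_per T0 w" shows "approximable (%p. w (fst p) (snd p) * f p)"
 unfolding approximable_def
proof (intro conjI allI impI)
 obtain K where K: "K >= 0" "!!y t. abs (w y t) <= K" using cont_per_bounded[OF w T0] by blast
 have i: "integrable nu f" using f unfolding approximable_def by auto
 have wm: "(%p. w (fst p) (snd p)) : borel_measurable nu"
  using borel_measurable_integrable[OF cont_per_integrable[OF nu T0 w]] .
 have bnd: "integrable nu (%p. w (fst p) (snd p) * g p)" if "integrable nu g" for g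
  using that wm K by (intro Bochner_Integration.integrable_bound[OF integrable_mult_right[OF that, of K]])
   (auto simp: abs_mult intro!: AE_I2 mult_right_mono)
 show "integrable nu (%p. w (fst p) (snd p) * f p)" by (rule bnd[OF i])
 fix ep :: real assume ep: "ep > 0"
 have "ep / (K + 1) > 0" using ep K by simp
 then obtain u where u: "cont_per T0 u" "(LINT p|nu. abs (f p - u (fst p) (snd p))) < ep / (K + 1)"
  using f unfolding approximable_def by meson
 note cu = cont_per_integrable[OF nu T0 u(1)]
 have d: "integrable nu (%p. f p - u (fst p) (snd p))" using i cu by simp
 have "(LINT p|nu. abs (w (fst p) (snd p) * f p - w (fst p) (snd p) * u (fst p) (snd p))) <= (LINT p|nu. K * abs (f p - u (fst p) (snd p)))"
 proof (rule integral_mono)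
  show "integrable nu (%p. abs (w (fst p) (snd p) * f p - w (fst p) (snd p) * u (fst p) (snd p)))"
   using bnd[OF i] bnd[OF cu] by simp
  show "integrable nu (%p. K * abs (f p - u (fst p) (snd p)))" using d by simp
  show "abs (w (fst p) (snd p) * f p - w (fst p) (snd p) * u (fst p) (snd p)) <= K * abs (f p - u (fst p) (snd p))" for p
   unfolding right_diff_distrib[symmetric] abs_mult using K by (intro mult_right_mono) auto
 qed
 also have "... = K * (LINT p|nu. abs (f p - u (fst p) (snd p)))" by simp
 also have "... <= (K + 1) * (LINT p|nu. abs (f p - u (fst p) (snd p)))" by (intro mult_right_mono) auto
 also have "... < ep" using u K by (simp add: pos_less_divide_eq mult.commute)
 finally show "EX v. cont_per T0 v & (LINT p|nu. abs (w (fst p) (snd p) * f p - v (fst p) (snd p))) < ep"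
  using cont_per_mult[OF w u(1)] by (intro exI[of _ "%y t. w y t * u y t"]) auto
qed

lemma approximable_lim:
 assumes s: "!!i. approximable (s i)" and lim: "AE p in nu. (%i. s i p) \<longlonglongrightarrow> f p"
  and dom: "!!i. AE p in nu. abs (s i p) <= w p" and w: "integrable nu w" and fm: "f : borel_measurable nu"
 shows "approximable f"
 unfolding approximable_def
proof (intro conjI allI impI)
 have si: "integrable nu (s i)" for i using s unfolding approximable_def by auto
 hence sm: "s i : borel_measurable nu" for i by auto
 show fi: "integrable nu f"
  using dom by (intro integrable_dominated_convergence[OF fm sm w lim]) auto
 have "(%i. \<integral>p. abs (f p - s i p) \<partial>nu) \<longlonglongrightarrow> (LINT p|nu. 0)"
 proof (rule integral_dominated_convergence[where w = "%p. abs (f p) + w p"])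
  show "AE p in nu. (%i. abs (f p - s i p)) \<longlonglongrightarrow> 0"
   using lim by eventually_elim (auto intro!: tendsto_eq_intros)
  show "AE p in nu. norm \<bar>f p - s i p\<bar> <= \<bar>f p\<bar> + w p" for i
   using dom[of i] by eventually_elim auto
 qed (use fm sm fi w in auto)
 hence lim0: "(%i. \<integral>p. abs (f p - s i p) \<partial>nu) \<longlonglongrightarrow> 0" by simp
 fix ep :: real assume ep: "ep > 0"
 hence "\<forall>\<^sub>F i in sequentially. (LINT p|nu. abs (f p - s i p)) < ep / 2"
  using lim0 by (intro order_tendstoD) auto
 then obtain i where i: "(LINT p|nu. abs (f p - s i p)) < ep / 2" by (auto simp: eventually_sequentially)
 obtain u where u: "cont_per T0 u" "(LINT p|nu. abs (s i p - u (fst p) (snd p))) < ep / 2"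
  using s[of i] ep unfolding approximable_def by (meson half_gt_zero)
 note cu = cont_per_integrable[OF nu T0 u(1)]
 have "(LINT p|nu. abs (f p - u (fst p) (snd p))) <= (LINT p|nu. abs (f p - s i p) + abs (s i p - u (fst p) (snd p)))"
  using fi si cu by (intro integral_mono) auto
 also have "... = (LINT p|nu. abs (f p - s i p)) + (LINT p|nu. abs (s i p - u (fst p) (snd p)))"
  using fi si cu by (intro Bochner_Integration.integral_add) auto
 also have "... < ep" using i u by simp
 finally show "EX u. cont_per T0 u & (LINT p|nu. abs (f p - u (fst p) (snd p))) < ep" using u by blast
qed

lemma approximable_lessThan: "approximable (%p. indicator {..<b} (snd p))"
proof -
 interpret finite_measure nu by (rule circle_measureD(1)[OF nu])
 have mi: "(%p. indicator {..<b} (snd p) :: real) : borel_measurable nu"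
  by (rule circle_measurable[OF nu], rule SpV_measurable[where f = "%_. indicator {..<b}"]) auto
 note AE = circle_measureD(4)[OF nu]
 show ?thesis
 proof (cases "0 < b & b < T0")
  case True
  \<comment> \<open>Descends to 0 at \<open>b\<close> and climbs back to 1 just before
    \<open>T0\<close>, so that the values at 0 and \<open>T0\<close> agree. The second ramp shrinks
    to the point \<open>T0\<close>, which lies outside {0..<T0}; \<open>k0\<close> is large enough
    for the value at 0 to be 1.\<close>
  define v where "v k s = min 1 (max 0 (real k * (b - s)) + max 0 (1 - real k * (T0 - s)))" for k :: nat and s
  obtain k0 :: nat where k0: "1 / b <= real k0" using real_arch_simple by blast
  define u where "u k t = v (k + k0) (pmod t T0)" for k t
  have "continuous_on UNIV (u k)" for k
  proof -
   have kb: "1 <= real (k + k0) * b"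
    using k0 True by (simp add: divide_le_eq) (metis add_increasing distrib_right mult_nonneg_nonneg less_imp_le of_nat_0_le_iff)
   have "v (k + k0) 0 = v (k + k0) T0" using kb True unfolding v_def by auto
   moreover have "continuous_on {0..T0} (v (k + k0))" unfolding v_def[abs_def] by (intro continuous_intros)
   ultimately show ?thesis unfolding u_def[abs_def] by (intro continuous_pmod_extension T0)
  qed
  hence cp: "cont_per T0 (%y::'a. u k)" for k unfolding cont_per_def using T0 by (auto simp: u_def)
  show ?thesis
  proof (rule approximable_lim[where w = "%_. 1"])
   show "approximable (%p. u k (snd p))" for k using approximable_cont[OF cp[of k]] .
   show "AE p in nu. (%k. u k (snd p)) \<longlonglongrightarrow> indicator {..<b} (snd p)"
    using AE
   proof eventually_elim
    case (elim p)
    define s where "s = snd p"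
    have s: "pmod s T0 = s" "s < T0" "0 <= s" using elim by (auto simp: s_def pmod_id)
    have large: "\<forall>\<^sub>F k in sequentially. 1 <= real (k + k0) * d" if "d > 0" for d
    proof -
     obtain m :: nat where "1 / d <= real m" using real_arch_simple by blast
     hence "1 <= real m * d" using \<open>d > 0\<close> by (simp add: divide_le_eq)
     moreover have "real m * d <= real (k + k0) * d" if "k >= m" for k
      using \<open>d > 0\<close> that by (intro mult_right_mono) auto
     ultimately have "1 <= real (k + k0) * d" if "k >= m" for k using that by (meson order_trans)
     thus ?thesis by (auto simp: eventually_sequentially)
    qed
    have "\<forall>\<^sub>F k in sequentially. u k s = indicator {..<b} s"
    proof (cases "s < b")
     case True
     show ?thesis using large[of "b - s"] True by (auto elim!: eventually_mono simp: u_def v_def s)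
    next
     case False
     have "u k s = indicator {..<b} s" if "1 <= real (k + k0) * (T0 - s)" for k
     proof -
      have "real (k + k0) * (b - s) <= 0" using False by (intro mult_nonneg_nonpos) auto
      thus ?thesis unfolding u_def v_def s(1) using that False by (simp del: of_nat_add)
     qed
     thus ?thesis using large[of "T0 - s"] s by (auto elim!: eventually_mono)
    qed
    thus ?case unfolding s_def[symmetric] by (rule tendsto_eventually)
   qed
   show "AE p in nu. abs (u k (snd p)) <= 1" for k by (auto simp: u_def v_def)
  qed (use mi in auto)
 next
  case False
  define r :: real where "r = (if b <= 0 then 0 else 1)"
  show ?thesis
  proof (rule approximable_lim[where s = "%_ _. r" and w = "%_. 1"])
   show "approximable (%p. r)" using approximable_cont[OF cont_per_const[of T0 "%_. r"]] by simp
   show "AE p in nu. (%i. r) \<longlonglongrightarrow> indicator {..<b} (snd p)"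
    using AE by eventually_elim (use False in \<open>auto simp: r_def indicator_def\<close>)
  qed (use mi in \<open>auto simp: r_def\<close>)
 qed
qed

lemma approximable_snd_set:
 assumes B: "B : sets borel" shows "approximable (%p. indicator B (snd p))"
proof -
 interpret finite_measure nu by (rule circle_measureD(1)[OF nu])
 have mi: "(%p. indicator B (snd p) :: real) : borel_measurable nu" if "B : sets borel" for B
  by (rule circle_measurable[OF nu], rule SpV_measurable[where f = "%_. indicator B"]) (use that in auto)
 have gen: "sets (borel :: real measure) = sigma_sets UNIV (range lessThan)"
  by (subst borel_Iio) (simp add: sets_measure_of)
 have "Int_stable (range (lessThan :: real => _))"
  unfolding Int_stable_def
 proof (intro ballI)
  fix A B :: "real set" assume "A : range lessThan" "B : range lessThan"
  then obtain a b where "A = {..<a}" "B = {..<b}" by blast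
  hence "A \<inter> B = {..<min a b}" by auto
  thus "A \<inter> B : range lessThan" by blast
 qed
 moreover have "range lessThan \<subseteq> Pow (UNIV :: real set)" by simp
 moreover have "B : sigma_sets UNIV (range lessThan)" using B gen by simp
 ultimately show ?thesis
 proof (induction rule: sigma_sets_induct_disjoint[of "range lessThan" UNIV])
  case (basic A)
  thus ?case using approximable_lessThan by auto
 next
  case empty
  show ?case using approximable_cont[OF cont_per_const[of T0 "%_. 0"]] by simp
 next
  case (compl A)
  have "approximable (%p. 1 + (-1) * indicator A (snd p))"
   using approximable_add[OF approximable_cont[OF cont_per_const[of T0 "%_. 1"]]
     approximable_mult[OF compl(2) cont_per_const[of T0 "%_. -1"]]] by simp
  moreover have "(%p::'a * real. 1 + (-1) * indicator A (snd p)) = (%p. indicator (UNIV - A) (snd p) :: real)"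
   by (auto simp: indicator_def)
  ultimately show ?case by (simp only:)
 next
  case (union A)
  have "approximable (%p. SUM i<n. indicator (A i) (snd p))" for n
  proof (induction n)
   case 0
   thus ?case using approximable_cont[OF cont_per_const[of T0 "%_. 0"]] by simp
  next
   case (Suc n)
   thus ?case using approximable_add[OF Suc union(3)[of n]] by simp
  qed
  thus ?case
  proof (rule approximable_lim[where w = "%_. 1"])
   have eq: "(SUM i<n. indicator (A i) t) = (indicator (UN i<n. A i) t :: real)" for n t
    using union(1) by (subst indicator_UN_disjoint) (auto simp: disjoint_family_on_def)
   show "AE p in nu. (%n. SUM i<n. indicator (A i) (snd p)) \<longlonglongrightarrow> (indicator (\<Union> (range A)) (snd p) :: real)"
    unfolding eq by (intro AE_I2 LIMSEQ_indicator_UN)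
   show "AE p in nu. abs (SUM i<n. indicator (A i) (snd p)) <= (1::real)" for n
    unfolding eq by (auto simp: indicator_def)
   show "(%p. indicator (\<Union> (range A)) (snd p) :: real) : borel_measurable nu"
    using union(2) gen by (intro mi) (auto simp: image_subset_iff intro!: sets.countable_UN)
  qed auto
 qed
qed

lemma approximable_integrable:
 assumes "integrable nu f" shows "approximable f"
 using assms
proof (induction rule: integrable_induct)
 case (base A r)
 have A: "A : sets SpV" using base circle_measureD(2)[OF nu] by simp
 have slice: "{t. (y, t) : A} : sets borel" for y
  using sets_Pair1[OF A, of y] by (simp add: vimage_def)
 define w where "w y y' = (if y' = y then r else 0)" for y y' :: 'a
 have "approximable (%p. SUM y:Y. w y (fst p) * indicator {t. (y, t) : A} (snd p))" if "finite Y" for Y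
  using that
 proof (induction Y)
  case empty
  thus ?case using approximable_cont[OF cont_per_const[of T0 "%_. 0"]] by simp
 next
  case (insert y Y)
  show ?case unfolding sum.insert[OF insert.hyps]
   by (rule approximable_add[OF approximable_mult[OF approximable_snd_set[OF slice[of y]] cont_per_const[of T0 "w y"]] insert.IH])
 qed
 from this[of UNIV] have "approximable (%p. SUM y:UNIV. w y (fst p) * indicator {t. (y, t) : A} (snd p))" by simp
 moreover have "(%p. SUM y:UNIV. w y (fst p) * indicator {t. (y, t) : A} (snd p)) = (%p. indicator A p *\<^sub>R r)"
 proof
  fix p :: "'a * real"
  have "(SUM y:UNIV. w y (fst p) * indicator {t. (y, t) : A} (snd p)) = (SUM y:UNIV. if y = fst p then indicator A p * r else 0)"
   unfolding w_def by (intro sum.cong) (auto simp: indicator_def)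
  thus "(SUM y:UNIV. w y (fst p) * indicator {t. (y, t) : A} (snd p)) = indicator A p *\<^sub>R r" by simp
 qed
 ultimately show ?case by simp
next
 case (add f g)
 show ?case by (rule approximable_add) (use add in auto)
next
 case (lim f s)
 show ?case
  by (rule approximable_lim[where s = s and w = "%p. 2 * abs (f p)"]) (use lim in auto)
qed

text \<open>Clipping an approximation to the range of \<open>f\<close> does not increase its
  distance from \<open>f\<close>. The preserved bound matters where exponentials of the
  approximation are compared.\<close>

lemma approx_cont_per:
 assumes f: "f : borel_measurable SpV" "!!p. abs (f p) <= K" and ep: "ep > 0"
 obtains u where "cont_per T0 u" "!!y t. abs (u y t) <= K" "(LINT p|nu. abs (f p - u (fst p) (snd p))) < ep"
proof -
 have fi: "integrable nu f" by (rule circle_integrable_bounded[OF nu f])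
 obtain u where u: "cont_per T0 u" "(LINT p|nu. abs (f p - u (fst p) (snd p))) < ep"
  using approximable_integrable[OF fi] ep unfolding approximable_def by blast
 have K: "K >= 0" using f(2) by (meson abs_ge_zero order_trans)
 define v where "v y t = max (- K) (min K (u y t))" for y t
 have v: "cont_per T0 v"
  using u(1) unfolding cont_per_def v_def by (simp add: continuous_on_max continuous_on_min)
 have "(LINT p|nu. abs (f p - v (fst p) (snd p))) <= (LINT p|nu. abs (f p - u (fst p) (snd p)))"
 proof (intro integral_mono)
  fix p show "abs (f p - v (fst p) (snd p)) <= abs (f p - u (fst p) (snd p))"
   using f(2)[of p] by (auto simp: v_def abs_le_iff max_def min_def)
 qed (use fi cont_per_integrable[OF nu T0 u(1)] cont_per_integrable[OF nu T0 v] in auto)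
 thus ?thesis using that[OF v] u(2) K by (auto simp: v_def)
qed

end

text \<open>Serves to approximate by one continuous function with respect to two measures at
  once.\<close>

definition plus_measure :: "'b measure => 'b measure => 'b measure" where
 "plus_measure M N = measure_of (space M) (sets M) (%A. emeasure M A + emeasure N A)"

lemma plus_measure:
 assumes s: "sets N = sets M"
 shows "sets (plus_measure M N) = sets M" "space (plus_measure M N) = space M"
  "A : sets M ==> emeasure (plus_measure M N) A = emeasure M A + emeasure N A"
proof -
 show s1: "sets (plus_measure M N) = sets M" "space (plus_measure M N) = space M"
  unfolding plus_measure_def by (auto simp: space_measure_of_conv sets.space_closed)
 assume A: "A : sets M"
 show "emeasure (plus_measure M N) A = emeasure M A + emeasure N A"
 proof (rule emeasure_measure_of[OF plus_measure_def])
  show "sets M \<subseteq> Pow (space M)" by (rule sets.space_closed)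
  show "A : sets (plus_measure M N)" using A s1 by simp
  show "positive (sets (plus_measure M N)) (%A. emeasure M A + emeasure N A)" by (auto simp: positive_def)
  show "countably_additive (sets (plus_measure M N)) (%A. emeasure M A + emeasure N A)"
   unfolding s1
  proof (rule countably_additiveI)
   fix A :: "nat => _" assume A: "range A \<subseteq> sets M" "disjoint_family A" "\<Union> (range A) : sets M"
   have "(\<Sum>i. emeasure M (A i) + emeasure N (A i)) = (\<Sum>i. emeasure M (A i)) + (\<Sum>i. emeasure N (A i))"
    by (rule suminf_add[symmetric]) auto
   thus "(\<Sum>i. emeasure M (A i) + emeasure N (A i)) = emeasure M (\<Union> (range A)) + emeasure N (\<Union> (range A))"
    using A s by (simp add: suminf_emeasure)
  qed
 qed
qed

lemma plus_measure_ge: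
 assumes "sets N = sets M" shows "M <= plus_measure M N" "N <= plus_measure M N"
proof -
 have sp: "space N = space M" by (rule sets_eq_imp_space_eq[OF assms])
 have "emeasure M A <= emeasure (plus_measure M N) A & emeasure N A <= emeasure (plus_measure M N) A" for A
 proof (cases "A : sets M")
  case True
  thus ?thesis by (simp add: plus_measure(3)[OF assms])
 next
  case False
  thus ?thesis using assms by (simp add: emeasure_notin_sets)
 qed
 thus "M <= plus_measure M N" "N <= plus_measure M N"
  using plus_measure(1,2)[OF assms] assms sp by (auto simp: le_measure_iff intro!: le_funI)
qed

section \<open>The rate function dominates the conjugate of the eigenvalue\<close>

definition period :: "real => real => real" where
 "period T0 t = indicator {0..<T0} t"

lemma period_measurable [measurable]: "period T0 : borel_measurable borel"
 unfolding period_def[abs_def] by measurable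

lemma period_eq: "t : {0..<T0} ==> period T0 t = 1" "t ~: {0..<T0} ==> period T0 t = 0" "0 <= period T0 t" "period T0 t <= 1"
 by (auto simp: period_def indicator_def)

definition slice_density :: "real => (real => 'a => real) => ('a::finite * real) measure" where
 "slice_density T0 m = density SpV (%p. ennreal (m (snd p) (fst p)) * indicator {0..<T0} (snd p))"

lemma slice_density_alt:
 "slice_density T0 m = density SpV (%p. ennreal (period T0 (snd p) * m (snd p) (fst p)))"
 unfolding slice_density_def period_def by (rule arg_cong[where f = "density SpV"]) (auto simp: indicator_def)

lemma slice_density_integral:
 fixes m :: "real => 'a::finite => real"
 assumes m: "(%p. m (snd p) (fst p)) : borel_measurable SpV" "!!t y. 0 <= m t y"
  and nu: "circle_measure T0 (slice_density T0 m)" and f: "!!y. f y : borel_measurable borel" "!!y t. abs (f y t) <= K"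
 shows "integrable lborel (%t. period T0 t * (m t y * f y t))"
  and "itg (slice_density T0 m) f = (SUM y:UNIV. \<integral>t. period T0 t * (m t y * f y t) \<partial>lborel)"
proof -
 let ?g = "%p. period T0 (snd p) * m (snd p) (fst p)"
 have g: "?g : borel_measurable SpV" using m(1) by measurable
 have g0: "AE p in SpV. 0 <= ?g p" using m(2) by (auto simp: period_eq)
 have fm: "(%p. f (fst p) (snd p)) : borel_measurable SpV" by (rule SpV_measurable[OF f(1)])
 have "integrable (slice_density T0 m) (%p. f (fst p) (snd p))"
  by (rule circle_integrable_bounded[OF nu fm]) (rule f(2))
 hence i: "integrable SpV (%p. ?g p * f (fst p) (snd p))"
  unfolding slice_density_alt using integrable_density[OF fm g g0] by simp
 show "integrable lborel (%t. period T0 t * (m t y * f y t))" using integral_SpV(1)[OF i, of y] by (simp add: mult.assoc)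
 show "itg (slice_density T0 m) f = (SUM y:UNIV. \<integral>t. period T0 t * (m t y * f y t) \<partial>lborel)"
  unfolding slice_density_alt using integral_density[OF fm g g0] integral_SpV(2)[OF i] by (simp add: mult.assoc)
qed

lemma Mstar_circle:
 assumes "(mu, Q) : Mstar T0 E"
 shows "circle_measure T0 mu" "circle_measure T0 Q" "AE p in Q. fst p : E" "emeasure mu (space mu) = ennreal T0"
proof -
 have s: "sets mu = sets SpV" "sets Q = sets SpV" and sp: "space Q = UNIV"
  using assms sets_eq_imp_space_eq[of Q SpV] by (auto simp: Mstar_def)
 show "circle_measure T0 mu" "emeasure mu (space mu) = ennreal T0" using assms by (auto simp: Mstar_def circle_measure_def)
 have E: "E \<times> {0..<T0} : sets Q" unfolding s by (rule SpV_times_sets) simp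
 have n: "space Q - E \<times> {0..<T0} : null_sets Q"
  using assms E by (auto simp: Mstar_def null_sets_def)
 have "UNIV \<times> {0..<T0} : sets Q" unfolding s by (rule SpV_times_sets) simp
 hence "space Q - UNIV \<times> {0..<T0} : null_sets Q" by (intro null_sets_subset[OF n] sets.compl_sets) (auto simp: sp)
 thus "circle_measure T0 Q" using assms by (auto simp: Mstar_def circle_measure_def)
 show "AE p in Q. fst p : E" by (rule AE_I'[OF n]) auto
qed

definition ev :: "('v tfun) => (('v * 'v) tfun) => ('v * real) measure \<times> (('v * 'v) * real) measure => real" where
 "ev f g PQ = itg (fst PQ) f + itg (snd PQ) g"

lemma sum_pairs_E:
 fixes F :: "'v::finite * 'v => real"
 shows "(SUM y:UNIV. SUM z:UNIV. if (y, z) : E then F (y, z) else 0) = (SUM e:E. F e)"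
proof -
 have "(SUM y:UNIV. SUM z:UNIV. if (y, z) : E then F (y, z) else 0) = (SUM e:UNIV. if e : E then F e else 0)"
  by (simp add: sum.cartesian_product)
 thus ?thesis by (simp add: sum.If_cases)
qed

lemma divg_pairing: "(SUM y:UNIV. divg E A y * ph y) = (SUM e:E. A e * (ph (fst e) - ph (snd e)))"
proof -
 have "(SUM y:UNIV. divg E A y * ph y) = (SUM y:UNIV. SUM z:UNIV. if (y, z) : E then A (y, z) * ph y else 0)
   - (SUM y:UNIV. SUM z:UNIV. if (z, y) : E then A (z, y) * ph y else 0)"
  unfolding divg_def left_diff_distrib sum_subtractf sum_distrib_right by (intro arg_cong2[where f = "(-)"] sum.cong) auto
 also have "(SUM y:UNIV. SUM z:UNIV. if (z, y) : E then A (z, y) * ph y else 0)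
   = (SUM z:UNIV. SUM y:UNIV. if (z, y) : E then A (z, y) * ph y else 0)" by (rule sum.swap)
 finally show ?thesis
  using sum_pairs_E[of E "%e. A e * ph (fst e)"] sum_pairs_E[of E "%e. A e * ph (snd e)"]
  by (simp only: right_diff_distrib sum_subtractf fst_conv snd_conv)
qed

text \<open>Convex duality of the Poisson relative entropy, with equality at
  \<open>G = ln (q / p)\<close>; the inequality is \<open>1 + u <= exp u\<close> at
  \<open>u = G - ln (q / p)\<close>. Negative left sides become 0 in \<open>ennreal\<close>.\<close>

lemma young:
 assumes "0 <= q" "0 <= p" shows "ennreal (q * G - p * (exp G - 1)) <= Phi q p"
proof (cases "q = 0")
 case True
 have "- (p * (exp G - 1)) <= p" using assms by (simp add: algebra_simps)
 thus ?thesis using True by (simp add: Phi_def ennreal_leI)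
next
 case False
 show ?thesis
 proof (cases "p = 0")
  case True
  thus ?thesis using False by (simp add: Phi_def)
 next
  case p: False
  have pos: "q > 0" "p > 0" using assms False p by auto
  have "1 + (G - ln (q / p)) <= exp (G - ln (q / p))" by (rule exp_ge_add_one_self)
  also have "... = p * exp G / q" using pos by (simp add: exp_diff)
  finally have "q * (1 + (G - ln (q / p))) <= p * exp G" using pos by (simp add: pos_le_divide_eq mult.commute)
  hence "q * G - p * (exp G - 1) <= q * ln (q / p) - (q - p)" by (simp add: algebra_simps)
  thus ?thesis using False p by (simp add: Phi_def ennreal_leI)
 qed
qed

lemma integral_le_nn_integral:
 assumes "integrable M f" "!!x. x : space M ==> ennreal (f x) <= F x"
 shows "ennreal (LINT x|M. f x) <= (\<integral>\<^sup>+x. F x \<partial>M)"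
proof -
 have i: "integrable M (%x. max 0 (f x))" using assms(1) by simp
 have "(LINT x|M. f x) <= (LINT x|M. max 0 (f x))" using assms(1) i by (intro integral_mono) auto
 hence "ennreal (LINT x|M. f x) <= ennreal (LINT x|M. max 0 (f x))" by (rule ennreal_leI)
 also have "... = (\<integral>\<^sup>+x. ennreal (max 0 (f x)) \<partial>M)" using i by (intro nn_integral_eq_integral[symmetric]) auto
 also have "... <= (\<integral>\<^sup>+x. F x \<partial>M)"
  using assms(2) by (intro nn_integral_mono) (auto simp: max_def ennreal_neg)
 finally show ?thesis .
qed

text \<open>A forward average turns a continuous periodic function into a C^1 periodic one, hence
  into a test function for the continuity equation.\<close>

definition steklov :: "real => (real => real) => real => real" where
 "steklov d ph t = integral {t..t + d} ph / d"

lemma steklov_deriv: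
 assumes ph: "continuous_on UNIV ph" and d: "d > 0"
 shows "(steklov d ph has_real_derivative (ph (t + d) - ph t) / d) (at t)"
proof -
 define F where "F x = integral {t - 1..x} ph" for x
 have c: "continuous_on A ph" for A using continuous_on_subset[OF ph] by blast
 have F: "(F has_real_derivative ph x) (at x)" if x: "t - 1 < x" for x
 proof -
  have "(F has_real_derivative ph x) (at x within {t - 1..x + 1})"
   unfolding F_def[abs_def] using x by (intro integral_has_real_derivative c) auto
  thus ?thesis using at_within_interior[of x "{t - 1..x + 1}"] x by (simp add: interior_atLeastAtMost_real)
 qed
 have "((%x. (F (x + d) - F x) / d) has_real_derivative (ph (t + d) * 1 - ph t) / d) (at t)"
  using d by (intro DERIV_cdivide DERIV_diff DERIV_chain2[where f = F and g = "%x. x + d"] F derivative_eq_intros) auto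
 moreover have "eventually (%x. steklov d ph x = (F (x + d) - F x) / d) (nhds t)"
 proof (rule eventually_mono[OF eventually_nhds_in_open[of "{t - 1<..}"]])
  fix x assume "x : {t - 1<..}"
  hence "integral {t - 1..x} ph + integral {x..x + d} ph = integral {t - 1..x + d} ph"
   using d by (intro Henstock_Kurzweil_Integration.integral_combine integrable_continuous_real c) auto
  thus "steklov d ph x = (F (x + d) - F x) / d" by (simp add: steklov_def F_def)
 qed auto
 ultimately show ?thesis by (subst DERIV_cong_ev[OF refl _ refl]) auto
qed

lemma steklov_C1:
 assumes ph: "continuous_on UNIV ph" "!!t. ph (t + T0) = ph t" and d: "d > 0"
 shows "steklov d ph C1_differentiable_on UNIV" "steklov d ph (t + T0) = steklov d ph t"
proof -
 show "steklov d ph C1_differentiable_on UNIV"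
  unfolding C1_differentiable_on_def
  using steklov_deriv[OF ph(1) d] d
  by (intro exI[of _ "%t. (ph (t + d) - ph t) / d"])
   (auto simp: has_real_derivative_iff_has_vector_derivative intro!: continuous_intros continuous_on_compose2[OF ph(1)])
 have "integral {t..t + d} (%t. ph (t + T0)) = integral {t + T0..t + d + T0} ph" by (rule integral_shift_real)
 thus "steklov d ph (t + T0) = steklov d ph t"
  unfolding steklov_def using ph(2) by (simp add: add_ac)
qed

text \<open>Convergence of forward averages at a point of continuity. For functions built from the
  rates, (A4) supplies such points at almost every time.\<close>

lemma mean_tendsto:
 assumes k: "bdd_borel k" and c: "isCont k t"
 shows "(%n. integral {t..t + 1 / real (Suc n)} k / (1 / real (Suc n))) \<longlonglongrightarrow> k t"
proof (rule LIMSEQ_I)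
 fix r :: real assume r: "r > 0"
 obtain d where d: "d > 0" "!!s. abs (s - t) < d ==> abs (k s - k t) < r / 2"
  using c r unfolding continuous_at_eps_delta by (metis dist_real_def half_gt_zero)
 obtain N where N: "inverse (real (Suc N)) < d" using reals_Archimedean[OF d(1)] by blast
 have "norm (integral {t..t + 1 / real (Suc n)} k / (1 / real (Suc n)) - k t) < r" if n: "n >= N" for n
 proof -
  define e where "e = 1 / real (Suc n)"
  have "e <= inverse (real (Suc N))" using n by (auto simp: e_def inverse_eq_divide intro!: frac_le)
  hence e: "e > 0" "e < d" using N by (auto simp: e_def)
  have "integral {t..t + e} k = integral {t..t + e} (%s. k t + (k s - k t))" by simp
  also have "... = k t * e + integral {t..t + e} (%s. k s - k t)"
   using e k by (subst integral_bdd_add) (auto intro!: bdd_borel_intros)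
  finally have "integral {t..t + e} k / e - k t = integral {t..t + e} (%s. k s - k t) / e" using e by (simp add: field_simps)
  moreover have "abs (integral {t..t + e} (%s. k s - k t)) <= (r / 2) * (t + e - t)"
  proof (rule abs_integral_le)
   show "abs (k s - k t) <= r / 2" if "s : {t..t + e}" for s
    using that e by (intro less_imp_le d(2)) auto
  qed (use e k in \<open>auto intro!: bdd_borel_intros\<close>)
  moreover have "(r / 2) * (t + e - t) < r * e" using e r by simp
  ultimately have "integral {t..t + e} k / e - k t = integral {t..t + e} (%s. k s - k t) / e"
   "abs (integral {t..t + e} (%s. k s - k t)) < r * e" by linarith+
  hence "abs (integral {t..t + e} k / e - k t) < r" using e by (simp add: abs_divide pos_divide_less_eq)
  thus ?thesis unfolding e_def by (simp only: real_norm_def)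
 qed
 thus "EX N. ALL n>=N. norm (integral {t..t + 1 / real (Suc n)} k / (1 / real (Suc n)) - k t) < r" by blast
qed

lemma LINT_period:
 fixes f :: "real => real"
 assumes "f : borel_measurable borel"
 shows "(LINT s:{0..T0}|lborel. f s) = (LINT s|lborel. period T0 s * f s)"
 unfolding set_lebesgue_integral_def
proof (rule integral_cong_AE)
 have "AE s in lborel. s ~= T0" by (rule AE_lborel_singleton)
 thus "AE s in lborel. indicator {0..T0} s *\<^sub>R f s = period T0 s * f s"
  by eventually_elim (auto simp: period_def indicator_def)
qed (use assms in auto)

lemma indef_continuous:
 assumes "!!a b. indef a b h k" "bdd_borel k" shows "continuous_on UNIV h"
proof -
 obtain K where K: "K >= 0" "!!t. abs (k t) <= K" using assms(2) by (metis bdd_borel_bound)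
 have "dist (h s) (h t) <= K * dist s t" for s t
  using indef_lipschitz[OF assms(1) assms(2) K(2), of t "min s t" "max s t" s] by (simp add: dist_real_def)
 thus ?thesis using K by (intro lipschitz_on_continuous_on[of K] lipschitz_onI) auto
qed

lemma ennreal_sum_le: "ennreal (SUM i:I. a i) <= (SUM i:I. ennreal (a i))"
proof -
 have "ennreal (SUM i:I. a i) <= ennreal (SUM i:I. max 0 (a i))" by (intro ennreal_leI sum_mono) auto
 also have "... = (SUM i:I. ennreal (max 0 (a i)))" by (rule sum_ennreal[symmetric]) auto
 also have "... = (SUM i:I. ennreal (a i))" by (intro sum.cong) (auto simp: max_def ennreal_neg)
 finally show ?thesis .
qed

lemma Lambda_witD:
 assumes "Lambda_wit T0 E mu Q m q"
 shows "(%p. m (snd p) (fst p)) : borel_measurable SpV" "!!t y. 0 <= m t y"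
  "(%p. q (snd p) (fst p)) : borel_measurable SpV" "!!t e. 0 <= q t e"
  "mu = slice_density T0 m" "Q = slice_density T0 q" "AE t in lborel. t : {0..<T0} --> (SUM y:UNIV. m t y) = 1"
  "AE t in lborel. t : {0..<T0} --> (ALL y z. (y, z) : E --> m t y = 0 --> q t (y, z) = 0)"
 using assms unfolding Lambda_wit_def slice_density_def by blast+

lemma Lambda_wit_weak:
 assumes "Lambda_wit T0 E mu Q m q" "!!y. f y C1_differentiable_on UNIV" "!!y t. f y (t + T0) = f y t"
 shows "(LINT s:{0..T0}|lborel. SUM y:UNIV. m s y * deriv (f y) s) = (LINT s:{0..T0}|lborel. SUM y:UNIV. divg E (q s) y * f y s)"
 using assms unfolding Lambda_wit_def by blast

lemma flow_integral:
 fixes g :: "'v::finite * 'v => real => real"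
 assumes Q: "circle_measure T0 (slice_density T0 q)" "AE p in slice_density T0 q. fst p : E"
  and q: "(%p. q (snd p) (fst p)) : borel_measurable SpV" "!!t e. 0 <= q t e"
  and g: "!!e. g e : borel_measurable borel" "!!e t. abs (g e t) <= K"
 shows "itg (slice_density T0 q) g = (SUM e:E. \<integral>t. period T0 t * (q t e * g e t) \<partial>lborel)"
proof -
 define g' where "g' e t = (if e : E then g e t else 0)" for e t
 have g'm: "g' e : borel_measurable borel" for e using g by (cases "e : E") (auto simp: g'_def[abs_def])
 have K: "0 <= K" using g(2) by (meson abs_ge_zero order_trans)
 have "itg (slice_density T0 q) g = itg (slice_density T0 q) g'"
  using Q(2) circle_measurable[OF Q(1) SpV_measurable[OF g(1)]] circle_measurable[OF Q(1) SpV_measurable[OF g'm]]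
  by (intro integral_cong_AE) (auto simp: g'_def)
 also have "... = (SUM e:UNIV. \<integral>t. period T0 t * (q t e * g' e t) \<partial>lborel)"
  using g(2) K by (intro slice_density_integral(2)[where K = K, OF q Q(1) g'm]) (auto simp: g'_def)
 also have "... = (SUM e:UNIV. if e : E then \<integral>t. period T0 t * (q t e * g e t) \<partial>lborel else 0)"
  by (intro sum.cong) (auto simp: g'_def)
 also have "... = (SUM e:E. \<integral>t. period T0 t * (q t e * g e t) \<partial>lborel)" by (simp add: sum.If_cases)
 finally show ?thesis .
qed

context periodic_chain
begin

lemma cont_per_test_pair:
 fixes f :: "'v tfun"
 assumes f: "cont_per T0 f" and g: "cont_per T0 g" obtains L where "test_pair L f g"
proof -
 obtain K1 K2 where K: "!!y t. abs (f y t) <= K1" "!!y t. abs (g y t) <= K2"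
  using cont_per_bounded[OF f T0] cont_per_bounded[OF g T0] by metis
 have "test_pair (max K1 K2) f g"
  unfolding test_pair_def using cont_perD[OF f] cont_perD[OF g] K
  by (auto simp: le_max_iff_disj intro!: borel_measurable_continuous_onI)
 thus ?thesis by (rule that)
qed

text \<open>With \<open>ph = ln h\<close>, the backward equation divided by \<open>h\<close>
  expresses \<open>f - l / T0\<close> as minus the time derivative of \<open>ph\<close> minus the
  jump terms \<open>R * (exp G - 1)\<close>. The continuity equation trades the derivative for the
  gradient of \<open>ph\<close> along the flow, which completes \<open>g\<close> to
  \<open>G\<close>. The outcome is the left side of Young's inequality summed over edges and
  integrated in time.\<close>

theorem conj_le_rate:
 assumes ae: "AE t in lborel. t : {0..<T0} --> (ALL y z. isCont (R y z) t)"
  and PQ: "(mu, Q) : Mstar T0 E" and wit: "Lambda_wit T0 E mu Q m q" and f: "cont_per T0 f" and g: "cont_per T0 g"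
 shows "ennreal (ev f g (mu, Q) - lam f g) <= rate_int R T0 E m q"
proof -
 note W = Lambda_witD[OF wit]
 note cm = Mstar_circle(1)[OF PQ, unfolded W(5)] and cq = Mstar_circle(2,3)[OF PQ, unfolded W(6)]
 obtain L where tp: "test_pair L f g" using cont_per_test_pair[OF f g] by blast
 have L: "0 <= L" using test_pairD(2)[OF tp] by (meson abs_ge_zero order_trans)
 define l where "l = lam f g"
 obtain h k1 where hb: "!!y. bdd_borel (h y)" and k1: "k1 > 0" "!!y t. k1 <= h y t" and hper: "!!y t. h y (t + T0) = h y t"
  and hind: "!!y a b. indef a b (h y) (bw (%y u. f y u - l / T0) g h y)"
 proof -
  have "EX h k1. k1 > 0 & (ALL y. bdd_borel (h y)) & (ALL y t. k1 <= h y t) & (ALL y t. h y (t + T0) = h y t) &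
    (ALL y a b. indef a b (h y) (bw (%y u. f y u - l / T0) g h y))"
   unfolding l_def by (rule perron_lam[OF L]) (use tp in metis)
  thus ?thesis using that by blast
 qed
 have hpos: "h y t > 0" for y t using k1(1) k1(2)[of y t] by linarith
 have flb: "bdd_borel (%u. f y u - l / T0)" for y using test_pair_bdd(1)[OF tp] by (intro bdd_borel_intros)
 have bwb: "bdd_borel (bw (%y u. f y u - l / T0) g h y)" for y by (intro bw_bdd flb test_pair_bdd(2)[OF tp] hb)
 define ph where "ph y t = ln (h y t)" for y t
 define k where "k y u = bw (%y u. f y u - l / T0) g h y u / h y u" for y u
 define G where "G e u = g e u + ph (snd e) u - ph (fst e) u" for e u
 have kb: "bdd_borel (k y)" for y unfolding k_def[abs_def] by (rule bdd_borel_divide[OF bwb hb k1])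
 have phind: "indef a b (ph y) (k y)" for y a b unfolding ph_def[abs_def] k_def[abs_def] by (rule indef_ln[OF hind bwb hb k1])
 have phc: "continuous_on UNIV (ph y)" for y by (rule indef_continuous[OF phind kb])
 have phb: "bdd_borel (ph y)" for y unfolding ph_def[abs_def] by (rule bdd_borel_ln[OF hb k1])
 have phper: "ph y (t + T0) = ph y t" for y t by (simp add: ph_def hper)
 have Gb: "bdd_borel (G e)" for e unfolding G_def[abs_def] using test_pair_bdd(2)[OF tp] phb by (intro bdd_borel_intros)
 have k_eq: "k y u = (SUM z:UNIV. R y z u * (exp (G (y, z) u) - 1)) + (f y u - l / T0)" for y u
 proof -
  have "exp (G (y, z) u) = exp (g (y, z) u) * h z u / h y u" for z
   unfolding G_def ph_def using hpos by (simp add: exp_diff exp_add)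
  hence "R y z u * (exp (G (y, z) u) - 1) = R y z u * (exp (g (y, z) u) * h z u - h y u) / h y u" for z
   using hpos[of y u] by (simp add: field_simps)
  thus ?thesis unfolding k_def bw_def using hpos[of y u] by (simp add: add_divide_distrib sum_divide_distrib)
 qed
 have k_cont: "isCont (k y) t" if "ALL y z. isCont (R y z) t" for y t
 proof -
  have cont: "isCont (f y) t" "isCont (g e) t" "isCont (ph y) t" for y e
   using cont_perD(1)[OF f, of y] cont_perD(1)[OF g, of e] phc[of y] by (auto simp: continuous_on_eq_continuous_at)
  show ?thesis unfolding k_eq[abs_def] G_def using that by (intro continuous_intros cont) (use that in blast)
 qed
 obtain Kk where Kk: "Kk >= 0" "!!y t. abs (k y t) <= Kk" using bdd_borel_family_bound[of k] kb by metis
 obtain Kp where Kp: "Kp >= 0" "!!y t. abs (ph y t) <= Kp" using bdd_borel_family_bound[of ph] phb by metis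
 have mI: "integrable lborel (%t. period T0 t * (m t y * F t))" if "bdd_borel F" for F y
 proof -
  obtain K where "!!t. abs (F t) <= K" using \<open>bdd_borel F\<close> unfolding bdd_borel_def by blast
  thus ?thesis using slice_density_integral(1)[OF W(1,2) cm, of "%_. F" K] bdd_borel_measurable[OF that] by blast
 qed
 have qI: "integrable lborel (%t. period T0 t * (q t e * F t))" if "bdd_borel F" for F e
 proof -
  obtain K where "!!t. abs (F t) <= K" using \<open>bdd_borel F\<close> unfolding bdd_borel_def by blast
  thus ?thesis using slice_density_integral(1)[OF W(3,4) cq(1), of "%_. F" K] bdd_borel_measurable[OF that] by blast
 qed
 have mm: "(%t. m t y) : borel_measurable borel" for y using SpV_slice_measurable[of "%y t. m t y"] W(1) by simp
 have qm: "(%t. q t e) : borel_measurable borel" for e using SpV_slice_measurable[of "%e t. q t e"] W(3) by simp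
 define d where "d n = 1 / real (Suc n)" for n
 have d: "d n > 0" for n by (simp add: d_def)
 let ?V = "%n s. SUM y:UNIV. m s y * deriv (steklov (d n) (ph y)) s"
  and ?D = "%n e s. steklov (d n) (ph (fst e)) s - steklov (d n) (ph (snd e)) s"
  and ?W = "%e t. R (fst e) (snd e) t * (exp (G e t) - 1)"
 let ?mf = "%t. SUM y:UNIV. m t y * f y t" and ?qg = "%t. SUM e:E. q t e * g e t"
  and ?ml = "%t. SUM y:UNIV. m t y * (l / T0)" and ?mk = "%t. SUM y:UNIV. m t y * k y t"
  and ?mW = "%t. SUM e:E. m t (fst e) * ?W e t" and ?qph = "%t. SUM e:E. q t e * (ph (fst e) t - ph (snd e) t)"
  and ?I = "%h. \<integral>t. period T0 t * h t \<partial>lborel"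
 have sd: "deriv (steklov (d n) (ph y)) s = - (integral {s..s + d n} (k y) / d n)" for n y s
 proof -
  have "deriv (steklov (d n) (ph y)) s = (ph y (s + d n) - ph y s) / d n"
   by (rule DERIV_imp_deriv[OF steklov_deriv[OF phc d]])
  moreover have "ph y s = ph y (s + d n) + integral {s..s + d n} (k y)" using d[of n] by (intro indefD[OF phind]) auto
  hence "ph y (s + d n) - ph y s = - integral {s..s + d n} (k y)" by linarith
  ultimately show ?thesis by (simp only: minus_divide_left)
 qed
 have sm: "steklov (d n) (ph y) : borel_measurable borel" "(%s. deriv (steklov (d n) (ph y)) s) : borel_measurable borel" for n y
 proof -
  have "continuous_on UNIV (steklov (d n) (ph y))"
   using steklov_deriv[OF phc d] by (meson DERIV_continuous continuous_at_imp_continuous_on)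
  thus "steklov (d n) (ph y) : borel_measurable borel" by (rule borel_measurable_continuous_onI)
  have "(%s. deriv (steklov (d n) (ph y)) s) = (%s. (ph y (s + d n) - ph y s) / d n)"
   by (rule ext) (rule DERIV_imp_deriv[OF steklov_deriv[OF phc d]])
  moreover have "(%s. (ph y (s + d n) - ph y s) / d n) : borel_measurable borel"
   using bdd_borel_measurable[OF phb[of y]] by measurable
  ultimately show "(%s. deriv (steklov (d n) (ph y)) s) : borel_measurable borel" by simp
 qed
 have weak: "?I (?V n)
   = (LINT s|lborel. period T0 s * (SUM e:E. q s e * ?D n e s))" for n
 proof -
  have "(LINT s:{0..T0}|lborel. SUM y:UNIV. m s y * deriv (steklov (d n) (ph y)) s)
    = (LINT s:{0..T0}|lborel. SUM y:UNIV. divg E (q s) y * steklov (d n) (ph y) s)"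
   by (rule Lambda_wit_weak[OF wit]) (rule steklov_C1[OF phc phper d])+
  thus ?thesis unfolding divg_pairing using mm qm sm
   by (subst (asm) (1 2) LINT_period) (auto intro!: borel_measurable_sum borel_measurable_times borel_measurable_diff)
 qed
 \<comment> \<open>The derivatives of the Steklov means are averages of \<open>- k\<close>, and
   \<open>k\<close> contains the rates: convergence holds almost everywhere through
   \<open>ae\<close>. On the flow side below, \<open>ph\<close> is continuous and convergence holds
   at every time.\<close>
 have lim1: "(%n. \<integral>s. period T0 s * ?V n s \<partial>lborel)
   \<longlonglongrightarrow> (LINT s|lborel. period T0 s * (SUM y:UNIV. m s y * (- k y s)))"
 proof (rule integral_dominated_convergence[where w = "%s. SUM y:UNIV. period T0 s * (m s y * Kk)"])
  show "AE s in lborel. (%n. period T0 s * ?V n s) \<longlonglongrightarrow> period T0 s * (SUM y:UNIV. m s y * (- k y s))"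
   using ae
  proof eventually_elim
   case (elim s)
   show ?case
   proof (cases "s : {0..<T0}")
    case True
    hence "isCont (k y) s" for y using elim k_cont by blast
    thus ?thesis unfolding sd unfolding d_def
     by (intro tendsto_mult tendsto_sum tendsto_minus tendsto_const mean_tendsto[OF kb])
   qed (simp add: period_eq)
  qed
  show "AE s in lborel. norm (period T0 s * ?V n s) <= (SUM y:UNIV. period T0 s * (m s y * Kk))" for n
  proof (rule AE_I2)
   fix s
   have "abs (deriv (steklov (d n) (ph y)) s) <= Kk" for y
    using abs_integral_le[OF kb Kk(2), of s "s + d n" y] d[of n] unfolding sd by (simp add: abs_divide divide_le_eq)
   hence "abs (m s y * deriv (steklov (d n) (ph y)) s) <= m s y * Kk" for y
    unfolding abs_mult using W(2)[of s y] by (simp add: mult_left_mono)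
   hence "abs (?V n s) <= (SUM y:UNIV. m s y * Kk)" by (intro order_trans[OF sum_abs sum_mono])
   thus "norm (period T0 s * ?V n s) <= (SUM y:UNIV. period T0 s * (m s y * Kk))"
    by (simp add: abs_mult period_eq sum_distrib_left[symmetric] mult_left_mono)
  qed
  show "integrable lborel (%s. SUM y:UNIV. period T0 s * (m s y * Kk))" by (intro Bochner_Integration.integrable_sum mI bdd_borel_const)
 qed (use mm sm bdd_borel_measurable[OF kb] in measurable)
 have lim2: "(%n. \<integral>s. period T0 s * (SUM e:E. q s e * ?D n e s) \<partial>lborel)
   \<longlonglongrightarrow> ?I ?qph"
 proof (rule integral_dominated_convergence[where w = "%s. SUM e:E. period T0 s * (q s e * (2 * Kp))"])
  show "AE s in lborel. (%n. period T0 s * (SUM e:E. q s e * ?D n e s))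
   \<longlonglongrightarrow> period T0 s * ?qph s"
  proof -
   have "isCont (ph y) s" for y s using phc[of y] by (auto simp: continuous_on_eq_continuous_at)
   thus ?thesis unfolding steklov_def d_def
    by (intro AE_I2 tendsto_mult tendsto_sum tendsto_diff tendsto_const mean_tendsto[OF phb])
  qed
  show "AE s in lborel. norm (period T0 s * (SUM e:E. q s e * ?D n e s))
   <= (SUM e:E. period T0 s * (q s e * (2 * Kp)))" for n
  proof (rule AE_I2)
   fix s
   have st: "abs (steklov (d n) (ph y) s) <= Kp" for y
    using abs_integral_le[OF phb Kp(2), of s "s + d n" y] d[of n] unfolding steklov_def by (simp add: abs_divide divide_le_eq)
   have "abs (steklov (d n) (ph y) s - steklov (d n) (ph z) s) <= 2 * Kp" for y z using st[of y] st[of z] by linarith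
   hence "abs (q s e * ?D n e s) <= q s e * (2 * Kp)" for e
    unfolding abs_mult using W(4)[of s e] by (simp add: mult_left_mono)
   hence "abs (SUM e:E. q s e * ?D n e s) <= (SUM e:E. q s e * (2 * Kp))"
    by (intro order_trans[OF sum_abs sum_mono])
   thus "norm (period T0 s * (SUM e:E. q s e * ?D n e s))
     <= (SUM e:E. period T0 s * (q s e * (2 * Kp)))"
    by (simp only: abs_mult real_norm_def sum_distrib_left[symmetric]) (simp add: period_eq mult_left_mono)
  qed
  show "integrable lborel (%s. SUM e:E. period T0 s * (q s e * (2 * Kp)))" by (intro Bochner_Integration.integrable_sum qI bdd_borel_const)
 qed (use qm sm bdd_borel_measurable[OF phb] in measurable)
 have weak_lim: "(LINT s|lborel. period T0 s * (SUM y:UNIV. m s y * (- k y s))) = ?I ?qph"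
  using LIMSEQ_unique[OF lim1 lim2[folded weak]] .
 define X where "X t = (SUM e:E. q t e * G e t - m t (fst e) * R (fst e) (snd e) t * (exp (G e t) - 1))" for t
 have mRI: "integrable lborel (%t. period T0 t * (m t (fst e) * ?W e t))" for e
  using R_bdd Gb by (intro mI bdd_borel_intros)
 have "ev f g (mu, Q) - l = ?I ?mf + ?I ?qg
   - ?I ?ml"
 proof -
  have "itg mu f = (SUM y:UNIV. \<integral>t. period T0 t * (m t y * f y t) \<partial>lborel)"
   unfolding W(5) by (rule slice_density_integral(2)[OF W(1,2) cm test_pairD(1,2)[OF tp]])
  also have "... = ?I ?mf"
   unfolding sum_distrib_left using mI[OF test_pair_bdd(1)[OF tp]] by (intro Bochner_Integration.integral_sum[symmetric]) auto
  moreover have "itg Q g = (SUM e:E. \<integral>t. period T0 t * (q t e * g e t) \<partial>lborel)"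
   unfolding W(6) by (rule flow_integral[OF cq W(3,4) bdd_borel_measurable[OF test_pair_bdd(2)[OF tp]] test_pairD(5)[OF tp]])
  moreover have "... = ?I ?qg"
   unfolding sum_distrib_left using qI[OF test_pair_bdd(2)[OF tp]] by (intro Bochner_Integration.integral_sum[symmetric]) auto
  moreover have "?I ?ml = (LINT t|lborel. period T0 t * (l / T0))"
  proof (rule integral_cong_AE)
   show "AE t in lborel. period T0 t * ?ml t = period T0 t * (l / T0)"
    using W(7) by eventually_elim (auto simp: period_def sum_distrib_right[symmetric] sum_divide_distrib[symmetric] indicator_def)
  qed (use mm in measurable)
  moreover have "(LINT t|lborel. period T0 t * (l / T0)) = l"
   unfolding period_def using T0 by simp
  ultimately show ?thesis by (simp add: ev_def)
 qed
 also have "... = (LINT t|lborel. period T0 t * ?mk t - period T0 t * ?mW t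
   + period T0 t * ?qg t)" (is "?lhs = ?rhs")
 proof -
  have pt: "?mf t - ?ml t = ?mk t - ?mW t" for t
  proof -
   have "?mW t = (SUM y:UNIV. SUM z:UNIV. m t y * (R y z t * (exp (G (y, z) t) - 1)))"
    unfolding sum_pairs_E[of E, symmetric] by (intro sum.cong refl) (auto simp: R_off)
   thus ?thesis unfolding k_eq by (simp add: distrib_left right_diff_distrib sum.distrib sum_subtractf sum_distrib_left)
  qed
  have "integrable lborel (%t. period T0 t * ?mf t)" "integrable lborel (%t. period T0 t * ?qg t)"
   "integrable lborel (%t. period T0 t * ?ml t)"
   unfolding sum_distrib_left using mI[OF test_pair_bdd(1)[OF tp]] qI[OF test_pair_bdd(2)[OF tp]] mI[OF bdd_borel_const]
   by (intro Bochner_Integration.integrable_sum; simp)+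
  hence "?lhs = (LINT t|lborel. period T0 t * ?mf t + period T0 t * ?qg t
    - period T0 t * ?ml t)" by simp
  also have "... = ?rhs"
  proof (rule Bochner_Integration.integral_cong[OF refl])
   have aux: "a - c = a' - c' ==> r * a + r * b - r * c = r * a' - r * c' + r * b" for r a b c a' c' :: real
    by (drule arg_cong[where f = "%x. r * x"]) (simp add: algebra_simps)
   show "period T0 t * ?mf t + period T0 t * ?qg t - period T0 t * ?ml t
    = period T0 t * ?mk t - period T0 t * ?mW t
   + period T0 t * ?qg t" for t by (rule aux[OF pt])
  qed
  finally show ?thesis .
 qed
 also have "... = ?I ?mk - ?I ?mW
   + ?I ?qg"
  unfolding sum_distrib_left using mI[OF kb] qI[OF test_pair_bdd(2)[OF tp]] mRI by simp
 also have "?I ?mk = - ?I ?qph"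
  unfolding weak_lim[symmetric] by (simp add: sum_negf)
 also have "- ?I ?qph
   - ?I ?mW
   + ?I ?qg
  = (LINT t|lborel. - (period T0 t * ?qph t) - period T0 t * ?mW t
   + period T0 t * ?qg t)"
  unfolding sum_distrib_left using qI[OF bdd_borel_diff[OF phb phb]] qI[OF test_pair_bdd(2)[OF tp]] mRI by simp
 also have "... = (LINT t|lborel. period T0 t * X t)"
  unfolding X_def G_def by (intro Bochner_Integration.integral_cong refl) (simp add: sum_subtractf sum.distrib algebra_simps)
 finally have eq: "ev f g (mu, Q) - l = (LINT t|lborel. period T0 t * X t)" .
 have XI: "integrable lborel (%t. period T0 t * X t)"
 proof -
  have "integrable lborel (%t. SUM e:E. period T0 t * (q t e * G e t) - period T0 t * (m t (fst e) * ?W e t))"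
   using qI[OF Gb] mRI by (intro Bochner_Integration.integrable_sum Bochner_Integration.integrable_diff) auto
  thus ?thesis unfolding X_def by (simp add: sum_distrib_left right_diff_distrib mult.assoc)
 qed
 show ?thesis
  unfolding l_def[symmetric] eq rate_int_def
 proof (rule integral_le_nn_integral[OF XI])
  fix t
  show "ennreal (period T0 t * X t) <= indicator {0..<T0} t * (SUM e:E. Phi (q t e) (m t (fst e) * R (fst e) (snd e) t))"
  proof (cases "t : {0..<T0}")
   case True
   have "ennreal (X t) <= (SUM e:E. ennreal (q t e * G e t - m t (fst e) * R (fst e) (snd e) t * (exp (G e t) - 1)))"
    unfolding X_def by (rule ennreal_sum_le)
   also have "... <= (SUM e:E. Phi (q t e) (m t (fst e) * R (fst e) (snd e) t))"
    using W(2,4) R_nonneg by (intro sum_mono young) auto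
   finally show ?thesis using True by (simp add: period_eq)
  qed (simp add: period_eq)
 qed
qed

end

section \<open>The conjugate of the eigenvalue dominates the rate function\<close>

lemma slice_density_circle:
 fixes m :: "real => 'a::finite => real"
 assumes m: "(%p. m (snd p) (fst p)) : borel_measurable SpV" "!!t y. 0 <= m t y" and i: "!!y. integrable lborel (%t. period T0 t * m t y)"
 shows "circle_measure T0 (slice_density T0 m)"
proof -
 let ?g = "%p. ennreal (period T0 (snd p) * m (snd p) (fst p))"
 have g: "?g : borel_measurable SpV" using m(1) by measurable
 have s: "sets (slice_density T0 m) = sets SpV" "space (slice_density T0 m) = UNIV" unfolding slice_density_alt by auto
 have "emeasure (slice_density T0 m) UNIV = (\<integral>\<^sup>+p. ?g p \<partial>SpV)"
  unfolding slice_density_alt by (subst emeasure_density[OF g SpV_sets(1)]) simp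
 also have "... = (SUM y:UNIV. \<integral>\<^sup>+t. ennreal (period T0 t * m t y) \<partial>lborel)"
  using nn_integral_SpV[OF g] by simp
 also have "... < \<infinity>"
  using i m(2) by (subst nn_integral_eq_integral) (auto simp: period_eq sum_ennreal)
 finally have fin: "emeasure (slice_density T0 m) UNIV < \<infinity>" .
 have "emeasure (slice_density T0 m) (UNIV - UNIV \<times> {0..<T0}) = (\<integral>\<^sup>+p. ?g p * indicator (UNIV - UNIV \<times> {0..<T0}) p \<partial>SpV)"
  unfolding slice_density_alt by (rule emeasure_density[OF g SpV_sets(2)])
 also have "... = (\<integral>\<^sup>+p. 0 \<partial>(SpV :: ('a * real) measure))"
  by (intro nn_integral_cong) (auto simp: period_def indicator_def)
 finally show ?thesis using s fin by (simp add: circle_measure_def)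
qed

text \<open>The Radon-Nikodym derivative is almost everywhere finite and vanishes off the period, so
  a nonnegative real version exists that is defined everywhere, as \<open>Lambda_wit\<close>
  demands.\<close>

lemma slice_density_exists:
 fixes nu :: "('a::finite * real) measure"
 assumes nu: "circle_measure T0 nu" and ac: "!!N. N : null_sets SpV ==> N : null_sets nu"
 obtains m where "(%p. m (snd p) (fst p)) : borel_measurable SpV" "!!t y. 0 <= m t y" "nu = slice_density T0 m"
proof -
 interpret pair_sigma_finite "count_space (UNIV :: 'a set)" lborel
  by (intro pair_sigma_finite.intro lborel.sigma_finite_measure_axioms sigma_finite_measure_count_space_finite) auto
 interpret sigma_finite_measure "SpV :: ('a * real) measure" by (rule sigma_finite_measure_axioms)
 note c = circle_measureD[OF nu]
 have "absolutely_continuous SpV nu" using ac unfolding absolutely_continuous_def by blast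
 then obtain F where F: "F : borel_measurable SpV" "density SpV F = nu" using Radon_Nikodym c(2) by metis
 have "(\<integral>\<^sup>+p. F p \<partial>SpV) = emeasure (density SpV F) UNIV"
  using emeasure_density[OF F(1) SpV_sets(1)] by simp
 also have "... < \<infinity>" using nu c(3) F(2) by (simp add: circle_measure_def)
 finally have a1: "AE p in SpV. F p ~= \<infinity>" using F(1) by (intro nn_integral_PInf_AE) auto
 let ?A = "UNIV - UNIV \<times> {0..<T0} :: ('a * real) set"
 note A = SpV_sets(2)[where 'a = 'a, of T0]
 have "(\<integral>\<^sup>+p. F p * indicator ?A p \<partial>SpV) = emeasure (density SpV F) ?A"
  by (rule emeasure_density[OF F(1) A, symmetric])
 also have "... = 0" using nu c(3) F(2) by (simp add: circle_measure_def)
 finally have a2: "AE p in SpV. F p * indicator ?A p = 0"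
  using F(1) A by (subst (asm) nn_integral_0_iff_AE) auto
 define m where "m t y = enn2real (F (y, t))" for t y
 have mm: "(%p. m (snd p) (fst p)) : borel_measurable SpV" unfolding m_def using F(1) by simp
 have "slice_density T0 m = density SpV F"
  unfolding slice_density_def
 proof (rule density_cong)
  show "AE p in SpV. ennreal (m (snd p) (fst p)) * indicator {0..<T0} (snd p) = F p"
   using a1 a2 by eventually_elim (auto simp: m_def indicator_def mem_Times_iff less_top split: if_splits)
 qed (use mm F(1) in measurable)
 moreover have "!!t y. 0 <= m t y" by (simp add: m_def)
 ultimately show ?thesis using that[of m] mm F(2) by simp
qed

lemma integral_le_plus_measure:
 fixes f :: "'a::finite * real => real"
 assumes M: "circle_measure T0 M" and N: "circle_measure T0 N" and f: "f : borel_measurable SpV" "!!p. abs (f p) <= K"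
 shows "circle_measure T0 (plus_measure M N)"
  "(LINT p|M. abs (f p)) <= (LINT p|plus_measure M N. abs (f p))" "(LINT p|N. abs (f p)) <= (LINT p|plus_measure M N. abs (f p))"
proof -
 note cM = circle_measureD[OF M] and cN = circle_measureD[OF N]
 have s: "sets N = sets M" using cM cN by simp
 have A: "UNIV - UNIV \<times> {0..<T0} : sets M" unfolding cM(2) by (rule SpV_sets)
 show c: "circle_measure T0 (plus_measure M N)"
  using M N A sets.top[of M] plus_measure[OF s] cM cN unfolding circle_measure_def by (auto simp: ennreal_add_less_top)
 have f': "(%p. abs (f p)) : borel_measurable SpV" using f by measurable
 have le: "(LINT p|M'. abs (f p)) <= (LINT p|plus_measure M N. abs (f p))" if M': "circle_measure T0 M'" "M' <= plus_measure M N" for M'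
 proof -
  have nn: "ennreal (LINT p|M''. abs (f p)) = (\<integral>\<^sup>+p. abs (f p) \<partial>M'')" if "circle_measure T0 M''" for M'' :: "('a * real) measure"
   using f(2) by (intro nn_integral_eq_integral[symmetric] circle_integrable_bounded[OF that f', of K]) auto
  have "(\<integral>\<^sup>+p. abs (f p) \<partial>M') <= (\<integral>\<^sup>+p. abs (f p) \<partial>plus_measure M N)"
   using circle_measureD(2)[OF M'(1)] circle_measureD(2)[OF c] M'(2) by (intro nn_integral_mono_measure) auto
  thus ?thesis unfolding nn[OF M'(1), symmetric] nn[OF c, symmetric] by simp
 qed
 show "(LINT p|M. abs (f p)) <= (LINT p|plus_measure M N. abs (f p))" "(LINT p|N. abs (f p)) <= (LINT p|plus_measure M N. abs (f p))"
  using le M N plus_measure_ge[OF s] by blast+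
qed

lemma integral_periods:
 assumes k: "bdd_borel k" "!!t. k (t + T0) = k t" and T0: "0 <= T0"
 shows "integral {0..real n * T0} k = real n * integral {0..T0} k"
proof (induction n)
 case (Suc n)
 have "integral {0..real (Suc n) * T0} k = integral {0..real n * T0} k + integral {real n * T0..real (Suc n) * T0} k"
  using T0 by (intro integral_split k) (auto simp: mult_right_mono)
 moreover have "integral {real n * T0..real (Suc n) * T0} k = integral {0..T0} k"
  using integral_shift_periodic[of k T0 0 "int n" T0, OF k(2)] by (simp add: algebra_simps)
 ultimately show ?case using Suc by (simp add: algebra_simps)
qed simp

text \<open>The way linear constraints are extracted from a finite conjugate: a linear quantity that
  stays below \<open>a\<close> under all scalings must vanish.\<close>

lemma eq_0_of_scaling: "(!!k::real. k * w <= a) ==> w = 0"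
proof (rule ccontr)
 assume *: "!!k. k * w <= a" and "w ~= 0"
 thus False using *[of "(a + 1) / w"] by simp
qed

lemma integral_period_HK: "bdd_borel k ==> (LINT t|lborel. period T0 t * k t) = integral {0..T0} k"
 by (simp add: LINT_period[symmetric] bdd_borel_measurable bdd_borel_LINT)

context periodic_chain
begin

text \<open>A potential depending on time only has a deterministic path integral. Tested with all
  multiples, it forces the time marginal of \<open>mu\<close> to be Lebesgue measure.\<close>

lemma lam_time:
 assumes u: "continuous_on UNIV u" "!!t. u (t + T0) = u t"
 shows "lam (%_ t. u t) (%_ _. 0) = integral {0..T0} u"
proof (rule lam_eqI)
 have "cont_per T0 (%_::'v. u)" using u by (simp add: cont_per_def)
 then obtain K where "!!t. abs (u t) <= K" using cont_per_bounded[OF _ T0] by metis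
 hence ub: "bdd_borel u" using u by (intro bdd_borelI borel_measurable_continuous_onI)
 have "path_fun (real n * T0) (%_ t. u t) (%_ _. 0) Y = real n * integral {0..T0} u" for n and Y :: "real => 'v"
 proof -
  have "integral {0..real n * T0} (along (%_ t. u t) Y) = integral {0..real n * T0} u"
   by (intro Henstock_Kurzweil_Integration.integral_cong) (auto simp: along_eq)
  thus ?thesis using integral_periods[OF ub u(2) less_imp_le[OF T0]] by (simp add: path_fun_def)
 qed
 hence "part_fun n (%_ t. u t) (%_ _. 0) = exp (real n * integral {0..T0} u)" for n
  unfolding part_fun_def by (simp add: prob_space)
 thus "growth (%_ t. u t) (%_ _. 0) (integral {0..T0} u)" unfolding growth_def by (intro exI[of _ 1] conjI) auto
qed

context
 fixes mu :: "('v * real) measure" and Q :: "(('v * 'v) * real) measure" and a :: real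
 assumes PQ: "(mu, Q) : Mstar T0 E"
  and conj: "!!f g. cont_per T0 f ==> cont_per T0 g ==> ev f g (mu, Q) - lam f g <= a"
begin

lemma time_marginal_cont:
 fixes u :: "real => real"
 assumes u: "continuous_on UNIV u" "!!t. u (t + T0) = u t"
 shows "(LINT p|mu. u (snd p)) = integral {0..T0} u"
proof -
 have "k * ((LINT p|mu. u (snd p)) - integral {0..T0} u) <= a" for k
 proof -
  have "ev (%_ t. k * u t) (%_ _. 0) (mu, Q) - lam (%_ t. k * u t) (%_ _. 0) <= a"
   using u by (intro conj) (auto simp: cont_per_def intro!: continuous_intros)
  moreover have "lam (%_ t. k * u t) (%_ _. 0) = integral {0..T0} (%t. k * u t)"
   using u by (intro lam_time) (auto intro!: continuous_intros)
  ultimately show ?thesis by (simp add: ev_def right_diff_distrib)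
 qed
 from eq_0_of_scaling[OF this] show ?thesis by simp
qed

lemma time_marginal:
 assumes A: "A : sets borel"
 shows "measure mu (UNIV \<times> A) = (LINT t|lborel. period T0 t * indicator A t)"
proof -
 note cmu = Mstar_circle(1)[OF PQ] and dmu = circle_measureD[OF Mstar_circle(1)[OF PQ]]
 interpret finite_measure mu by (rule dmu(1))
 \<comment> \<open>The time marginal of \<open>mu\<close> and Lebesgue measure as measures on a
   single circle, indexed by \<open>unit\<close> so that the density results for families of circles
   apply to both.\<close>
 define D1 :: "(unit * real) measure" where "D1 = distr mu SpV (%p. ((), snd p))"
 define D2 :: "(unit * real) measure" where "D2 = slice_density T0 (%_ _. 1)"
 have sm: "(%p. ((), snd p)) : measurable mu (SpV :: (unit * real) measure)"
  unfolding measurable_cong_sets[OF dmu(2) refl] by measurable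
 have ip: "integrable lborel (%t. period T0 t * 1)"
  using T0 by (simp add: period_def[abs_def] integrable_real_indicator)
 have D2: "circle_measure T0 D2" unfolding D2_def using ip by (intro slice_density_circle) auto
 have D1: "circle_measure T0 D1"
 proof -
  have "(%p. ((), snd p)) -` (UNIV - UNIV \<times> {0..<T0}) \<inter> space mu = space mu - UNIV \<times> {0..<T0}" by auto
  hence "emeasure D1 (UNIV - UNIV \<times> {0..<T0}) = emeasure mu (space mu - UNIV \<times> {0..<T0})"
   unfolding D1_def by (simp add: emeasure_distr[OF sm SpV_sets(2)])
  moreover have "emeasure D1 UNIV = emeasure mu (space mu)" unfolding D1_def using emeasure_distr[OF sm SpV_sets(1)] by simp
  ultimately show ?thesis using cmu unfolding circle_measure_def by (simp add: D1_def)
 qed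
 have i1: "(LINT p|D1. F p) = (LINT p|mu. F ((), snd p))" if "F : borel_measurable SpV" for F :: "unit * real => real"
  unfolding D1_def by (rule integral_distr[OF sm that])
 have i2: "(LINT p|D2. F (snd p)) = (LINT t|lborel. period T0 t * F t)" if "F : borel_measurable borel" "!!t. abs (F t) <= K" for F K
  unfolding D2_def using slice_density_integral(2)[of "%_ _. 1" T0 "%_::unit. F" K] D2[unfolded D2_def] that by (simp add: UNIV_unit)
 let ?F = "%p::unit * real. indicator A (snd p) :: real"
 have Fm: "?F : borel_measurable SpV" by (rule SpV_measurable[where f = "%_. indicator A"]) (use A in auto)
 have Fb: "abs (?F p) <= 1" for p by simp
 have "abs ((LINT p|D1. ?F p) - (LINT p|D2. ?F p)) <= e" if e: "e > 0" for e
 proof -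
  obtain u where u: "cont_per T0 u" "!!y t. abs (u y t) <= 1" "(LINT p|plus_measure D1 D2. abs (?F p - u (fst p) (snd p))) < e / 2"
   using approx_cont_per[OF T0 integral_le_plus_measure(1)[OF D1 D2 Fm Fb] Fm Fb, of "e / 2"] e by auto
  note um = cont_per_measurable[OF u(1)]
  have bm: "(%p. ?F p - u (fst p) (snd p)) : borel_measurable SpV" using Fm um by measurable
  have bb: "abs (?F p - u (fst p) (snd p)) <= 2" for p using u(2)[of "fst p" "snd p"] by (auto simp: indicator_def)
  have cl: "abs ((LINT p|D. ?F p) - itg D u) <= (LINT p|D. abs (?F p - u (fst p) (snd p)))" if D: "circle_measure T0 D" for D
  proof -
   have "integrable D ?F" "integrable D (%p. u (fst p) (snd p))"
    using circle_integrable_bounded[OF D Fm Fb] cont_per_integrable[OF D T0 u(1)] by auto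
   thus ?thesis using integral_abs_bound[of D "%p. ?F p - u (fst p) (snd p)"] by simp
  qed
  have "itg D1 u = itg D2 u"
  proof -
   have "bdd_borel (u ())" using u(2) cont_perD(1)[OF u(1)] by (intro bdd_borelI borel_measurable_continuous_onI)
   hence "(LINT p|D2. u () (snd p)) = integral {0..T0} (u ())"
    using i2[OF bdd_borel_measurable u(2)] integral_period_HK by simp
   moreover have "itg D1 u = integral {0..T0} (u ())"
    using i1[OF um] time_marginal_cont[OF cont_perD(1)[OF u(1)] cont_perD(2)[OF u(1)]] by simp
   ultimately show ?thesis by simp
  qed
  thus ?thesis
   using cl[OF D1] cl[OF D2] integral_le_plus_measure(2,3)[OF D1 D2 bm bb] u(3) by linarith
 qed
 hence "(LINT p|D1. ?F p) = (LINT p|D2. ?F p)" by (metis abs_le_zero_iff dense_ge eq_iff_diff_eq_0)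
 moreover have "(LINT p|D2. ?F p) = (LINT t|lborel. period T0 t * indicator A t)" by (rule i2[of "indicator A" 1]) (use A in auto)
 moreover have "(LINT p|D1. ?F p) = measure mu (UNIV \<times> A)"
 proof -
  have "(LINT p|D1. ?F p) = (LINT p|mu. indicator (UNIV \<times> A) p)"
   unfolding i1[OF Fm] by (intro Bochner_Integration.integral_cong) (auto simp: indicator_def)
  also have "... = measure mu (UNIV \<times> A)" using dmu(3) by simp
  finally show ?thesis .
 qed
 ultimately show ?thesis by simp
qed

lemma conj_density:
 obtains m where "(%p. m (snd p) (fst p)) : borel_measurable SpV" "!!t y. 0 <= m t y" "mu = slice_density T0 m"
  "AE t in lborel. t : {0..<T0} --> (SUM y:UNIV. m t y) = 1"
proof -
 note cmu = Mstar_circle(1)[OF PQ] and dmu = circle_measureD[OF Mstar_circle(1)[OF PQ]]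
 interpret finite_measure mu by (rule dmu(1))
 \<comment> \<open>The sections of a null set are Lebesgue null, so by the time marginal the full
   cylinders over them are \<open>mu\<close>-null, and \<open>N\<close> lies in their union.\<close>
 have ac: "N : null_sets mu" if N: "N : null_sets SpV" for N
 proof -
  have Ns: "N : sets SpV" using N by auto
  have sl: "{t. (y, t) : N} : sets borel" for y using sets_Pair1[OF Ns, of y] by (simp add: vimage_def)
  have "emeasure SpV N = (\<integral>\<^sup>+p. indicator N p \<partial>SpV)" using Ns by simp
  also have "... = (SUM y:UNIV. \<integral>\<^sup>+t. indicator N (y, t) \<partial>lborel)" using Ns by (intro nn_integral_SpV borel_measurable_indicator)
  finally have "(\<integral>\<^sup>+t. indicator N (y, t) \<partial>lborel) = 0" for y using N by (auto simp: null_sets_def)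
  moreover have "(%t. indicator N (y, t)) = (indicator {t. (y, t) : N} :: real => ennreal)" for y by (auto simp: indicator_def)
  ultimately have z: "emeasure lborel {t. (y, t) : N} = 0" for y
   using nn_integral_indicator[of "{t. (y, t) : N}" lborel] sl[of y] by simp
  have "measure mu (UNIV \<times> {t. (y, t) : N}) = 0" for y
  proof -
   have "AE t in lborel. period T0 t * indicator {t. (y, t) : N} t = 0"
    using AE_not_in[of "{t. (y, t) : N}" lborel] z[of y] sl[of y] by (auto simp: null_sets_def elim!: eventually_mono)
   thus ?thesis unfolding time_marginal[OF sl] by (simp add: integral_eq_zero_AE)
  qed
  hence "UNIV \<times> {t. (y, t) : N} : null_sets mu" for y
   using SpV_times_sets[OF sl] dmu(2) by (auto simp: null_sets_def emeasure_eq_measure)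
  hence "(\<Union>y. UNIV \<times> {t. (y, t) : N}) : null_sets mu" by (intro null_sets_UN') auto
  thus ?thesis using Ns dmu(2) by (rule_tac null_sets_subset) auto
 qed
 obtain m where m: "(%p. m (snd p) (fst p)) : borel_measurable SpV" "!!t y. 0 <= m t y" "mu = slice_density T0 m"
  using slice_density_exists[OF cmu ac] by blast
 have mm: "(%t. m t y) : borel_measurable borel" for y using SpV_slice_measurable[of "%y t. m t y"] m(1) by simp
 \<comment> \<open>The time marginal computed in two ways; uniqueness of densities makes the masses
   \<open>m t y\<close> sum to 1 almost everywhere.\<close>
 have "density lborel (%t. ennreal (period T0 t * (SUM y:UNIV. m t y))) = density lborel (%t. ennreal (period T0 t))"
 proof (rule measure_eqI)
  fix A assume "A : sets (density lborel (%t. ennreal (period T0 t * (SUM y:UNIV. m t y))))"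
  hence A: "A : sets borel" by simp
  have "emeasure (density lborel (%t. ennreal (period T0 t * (SUM y:UNIV. m t y)))) A
    = (\<integral>\<^sup>+t. (SUM y:UNIV. ennreal (period T0 t * m t y) * indicator A t) \<partial>lborel)"
   using A mm m(2) by (subst emeasure_density) (auto simp: sum_distrib_left sum_distrib_right[symmetric] sum_ennreal period_eq intro!: nn_integral_cong)
  also have "... = (SUM y:UNIV. \<integral>\<^sup>+t. ennreal (period T0 t * m t y) * indicator A t \<partial>lborel)"
   using A mm by (intro nn_integral_sum) (auto intro!: borel_measurable_times borel_measurable_indicator)
  also have "... = (\<integral>\<^sup>+p. ennreal (period T0 (snd p) * m (snd p) (fst p)) * indicator A (snd p) \<partial>SpV)"
   using A m(1) by (subst nn_integral_SpV) auto
  also have "... = (\<integral>\<^sup>+p. ennreal (period T0 (snd p) * m (snd p) (fst p)) * indicator (UNIV \<times> A) p \<partial>SpV)"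
   by (intro nn_integral_cong) (auto simp: indicator_def)
  also have "... = emeasure mu (UNIV \<times> A)"
   unfolding m(3) slice_density_alt using m(1) SpV_times_sets[OF A] by (subst emeasure_density) auto
  also have "... = ennreal (LINT t|lborel. period T0 t * indicator A t)" by (simp add: emeasure_eq_measure time_marginal[OF A])
  also have "... = (\<integral>\<^sup>+t. ennreal (period T0 t * indicator A t) \<partial>lborel)"
  proof (rule nn_integral_eq_integral[symmetric])
   have "(%t. period T0 t * indicator A t) = (indicator ({0..<T0} \<inter> A) :: real => real)" by (auto simp: period_def indicator_def)
   moreover have "emeasure lborel ({0..<T0} \<inter> A) <= emeasure lborel {0..<T0}" using A by (intro emeasure_mono) auto
   hence "emeasure lborel ({0..<T0} \<inter> A) < \<infinity>" using T0 by (simp add: order_le_less_trans)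
   ultimately show "integrable lborel (%t. period T0 t * indicator A t)" using A by (simp add: integrable_indicator_iff)
  qed (auto simp: period_eq)
  also have "... = emeasure (density lborel (%t. ennreal (period T0 t))) A"
   using A by (subst emeasure_density) (auto simp: ennreal_mult'' ennreal_indicator period_eq intro!: nn_integral_cong)
  finally show "emeasure (density lborel (%t. ennreal (period T0 t * (SUM y:UNIV. m t y)))) A = emeasure (density lborel (%t. ennreal (period T0 t))) A" .
 qed simp
 hence "AE t in lborel. ennreal (period T0 t * (SUM y:UNIV. m t y)) = ennreal (period T0 t)"
  using mm period_measurable[of T0] by (intro sigma_finite_measure.density_unique[OF lborel.sigma_finite_measure_axioms]) auto
 hence "AE t in lborel. t : {0..<T0} --> (SUM y:UNIV. m t y) = 1"
  by eventually_elim (auto simp: period_eq m(2) sum_nonneg)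
 thus ?thesis using that m by blast
qed

context
 fixes m :: "real => 'v => real"
 assumes m: "(%p. m (snd p) (fst p)) : borel_measurable SpV" "!!t y. 0 <= m t y" "mu = slice_density T0 m"
  and m1: "AE t in lborel. t : {0..<T0} --> (SUM y:UNIV. m t y) = 1"
begin

lemma m_measurable: "(%t. m t y) : borel_measurable borel"
 using SpV_slice_measurable[of "%y t. m t y"] m(1) by simp

lemma m_le_1: "AE t in lborel. period T0 t * m t y <= period T0 t"
 using m1
proof eventually_elim
 case (elim t)
 have "m t y <= (SUM y:UNIV. m t y)" by (rule member_le_sum) (use m(2) in auto)
 thus ?case using elim by (cases "t : {0..<T0}") (auto simp: period_eq)
qed

lemma m_integrable:
 assumes "bdd_borel f" shows "integrable lborel (%t. period T0 t * (m t y * f t))"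
proof -
 obtain K where K: "!!t. abs (f t) <= K" using bdd_borel_bound[OF assms] by blast
 show ?thesis
  using slice_density_integral(1)[OF m(1,2) Mstar_circle(1)[OF PQ, unfolded m(3)], of "%_. f" K y] bdd_borel_measurable[OF assms] K by blast
qed

lemma m_integral:
 assumes "!!y. bdd_borel (f y)"
 shows "itg mu f = (SUM y:UNIV. \<integral>t. period T0 t * (m t y * f y t) \<partial>lborel)"
proof -
 obtain K where K: "!!y t. abs (f y t) <= K" using bdd_borel_family_bound[of f, OF assms] by blast
 show ?thesis unfolding m(3)
  by (rule slice_density_integral(2)[OF m(1,2) Mstar_circle(1)[OF PQ, unfolded m(3)], of f K]) (use bdd_borel_measurable[OF assms] K in auto)
qed

text \<open>The function \<open>f\<close> is chosen so that \<open>exp ph\<close> solves the backward equation with eigenvalue 0.\<close>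
lemma entropic_cont:
 assumes ph: "!!y t. (ph y has_real_derivative ph' y t) (at t)" "cont_per T0 ph" "cont_per T0 ph'" and G: "cont_per T0 G"
 shows "itg Q G - (LINT p|Q. ph (snd (fst p)) (snd p) - ph (fst (fst p)) (snd p))
  - (SUM y:UNIV. \<integral>t. period T0 t * (m t y * (ph' y t + (SUM z:UNIV. R y z t * (exp (G (y, z) t) - 1)))) \<partial>lborel) <= a"
proof -
 note cQ = Mstar_circle(2)[OF PQ]
 define g where "g e t = G e t + - 1 * (ph (snd e) t - ph (fst e) t)" for e t
 define f where "f y t = - (ph' y t + (SUM z:UNIV. R y z t * (exp (G (y, z) t) - 1)))" for y t
 have dph: "cont_per T0 (%e t. ph (snd e) t - ph (fst e) t)"
  using ph(2) by (auto simp: cont_per_def intro!: continuous_intros)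
 have g: "cont_per T0 g" unfolding g_def[abs_def] by (intro cont_per_add cont_per_cmult G dph)
 have f: "bdd_borel (f y)" for y
  unfolding f_def[abs_def] by (intro bdd_borel_intros cont_per_bdd[OF ph(3) T0] cont_per_bdd[OF G T0] R_bdd)
 have fper: "f y (t + T0) = f y t" for y t
  using cont_perD(2)[OF ph(3)] cont_perD(2)[OF G] by (simp add: f_def R_per)
 obtain Kph where Kph: "!!y t. abs (ph y t) <= Kph" using cont_per_bounded[OF ph(2) T0] by metis
 have bw: "indef s t (%t. exp (ph y t)) (bw f g (%y t. exp (ph y t)) y)" for y s t
 proof (rule indef_C1)
  fix t
  have "R y z t * (exp (g (y, z) t) * exp (ph z t) - exp (ph y t)) = exp (ph y t) * (R y z t * (exp (G (y, z) t) - 1))" for z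
   by (simp add: g_def mult_exp_exp algebra_simps)
  hence "- bw f g (%y t. exp (ph y t)) y t = exp (ph y t) * ph' y t"
   unfolding bw_def f_def by (simp only: sum_distrib_left[symmetric]) (simp add: algebra_simps)
  thus "((%t. exp (ph y t)) has_real_derivative - bw f g (%y t. exp (ph y t)) y t) (at t)"
   using ph(1)[of y t] by (auto intro!: derivative_eq_intros)
 qed
 have pf: "integrable M (%om. exp (psum n f g om))" "part_fun n f g <= exp Kph / exp (- Kph)" if "n >= 1" for n
  using fk_bounds(1,3)[OF f cont_perD(1)[OF g] cont_per_bdd[OF g T0] bdd_borel_exp[OF cont_per_bdd[OF ph(2) T0]] bw, of "exp (- Kph)" "exp Kph" n] Kph that
  by (auto simp: abs_le_iff minus_le_iff)
 have ip: "integrable lborel (%t. period T0 t * 1)"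
  using T0 by (simp add: period_def[abs_def] integrable_real_indicator)
 let ?D = "slice_density T0 (%_ _. 1) :: ('v * real) measure"
 have D: "circle_measure T0 ?D" using ip by (intro slice_density_circle) auto
 have "itg Q g + (SUM y:UNIV. \<integral>t. period T0 t * (m t y * f y t) \<partial>lborel) <= a + e" if e: "e > 0" for e
 proof -
  obtain K where K: "!!y t. abs (f y t) <= K" using bdd_borel_family_bound[of f, OF f] by blast
  have fm: "(%p. f (fst p) (snd p)) : borel_measurable SpV" by (intro SpV_measurable bdd_borel_measurable f)
  \<comment> \<open>The hypothesis \<open>conj\<close> covers continuous potentials only, while
    \<open>f\<close> contains the rates; \<open>u\<close> is close to \<open>f\<close> in L^1 of
    Lebesgue measure on all circles.\<close>
  obtain u where u: "cont_per T0 u" "(LINT p|?D. abs (f (fst p) (snd p) - u (fst p) (snd p))) < e / 2"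
   by (rule approx_cont_per[OF T0 D fm, of K "e / 2"]) (use K e in auto)
  have db: "bdd_borel (%t. abs (f y t - u y t))" for y
  proof -
   obtain K' where "!!t. abs (f y t - u y t) <= K'" using bdd_borel_bound[OF bdd_borel_diff[OF f cont_per_bdd[OF u(1) T0]]] by metis
   thus ?thesis using bdd_borel_measurable[OF f] bdd_borel_measurable[OF cont_per_bdd[OF u(1) T0]] by (intro bdd_borelI[of _ K']) auto
  qed
  \<comment> \<open>A bound on \<open>abs (f - u)\<close> that does not depend on the state: along
    every path the two time integrals over \<open>n\<close> periods differ by at most
    \<open>n * (e / 2)\<close>. As \<open>f\<close>, \<open>g\<close> has bounded partition
    functions, \<open>lam u g\<close> is at most \<open>e / 2\<close>.\<close>
  define w where "w t = (SUM y:UNIV. abs (f y t - u y t))" for t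
  have wb: "bdd_borel w" unfolding w_def[abs_def] by (intro bdd_borel_intros db)
  obtain K' where K': "!!y t. abs (abs (f y t - u y t)) <= K'" using bdd_borel_family_bound[of "%y t. abs (f y t - u y t)", OF db] by blast
  have "(LINT p|?D. abs (f (fst p) (snd p) - u (fst p) (snd p))) = (SUM y:UNIV. integral {0..T0} (%t. abs (f y t - u y t)))"
   using slice_density_integral(2)[OF _ _ D, of "%y t. abs (f y t - u y t)" K'] K' bdd_borel_measurable[OF db]
   by (simp add: integral_period_HK[OF db])
  hence we: "(SUM y:UNIV. integral {0..T0} (%t. abs (f y t - u y t))) < e / 2" using u(2) by simp
  hence we': "integral {0..T0} w < e / 2" unfolding w_def[abs_def] by (subst integral_bdd_sum) (auto intro: db)
  have wn: "integral {0..real n * T0} w <= real n * (e / 2)" for n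
  proof -
   have "integral {0..real n * T0} w = real n * integral {0..T0} w"
    using fper cont_perD(2)[OF u(1)] T0 by (intro integral_periods wb) (simp_all add: w_def)
   thus ?thesis using mult_left_mono[OF less_imp_le[OF we'], of "real n"] by simp
  qed
  obtain L where L: "test_pair L u g" using cont_per_test_pair[OF u(1) g] .
  have "lam u g <= e / 2"
  proof (rule growth_le[OF test_pair_lam(1)[OF L]])
   fix n :: nat assume n: "n >= 1"
   have "psum n u g om <= psum n f g om + real n * (e / 2)" if w: "om : space M" for om
   proof -
    note ab = along_bdd[OF X_cadlag[OF w], of u, OF cont_per_bdd[OF u(1) T0]] along_bdd[OF X_cadlag[OF w], of f, OF f]
    have "integral {0..real n * T0} (along u (X om)) <= integral {0..real n * T0} (%t. along f (X om) t + w t)"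
    proof (intro integral_bdd_mono bdd_borel_add ab wb)
     fix t assume t: "t : {0..real n * T0}"
     have "abs (f (X om t) t - u (X om t) t) <= w t" unfolding w_def by (rule member_le_sum[of _ _ "%y. abs (f y t - u y t)"]) auto
     thus "along u (X om) t <= along f (X om) t + w t" using t by (simp add: along_eq)
    qed
    thus ?thesis using wn[of n] by (simp add: path_fun_def integral_bdd_add[OF ab(2) wb])
   qed
   hence "part_fun n u g <= expectation (%om. exp (real n * (e / 2)) * exp (psum n f g om))"
    unfolding part_fun_def using test_pair_lam(2)[OF L n] pf(1)[OF n]
    by (intro integral_mono integrable_mult_right) (simp_all only: mult_exp_exp exp_le_cancel_iff add.commute)
   also have "... = exp (real n * (e / 2)) * part_fun n f g" by (simp add: part_fun_def)
   also have "... <= exp Kph / exp (- Kph) * exp (real n * (e / 2))" 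
    using mult_right_mono[OF pf(2)[OF n], of "exp (real n * (e / 2))"] by (simp only: exp_ge_zero mult.commute)
   finally show "part_fun n u g <= exp Kph / exp (- Kph) * exp (real n * (e / 2))" .
  qed
  hence le: "(SUM y:UNIV. \<integral>t. period T0 t * (m t y * u y t) \<partial>lborel) + itg Q g <= a + e / 2"
   using conj[OF u(1) g] by (simp add: ev_def m_integral[of u, OF cont_per_bdd[OF u(1) T0]])
  \<comment> \<open>Since the densities \<open>m\<close> are at most 1, the same Lebesgue distance
    controls the integrals against \<open>mu\<close>.\<close>
  have "(LINT t|lborel. period T0 t * (m t y * f y t)) <= (LINT t|lborel. period T0 t * (m t y * u y t)) + integral {0..T0} (%t. abs (f y t - u y t))" for y
  proof -
   have i: "integrable lborel (%t. period T0 t * abs (f y t - u y t))"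
    using bdd_borel_set_integrable[OF db[of y], of 0 T0] ip bdd_borel_measurable[OF db]
    by (intro Bochner_Integration.integrable_bound[OF bdd_borel_set_integrable[OF db[of y], of 0 T0, unfolded set_integrable_def]])
     (auto simp: period_def indicator_def)
   have "(LINT t|lborel. period T0 t * (m t y * f y t)) <= (LINT t|lborel. period T0 t * (m t y * u y t) + period T0 t * abs (f y t - u y t))"
   proof (intro integral_mono_AE Bochner_Integration.integrable_add i m_integrable f cont_per_bdd[OF u(1) T0])
    show "AE t in lborel. period T0 t * (m t y * f y t) <= period T0 t * (m t y * u y t) + period T0 t * abs (f y t - u y t)"
     using m_le_1[of y]
    proof eventually_elim
     case (elim t)
     have "(period T0 t * m t y) * (f y t - u y t) <= (period T0 t * m t y) * abs (f y t - u y t)"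
      using m(2) by (intro mult_left_mono) (auto simp: period_eq)
     also have "... <= period T0 t * abs (f y t - u y t)" by (rule mult_right_mono[OF elim]) simp
     finally show ?case by (simp add: algebra_simps)
    qed
   qed
   thus ?thesis
    using i m_integrable[OF cont_per_bdd[OF u(1) T0]] by (simp add: integral_period_HK[OF db])
  qed
  hence "(SUM y:UNIV. \<integral>t. period T0 t * (m t y * f y t) \<partial>lborel)
    <= (SUM y:UNIV. (LINT t|lborel. period T0 t * (m t y * u y t)) + integral {0..T0} (%t. abs (f y t - u y t)))"
   by (rule sum_mono)
  thus ?thesis using le we by (simp add: sum.distrib)
 qed
 hence "itg Q g + (SUM y:UNIV. \<integral>t. period T0 t * (m t y * f y t) \<partial>lborel) <= a"
  by (rule field_le_epsilon)
 moreover have "itg Q g = itg Q G - (LINT p|Q. ph (snd (fst p)) (snd p) - ph (fst (fst p)) (snd p))"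
  using Bochner_Integration.integral_diff[OF cont_per_integrable[OF cQ T0 G] cont_per_integrable[OF cQ T0 dph]]
  unfolding g_def by (simp add: mult_minus1 diff_conv_add_uminus[symmetric] del: minus_diff_eq minus_add_distrib)
 moreover have "(LINT t|lborel. period T0 t * (m t y * f y t))
   = - (LINT t|lborel. period T0 t * (m t y * (ph' y t + (SUM z:UNIV. R y z t * (exp (G (y, z) t) - 1)))))" for y
  unfolding f_def by (simp only: mult_minus_right Bochner_Integration.integral_minus)
 ultimately show ?thesis by (simp add: sum_negf)
qed

definition expected_flow :: "(('v * 'v) * real) measure" where
 "expected_flow = slice_density T0 (%t e. m t (fst e) * R (fst e) (snd e) t)"

lemma expected_flow_circle:
 shows "circle_measure T0 expected_flow"
  and "(%p. m (snd p) (fst (fst p)) * R (fst (fst p)) (snd (fst p)) (snd p)) : borel_measurable SpV"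
proof -
 show *: "(%p. m (snd p) (fst (fst p)) * R (fst (fst p)) (snd (fst p)) (snd p)) : borel_measurable SpV"
  by (rule SpV_measurable[where f = "%e t. m t (fst e) * R (fst e) (snd e) t"])
   (intro borel_measurable_times m_measurable bdd_borel_measurable[OF R_bdd])
 show "circle_measure T0 expected_flow"
  unfolding expected_flow_def using * m(2) R_nonneg m_integrable[OF R_bdd] by (intro slice_density_circle) auto
qed

lemma expected_flow_integral:
 assumes "!!e. bdd_borel (G e)"
 shows "!!e. integrable lborel (%t. period T0 t * (m t (fst e) * R (fst e) (snd e) t * G e t))"
  "itg expected_flow G = (SUM e:UNIV. \<integral>t. period T0 t * (m t (fst e) * R (fst e) (snd e) t * G e t) \<partial>lborel)"
proof -
 obtain K where K: "!!y t. abs (G y t) <= K" using bdd_borel_family_bound[of G, OF assms] by blast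
 note * = slice_density_integral[OF expected_flow_circle(2) _ expected_flow_circle(1)[unfolded expected_flow_def], of G K]
 show "!!e. integrable lborel (%t. period T0 t * (m t (fst e) * R (fst e) (snd e) t * G e t))"
  "itg expected_flow G = (SUM e:UNIV. \<integral>t. period T0 t * (m t (fst e) * R (fst e) (snd e) t * G e t) \<partial>lborel)"
  unfolding expected_flow_def using * K m(2) R_nonneg bdd_borel_measurable[OF assms] by auto
qed

text \<open>For \<open>G = 0\<close> the bound of \<open>entropic_cont\<close> is linear in
  \<open>ph\<close> and holds for all real multiples of it, so the linear functional vanishes. This
  is the continuity equation.\<close>

lemma weak_continuity:
 assumes ph: "!!y t. (ph y has_real_derivative ph' y t) (at t)" "cont_per T0 ph" "cont_per T0 ph'"
 shows "(LINT p|Q. ph (snd (fst p)) (snd p) - ph (fst (fst p)) (snd p)) = - (SUM y:UNIV. \<integral>t. period T0 t * (m t y * ph' y t) \<partial>lborel)"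
proof -
 let ?w = "(LINT p|Q. ph (snd (fst p)) (snd p) - ph (fst (fst p)) (snd p)) + (SUM y:UNIV. \<integral>t. period T0 t * (m t y * ph' y t) \<partial>lborel)"
 have "k * ?w <= a" for k
 proof -
  have "cont_per T0 (%y t. - k * ph y t)" "cont_per T0 (%y t. - k * ph' y t)" "cont_per T0 (%e t. 0)"
   using cont_per_cmult[OF ph(2), of "- k"] cont_per_cmult[OF ph(3), of "- k"] by (simp_all add: cont_per_def)
  moreover have "((%t. - k * ph y t) has_real_derivative - k * ph' y t) (at t)" for y t
   using ph(1)[of y t] by (auto intro!: derivative_eq_intros)
  ultimately have "- (LINT p|Q. - k * ph (snd (fst p)) (snd p) - - k * ph (fst (fst p)) (snd p))
    - (SUM y:UNIV. \<integral>t. period T0 t * (m t y * (- k * ph' y t)) \<partial>lborel) <= a"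
   using entropic_cont[of "%y t. - k * ph y t" "%y t. - k * ph' y t" "%_ _. 0"] by simp
  moreover have "(LINT p|Q. - k * ph (snd (fst p)) (snd p) - - k * ph (fst (fst p)) (snd p)) = - k * (LINT p|Q. ph (snd (fst p)) (snd p) - ph (fst (fst p)) (snd p))"
   by (simp only: right_diff_distrib[symmetric] integral_mult_right_zero)
  moreover have "(LINT t|lborel. period T0 t * (m t y * (- k * ph' y t))) = - k * (LINT t|lborel. period T0 t * (m t y * ph' y t))" for y
   by (simp only: integral_mult_right_zero[symmetric] mult_ac)
  ultimately show ?thesis by (simp add: sum_distrib_left[symmetric] sum_negf distrib_left)
 qed
 from eq_0_of_scaling[OF this] show ?thesis by simp
qed

text \<open>The case \<open>ph = 0\<close>, extended from continuous to bounded Borel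
  \<open>G\<close>. Under \<open>Q\<close> the function enters linearly and under the expected flow
  through its exponential; one approximation serves both via the sum of the two measures, and
  \<open>1 + exp K\<close> collects the two Lipschitz constants.\<close>

lemma entropic:
 assumes G: "!!e. G e : borel_measurable borel" "!!e t. abs (G e t) <= K"
 shows "itg Q G - (LINT p|expected_flow. exp (G (fst p) (snd p)) - 1) <= a"
proof (rule field_le_epsilon)
 fix e :: real assume e: "e > 0"
 note cQ = Mstar_circle(2)[OF PQ] and cN = expected_flow_circle(1)
 have Gm: "(%p. G (fst p) (snd p)) : borel_measurable SpV" by (rule SpV_measurable[OF G(1)])
 obtain u where u: "cont_per T0 u" "!!y t. abs (u y t) <= K"
   "(LINT p|plus_measure Q expected_flow. abs (G (fst p) (snd p) - u (fst p) (snd p))) < e / (1 + exp K)"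
  by (rule approx_cont_per[OF T0 integral_le_plus_measure(1)[OF cQ cN Gm G(2)] Gm, of K "e / (1 + exp K)"])
   (use G(2) e in \<open>auto intro!: divide_pos_pos add_pos_pos\<close>)
 note um = cont_per_measurable[OF u(1)]
 let ?d = "%p. abs (G (fst p) (snd p) - u (fst p) (snd p))"
 have bm: "(%p. G (fst p) (snd p) - u (fst p) (snd p)) : borel_measurable SpV" using Gm um by measurable
 have bb: "abs (G (fst p) (snd p) - u (fst p) (snd p)) <= 2 * K" for p
  using u(2)[of "fst p" "snd p"] G(2)[of "fst p" "snd p"] by linarith
 note pm = integral_le_plus_measure(2,3)[OF cQ cN bm bb]
 have dm: "?d : borel_measurable SpV" using bm by measurable
 have id: "integrable Q ?d" "integrable expected_flow ?d"
  using circle_integrable_bounded[OF cQ dm, of "2 * K"] circle_integrable_bounded[OF cN dm, of "2 * K"] bb by simp_all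
 have ex: "integrable expected_flow (%p. exp (v (fst p) (snd p)) - 1)"
  if "(%p. v (fst p) (snd p)) : borel_measurable SpV" "!!e t. abs (v e t) <= K" for v
 proof (rule circle_integrable_bounded[OF cN, where K = "exp K + 1"])
  show "(%p. exp (v (fst p) (snd p)) - 1) : borel_measurable SpV" using that(1) by measurable
  show "abs (exp (v (fst p) (snd p)) - 1) <= exp K + 1" for p
  proof -
   have "exp (v (fst p) (snd p)) <= exp K" using that(2)[of "fst p" "snd p"] by (subst exp_le_cancel_iff) linarith
   thus ?thesis using exp_gt_zero[of "v (fst p) (snd p)"] by linarith
  qed
 qed
 have "itg Q G <= (LINT p|Q. u (fst p) (snd p) + ?d p)"
  using cont_per_integrable[OF cQ T0 u(1)] id circle_integrable_bounded[OF cQ Gm G(2)] by (intro integral_mono) auto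
 hence 1: "itg Q G <= itg Q u + (LINT p|Q. ?d p)"
  using cont_per_integrable[OF cQ T0 u(1)] id by simp
 have "(LINT p|expected_flow. exp (u (fst p) (snd p)) - 1) <= (LINT p|expected_flow. (exp (G (fst p) (snd p)) - 1) + exp K * ?d p)"
 proof (intro integral_mono Bochner_Integration.integrable_add ex um u(2) Gm G(2) integrable_mult_right id)
  fix p
  let ?x = "u (fst p) (snd p)" and ?y = "G (fst p) (snd p)"
  have "exp ?x * (1 + (?y - ?x)) <= exp ?x * exp (?y - ?x)" by (intro mult_left_mono exp_ge_add_one_self) auto
  hence "exp ?x - exp ?y <= exp ?x * (?x - ?y)" by (simp add: mult_exp_exp algebra_simps)
  also have "... <= exp ?x * ?d p" by (intro mult_left_mono) auto
  also have "... <= exp K * ?d p" using u(2)[of "fst p" "snd p"] by (intro mult_right_mono) (auto simp: abs_le_iff)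
  finally show "exp ?x - 1 <= exp ?y - 1 + exp K * ?d p" by simp
 qed
 hence 2: "(LINT p|expected_flow. exp (u (fst p) (snd p)) - 1) <= (LINT p|expected_flow. exp (G (fst p) (snd p)) - 1) + exp K * (LINT p|expected_flow. ?d p)"
  using ex[OF Gm G(2)] id by simp
 note cb = cont_per_bdd[OF u(1) T0]
 have "(SUM y:UNIV. \<integral>t. period T0 t * (m t y * (SUM z:UNIV. R y z t * (exp (u (y, z) t) - 1))) \<partial>lborel)
   = (SUM y:UNIV. SUM z:UNIV. \<integral>t. period T0 t * (m t y * R y z t * (exp (u (y, z) t) - 1)) \<partial>lborel)"
 proof (rule sum.cong[OF refl])
  fix y
  have "(LINT t|lborel. period T0 t * (m t y * (SUM z:UNIV. R y z t * (exp (u (y, z) t) - 1))))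
    = (LINT t|lborel. (SUM z:UNIV. period T0 t * (m t y * R y z t * (exp (u (y, z) t) - 1))))"
   by (simp add: sum_distrib_left mult.assoc)
  also have "... = (SUM z:UNIV. \<integral>t. period T0 t * (m t y * R y z t * (exp (u (y, z) t) - 1)) \<partial>lborel)"
  proof (rule Bochner_Integration.integral_sum)
   have "bdd_borel (%t. exp (u e t) - 1)" for e using cb by (intro bdd_borel_intros)
   from expected_flow_integral(1)[of "%e t. exp (u e t) - 1", OF this]
   show "integrable lborel (%t. period T0 t * (m t y * R y z t * (exp (u (y, z) t) - 1)))" for z by (metis fst_conv snd_conv)
  qed
  finally show "(LINT t|lborel. period T0 t * (m t y * (SUM z:UNIV. R y z t * (exp (u (y, z) t) - 1)))) = ..." .
 qed
 also have "... = (SUM e:UNIV. \<integral>t. period T0 t * (m t (fst e) * R (fst e) (snd e) t * (exp (u e t) - 1)) \<partial>lborel)"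
  by (subst sum.cartesian_product) (simp add: case_prod_beta)
 also have "... = (LINT p|expected_flow. exp (u (fst p) (snd p)) - 1)"
  using cb by (subst expected_flow_integral(2)[of "%e t. exp (u e t) - 1"]) (auto intro!: bdd_borel_intros)
 finally have "itg Q u - (LINT p|expected_flow. exp (u (fst p) (snd p)) - 1) <= a"
  using entropic_cont[of "%_ _. 0" "%_ _. 0" u] u(1) by (simp add: cont_per_def)
 moreover have "(LINT p|Q. ?d p) + exp K * (LINT p|expected_flow. ?d p) <= e"
 proof -
  have "(LINT p|Q. ?d p) + exp K * (LINT p|expected_flow. ?d p) <= (1 + exp K) * (LINT p|plus_measure Q expected_flow. ?d p)"
   using pm(1) mult_left_mono[OF pm(2), of "exp K"] by (simp only: distrib_right mult_1 exp_ge_zero add_mono)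
  also have "... <= (1 + exp K) * (e / (1 + exp K))" using u(3) exp_gt_zero[of K] by (intro mult_left_mono) auto
  finally show ?thesis using exp_gt_zero[of K] by (simp add: add_pos_pos less_imp_neq[symmetric])
 qed
 ultimately show "itg Q G - (LINT p|expected_flow. exp (G (fst p) (snd p)) - 1) <= a + e"
  using 1 2 by linarith
qed

text \<open>Tested with \<open>k\<close> times the indicator of \<open>A\<close>, the exponential
  term vanishes and the linear term \<open>k * measure Q A\<close> stays below \<open>a\<close> for
  every real \<open>k\<close>.\<close>

lemma flow_null:
 assumes A: "A : null_sets expected_flow" shows "A : null_sets Q"
proof -
 note cQ = Mstar_circle(2)[OF PQ] and cN = expected_flow_circle(1)
 have As: "A : sets SpV" using A circle_measureD(2)[OF cN] by auto
 have sl: "{t. (e, t) : A} : sets borel" for e using sets_Pair1[OF As, of e] by (simp add: vimage_def)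
 have "k * measure Q A <= a" for k
 proof -
  have "(%t. k * indicator A (e, t)) = (%t. k * indicator {t. (e, t) : A} t)" for e by (auto simp: indicator_def)
  hence "(%t. k * indicator A (e, t)) : borel_measurable borel" for e using sl[of e] by simp
  moreover have "abs (k * indicator A (e, t)) <= abs k" for e t by (auto simp: indicator_def)
  ultimately have "(LINT p|Q. k * indicator A (fst p, snd p)) - (LINT p|expected_flow. exp (k * indicator A (fst p, snd p)) - 1) <= a"
   by (rule entropic)
  moreover have "(LINT p|expected_flow. exp (k * indicator A (fst p, snd p)) - 1) = 0"
   by (intro integral_eq_zero_AE eventually_mono[OF AE_not_in[OF A]]) (simp add: indicator_def)
  moreover have "(LINT p|Q. k * indicator A (fst p, snd p)) = k * measure Q A" using circle_measureD(3)[OF cQ] by simp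
  moreover have "A \<inter> space Q = A" using circle_measureD(3)[OF cQ] by simp
  ultimately show ?thesis by simp
 qed
 hence "measure Q A = 0" by (rule eq_0_of_scaling)
 thus ?thesis
  using As circle_measureD(1,2)[OF cQ] by (auto simp: null_sets_def finite_measure.emeasure_eq_measure)
qed

end

lemma conj_Lambda: "(mu, Q) : Lambda T0 E"
proof -
 note cQ = Mstar_circle(2)[OF PQ]
 obtain m where m: "(%p. m (snd p) (fst p)) : borel_measurable SpV" "!!t y. 0 <= m t y" "mu = slice_density T0 m"
  "AE t in lborel. t : {0..<T0} --> (SUM y:UNIV. m t y) = 1" using conj_density by blast
 have fm: "(%p. m (snd p) (fst (fst p)) * R (fst (fst p)) (snd (fst p)) (snd p)) : borel_measurable SpV"
  by (rule expected_flow_circle(2)[OF m])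
 let ?p = "%p. ennreal (period T0 (snd p) * (m (snd p) (fst (fst p)) * R (fst (fst p)) (snd (fst p)) (snd p)))"
 have pm: "?p : borel_measurable SpV" using fm by measurable
 \<comment> \<open>Used twice: for null sets of \<open>SpV\<close>, which yields the density
   \<open>q\<close>, and for the set where \<open>m\<close> vanishes, on which \<open>q\<close> must
   then vanish too.\<close>
 have null: "A : null_sets Q" if "A : sets SpV" "AE p in SpV. p : A --> ?p p = 0" for A
 proof (rule flow_null[OF m])
  show "A : null_sets (expected_flow m)"
   using that unfolding expected_flow_def[OF m] slice_density_alt by (simp add: null_sets_density_iff[OF pm])
 qed
 have "N : null_sets Q" if "N : null_sets SpV" for N
  using that AE_not_in[OF that] by (intro null) (auto elim!: eventually_mono)
 from slice_density_exists[OF cQ this] obtain q where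
  q: "(%p. q (snd p) (fst p)) : borel_measurable SpV" "!!t e. 0 <= q t e" "Q = slice_density T0 q" by blast
 have qm: "(%t. q t e) : borel_measurable borel" for e using SpV_slice_measurable[of "%y t. q t y"] q(1) by simp
 have mm: "(%t. m t e) : borel_measurable borel" for e using SpV_slice_measurable[of "%y t. m t y"] m(1) by simp
 have w4: "AE t in lborel. t : {0..<T0} --> (ALL y z. (y, z) : E --> m t y = 0 --> q t (y, z) = 0)"
 proof -
  let ?A = "{p : space SpV. m (snd p) (fst (fst p)) = 0} :: (('v * 'v) * real) set"
  have m': "(%p. m (snd p) (fst (fst p))) : borel_measurable (SpV :: (('v * 'v) * real) measure)"
   by (rule SpV_measurable[where f = "%e t. m t (fst e)"]) (rule mm)
  have As: "?A : sets SpV" using measurable_sets[OF m', of "{0}"] by (simp add: vimage_def Int_def conj_commute)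
  let ?q = "%p. ennreal (period T0 (snd p) * q (snd p) (fst p))"
  have qm': "?q : borel_measurable SpV" using q(1) by measurable
  have "emeasure Q ?A = 0" using null[OF As] by auto
  hence "(\<integral>\<^sup>+p. ?q p * indicator ?A p \<partial>SpV) = 0"
   unfolding q(3) slice_density_alt by (subst (asm) emeasure_density[OF qm' As])
  hence z: "(\<integral>\<^sup>+t. ?q (e, t) * indicator ?A (e, t) \<partial>lborel) = 0" for e
   using As qm' by (cases e, subst (asm) nn_integral_SpV) (auto intro!: borel_measurable_times_ennreal borel_measurable_indicator)
  have "AE t in lborel. ennreal (period T0 t * q t e) * indicator {t. m t (fst e) = 0} t = 0" for e
  proof -
   have eq: "(%t. ?q (e, t) * indicator ?A (e, t)) = (%t. ennreal (period T0 t * q t e) * indicator {t. m t (fst e) = 0} t)"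
    by (auto simp: indicator_def)
   have "(%t. ennreal (period T0 t * q t e) * indicator {t. m t (fst e) = 0} t) : borel_measurable lborel"
    using qm[of e] mm[of "fst e"] by measurable
   thus ?thesis using z[of e] unfolding eq by (simp only: nn_integral_0_iff_AE)
  qed
  hence "AE t in lborel. ALL e. ennreal (period T0 t * q t e) * indicator {t. m t (fst e) = 0} t = 0" by (rule AE_all_countable[THEN iffD2, OF allI])
  thus ?thesis
  proof eventually_elim
   case (elim t)
   show ?case
   proof (intro impI allI)
    fix y z assume "t : {0..<T0}" "m t y = 0"
    thus "q t (y, z) = 0" using elim[THEN spec, of "(y, z)"] q(2)[of t "(y, z)"] by (simp add: period_eq indicator_def ennreal_eq_0_iff)
   qed
  qed
 qed
 have weak: "(LINT s:{0..T0}|lborel. SUM y:UNIV. m s y * deriv (f y) s) = (LINT s:{0..T0}|lborel. SUM y:UNIV. divg E (q s) y * f y s)"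
  if f: "ALL y. f y C1_differentiable_on UNIV & (ALL t. f y (t + T0) = f y t)" for f :: "'v tfun"
 proof -
  obtain D where D: "!!y t. (f y has_real_derivative D y t) (at t)" "!!y. continuous_on UNIV (D y)"
   using f unfolding C1_differentiable_on_def has_real_derivative_iff_has_vector_derivative by (metis UNIV_I)
  have dD: "deriv (f y) = D y" for y using D(1) by (auto intro: DERIV_imp_deriv)
  have cf: "cont_per T0 f" using f D(1) unfolding cont_per_def by (metis DERIV_isCont continuous_at_imp_continuous_on)
  have "D y (t + T0) = D y t" for y t
  proof -
   have "((%t. f y (t + T0)) has_real_derivative D y (t + T0)) (at t)" using D(1) by (subst DERIV_shift[symmetric])
   thus ?thesis using f D(1)[of y t] by (simp add: DERIV_unique)
  qed
  hence cD: "cont_per T0 D" using D(2) by (simp add: cont_per_def)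
  have cdf: "cont_per T0 (%e t. f (snd e) t - f (fst e) t)"
   using cf by (auto simp: cont_per_def intro!: continuous_intros)
  obtain K where K: "!!e t. abs (f (snd e) t - f (fst e) t) <= K" using cont_per_bounded[OF cdf T0] by metis
  have "(LINT s:{0..T0}|lborel. SUM y:UNIV. m s y * deriv (f y) s) = (LINT t|lborel. (SUM y:UNIV. period T0 t * (m t y * D y t)))"
   unfolding dD using mm bdd_borel_measurable[OF cont_per_bdd[OF cD T0]]
   by (subst LINT_period) (auto simp: sum_distrib_left intro!: borel_measurable_sum borel_measurable_times)
  also have "... = (SUM y:UNIV. \<integral>t. period T0 t * (m t y * D y t) \<partial>lborel)"
   by (intro Bochner_Integration.integral_sum m_integrable[OF m] cont_per_bdd[OF cD T0])
  also have "... = - (LINT p|Q. f (snd (fst p)) (snd p) - f (fst (fst p)) (snd p))" using weak_continuity[OF m D(1) cf cD] by simp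
  also have "... = - (SUM e:E. \<integral>t. period T0 t * (q t e * (f (snd e) t - f (fst e) t)) \<partial>lborel)"
   unfolding q(3) using flow_integral[OF cQ[unfolded q(3)] Mstar_circle(3)[OF PQ, unfolded q(3)] q(1,2), of "%e t. f (snd e) t - f (fst e) t" K]
    bdd_borel_measurable[OF cont_per_bdd[OF cdf T0]] K by simp
  also have "... = (SUM e:E. \<integral>t. period T0 t * (q t e * (f (fst e) t - f (snd e) t)) \<partial>lborel)"
   by (simp only: sum_negf[symmetric] Bochner_Integration.integral_minus[symmetric] mult_minus_right[symmetric] minus_diff_eq)
  also have "... = (LINT t|lborel. (SUM e:E. period T0 t * (q t e * (f (fst e) t - f (snd e) t))))"
  proof (rule Bochner_Integration.integral_sum[symmetric])
   fix e
   have "integrable lborel (%t. period T0 t * (q t e * (f (snd e) t - f (fst e) t)))"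
    using slice_density_integral(1)[OF q(1,2) cQ[unfolded q(3)], of "%e t. f (snd e) t - f (fst e) t" K e] bdd_borel_measurable[OF cont_per_bdd[OF cdf T0]] K by simp
   from Bochner_Integration.integrable_minus[OF this]
   show "integrable lborel (%t. period T0 t * (q t e * (f (fst e) t - f (snd e) t)))" by (simp only: mult_minus_right[symmetric] minus_diff_eq)
  qed
  also have "... = (LINT s:{0..T0}|lborel. SUM y:UNIV. divg E (q s) y * f y s)"
   unfolding divg_pairing using qm bdd_borel_measurable[OF cont_per_bdd[OF cf T0]]
   by (subst LINT_period) (auto simp: sum_distrib_left intro!: borel_measurable_sum borel_measurable_times borel_measurable_diff)
  finally show ?thesis .
 qed
 have "Lambda_wit T0 E mu Q m q"
  unfolding Lambda_wit_def using m q w4 weak by (simp add: slice_density_def)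
 thus ?thesis unfolding Lambda_def using PQ by auto
qed

text \<open>The optimal function \<open>ln (q / p)\<close> in Young's inequality is unbounded. Its
  truncations at level \<open>k\<close> are admissible, their integrands \<open>psi k\<close> are
  nonnegative and converge to \<open>Phi\<close>, and Fatou's lemma gives the bound.\<close>

lemma conj_rate_int:
 assumes wit: "Lambda_wit T0 E mu Q m q" shows "rate_int R T0 E m q <= ennreal a"
proof -
 note W = Lambda_witD[OF wit] and cQ = Mstar_circle(2)[OF PQ]
 have qm: "(%t. q t e) : borel_measurable borel" for e using SpV_slice_measurable[of "%y t. q t y"] W(3) by simp
 have mm: "(%t. m t e) : borel_measurable borel" for e using SpV_slice_measurable[of "%y t. m t y"] W(1) by simp
 define p where "p t e = m t (fst e) * R (fst e) (snd e) t" for t e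
 have p0: "0 <= p t e" for t e unfolding p_def using W(2) R_nonneg by simp
 have pm: "(%t. p t e) : borel_measurable borel" for e
  unfolding p_def using mm bdd_borel_measurable[OF R_bdd] by (intro borel_measurable_times)
 \<comment> \<open>Where \<open>q\<close> vanishes the optimum is minus infinity, hence
   \<open>- real k\<close>. The value 0 for \<open>p = 0 < q\<close> is a convention on a null set
   of times.\<close>
 define G where "G k e t = (if e : E then if q t e = 0 then - real k else if p t e = 0 then 0
   else max (- real k) (min (real k) (ln (q t e / p t e))) else 0)" for k e t
 define psi where "psi k t e = q t e * G k e t - p t e * (exp (G k e t) - 1)" for k t e
 have Gm: "G k e : borel_measurable borel" for k e
  unfolding G_def[abs_def] using qm[of e] pm[of e] by (cases "e : E") (simp_all, measurable)
 have Gb: "abs (G k e t) <= real k" for k e t by (auto simp: G_def)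
 have GB: "bdd_borel (G k e)" for k e using Gm Gb by (rule bdd_borelI)
 have key: "0 <= v * (exp g * g - (exp g - 1))" if "0 <= v" for v g :: real
 proof -
  have "exp g * (1 + (- g)) <= exp g * exp (- g)" by (intro mult_left_mono exp_ge_add_one_self) auto
  thus ?thesis using that by (intro mult_nonneg_nonneg) (auto simp: mult_exp_exp algebra_simps)
 qed
 \<comment> \<open>The truncated value lies between 0 and the optimum, so
   \<open>q * G >= p * exp G * G\<close>; what remains is nonnegative by \<open>key\<close>.\<close>
 have psi0: "0 <= psi k t e" for k t e
 proof -
  have *: "p t e * (exp (G k e t) * G k e t) <= q t e * G k e t" if ne: "q t e > 0" "p t e > 0" "e : E"
  proof (cases "ln (q t e / p t e) >= 0")
   case True
   have "G k e t = max (- real k) (min (real k) (ln (q t e / p t e)))" using ne by (simp add: G_def)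
   hence g: "0 <= G k e t" "G k e t <= ln (q t e / p t e)" using True by linarith+
   have "exp (G k e t) <= exp (ln (q t e / p t e))" using g(2) by (simp only: exp_le_cancel_iff)
   hence "p t e * exp (G k e t) <= q t e" using ne by (simp add: field_simps)
   thus ?thesis using mult_right_mono g(1) by (fastforce simp: mult.assoc)
  next
   case False
   have "G k e t = max (- real k) (min (real k) (ln (q t e / p t e)))" using ne by (simp add: G_def)
   hence g: "G k e t <= 0" "ln (q t e / p t e) <= G k e t" using False by linarith+
   have "exp (ln (q t e / p t e)) <= exp (G k e t)" using g(2) by (simp only: exp_le_cancel_iff)
   hence "q t e <= p t e * exp (G k e t)" using ne by (simp add: field_simps)
   thus ?thesis using mult_right_mono_neg g(1) by (fastforce simp: mult.assoc)
  qed
  consider "e ~: E" | "e : E" "q t e = 0" | "e : E" "q t e > 0" "p t e = 0" | "e : E" "q t e > 0" "p t e > 0"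
   using W(4)[of t e] p0[of t e] by linarith
  thus ?thesis
  proof cases
   case 4
   thus ?thesis using *[OF 4(2,3,1)] key[OF p0[of t e], of "G k e t"] by (simp add: psi_def right_diff_distrib)
  qed (use p0[of t e] in \<open>auto simp: psi_def G_def mult_le_0_iff\<close>)
 qed
 have il: "integrable lborel (%t. period T0 t * psi k t e)" for k e
 proof -
  have "integrable lborel (%t. period T0 t * (q t e * G k e t))"
   using slice_density_integral(1)[OF W(3,4) cQ[unfolded W(6)], of "G k" "real k" e] Gm Gb by simp
  moreover have "integrable lborel (%t. period T0 t * (p t e * (exp (G k e t) - 1)))"
   unfolding p_def by (rule expected_flow_integral(1)[OF W(1,2,5,7)]) (intro bdd_borel_intros GB)
  ultimately show ?thesis using Bochner_Integration.integrable_diff by (fastforce simp: psi_def right_diff_distrib)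
 qed
 have int: "(SUM e:E. \<integral>t. period T0 t * psi k t e \<partial>lborel) <= a" for k
 proof -
  have i1: "integrable lborel (%t. period T0 t * (q t e * G k e t))" for e
   using slice_density_integral(1)[OF W(3,4) cQ[unfolded W(6)], of "G k" "real k" e] Gm Gb by simp
  have eb: "bdd_borel (%t. exp (G k e t) - 1)" for e by (intro bdd_borel_intros GB)
  note e1 = expected_flow_integral[OF W(1,2,5,7), of "%e t. exp (G k e t) - 1", OF eb, folded p_def]
  have "(SUM e:E. \<integral>t. period T0 t * (q t e * G k e t) \<partial>lborel) = (LINT p|Q. G k (fst p) (snd p))"
   unfolding W(6) using flow_integral[OF cQ[unfolded W(6)] Mstar_circle(3)[OF PQ, unfolded W(6)] W(3,4), of "G k" "real k"] Gm Gb by simp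
  moreover have "(SUM e:E. \<integral>t. period T0 t * (p t e * (exp (G k e t) - 1)) \<partial>lborel) = (SUM e:UNIV. \<integral>t. period T0 t * (p t e * (exp (G k e t) - 1)) \<partial>lborel)"
   by (rule sum.mono_neutral_left) (auto simp: G_def)
  moreover have "(LINT t|lborel. period T0 t * psi k t e)
    = (LINT t|lborel. period T0 t * (q t e * G k e t)) - (LINT t|lborel. period T0 t * (p t e * (exp (G k e t) - 1)))" for e
   unfolding psi_def right_diff_distrib[of "period T0 _"] by (rule Bochner_Integration.integral_diff[OF i1 e1(1)])
  ultimately show ?thesis
   using entropic[OF W(1,2,5,7), of "G k" "real k"] Gm Gb e1(2) by (simp add: sum_subtractf)
 qed
 let ?u = "%k t. ennreal (SUM e:E. period T0 t * psi k t e)"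
 have um: "?u k : borel_measurable lborel" for k
  using borel_measurable_integrable[OF il] by (intro measurable_compose[OF _ measurable_ennreal] borel_measurable_sum) auto
 have ui: "(\<integral>\<^sup>+t. ?u k t \<partial>lborel) <= ennreal a" for k
 proof -
  have "(\<integral>\<^sup>+t. ?u k t \<partial>lborel) = ennreal (LINT t|lborel. (SUM e:E. period T0 t * psi k t e))"
   using psi0 by (intro nn_integral_eq_integral Bochner_Integration.integrable_sum il) (auto intro!: sum_nonneg simp: period_eq)
  also have "(LINT t|lborel. (SUM e:E. period T0 t * psi k t e)) = (SUM e:E. \<integral>t. period T0 t * psi k t e \<partial>lborel)"
   by (intro Bochner_Integration.integral_sum il)
  finally show ?thesis using int[of k] by (simp add: ennreal_leI)
 qed
 have "AE t in lborel. indicator {0..<T0} t * (SUM e:E. Phi (q t e) (m t (fst e) * R (fst e) (snd e) t)) = liminf (%k. ?u k t)"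
  using W(8)
 proof eventually_elim
  case (elim t)
  define l where "l e = (if q t e = 0 then p t e else q t e * ln (q t e / p t e) - (q t e - p t e))" for e
  show ?case
  proof (cases "t : {0..<T0}")
   case True
   \<comment> \<open>A positive flow needs \<open>m > 0\<close> at its origin by the last clause of
     \<open>Lambda_wit\<close>, and rates on edges are at least \<open>c\<close>.\<close>
   have ps: "p t e > 0" if "e : E" "q t e ~= 0" for e
   proof -
    have "m t (fst e) ~= 0" using elim True that by (cases e) auto
    moreover have "c <= R (fst e) (snd e) t" using that(1) R_lo by (cases e) auto
    ultimately show ?thesis unfolding p_def using c W(2)[of t "fst e"] by (intro mult_pos_pos) auto
   qed
   have lim: "(%k. psi k t e) \<longlonglongrightarrow> l e" if e: "e : E" for e
   proof (cases "q t e = 0")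
    case True
    have "(%k. - (p t e * (exp (- real k) - 1))) \<longlonglongrightarrow> - (p t e * (0 - 1))"
     by (intro tendsto_intros filterlim_compose[OF exp_at_bot] filterlim_compose[OF filterlim_uminus_at_bot_at_top filterlim_real_sequentially])
    thus ?thesis using True e by (simp add: psi_def G_def l_def)
   next
    case False
    hence q: "q t e > 0" using W(4)[of t e] by simp
    obtain N where N: "abs (ln (q t e / p t e)) <= real N" using real_arch_simple by blast
    have "\<forall>\<^sub>F k in sequentially. psi k t e = l e"
     using eventually_ge_at_top[of N]
    proof eventually_elim
     case (elim k)
     hence "abs (ln (q t e / p t e)) <= real k" using N by linarith
     hence "G k e t = ln (q t e / p t e)" using e False ps[OF e False] by (auto simp: G_def)
     thus ?case using q ps[OF e False] by (simp add: psi_def l_def right_diff_distrib)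
    qed
    thus ?thesis by (rule tendsto_eventually)
   qed
   have l0: "0 <= l e" if "e : E" for e using LIMSEQ_le_const[OF lim[OF that]] psi0 by blast
   have P: "Phi (q t e) (p t e) = ennreal (l e)" if "e : E" for e using ps[OF that] by (cases "q t e = 0") (auto simp: Phi_def l_def)
   have "(%k. ?u k t) \<longlonglongrightarrow> ennreal (SUM e:E. 1 * l e)"
    using lim True by (intro tendsto_ennrealI tendsto_sum tendsto_mult) (auto simp: period_eq)
   hence "liminf (%k. ?u k t) = ennreal (SUM e:E. 1 * l e)" by (intro lim_imp_Liminf) auto
   also have "... = (SUM e:E. Phi (q t e) (p t e))" using l0 P by simp
   finally show ?thesis using True by (simp add: p_def)
  next
   case False
   thus ?thesis by (simp add: period_eq Liminf_const)
  qed
 qed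
 hence "rate_int R T0 E m q = (\<integral>\<^sup>+t. liminf (%k. ?u k t) \<partial>lborel)"
  unfolding rate_int_def by (rule nn_integral_cong_AE)
 also have "... <= liminf (%k. \<integral>\<^sup>+t. ?u k t \<partial>lborel)" by (rule nn_integral_liminf[OF um])
 also have "... <= limsup (%k. \<integral>\<^sup>+t. ?u k t \<partial>lborel)" by (rule Liminf_le_Limsup) simp
 also have "... <= ennreal a" using ui by (intro Limsup_bounded) auto
 finally show ?thesis .
qed

end

end

section \<open>Compactness and measurability\<close>

text \<open>The circles are laid out on the real line at distance \<open>3 T0\<close>, where Helly's theorem applies.\<close>
lemma circle_seq_compact:
 fixes nu :: "nat => ('a::finite * real) measure"
 assumes T0: "T0 > 0" and nu: "!!n. circle_measure T0 (nu n)" and S: "!!n. measure (nu n) UNIV <= S"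
 obtains r nu' where "strict_mono r" "circle_measure T0 nu'"
  "ALL f. cont_per T0 f --> (%n. \<integral>p. f (fst p) (snd p) \<partial>nu (r n)) \<longlonglongrightarrow> (itg nu' f)"
proof -
 define s where "s n = measure (nu n) UNIV" for n
 obtain s' r1 where s': "s' : {0..S}" "strict_mono r1" "(s \<circ> r1) \<longlonglongrightarrow> s'"
  using seq_compactE[OF compact_imp_seq_compact[OF compact_Icc], of s 0 S] S by (auto simp: s_def)
 note U = SpV_sets(1)[where 'a = 'a]
 \<comment> \<open>Helly's theorem is for probability measures. Masses are split off as
   \<open>s n\<close>; if the mass is zero a point mass stands in, which the factor
   \<open>s n\<close> then annihilates.\<close>
 define P where "P n = (if s n = 0 then return SpV (undefined, 0) else density (nu n) (%_. ennreal (1 / s n)))" for n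
 have P: "circle_measure T0 (P n)" "prob_space (P n)"
  and Pi: "cont_per T0 f ==> (itg (nu n) f) = s n * itg (P n) f" for n f
 proof -
  note c = circle_measureD[OF nu[of n]]
  interpret finite_measure "nu n" by (rule c(1))
  note Z = SpV_sets(2)[where 'a = 'a, of T0]
  have c0: "emeasure (nu n) (UNIV - UNIV \<times> {0..<T0}) = 0" using nu[of n] c(3) by (simp add: circle_measure_def)
  have "circle_measure T0 (P n) & emeasure (P n) (space (P n)) = 1 &
   (cont_per T0 f --> (itg (nu n) f) = s n * itg (P n) f)"
  proof (cases "s n = 0")
   case True
   hence "emeasure (nu n) (space (nu n)) = 0" using c(3) by (simp add: s_def emeasure_eq_measure)
   hence "AE p in nu n. False" using AE_iff_measurable[of "space (nu n)" "nu n" "%_. False"] by simp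
   hence "itg (nu n) f = 0" by (intro integral_eq_zero_AE) auto
   thus ?thesis using True T0 U Z by (simp add: P_def circle_measure_def)
  next
   case False
   hence sp: "s n > 0" using measure_nonneg[of "nu n" UNIV] by (simp add: s_def less_le)
   have e: "emeasure (P n) A = ennreal (1 / s n) * emeasure (nu n) A" if "A : sets SpV" for A
    using False that c(2) by (simp add: P_def emeasure_density_const)
   have "emeasure (P n) UNIV = 1" using e[OF U] sp by (simp add: emeasure_eq_measure s_def[symmetric] ennreal_mult'[symmetric])
   moreover have "space (P n) = UNIV" "sets (P n) = sets SpV" using False c by (auto simp: P_def)
   moreover have "itg (nu n) f = s n * itg (P n) f" if "cont_per T0 f"
    using False sp circle_measurable[OF nu cont_per_measurable[OF that]] by (simp add: P_def integral_density)
   ultimately show ?thesis using e[OF Z] c0 by (simp add: circle_measure_def)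
  qed
  thus "circle_measure T0 (P n)" "prob_space (P n)"
   "cont_per T0 f ==> (itg (nu n) f) = s n * itg (P n) f"
   by (auto intro: prob_spaceI)
 qed
 \<comment> \<open>Circle \<open>y\<close> occupies the interval from \<open>c y\<close> to
   \<open>c y + T0\<close>. The offsets are multiples of \<open>T0\<close>, so periodic functions
   are unaffected, and the gaps of length \<open>2 * T0\<close> leave room for the ramps of
   \<open>hat\<close>.\<close>
 define c where "c y = real_of_int (3 * int (to_nat y)) * T0" for y :: 'a
 define Z where "Z = (\<Union>y. {c y..c y + T0})"
 define code where "code q = c (fst q) + snd q" for q :: "'a * real"
 define dec where "dec x = (from_nat (nat \<lfloor>x / (3 * T0)\<rfloor>) :: 'a, pmod x T0)" for x
 define hat where "hat u = max 0 (1 - max 0 (max (- u) (u - T0)) / T0)" for u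
 define F where "F f x = (SUM y:UNIV. f y x * hat (x - c y))" for f and x :: real
 have hat: "continuous_on UNIV (%x. hat (x - c y))" "abs (hat u) <= 1" for y u
  unfolding hat_def using T0 by (auto intro!: continuous_intros)
 have dec: "dec x = (y, pmod x T0)" and Ff: "F f x = f y x" if x: "x : {c y..c y + T0}" for x y f
 proof -
  have "\<lfloor>x / (3 * T0)\<rfloor> = int (to_nat y)"
   unfolding floor_eq_iff using x T0 by (auto simp: c_def field_simps)
  thus "dec x = (y, pmod x T0)" by (simp add: dec_def)
  have "hat (x - c z) = 0" if "z ~= y" for z
  proof -
   have "to_nat z ~= to_nat y" using that by simp
   then consider "real (to_nat z) + 1 <= real (to_nat y)" | "real (to_nat y) + 1 <= real (to_nat z)" by linarith
   hence "c z + 3 * T0 <= c y | c y + 3 * T0 <= c z"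
   proof cases
    case 1 thus ?thesis using mult_right_mono[OF 1, of "3 * T0"] T0 by (simp add: c_def algebra_simps)
   next
    case 2 thus ?thesis using mult_right_mono[OF 2, of "3 * T0"] T0 by (simp add: c_def algebra_simps)
   qed
   hence "T0 <= max 0 (max (- (x - c z)) (x - c z - T0))" using x T0 by auto
   hence "1 <= max 0 (max (- (x - c z)) (x - c z - T0)) / T0" using T0 by simp
   thus ?thesis by (simp add: hat_def)
  qed
  hence "f z x * hat (x - c z) = (if z = y then f y x else 0)" for z using x by (auto simp: hat_def)
  thus "F f x = f y x" by (simp add: F_def)
 qed
 have codem: "code : borel_measurable SpV" unfolding code_def[abs_def] by (rule SpV_measurable) auto
 have codeZ: "code q : Z" "F f (code q) = f (fst q) (snd q)" if "snd q : {0..<T0}" "cont_per T0 f" for q f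
 proof -
  have x: "code q : {c (fst q)..c (fst q) + T0}" using that by (simp add: code_def)
  thus "code q : Z" by (auto simp: Z_def)
  show "F f (code q) = f (fst q) (snd q)"
   using Ff[OF x, of f] periodic_add_int[of "f (fst q)" T0 "snd q" "3 * int (to_nat (fst q))"] cont_perD(2)[OF that(2)]
   by (simp add: code_def c_def add.commute)
 qed
 have decm: "dec : measurable borel SpV" unfolding dec_def[abs_def] by measurable
 have Zc: "closed Z" "Z ~= {}" "bounded Z" unfolding Z_def using T0 by auto
 define D where "D n = distr (P n) borel code" for n
 have codem': "code : borel_measurable (P n)" for n by (rule circle_measurable[OF P(1) codem])
 have Dd: "real_distribution (D n)" for n
  unfolding D_def using prob_space.real_distribution_distr[OF P(2) codem'] .
 have cp1: "cont_per T0 (%y::'a. %t. 0)" by (simp add: cont_per_def)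
 have AZ: "AE q in P n. code q : Z" for n
  using circle_measureD(4)[OF P(1)[of n]] by eventually_elim (rule codeZ(1)[OF _ cp1])
 have "tight D"
  unfolding tight_def
 proof (intro conjI allI impI Dd)
  fix e :: real assume e: "e > 0"
  obtain b where b: "ALL x:Z. abs x <= b" using Zc(3) by (auto simp: bounded_real)
  have "measure (D n) {- b - 1<..abs b} = 1" for n
  proof -
   interpret prob_space "P n" by (rule P(2))
   have "AE q in P n. code q : {- b - 1<..abs b}" using AZ
   proof eventually_elim
    case (elim q)
    hence "abs (code q) <= b" using b by blast
    thus ?case by (auto simp: abs_le_iff)
   qed
   thus ?thesis unfolding D_def using codem' by (simp add: measure_distr prob_eq_1 vimage_def Int_def conj_commute)
  qed
  moreover have "b >= 0" using b Zc(2) by (metis abs_ge_zero ex_in_conv order_trans)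
  ultimately show "EX a b. a < b & (ALL n. 1 - e < measure (D n) {a<..b})" using e by (intro exI[of _ "- b - 1"] exI[of _ "abs b"]) auto
 qed
 from tight_imp_convergent_subsubsequence[OF this s'(2)] obtain r2 D'
  where r2: "strict_mono r2" "real_distribution D'" "weak_conv_m (D \<circ> r1 \<circ> r2) D'" by blast
 have conv: "(%n. integral\<^sup>L (D (r1 (r2 n))) h) \<longlonglongrightarrow> integral\<^sup>L D' h"
  if "continuous_on UNIV h" "!!x. abs (h x) <= K" for h :: "real => real" and K
  using weak_conv_imp_integral_bdd_continuous_conv[OF _ r2(2,3), of h K] Dd that
  by (simp add: continuous_on_eq_continuous_at)
 interpret D': real_distribution D' by (rule r2(2))
 have "AE x in D'. x : Z"
 proof -
  \<comment> \<open>A bounded continuous function that vanishes exactly on the closed set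
    \<open>Z\<close>: its integrals survive the weak limit and show that the limit is concentrated
    on \<open>Z\<close>.\<close>
  let ?w = "%x. min 1 (infdist x Z)"
  have wc: "continuous_on UNIV ?w" by (intro continuous_intros)
  have wb: "abs (?w x) <= 1" for x using infdist_nonneg[of x Z] by auto
  have "integral\<^sup>L (D n) ?w = 0" for n
  proof -
   have "integral\<^sup>L (D n) ?w = (LINT q|P n. ?w (code q))"
    unfolding D_def using wc by (intro integral_distr codem' borel_measurable_continuous_onI)
   also have "... = 0" by (intro integral_eq_zero_AE eventually_mono[OF AZ]) simp
   finally show ?thesis .
  qed
  hence "integral\<^sup>L D' ?w = 0" using conv[OF wc wb] by (simp add: LIMSEQ_const_iff)
  moreover have "integrable D' ?w"
   using wb borel_measurable_continuous_onI[OF wc] by (intro D'.integrable_const_bound[of _ 1]) auto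
  ultimately have "AE x in D'. ?w x = 0" by (subst (asm) integral_nonneg_eq_0_iff_AE) (auto simp: infdist_nonneg)
  thus ?thesis by eventually_elim (use Zc in \<open>auto simp: in_closed_iff_infdist_zero min_def split: if_splits\<close>)
 qed
 note AZ' = this
 \<comment> \<open>In the limit mass may sit at a right end \<open>c y + T0\<close>;
   \<open>dec\<close> wraps it to time 0, which periodic functions cannot distinguish.\<close>
 define nu' where "nu' = density (distr D' SpV dec) (%_. ennreal s')"
 have decm': "dec : measurable D' SpV" using decm by simp
 have nu': "circle_measure T0 nu'"
 proof -
  note m = SpV_sets(2)[where 'a = 'a, of T0]
  have "dec -` (UNIV - UNIV \<times> {0..<T0}) = {}" using pmod_bounds[OF T0] by (auto simp: dec_def)
  hence "emeasure (distr D' SpV dec) (UNIV - UNIV \<times> {0..<T0}) = 0" by (simp add: emeasure_distr[OF decm' m])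
  moreover have "emeasure (distr D' SpV dec) UNIV = 1"
   using emeasure_distr[OF decm' U] D'.emeasure_space_1 by simp
  ultimately show ?thesis using U m by (simp add: circle_measure_def nu'_def emeasure_density_const)
 qed
 have "(%n. \<integral>p. f (fst p) (snd p) \<partial>nu (r1 (r2 n))) \<longlonglongrightarrow> (itg nu' f)" if f: "cont_per T0 f" for f
 proof -
  obtain K where K: "K >= 0" "!!y t. abs (f y t) <= K" using cont_per_bounded[OF f T0] by blast
  have Fc: "continuous_on UNIV (F f)" unfolding F_def[abs_def] by (intro continuous_intros cont_perD(1)[OF f] hat)
  have "abs (f y x * hat u) <= K" for y x u using mult_mono[OF K(2)[of y x] hat(2)[of u] K(1)] by (simp add: abs_mult)
  hence Fb: "abs (F f x) <= real CARD('a) * K" for x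
   unfolding F_def using sum_norm_bound[of UNIV "%y. f y x * hat (x - c y)" K] by (simp add: real_norm_def)
  have "integral\<^sup>L (D n) (F f) = itg (P n) f" for n
  proof -
   have "integral\<^sup>L (D n) (F f) = (LINT q|P n. F f (code q))"
    unfolding D_def using Fc by (intro integral_distr codem' borel_measurable_continuous_onI)
   also have "... = itg (P n) f"
    by (intro integral_cong_AE circle_measurable[OF P(1) cont_per_measurable[OF f]] measurable_compose[OF codem']
      borel_measurable_continuous_onI[OF Fc] eventually_mono[OF circle_measureD(4)[OF P(1)[of n]]] codeZ(2)[OF _ f])
   finally show ?thesis .
  qed
  hence "itg (nu n) f = s n * integral\<^sup>L (D n) (F f)" for n by (simp add: Pi[OF f])
  moreover have "(%n. s (r1 (r2 n)) * integral\<^sup>L (D (r1 (r2 n))) (F f)) \<longlonglongrightarrow> s' * integral\<^sup>L D' (F f)"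
   using LIMSEQ_subseq_LIMSEQ[OF s'(3) r2(1)] by (intro tendsto_mult conv[OF Fc Fb]) (simp add: comp_def)
  moreover have "s' * integral\<^sup>L D' (F f) = itg nu' f"
  proof -
   note fm = cont_per_measurable[OF f]
   have "itg nu' f = s' * itg (distr D' SpV dec) f"
    unfolding nu'_def using fm s'(1) by (subst integral_density) auto
   also have "itg (distr D' SpV dec) f = (LINT x|D'. f (fst (dec x)) (snd (dec x)))"
    by (rule integral_distr[OF decm' fm])
   also have "... = integral\<^sup>L D' (F f)"
   proof (rule integral_cong_AE)
    show "AE x in D'. f (fst (dec x)) (snd (dec x)) = F f x"
     using AZ'
    proof eventually_elim
     case (elim x)
     then obtain y where "x : {c y..c y + T0}" by (auto simp: Z_def)
     thus ?case using dec[of x y] Ff[of x y f] periodic_pmod[of "f y" T0 x] cont_perD(2)[OF f] by simp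
    qed
   qed (use measurable_compose[OF decm' fm] borel_measurable_continuous_onI[OF Fc] in auto)
   finally show ?thesis by simp
  qed
  ultimately show ?thesis by simp
 qed
 thus ?thesis using that[of "r1 \<circ> r2" nu'] s'(2) r2(1) nu' by (simp add: strict_mono_o)
qed

text \<open>The linear correction makes the values at 0 and \<open>T0\<close> agree.\<close>
definition mono_per :: "real => nat => real => real" where
 "mono_per T0 k t = pmod t T0 ^ k - (T0 ^ k - 0 ^ k) * pmod t T0 / T0"

lemma mono_per_cont: "T0 > 0 ==> continuous_on UNIV (mono_per T0 k)" "T0 > 0 ==> mono_per T0 k (t + T0) = mono_per T0 k t"
 unfolding mono_per_def[abs_def]
 by (rule continuous_pmod_extension[where v = "%u. u ^ k - (T0 ^ k - 0 ^ k) * u / T0"]) (auto intro!: continuous_intros)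

lemma mono_per_dense:
 assumes T0: "T0 > 0" and f: "continuous_on UNIV f" "!!t. f (t + T0) = f t" and e: "e > 0"
 shows "EX a n. ALL t. abs (f t - (SUM k<=n. a k * mono_per T0 k t)) <= e"
proof -
 obtain g where g: "real_polynomial_function g" "!!u. u : {0..T0} ==> abs (f u - g u) < e / 3"
  using Stone_Weierstrass_real_polynomial_function[of "{0..T0}" f "e / 3"] continuous_on_subset[OF f(1)] e by auto
 then obtain a n where a: "g = (%x. SUM i<=n. a i * x ^ i)" using real_polynomial_function_iff_sum by auto
 have "abs (f t - (SUM k<=n. a k * mono_per T0 k t)) <= e" for t
 proof -
  define u where "u = pmod t T0"
  have u: "0 <= u" "u < T0" "f u = f t" using pmod_bounds[OF T0] periodic_pmod[of f T0 t] f(2) by (auto simp: u_def)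
  \<comment> \<open>The effect of the linear correction. As \<open>f\<close> agrees at 0 and
    \<open>T0\<close>, the polynomial nearly does, and the correction costs at most twice the
    approximation error.\<close>
  define v where "v = (g T0 - g 0) * (u / T0)"
  have "a k * mono_per T0 k t = a k * u ^ k - (a k * T0 ^ k - a k * 0 ^ k) * (u / T0)" for k
   using T0 by (simp add: mono_per_def u_def[symmetric] field_simps)
  hence "(SUM k<=n. a k * mono_per T0 k t) = g u - v"
   unfolding v_def a by (simp only: sum_subtractf sum_distrib_right[symmetric])
  moreover have "f T0 = f 0" using f(2)[of 0] by simp
  hence "abs (g T0 - g 0) <= 2 * (e / 3)" using g(2)[of 0] g(2)[of T0] T0 by (simp only: atLeastAtMost_iff) linarith
  hence "abs v <= 2 * (e / 3) * 1"
   unfolding abs_mult v_def using u T0 e by (intro mult_mono) auto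
  moreover have "abs (f t - g u) < e / 3" using g(2)[of u] u by simp
  ultimately show ?thesis by linarith
 qed
 thus ?thesis by blast
qed

text \<open>Reduces the lower bound to finitely many functionals. A pair with one component zero
  yields each of the two kinds of subbasic sets; finite intersections take the union of families and
  the smaller radius.\<close>

lemma weak_nbhd:
 assumes "generate_topology_on ({{(mu, Q). (itg mu f) : U} | f U. cont_per T0 f & open U} \<union>
   {{(mu, Q). (itg Q g) : U} | g U. cont_per T0 g & open U}) W" "PQ : W"
 shows "EX S e. finite S & e > 0 & (ALL F:S. cont_per T0 (fst F) & cont_per T0 (snd F)) &
  {PQ'. ALL F:S. abs (ev (fst F) (snd F) PQ' - ev (fst F) (snd F) PQ) < e} \<subseteq> W"
 using assms
proof (induction rule: generate_topology_on.induct)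
 case (Int a b)
 obtain S e where S: "finite S" "e > 0" "ALL F:S. cont_per T0 (fst F) & cont_per T0 (snd F)"
  "{PQ'. ALL F:S. abs (ev (fst F) (snd F) PQ' - ev (fst F) (snd F) PQ) < e} \<subseteq> a" using Int by auto
 obtain S' e' where S': "finite S'" "e' > 0" "ALL F:S'. cont_per T0 (fst F) & cont_per T0 (snd F)"
  "{PQ'. ALL F:S'. abs (ev (fst F) (snd F) PQ' - ev (fst F) (snd F) PQ) < e'} \<subseteq> b" using Int by auto
 show ?case using S S' by (intro exI[of _ "S \<union> S'"] exI[of _ "min e e'"]) auto
next
 case (UN K)
 thus ?case by (meson UnionE Union_upper order_trans)
next
 case (Basis s)
 have nb: "EX e>0. ALL v. abs (v - v0) < e --> v : U" if "open U" "v0 : U" for U and v0 :: real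
  using that unfolding open_real by (metis)
 from Basis(1) consider f U where "s = {(mu, Q). (itg mu f) : U}" "cont_per T0 f" "open U"
  | g U where "s = {(mu, Q). (itg Q g) : U}" "cont_per T0 g" "open U" by blast
 thus ?case
 proof cases
  case 1
  then obtain e where "e > 0" "ALL v. abs (v - itg (fst PQ) f) < e --> v : U" using nb[of U] Basis(2) by (cases PQ) auto
  thus ?thesis using 1 by (intro exI[of _ "{(f, %_ _. 0)}"] exI[of _ e]) (auto simp: ev_def cont_per_def)
 next
  case 2
  then obtain e where "e > 0" "ALL v. abs (v - itg (snd PQ) g) < e --> v : U" using nb[of U] Basis(2) by (cases PQ) auto
  thus ?thesis using 2 by (intro exI[of _ "{(%_ _. 0, g)}"] exI[of _ e]) (auto simp: ev_def cont_per_def)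
 qed
qed auto

lemma Mstar_topspace: "topspace (Mstar_top T0 E) = Mstar T0 E"
proof -
 have "UNIV : {{(mu, Q). (itg mu f) : U} | f U. cont_per T0 f & open U}"
  by (rule CollectI, rule exI[of _ "%_ _. 0"], rule exI[of _ UNIV]) (auto simp: cont_per_def)
 thus ?thesis unfolding Mstar_top_def weak_top_def by (auto simp: topology_generated_by_topspace)
qed

lemma Mstar_nbhd:
 assumes "openin (Mstar_top T0 E) G" "PQ : G"
 obtains S e where "finite S" "e > 0" "ALL F:S. cont_per T0 (fst F) & cont_per T0 (snd F)"
  "{PQ' : Mstar T0 E. ALL F:S. abs (ev (fst F) (snd F) PQ' - ev (fst F) (snd F) PQ) < e} \<subseteq> G"
proof -
 obtain W where W: "openin (weak_top T0) W" "G = W \<inter> Mstar T0 E"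
  using assms(1) unfolding Mstar_top_def openin_subtopology by blast
 from weak_nbhd[OF W(1)[unfolded weak_top_def openin_topology_generated_by_iff], of PQ] assms(2) W(2) that
 show ?thesis by blast
qed

lemma ev_openin:
 assumes f: "cont_per T0 f" and g: "cont_per T0 g" and U: "open U"
 shows "openin (Mstar_top T0 E) {PQ : Mstar T0 E. ev f g PQ : U}"
proof -
 let ?S = "{{(mu, Q). (itg mu f) : U} | f U. cont_per T0 f & open U} \<union>
   {{(mu, Q). (itg Q g) : U} | g U. cont_per T0 g & open U}"
 have "openin (weak_top T0) {PQ. (itg (fst PQ) f) : V}"
  "openin (weak_top T0) {PQ. (itg (snd PQ) g) : V}" if "open V" for V
  unfolding weak_top_def using that f g
  by (auto intro!: topology_generated_by_Basis exI[of _ f] exI[of _ g] exI[of _ V] simp: case_prod_beta)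
 hence "openin (Mstar_top T0 E) {PQ : Mstar T0 E. (itg (fst PQ) f) : V}"
  "openin (Mstar_top T0 E) {PQ : Mstar T0 E. (itg (snd PQ) g) : V}" if "open V" for V
  using that unfolding Mstar_top_def openin_subtopology by blast+
 hence "continuous_map (Mstar_top T0 E) euclideanreal (%PQ. \<integral>p. f (fst p) (snd p) \<partial>fst PQ)"
  "continuous_map (Mstar_top T0 E) euclideanreal (%PQ. \<integral>p. g (fst p) (snd p) \<partial>snd PQ)"
  unfolding continuous_map_def Mstar_topspace by auto
 from continuous_map_add[OF this] have "continuous_map (Mstar_top T0 E) euclideanreal (ev f g)" by (simp add: ev_def[abs_def])
 thus ?thesis using U unfolding continuous_map_def Mstar_topspace by auto
qed

lemma ev_sum:
 fixes E :: "('v::finite * 'v) set"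
 assumes PQ: "PQ : Mstar T0 E" and T0: "T0 > 0" and fg: "!!j. cont_per T0 (f j)" "!!j. cont_per T0 (g j)"
 shows "ev (%y t. SUM j:J. a j * f j y t) (%e t. SUM j:J. a j * g j e t) PQ = (SUM j:J. a j * ev (f j) (g j) PQ)"
proof -
 obtain mu Q where PQ': "PQ = (mu, Q)" "(mu, Q) : Mstar T0 E" using PQ by (cases PQ) auto
 show ?thesis
  using cont_per_integrable[OF Mstar_circle(1)[OF PQ'(2)] T0 fg(1)] cont_per_integrable[OF Mstar_circle(2)[OF PQ'(2)] T0 fg(2)]
  by (simp add: ev_def PQ'(1) sum.distrib[symmetric] distrib_left)
qed

lemma ev_close:
 fixes E :: "('v::finite * 'v) set"
 assumes PQ: "PQ : Mstar T0 E" and T0: "T0 > 0" and fg: "cont_per T0 f" "cont_per T0 g" "cont_per T0 f'" "cont_per T0 g'"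
  and d: "!!y t. abs (f y t - f' y t) <= d" "!!e t. abs (g e t - g' e t) <= d"
 shows "abs (ev f g PQ - ev f' g' PQ) <= d * (T0 + ev (%_ _. 0) (%_ _. 1) PQ)"
proof -
 obtain mu Q where PQ': "PQ = (mu, Q)" "(mu, Q) : Mstar T0 E" using PQ by (cases PQ) auto
 note c = Mstar_circle[OF PQ'(2)]
 have le: "abs ((itg nu u) - itg nu u') <= d * measure nu UNIV"
  if nu: "circle_measure T0 nu" and u: "cont_per T0 u" "cont_per T0 u'" "!!y t. abs (u y t - u' y t) <= d" for nu and u u' :: "'b::finite => real => real"
 proof -
  interpret finite_measure nu by (rule circle_measureD(1)[OF nu])
  note i = cont_per_integrable[OF nu T0 u(1)] cont_per_integrable[OF nu T0 u(2)]
  have "abs ((itg nu u) - itg nu u') = abs (\<integral>p. u (fst p) (snd p) - u' (fst p) (snd p) \<partial>nu)" using i by simp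
  also have "... <= (LINT p|nu. abs (u (fst p) (snd p) - u' (fst p) (snd p)))" by (rule integral_abs_bound)
  also have "... <= (LINT p|nu. d)" using i u(3) by (intro integral_mono) auto
  finally show ?thesis using circle_measureD(3)[OF nu] by (simp add: mult.commute)
 qed
 have "measure mu UNIV = T0" using c(4) T0 circle_measureD(3)[OF c(1)] by (simp add: measure_def)
 thus ?thesis
  using le[OF c(1) fg(1,3) d(1)] le[OF c(2) fg(2,4) d(2)] circle_measureD(3)[OF c(2)]
  by (simp add: ev_def PQ'(1) distrib_left)
qed

definition coord_f :: "real => ('v + 'v * 'v) \<times> nat => 'v tfun" where
 "coord_f T0 j y t = (if fst j = Inl y then mono_per T0 (snd j) t else 0)"

definition coord_g :: "real => ('v + 'v * 'v) \<times> nat => ('v * 'v) tfun" where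
 "coord_g T0 j e t = (if fst j = Inr e then mono_per T0 (snd j) t else 0)"

text \<open>Countably many functionals that determine the weak topology: open sets are pulled back from
 a countable product of real lines, so they are measurable, and sequential compactness implies compactness.\<close>
definition coords :: "real => ('v * real) measure \<times> (('v * 'v) * real) measure => ('v + 'v * 'v) \<times> nat => real" where
 "coords T0 PQ j = ev (coord_f T0 j) (coord_g T0 j) PQ"

lemma coord_cont_per: "T0 > 0 ==> cont_per T0 (coord_f T0 j)" "T0 > 0 ==> cont_per T0 (coord_g T0 j)"
proof -
 have "coord_f T0 j y = (if fst j = Inl y then mono_per T0 (snd j) else (%_. 0))"
  "coord_g T0 j x = (if fst j = Inr x then mono_per T0 (snd j) else (%_. 0))" for y x
  by (auto simp: coord_f_def coord_g_def fun_eq_iff)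
 thus "T0 > 0 ==> cont_per T0 (coord_f T0 j)" "T0 > 0 ==> cont_per T0 (coord_g T0 j)"
  using mono_per_cont by (simp_all add: cont_per_def)
qed

text \<open>Uniform approximation by coordinates costs \<open>d\<close> times the total mass
  \<open>T0 + Q(1)\<close>. The mass of \<open>Q\<close> is unbounded on \<open>Mstar\<close>, so
  the neighbourhood also keeps it below its value at \<open>PQ\<close> plus 1, and \<open>d\<close>
  is chosen for that enlarged mass.\<close>

lemma ev_coords:
 fixes f :: "'v::finite => real => real"
 assumes T0: "T0 > 0" and fg: "cont_per T0 f" "cont_per T0 g" and PQ: "PQ : Mstar T0 E" and e: "e > 0"
 obtains U where "open U" "coords T0 PQ : U" "!!PQ'. PQ' : Mstar T0 E ==> coords T0 PQ' : U ==> abs (ev f g PQ' - ev f g PQ) < e"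
proof -
 let ?m = "ev (%_ _. 0) (%_ _. 1)"
 have mnn: "0 <= ?m PQ'" for PQ' :: "('v * real) measure \<times> (('v * 'v) * real) measure" by (simp add: ev_def)
 define d where "d = e / (4 * (T0 + ?m PQ + 1))"
 have d: "d > 0" using e T0 mnn[of PQ] by (simp add: d_def)
 define h where "h i = (case i of Inl y => f y | Inr x => g x)" for i
 have "ALL i. EX a n. ALL t. abs (h i t - (SUM k<=n. a k * mono_per T0 k t)) <= d"
  using cont_perD[OF fg(1)] cont_perD[OF fg(2)] by (auto intro!: mono_per_dense[OF T0 _ _ d] simp: h_def split: sum.split)
 then obtain a n where a: "!!i t. abs (h i t - (SUM k<=n i. a i k * mono_per T0 k t)) <= d" by metis
 define J where "J = (SIGMA i:UNIV. {..n i})"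
 have h0: "(SUM j:J. a (fst j) (snd j) * (if fst j = i then mono_per T0 (snd j) t else 0)) = (SUM k<=n i. a i k * mono_per T0 k t)" for i t
 proof -
  have "(SUM k<=n i'. a i' k * (if i' = i then mono_per T0 k t else 0)) = (if i' = i then SUM k<=n i. a i k * mono_per T0 k t else 0)" for i' by simp
  moreover have "(SUM i':UNIV. SUM k<=n i'. a i' k * (if i' = i then mono_per T0 k t else 0))
    = (SUM j:J. a (fst j) (snd j) * (if fst j = i then mono_per T0 (snd j) t else 0))"
   unfolding J_def by (subst sum.Sigma) (auto simp: case_prod_beta)
  ultimately show ?thesis by simp
 qed
 define l where "l th = (SUM j:J. a (fst j) (snd j) * th j)" for th :: "_ => real"
 \<comment> \<open>\<open>mono_per T0 0\<close> is the constant 1, so \<open>m\<close> recovers the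
   total mass of \<open>Q\<close> from the coordinates.\<close>
 define m where "m th = (SUM j:range Inr \<times> {0}. th j)" for th :: "('v + 'v * 'v) \<times> nat => real"
 have cl: "continuous_on UNIV l" "continuous_on UNIV m"
  unfolding l_def[abs_def] m_def[abs_def] by (intro continuous_intros continuous_on_product_coordinates)+
 let ?J = "range Inr \<times> {0} :: (('v + 'v * 'v) \<times> nat) set"
 have mm: "m (coords T0 PQ') = ?m PQ'" if "PQ' : Mstar T0 E" for PQ' :: "('v * real) measure \<times> (('v * 'v) * real) measure"
 proof -
  have "(SUM j:?J. 1 * coord_f T0 j y t) = 0" "(SUM j:?J. 1 * coord_g T0 j x t) = 1" for y :: 'v and x :: "'v * 'v" and t
  proof -
   show "(SUM j:?J. 1 * coord_f T0 j y t) = 0" by (rule sum.neutral) (auto simp: coord_f_def)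
   have "(SUM j:?J. 1 * coord_g T0 j x t) = (SUM j:?J. if j = (Inr x, 0) then 1 else 0)"
    by (rule sum.cong) (auto simp: coord_g_def mono_per_def)
   thus "(SUM j:?J. 1 * coord_g T0 j x t) = 1" by simp
  qed
  thus ?thesis
   using ev_sum[OF that T0, of "coord_f T0" "coord_g T0", OF coord_cont_per[OF T0], where J = "?J" and a = "%_. 1"] by (simp add: m_def coords_def)
 qed
 have ll: "abs (ev f g PQ' - l (coords T0 PQ')) <= d * (T0 + ?m PQ')" if "PQ' : Mstar T0 E" for PQ'
 proof -
  have "l (coords T0 PQ') = ev (%y t. SUM j:J. a (fst j) (snd j) * coord_f T0 j y t) (%e t. SUM j:J. a (fst j) (snd j) * coord_g T0 j e t) PQ'"
   unfolding l_def coords_def by (rule ev_sum[OF that T0 coord_cont_per[OF T0], symmetric])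
  thus ?thesis
   using a[of "Inl _"] a[of "Inr _"] fg h0[of "Inl _"] h0[of "Inr _"] T0
   by (simp only:) (intro ev_close[OF that T0], auto simp: h_def coord_f_def coord_g_def cont_per_def mono_per_cont intro!: continuous_intros)
 qed
 let ?U = "{th. abs (l th - l (coords T0 PQ)) < e / 4} \<inter> {th. m th < m (coords T0 PQ) + 1}"
 have "open ?U" by (intro open_Int open_Collect_less continuous_intros cl)
 moreover have "abs (ev f g PQ' - ev f g PQ) < e" if PQ': "PQ' : Mstar T0 E" "coords T0 PQ' : ?U" for PQ'
 proof -
  have "d * (T0 + ?m PQ') <= d * (T0 + ?m PQ + 1)" using d PQ'(2) mm[OF PQ] mm[OF PQ'(1)] by (intro mult_left_mono) auto
  moreover have "d * (T0 + ?m PQ) <= d * (T0 + ?m PQ + 1)" using d by (intro mult_left_mono) auto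
  moreover have "d * (T0 + ?m PQ + 1) = e / 4"
   using T0 mnn[of PQ] nonzero_mult_div_cancel_right[of "T0 + ?m PQ + 1" "e / 4"] by (simp add: d_def)
  ultimately show ?thesis using ll[OF PQ] ll[OF PQ'(1)] PQ'(2) e by auto
 qed
 ultimately show ?thesis using that[of ?U] e by auto
qed

lemma Mstar_open_coords:
 fixes E :: "('v::finite * 'v) set"
 assumes T0: "T0 > 0" and G: "openin (Mstar_top T0 E) G"
 obtains U where "open U" "G = {PQ : Mstar T0 E. coords T0 PQ : U}"
proof -
 have GM: "G \<subseteq> Mstar T0 E" using openin_subset[OF G] by (simp add: Mstar_topspace)
 have "EX U. open U & coords T0 PQ : U & {PQ' : Mstar T0 E. coords T0 PQ' : U} \<subseteq> G" if PQ: "PQ : G" for PQ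
 proof -
  obtain S e where S: "finite S" "e > 0" "ALL F:S. cont_per T0 (fst F) & cont_per T0 (snd F)"
   "{PQ' : Mstar T0 E. ALL F:S. abs (ev (fst F) (snd F) PQ' - ev (fst F) (snd F) PQ) < e} \<subseteq> G" by (rule Mstar_nbhd[OF G PQ])
  have "ALL F:S. EX U. open U & coords T0 PQ : U & (ALL PQ':Mstar T0 E. coords T0 PQ' : U --> abs (ev (fst F) (snd F) PQ' - ev (fst F) (snd F) PQ) < e)"
  proof
   fix F assume F: "F : S"
   show "EX U. open U & coords T0 PQ : U & (ALL PQ':Mstar T0 E. coords T0 PQ' : U --> abs (ev (fst F) (snd F) PQ' - ev (fst F) (snd F) PQ) < e)"
    by (rule ev_coords[OF T0, of "fst F" "snd F" PQ E e]) (use S(2,3) F PQ GM in blast)+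
  qed
  then obtain U where U: "ALL F:S. open (U F) & coords T0 PQ : U F & (ALL PQ':Mstar T0 E. coords T0 PQ' : U F --> abs (ev (fst F) (snd F) PQ' - ev (fst F) (snd F) PQ) < e)"
   by (rule bchoice[THEN exE])
  hence "{PQ' : Mstar T0 E. coords T0 PQ' : (INT F:S. U F)} \<subseteq> G" "coords T0 PQ : (INT F:S. U F)" using S(4) by blast+
  thus ?thesis using U S(1) by (intro exI[of _ "INT F:S. U F"]) (simp add: open_INT)
 qed
 hence "ALL PQ:G. EX U. open U & coords T0 PQ : U & {PQ' : Mstar T0 E. coords T0 PQ' : U} \<subseteq> G" by blast
 then obtain U where U: "ALL PQ:G. open (U PQ) & coords T0 PQ : U PQ & {PQ' : Mstar T0 E. coords T0 PQ' : U PQ} \<subseteq> G"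
  by (rule bchoice[THEN exE])
 have "G = {PQ : Mstar T0 E. coords T0 PQ : (UN PQ:G. U PQ)}" using U GM by blast
 moreover have "open (UN PQ:G. U PQ)" using U by (intro open_UN) blast
 ultimately show ?thesis using that by blast
qed

text \<open>Both masses are bounded, so both components have convergent subsequences. The image
  under \<open>coords\<close> is therefore sequentially compact in a metrisable product, hence
  compact, and since open sets are preimages under \<open>coords\<close>, covers can be moved to the
  image and back.\<close>

lemma Mstar_compact:
 fixes E :: "('v::finite * 'v) set"
 assumes T0: "T0 > 0"
 shows "compactin (Mstar_top T0 E) {PQ : Mstar T0 E. ev (%_ _. 0) (%_ _. 1) PQ <= b}" (is "compactin _ ?K")
proof -
 have "seq_compact (coords T0 ` ?K)"
 proof (rule seq_compactI)
  fix th :: "nat => ('v + 'v * 'v) \<times> nat => real" assume "ALL n. th n : coords T0 ` ?K"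
  hence "ALL n. EX PQ. PQ : ?K & th n = coords T0 PQ" by blast
  from choice[OF this] obtain PQ where PQ: "!!n. PQ n : ?K" "!!n. th n = coords T0 (PQ n)" by blast
  have K: "(fst (PQ n), snd (PQ n)) : Mstar T0 E" for n using PQ(1)[of n] by simp
  note c = Mstar_circle[OF K]
  have T: "measure (fst (PQ n)) UNIV = T0" for n using c(4)[of n] T0 circle_measureD(3)[OF c(1)] by (simp add: measure_def)
  have K2: "measure (snd (PQ n)) UNIV <= b" for n
   using PQ(1)[of n] circle_measureD(3)[OF c(2)[of n]] by (simp add: ev_def)
  obtain r1 mu where mu: "strict_mono r1" "circle_measure T0 mu"
   "ALL f. cont_per T0 f --> (%n. \<integral>p. f (fst p) (snd p) \<partial>fst (PQ (r1 n))) \<longlonglongrightarrow> (itg mu f)"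
   by (rule circle_seq_compact[OF T0, of "%n. fst (PQ n)" T0]) (use c(1) T in auto)
  obtain r2 Q where Q: "strict_mono r2" "circle_measure T0 Q"
   "ALL g. cont_per T0 g --> (%n. \<integral>p. g (fst p) (snd p) \<partial>snd (PQ (r1 (r2 n)))) \<longlonglongrightarrow> (itg Q g)"
   by (rule circle_seq_compact[OF T0, of "%n. snd (PQ (r1 n))" b]) (use c(2) K2 in auto)
  have ev: "(%n. ev f g (PQ (r1 (r2 n)))) \<longlonglongrightarrow> ev f g (mu, Q)" if "cont_per T0 f" "cont_per T0 g" for f g
   using mu(3) Q(3) that LIMSEQ_subseq_LIMSEQ[OF _ Q(1)] unfolding ev_def comp_def by (fastforce intro!: tendsto_add)
  note d = circle_measureD[OF mu(2)] and dQ = circle_measureD[OF Q(2)]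
  have "(mu, Q) : Mstar T0 E"
  proof -
   have "(%n. T0) \<longlonglongrightarrow> measure mu UNIV"
    using mu(3)[rule_format, of "%_ _. 1"] T circle_measureD(3)[OF c(1)] d(3) by (simp add: cont_per_def)
   hence "measure mu UNIV = T0" by (simp add: LIMSEQ_const_iff)
   hence 1: "emeasure mu UNIV = ennreal T0" using finite_measure.emeasure_eq_measure[OF d(1)] by simp
   have E: "(- E) \<times> UNIV : sets SpV" by (rule SpV_times_sets) simp
   have i: "(LINT p|nu. indicator (- E) (fst p)) = measure nu ((- E) \<times> UNIV)" if "circle_measure T0 nu" for nu :: "(('v * 'v) * real) measure"
   proof -
    have "(LINT p|nu. indicator (- E) (fst p)) = (\<integral>p. indicator ((- E) \<times> UNIV) p \<partial>nu :: real)"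
     by (rule Bochner_Integration.integral_cong) (auto simp: indicator_def)
    thus ?thesis using circle_measureD(3)[OF that] by simp
   qed
   \<comment> \<open>The pairs of states form a discrete set, so the indicator of the complement of
     \<open>E\<close> is a continuous test function and the support condition passes to the
     limit.\<close>
   have "(LINT p|snd (PQ n). indicator (- E) (fst p)) = (0::real)" for n
    by (intro integral_eq_zero_AE eventually_mono[OF c(3)]) (auto simp: indicator_def)
   moreover have "(%n. \<integral>p. indicator (- E) (fst p) \<partial>snd (PQ (r1 (r2 n)))) \<longlonglongrightarrow> (\<integral>p. indicator (- E) (fst p) \<partial>Q :: real)"
    using Q(3)[rule_format, of "%e _. indicator (- E) e"] by (simp add: cont_per_def)
   ultimately have "measure Q ((- E) \<times> UNIV) = 0" using i[OF Q(2)] by (simp add: LIMSEQ_const_iff)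
   hence "(- E) \<times> UNIV : null_sets Q"
    using E dQ(2) by (auto simp: null_sets_def finite_measure.emeasure_eq_measure[OF dQ(1)])
   moreover have "UNIV - UNIV \<times> {0..<T0} : null_sets Q"
   proof -
    have "UNIV - UNIV \<times> {0..<T0} : sets Q" unfolding dQ(2) by (rule SpV_sets)
    thus ?thesis using Q(2) dQ(3) by (simp add: null_sets_def circle_measure_def)
   qed
   ultimately have "(- E) \<times> UNIV \<union> (UNIV - UNIV \<times> {0..<T0}) : null_sets Q" by (rule null_sets.Un)
   moreover have "(- E) \<times> UNIV \<union> (UNIV - UNIV \<times> {0..<T0}) = UNIV - E \<times> {0..<T0}" by auto
   ultimately show ?thesis using 1 mu(2) Q(2) d dQ by (simp add: Mstar_def circle_measure_def null_sets_def)
  qed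
  moreover have "ev (%_ _. 0) (%_ _. 1) (mu, Q) <= b"
   using PQ(1) by (intro LIMSEQ_le_const2[OF ev]) (auto simp: cont_per_def)
  ultimately have "(mu, Q) : ?K" by simp
  moreover have "(th \<circ> (r1 \<circ> r2)) \<longlonglongrightarrow> coords T0 (mu, Q)"
  proof -
   have "limitin (product_topology (%_. euclidean) UNIV) (th \<circ> (r1 \<circ> r2)) (coords T0 (mu, Q)) sequentially"
    unfolding limitin_componentwise using ev[OF coord_cont_per[OF T0]] by (simp add: PQ(2) comp_def coords_def)
   thus ?thesis unfolding euclidean_product_topology by simp
  qed
  ultimately show "EX l:coords T0 ` ?K. EX r. strict_mono r & (th \<circ> r) \<longlonglongrightarrow> l"
   using mu(1) Q(1) by (intro bexI[of _ "coords T0 (mu, Q)"] exI[of _ "r1 \<circ> r2"]) (auto simp: strict_mono_o)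
 qed
 hence comp: "compact (coords T0 ` ?K)" by (simp add: compact_eq_seq_compact_metric)
 show ?thesis
  unfolding compactin_def
 proof (intro conjI allI impI)
  fix UU assume UU: "(ALL G:UU. openin (Mstar_top T0 E) G) & ?K \<subseteq> \<Union>UU"
  have "ALL G:UU. EX U. open U & G = {PQ : Mstar T0 E. coords T0 PQ : U}"
  proof
   fix G assume "G : UU"
   with UU have "openin (Mstar_top T0 E) G" by blast
   thus "EX U. open U & G = {PQ : Mstar T0 E. coords T0 PQ : U}" by (rule Mstar_open_coords[OF T0]) blast
  qed
  then obtain U where U: "ALL G:UU. open (U G) & G = {PQ : Mstar T0 E. coords T0 PQ : U G}"
   by (rule bchoice[THEN exE])
  have cov: "coords T0 ` ?K \<subseteq> (UN G:UU. U G)"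
  proof
   fix th assume "th : coords T0 ` ?K"
   then obtain PQ where "PQ : ?K" "th = coords T0 PQ" by blast
   then obtain G where "G : UU" "PQ : G" using UU by blast
   thus "th : (UN G:UU. U G)" using U \<open>th = _\<close> by blast
  qed
  obtain D where D: "D \<subseteq> UU" "finite D" "coords T0 ` ?K \<subseteq> (UN G:D. U G)"
   by (rule compactE_image[OF comp _ cov]) (use U in auto)
  have "?K \<subseteq> \<Union>D"
  proof
   fix PQ assume PQ: "PQ : ?K"
   then obtain G where "G : D" "coords T0 PQ : U G" using D(3) by blast
   thus "PQ : \<Union>D" using U D(1) PQ by blast
  qed
  thus "EX FF. finite FF & FF \<subseteq> UU & ?K \<subseteq> \<Union>FF" using D by blast
 qed (auto simp: Mstar_topspace)
qed

section \<open>The large deviation principle\<close>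

lemma nn_integral_mix:
 assumes s: "sets nu1 = sets nu" "sets nu2 = sets nu" and e: "!!A. A : sets nu ==> emeasure nu A = a * emeasure nu1 A + b * emeasure nu2 A"
  and F: "F : borel_measurable nu"
 shows "(\<integral>\<^sup>+p. F p \<partial>nu) = a * (\<integral>\<^sup>+p. F p \<partial>nu1) + b * (\<integral>\<^sup>+p. F p \<partial>nu2)"
proof -
 have m: "measurable nu1 (borel :: ennreal measure) = measurable nu borel" "measurable nu2 (borel :: ennreal measure) = measurable nu borel"
  using s by (auto intro!: measurable_cong_sets)
 note sp = sets_eq_imp_space_eq[OF s(1)] sets_eq_imp_space_eq[OF s(2)]
 from F show ?thesis
 proof (induction rule: borel_measurable_induct)
  case (cong f g)
  thus ?case using nn_integral_cong[of nu f g] nn_integral_cong[of nu1 f g] nn_integral_cong[of nu2 f g] sp by simp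
 next
  case (set A) thus ?case using s e by simp
 next
  case (mult u v) thus ?case using m by (simp add: nn_integral_cmult distrib_left mult.left_commute)
 next
  case (add u v) thus ?case using m by (simp add: nn_integral_add distrib_left ac_simps)
 next
  case (seq U)
  have i: "incseq (%i. \<integral>\<^sup>+p. U i p \<partial>N)" for N using seq(3) by (auto simp: incseq_def le_fun_def intro!: nn_integral_mono)
  have U: "(\<integral>\<^sup>+p. (SUP i. U i) p \<partial>N) = (SUP i. \<integral>\<^sup>+p. U i p \<partial>N)" if "measurable N (borel :: ennreal measure) = measurable nu borel" for N
   using nn_integral_monotone_convergence_SUP[of U N] seq that by (simp add: SUP_apply[abs_def])
  show ?case
   unfolding U[OF refl] U[OF m(1)] U[OF m(2)] SUP_mult_left_ennreal seq.IH
   using i by (intro ennreal_SUP_add) (auto simp: incseq_def intro!: mult_left_mono)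
 qed
qed

lemma integral_mix:
 fixes nu :: "('a::finite * real) measure"
 assumes c: "circle_measure T0 nu" "circle_measure T0 nu1" "circle_measure T0 nu2" and ab: "0 <= a" "0 <= b"
  and e: "!!A. A : sets SpV ==> emeasure nu A = ennreal a * emeasure nu1 A + ennreal b * emeasure nu2 A"
  and f: "cont_per T0 f" and T0: "T0 > 0"
 shows "itg nu f = a * itg nu1 f + b * itg nu2 f"
proof -
 obtain K where K: "K >= 0" "!!y t. abs (f y t) <= K" using cont_per_bounded[OF f T0] by blast
 note d = circle_measureD[OF c(1)] circle_measureD[OF c(2)] circle_measureD[OF c(3)]
 have nn: "itg nu h = a * itg nu1 h + b * itg nu2 h"
  if h: "cont_per T0 h" "!!y t. 0 <= h y t" for h
 proof -
  have i: "ennreal (itg N h) = (\<integral>\<^sup>+p. h (fst p) (snd p) \<partial>N)" if "circle_measure T0 N" for N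
   using h by (intro nn_integral_eq_integral[symmetric] cont_per_integrable[OF that T0]) auto
  have n: "0 <= itg N h" for N using h(2) by simp
  have "ennreal (itg nu h) = ennreal a * ennreal (itg nu1 h) + ennreal b * ennreal (itg nu2 h)"
   unfolding i[OF c(1)] i[OF c(2)] i[OF c(3)]
   by (rule nn_integral_mix) (use d e circle_measurable[OF c(1)] cont_per_measurable[OF h(1)] in auto)
  also have "... = ennreal (a * itg nu1 h + b * itg nu2 h)"
   using ab n by (simp add: ennreal_mult ennreal_plus)
  finally show ?thesis using ab n by (subst (asm) ennreal_inj) auto
 qed
 have fK: "(LINT p|N. f (fst p) (snd p) + K) = itg N f + (LINT p|N. K)" if "circle_measure T0 N" for N
  using cont_per_integrable[OF that T0 f] finite_measure.integrable_const[OF circle_measureD(1)[OF that]] by (subst Bochner_Integration.integral_add) auto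
 have "0 <= f y t + K" for y t using K(2)[of y t] by linarith
 hence "(LINT p|nu. f (fst p) (snd p) + K) = a * (LINT p|nu1. f (fst p) (snd p) + K) + b * (LINT p|nu2. f (fst p) (snd p) + K)"
  by (intro nn[of "%y t. f y t + K"] cont_per_add f cont_per_const)
 moreover have "(LINT p|nu. K) = a * (LINT p|nu1. K) + b * (LINT p|nu2. K)"
  by (rule nn[of "%_ _. K"]) (use K in \<open>auto simp: cont_per_const\<close>)
 ultimately show ?thesis unfolding fK[OF c(1)] fK[OF c(2)] fK[OF c(3)] by (simp add: distrib_left)
qed

lemma integral_scale_measure:
 fixes f :: "'a => real"
 assumes "0 <= c" "f : borel_measurable M" shows "(LINT x|scale_measure (ennreal c) M. f x) = c * (LINT x|M. f x)"
proof -
 have "scale_measure (ennreal c) M = density M (%_. ennreal c)" by (rule measure_eqI) (auto simp: emeasure_density_const)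
 thus ?thesis using assms by (simp add: integral_density)
qed

lemma limsup_eln_le:
 assumes p: "!!n. n >= 1 ==> p n <= K * exp (- (real n * a))" and K: "K > 0"
 shows "limsup (%n. eln (p n) / ereal (real n)) <= ereal (- a)"
proof -
 have "limsup (%n. eln (p n) / ereal (real n)) <= limsup (%n. ereal (ln K / real n - a))"
 proof (rule Limsup_mono)
  show "\<forall>\<^sub>F n in sequentially. eln (p n) / ereal (real n) <= ereal (ln K / real n - a)"
   using eventually_ge_at_top[of 1]
  proof eventually_elim
   case (elim n)
   show ?case
   proof (cases "p n <= 0")
    case False
    hence "ln (p n) <= ln (K * exp (- (real n * a)))" using p[OF elim] by simp
    hence "ln (p n) / real n <= (ln K - real n * a) / real n" using K by (simp add: ln_mult divide_right_mono)
    thus ?thesis using False elim by (simp add: eln_def diff_divide_distrib)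
   qed (use elim in \<open>simp add: eln_def\<close>)
  qed
 qed
 also have "(%n. ln K / real n - a) \<longlonglongrightarrow> 0 - a" by (intro tendsto_diff tendsto_const lim_const_over_n)
 hence "limsup (%n. ereal (ln K / real n - a)) = ereal (- a)" by (intro lim_imp_Limsup) auto
 finally show ?thesis .
qed

lemma liminf_eln_ge:
 assumes p: "!!n. n >= N ==> k * exp (- (real n * a)) <= p n" and k: "k > 0"
 shows "ereal (- a) <= liminf (%n. eln (p n) / ereal (real n))"
proof -
 have "(%n. ln k / real n - a) \<longlonglongrightarrow> 0 - a" by (intro tendsto_diff tendsto_const lim_const_over_n)
 hence "ereal (- a) = liminf (%n. ereal (ln k / real n - a))" by (intro lim_imp_Liminf[symmetric]) auto
 also have "... <= liminf (%n. eln (p n) / ereal (real n))"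
 proof (rule Liminf_mono)
  show "\<forall>\<^sub>F n in sequentially. ereal (ln k / real n - a) <= eln (p n) / ereal (real n)"
   using eventually_ge_at_top[of "max 1 N"]
  proof eventually_elim
   case (elim n)
   have q: "0 < k * exp (- (real n * a))" using k by simp
   hence "ln (k * exp (- (real n * a))) <= ln (p n)" using p[of n] elim by simp
   hence "(ln k - real n * a) / real n <= ln (p n) / real n" using k by (simp add: ln_mult divide_right_mono)
   thus ?case using q p[of n] elim by (simp add: eln_def diff_divide_distrib)
  qed
 qed
 finally show ?thesis .
qed

context periodic_chain
begin

abbreviation emp :: "nat => 'w => ('v * real) measure \<times> (('v * 'v) * real) measure" where
 "emp n om \<equiv> (emp_meas T0 n (X om), emp_flow T0 n (X om))"

lemma emp_integrals:
 assumes w: "om : space M" and n: "n >= 1"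
 shows "(!!y. bdd_borel (f y)) ==> (itg (emp_meas T0 n (X om)) f) = integral {0..real n * T0} (along (%y t. f y (pmod t T0)) (X om)) / n"
  and "(!!e. bdd_borel (g e)) ==> (itg (emp_flow T0 n (X om)) g) = (SUM t:jumps (X om) (real n * T0). g (left_lim (X om) t, X om t) (pmod t T0)) / n"
  and "circle_measure T0 (emp_meas T0 n (X om))" "circle_measure T0 (emp_flow T0 n (X om))"
  and "emeasure (emp_meas T0 n (X om)) UNIV = ennreal T0"
proof -
 let ?L = "restrict_space lborel {0..real n * T0}" and ?Y = "%t. (X om t, pmod t T0)"
 let ?J = "jumps (X om) (real n * T0)" and ?Z = "%t. ((left_lim (X om) t, X om t), pmod t T0)"
 note cad = X_cadlag[OF w]
 have J: "finite ?J" by (rule cadlag_finite_jumps[OF cad])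
 have "X om : measurable ?L (count_space UNIV)"
 proof (rule measurable_count_space_eq2[THEN iffD2], simp, intro conjI ballI)
  fix y
  have "X om -` {y} \<inter> space ?L = {u. 0 <= u & X om u = y} \<inter> {0..real n * T0}" by (auto simp: space_restrict_space)
  thus "X om -` {y} \<inter> space ?L : sets ?L"
   using cadlag_level_set_borel[OF cad, of y] by (auto simp: sets_restrict_space)
 qed simp
 moreover have "(%t. pmod t T0) : borel_measurable ?L" by (rule measurable_restrict_space1) simp
 ultimately have Ym: "?Y : measurable ?L SpV" by (intro measurable_Pair) auto
 have Zm: "?Z : measurable (count_space ?J) SpV" by (auto simp: space_pair_measure)
 have b: "(%p. u (fst p) (snd p)) : borel_measurable SpV" if "!!y. bdd_borel (u y)" for u :: "'b::finite => real => real"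
  by (intro SpV_measurable bdd_borel_measurable that)
 show "itg (emp_meas T0 n (X om)) f = integral {0..real n * T0} (along (%y t. f y (pmod t T0)) (X om)) / n" if f: "!!y. bdd_borel (f y)"
 proof -
  have "bdd_borel (%t. f y (pmod t T0))" for y
   using bdd_borel_bound[OF f[of y]] measurable_compose[OF pmod_measurable bdd_borel_measurable[OF f]] by (metis bdd_borelI)
  hence ab: "bdd_borel (along (%y t. f y (pmod t T0)) (X om))" by (rule along_bdd[OF cad])
  have "itg (emp_meas T0 n (X om)) f = (1 / real n) * (LINT t|?L. f (X om t) (pmod t T0))"
   unfolding emp_meas_def using b[of f, OF f] Ym by (subst integral_scale_measure) (auto simp: integral_distr)
  also have "(LINT t|?L. f (X om t) (pmod t T0)) = (LINT t|lborel. indicator {0..real n * T0} t *\<^sub>R f (X om t) (pmod t T0))"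
   by (rule integral_restrict_space) simp
  also have "... = (LINT t:{0..real n * T0}|lborel. along (%y t. f y (pmod t T0)) (X om) t)"
   unfolding set_lebesgue_integral_def by (rule Bochner_Integration.integral_cong) (auto simp: along_eq indicator_def)
  finally show ?thesis by (simp add: bdd_borel_LINT[OF ab])
 qed
 show "itg (emp_flow T0 n (X om)) g = (SUM t:?J. g (left_lim (X om) t, X om t) (pmod t T0)) / n" if g: "!!e. bdd_borel (g e)"
  unfolding emp_flow_def using b[of g, OF g] Zm J
  by (subst integral_scale_measure) (auto simp: integral_distr lebesgue_integral_count_space_finite)
 note pb = pmod_bounds[OF T0]
 have "space ?L = {0..real n * T0}" by (simp add: space_restrict_space)
 hence "emeasure (distr ?L SpV ?Y) UNIV = ennreal (real n * T0)"
  using T0 by (simp add: emeasure_distr[OF Ym SpV_sets(1)] emeasure_restrict_space)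
 thus m: "emeasure (emp_meas T0 n (X om)) UNIV = ennreal T0"
  using n T0 by (simp add: emp_meas_def ennreal_mult[symmetric])
 have "?Y -` (UNIV - UNIV \<times> {0..<T0}) = {}" "?Z -` (UNIV - UNIV \<times> {0..<T0}) = {}" using pb by auto
 hence z: "emeasure (distr ?L SpV ?Y) (UNIV - UNIV \<times> {0..<T0}) = 0" "emeasure (distr (count_space ?J) SpV ?Z) (UNIV - UNIV \<times> {0..<T0}) = 0"
  by (simp_all add: emeasure_distr[OF Ym SpV_sets(2)] emeasure_distr[OF Zm SpV_sets(2)])
 show "circle_measure T0 (emp_meas T0 n (X om))"
  using m z(1) unfolding circle_measure_def by (simp add: emp_meas_def space_scale_measure)
 have "emeasure (distr (count_space ?J) SpV ?Z) UNIV < \<infinity>" using J by (simp add: emeasure_distr[OF Zm SpV_sets(1)] of_nat_less_top)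
 thus "circle_measure T0 (emp_flow T0 n (X om))"
  using z(2) unfolding circle_measure_def by (simp add: emp_flow_def space_scale_measure ennreal_mult_less_top)
qed

lemma emp_ev:
 assumes w: "om : space M" and n: "n >= 1" and fg: "cont_per T0 f" "cont_per T0 g"
 shows "ev f g (emp n om) = psum n f g om / n"
proof -
 obtain L where L: "test_pair L f g" using cont_per_test_pair[OF fg] .
 have "f y (pmod t T0) = f y t" "g e (pmod t T0) = g e t" for y e t
  by (rule periodic_pmod, rule test_pairD[OF L])+
 thus ?thesis
  using emp_integrals(1)[OF w n, of f] emp_integrals(2)[OF w n, of g] test_pair_bdd[OF L] by (simp add: ev_def path_fun_def add_divide_distrib)
qed

text \<open>The empirical flow lies in the space of flows on \<open>E\<close> iff the path makes no jump outside \<open>E\<close>; this is only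
 almost surely the case.\<close>
definition off_edge :: "('v * 'v) tfun" where
 "off_edge e t = indicator (- E) e"

lemma emp_Mstar:
 assumes w: "om : space M" and n: "n >= 1"
 shows "emp n om : Mstar T0 E \<longleftrightarrow> psum n (%_ _. 0) off_edge om = 0"
proof -
 note c = emp_integrals(3-5)[OF w n]
 note dQ = circle_measureD[OF c(2)]
 let ?Q = "emp_flow T0 n (X om)"
 have s: "(- E) \<times> UNIV : sets ?Q" "UNIV - UNIV \<times> {0..<T0} : sets ?Q" "UNIV - E \<times> {0..<T0} : sets ?Q"
  unfolding dQ(2) using SpV_times_sets[of UNIV "- E"] SpV_times_sets[of "{0..<T0}" UNIV] SpV_times_sets[of "{0..<T0}" E] sets.compl_sets[of _ SpV] by force+
 have z: "emeasure ?Q (UNIV - UNIV \<times> {0..<T0}) = 0" using c(2) dQ(3) by (simp add: circle_measure_def)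
 have "emp n om : Mstar T0 E \<longleftrightarrow> emeasure ?Q (UNIV - E \<times> {0..<T0}) = 0"
  using c dQ circle_measureD[OF c(1)] by (simp add: Mstar_def circle_measure_def)
 also have "... \<longleftrightarrow> emeasure ?Q ((- E) \<times> UNIV) = 0"
 proof
  assume "emeasure ?Q (UNIV - E \<times> {0..<T0}) = 0"
  moreover have "(- E) \<times> UNIV \<subseteq> UNIV - E \<times> {0..<T0}" by auto
  ultimately show "emeasure ?Q ((- E) \<times> UNIV) = 0" using emeasure_mono[OF _ s(3), of "(- E) \<times> UNIV"] by simp
 next
  assume "emeasure ?Q ((- E) \<times> UNIV) = 0"
  hence "(- E) \<times> UNIV \<union> (UNIV - UNIV \<times> {0..<T0}) : null_sets ?Q" using s z by (intro null_sets.Un) (auto simp: null_sets_def)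
  moreover have "(- E) \<times> UNIV \<union> (UNIV - UNIV \<times> {0..<T0}) = UNIV - E \<times> {0..<T0}" by auto
  ultimately show "emeasure ?Q (UNIV - E \<times> {0..<T0}) = 0" by (simp add: null_sets_def)
 qed
 also have "... \<longleftrightarrow> measure ?Q ((- E) \<times> UNIV) = 0" by (simp add: finite_measure.emeasure_eq_measure[OF dQ(1)])
 also have "measure ?Q ((- E) \<times> UNIV) = itg (?Q) off_edge"
 proof -
  have "itg (?Q) off_edge = (LINT p|?Q. indicator ((- E) \<times> UNIV) p)"
   by (rule Bochner_Integration.integral_cong) (auto simp: off_edge_def indicator_def)
  thus ?thesis using dQ(3) by simp
 qed
 also have "... = psum n (%_ _. 0) off_edge om / n"
  using emp_integrals(2)[OF w n, of off_edge] by (simp add: path_fun_def along_def[abs_def] off_edge_def[abs_def])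
 finally show ?thesis using n by simp
qed

text \<open>Rates vanish off \<open>E\<close>, so the constant 1 solves the backward equation with
  jump weight \<open>off_edge\<close> and the exponential moment is exactly 1. A nonnegative
  functional with this moment is zero almost surely.\<close>

lemma emp_Mstar_AE:
 assumes n: "n >= 1" shows "AE om in M. emp n om : Mstar T0 E"
proof -
 let ?S = "%om. psum n (%_ _. 0) off_edge om"
 have z: "bw (%_ _. 0) off_edge (%_ _. 1) y = (%_. 0)" for y
  using R_off by (auto simp: bw_def off_edge_def indicator_def fun_eq_iff intro!: sum.neutral)
 have "indef a b (%_. 1) (%_. 0)" for a b by (auto simp: indef_def)
 moreover have "bdd_borel (off_edge e)" for e by (simp add: off_edge_def[abs_def])
 ultimately have i: "integrable M (%om. exp (?S om))" "part_fun n (%_ _. 0) off_edge = 1"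
  using fk_bounds[of "%_ _. 0" off_edge "%_ _. 1" 1 1 n] n by (simp_all add: z off_edge_def)
 have "0 <= ?S om" for om by (auto simp: path_fun_def along_def[abs_def] off_edge_def intro!: sum_nonneg)
 moreover have "(LINT om|M. exp (?S om) - 1) = 0" using i by (simp add: part_fun_def prob_space)
 ultimately have "AE om in M. exp (?S om) - 1 = 0"
  using i(1) by (subst (asm) integral_nonneg_eq_0_iff_AE) auto
 thus ?thesis using emp_Mstar[OF _ n] by (auto elim!: AE_mp intro!: AE_I2)
qed

text \<open>An open set is cut out by an open set of countably many coordinates, each a measurable
  path functional, together with the measurable condition of no jump off \<open>E\<close>.\<close>

lemma emp_open_event:
 assumes G: "openin (Mstar_top T0 E) G" and n: "n >= 1" shows "{om : space M. emp n om : G} : sets M"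
proof -
 obtain U where U: "open U" "G = {PQ : Mstar T0 E. coords T0 PQ : U}" by (rule Mstar_open_coords[OF T0 G])
 have nT: "real n * T0 > 0" using n T0 by simp
 have "(%om. coords T0 (emp n om)) : borel_measurable M"
 proof (rule measurable_coordinatewise_then_product)
  fix j
  note c = coord_cont_per[OF T0, of j]
  obtain L where L: "test_pair L (coord_f T0 j) (coord_g T0 j)" using cont_per_test_pair[OF c] .
  have "(%om. psum n (coord_f T0 j) (coord_g T0 j) om / real n) : borel_measurable M"
   using path_fun_measurable[OF nT test_pair_bdd(1)[OF L] test_pairD(4)[OF L]] by simp
  thus "(%om. coords T0 (emp n om) j) : borel_measurable M"
   by (subst measurable_cong[where g = "%om. psum n (coord_f T0 j) (coord_g T0 j) om / real n"]) (auto simp: coords_def emp_ev[OF _ n c])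
 qed
 hence "(%om. coords T0 (emp n om)) -` U \<inter> space M : sets M" using U(1) by (intro measurable_sets) auto
 moreover have "(%om. psum n (%_ _. 0) off_edge om) -` {0} \<inter> space M : sets M"
  by (rule measurable_sets[OF path_fun_measurable[OF nT]]) (auto simp: off_edge_def[abs_def])
 ultimately have "((%om. coords T0 (emp n om)) -` U \<inter> space M) \<inter> ((%om. psum n (%_ _. 0) off_edge om) -` {0} \<inter> space M) : sets M" by (rule sets.Int)
 also have "((%om. coords T0 (emp n om)) -` U \<inter> space M) \<inter> ((%om. psum n (%_ _. 0) off_edge om) -` {0} \<inter> space M)
   = {om : space M. emp n om : G}" unfolding U(2) using emp_Mstar[OF _ n] by auto
 finally show ?thesis .
qed

lemma growthE:
 assumes "cont_per T0 f" "cont_per T0 g"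
 obtains K where "K > 0" "ALL n>=1. integrable M (%om. exp (psum n f g om)) & part_fun n f g <= K * exp (real n * lam f g)"
proof -
 obtain L where L: "test_pair L f g" using cont_per_test_pair[OF assms] .
 show ?thesis using that test_pair_lam[OF L] unfolding growth_def by blast
qed

lemma chebyshev:
 assumes fg: "cont_per T0 f" "cont_per T0 g"
 shows "EX K>0. ALL n>=1. {om : space M. real n * (lam f g + a) <= psum n f g om} : events &
  prob {om : space M. real n * (lam f g + a) <= psum n f g om} <= K * exp (- (real n * a))"
proof -
 obtain L where L: "test_pair L f g" using cont_per_test_pair[OF fg] .
 obtain K where K: "K > 0" "ALL n>=1. integrable M (%om. exp (psum n f g om)) & part_fun n f g <= K * exp (real n * lam f g)"
  by (rule growthE[OF fg])
 have "{om : space M. real n * (lam f g + a) <= psum n f g om} : events &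
  prob {om : space M. real n * (lam f g + a) <= psum n f g om} <= K * exp (- (real n * a))" if n: "n >= 1" for n
 proof -
  let ?S = "%om. psum n f g om"
  let ?A = "{om : space M. real n * (lam f g + a) <= ?S om}"
  have nT: "real n * T0 > 0" using n T0 by simp
  have A: "?A : events" using path_fun_measurable[OF nT test_pair_bdd(1)[OF L] test_pairD(4)[OF L]] by measurable
  have i: "integrable M (%om. exp (?S om))" using K n by blast
  have "prob ?A = (LINT om|M. indicator ?A om)" using A sets.sets_into_space[OF A] by (simp add: Int_absorb2)
  also have "... <= (LINT om|M. exp (- (real n * (lam f g + a))) * exp (?S om))"
   using i A by (intro integral_mono integrable_mult_right integrable_real_indicator) (auto simp: indicator_def mult_exp_exp emeasure_eq_measure)
  also have "... = exp (- (real n * (lam f g + a))) * part_fun n f g" by (simp add: part_fun_def)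
  also have "... <= exp (- (real n * (lam f g + a))) * (K * exp (real n * lam f g))" using K n by (intro mult_left_mono) auto
  also have "... = K * exp (- (real n * a))" by (simp add: mult.left_commute mult_exp_exp algebra_simps)
  finally show ?thesis using A by blast
 qed
 thus ?thesis using K(1) by blast
qed

lemma path_fun_sum:
 assumes "cadlag Y" "finite S" "!!F y. F : S ==> bdd_borel (fst F y)"
 shows "path_fun T (%y t. SUM F:S. th F * fst F y t) (%e t. SUM F:S. th F * snd F e t) Y = (SUM F:S. th F * path_fun T (fst F) (snd F) Y)"
 using assms(2,3)
proof (induction S rule: finite_induct)
 case empty
 thus ?case by (simp add: path_fun_def along_def[abs_def])
next
 case (insert G S)
 have "bdd_borel (%t. SUM F:S. th F * fst F y t)" for y using insert.prems by (intro bdd_borel_intros) auto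
 thus ?case
  using path_fun_lin[OF assms(1), of "%y t. SUM F:S. th F * fst F y t" "fst G" T "th G" "%e t. SUM F:S. th F * snd F e t" "snd G"] insert
  by (simp add: add.commute)
qed

section \<open>Large deviation bounds from the duality\<close>

context
 fixes I :: "('v * real) measure \<times> (('v * 'v) * real) measure => ennreal"
 assumes dual: "!!PQ a. PQ : Mstar T0 E ==> 0 <= a ==>
  I PQ <= ennreal a \<longleftrightarrow> (ALL f g. cont_per T0 f --> cont_per T0 g --> ev f g PQ - lam f g <= a)"
begin

lemma ldp_good: "compactin (Mstar_top T0 E) {PQ : Mstar T0 E. I PQ <= ennreal a}"
proof -
 \<comment> \<open>Negative levels mean level 0 in \<open>ennreal\<close>, while \<open>dual\<close>
   speaks of nonnegative levels.\<close>
 let ?a = "max a 0" and ?T = "{F :: ('v tfun) \<times> (('v * 'v) tfun). cont_per T0 (fst F) & cont_per T0 (snd F)}"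
 let ?H = "%F. {PQ : Mstar T0 E. ev (fst F) (snd F) PQ : {..lam (fst F) (snd F) + ?a}}"
 have c1: "(%_ _. 0, %_ _. 1) : ?T" by (simp add: cont_per_def)
 have ea: "ennreal ?a = ennreal a" by (simp add: max_def ennreal_neg)
 have eq: "{PQ : Mstar T0 E. I PQ <= ennreal a} = (INT F:?T. ?H F)"
 proof (intro set_eqI iffI)
  fix PQ assume "PQ : {PQ : Mstar T0 E. I PQ <= ennreal a}"
  hence PQ: "PQ : Mstar T0 E" "I PQ <= ennreal ?a" using ea by simp_all
  show "PQ : (INT F:?T. ?H F)"
  proof (rule INT_I)
   fix F assume "F : ?T"
   hence "ev (fst F) (snd F) PQ - lam (fst F) (snd F) <= ?a" using dual[OF PQ(1), of ?a] PQ(2) by simp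
   thus "PQ : ?H F" using PQ(1) by simp
  qed
 next
  fix PQ assume PQ: "PQ : (INT F:?T. ?H F)"
  have "ev f g PQ - lam f g <= ?a" if "cont_per T0 f" "cont_per T0 g" for f g
  proof -
   have "PQ : ?H (f, g)" using that by (intro INT_D[OF PQ]) simp
   thus ?thesis by simp
  qed
  moreover have "PQ : Mstar T0 E" using INT_D[OF PQ c1] by simp
  ultimately show "PQ : {PQ : Mstar T0 E. I PQ <= ennreal a}" using dual[of PQ ?a] ea by simp
 qed
 have "closedin (Mstar_top T0 E) (?H F)" if "F : ?T" for F
 proof -
  have o: "openin (Mstar_top T0 E) {PQ : Mstar T0 E. ev (fst F) (snd F) PQ : {lam (fst F) (snd F) + ?a<..}}"
   using that by (intro ev_openin) auto
  have eq: "?H F = topspace (Mstar_top T0 E) - {PQ : Mstar T0 E. ev (fst F) (snd F) PQ : {lam (fst F) (snd F) + ?a<..}}" by (auto simp: Mstar_topspace)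
  show ?thesis unfolding eq by (intro closedin_diff closedin_topspace o)
 qed
 hence "closedin (Mstar_top T0 E) (INT F:?T. ?H F)" using c1 by (intro closedin_INT) auto
 moreover have "(INT F:?T. ?H F) \<subseteq> {PQ : Mstar T0 E. ev (%_ _. 0) (%_ _. 1) PQ <= lam (%_ _. 0) (%_ _. 1) + ?a}"
  using c1 by fastforce
 ultimately show ?thesis unfolding eq by (intro closed_compactin[OF Mstar_compact[OF T0]])
qed

lemma ldp_convex:
 assumes M: "(mu1, Q1) : Mstar T0 E" "(mu2, Q2) : Mstar T0 E" "(mu, Q) : Mstar T0 E" and l: "0 <= l" "l <= 1"
  and e: "ALL A:sets SpV. emeasure mu A = ennreal l * emeasure mu1 A + ennreal (1 - l) * emeasure mu2 A"
   "ALL A:sets SpV. emeasure Q A = ennreal l * emeasure Q1 A + ennreal (1 - l) * emeasure Q2 A"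
 shows "I (mu, Q) <= ennreal l * I (mu1, Q1) + ennreal (1 - l) * I (mu2, Q2)"
proof (cases "ennreal l * I (mu1, Q1) < \<top> & ennreal (1 - l) * I (mu2, Q2) < \<top>")
 case True
 \<comment> \<open>For \<open>k = 0\<close> the value of \<open>I\<close> may be infinite; the
   product is 0 nevertheless, and any \<open>a\<close> serves.\<close>
 have ex: "EX a>=0. k * (ev f g PQ - lam f g) <= k * a & ennreal k * I PQ = ennreal (k * a)"
  if "0 <= k" "ennreal k * I PQ < \<top>" "PQ : Mstar T0 E" "cont_per T0 f" "cont_per T0 g" for k PQ and f :: "'v tfun" and g
 proof (cases "k = 0")
  case False
  hence k: "k > 0" using that by simp
  hence "I PQ < \<top>" using that(2) by (auto simp: ennreal_mult_less_top)
  then obtain a where a: "0 <= a" "I PQ = ennreal a" by (cases "I PQ") auto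
  thus ?thesis using dual[OF that(3) a(1)] that k by (intro exI[of _ a]) (auto simp: ennreal_mult)
 qed auto
 have fin: "I (mu, Q) <= ennreal (enn2real (ennreal l * I (mu1, Q1)) + enn2real (ennreal (1 - l) * I (mu2, Q2)))"
 proof (subst dual[OF M(3)], simp, intro allI impI)
  fix f :: "'v tfun" and g :: "('v * 'v) tfun"
  assume fg: "cont_per T0 f" "cont_per T0 g"
  obtain a where a: "a >= 0" "l * (ev f g (mu1, Q1) - lam f g) <= l * a" "ennreal l * I (mu1, Q1) = ennreal (l * a)" using ex[OF l(1) _ M(1) fg] True by blast
  obtain b where b: "b >= 0" "(1 - l) * (ev f g (mu2, Q2) - lam f g) <= (1 - l) * b" "ennreal (1 - l) * I (mu2, Q2) = ennreal ((1 - l) * b)" using ex[OF _ _ M(2) fg, of "1 - l"] l True by auto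
  have "ev f g (mu, Q) = l * ev f g (mu1, Q1) + (1 - l) * ev f g (mu2, Q2)"
   using integral_mix[OF Mstar_circle(1)[OF M(3)] Mstar_circle(1)[OF M(1)] Mstar_circle(1)[OF M(2)] l(1) _ _ fg(1) T0, of "1 - l"]
    integral_mix[OF Mstar_circle(2)[OF M(3)] Mstar_circle(2)[OF M(1)] Mstar_circle(2)[OF M(2)] l(1) _ _ fg(2) T0, of "1 - l"] e l
   by (simp add: ev_def distrib_left)
  show "ev f g (mu, Q) - lam f g <= enn2real (ennreal l * I (mu1, Q1)) + enn2real (ennreal (1 - l) * I (mu2, Q2))"
  proof -
   have "enn2real (ennreal (l * a)) = l * a" "enn2real (ennreal ((1 - l) * b)) = (1 - l) * b" using a(1) b(1) l by simp_all
   thus ?thesis unfolding a(3) b(3) using \<open>ev f g (mu, Q) = _\<close> a(2) b(2) by (simp only:) (simp add: algebra_simps)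
  qed
 qed
 thus ?thesis using True by (simp add: ennreal_plus)
qed (auto simp: not_less top_unique)

text \<open>Exponential tightness comes from the single functional \<open>Q(1)\<close>: outside
  \<open>?K\<close> Chebyshev's inequality already has rate \<open>a\<close>. The rest of
  \<open>C\<close> is compact and covered by finitely many open half-spaces, each with the same
  rate.\<close>

lemma ldp_upper:
 assumes C: "closedin (Mstar_top T0 E) C" and a: "0 <= a" "!!PQ. PQ : C ==> ~ I PQ <= ennreal a"
 shows "EX K>0. ALL n>=1. measure M {om : space M. emp n om : C} <= K * exp (- (real n * a))"
proof -
 have CM: "C \<subseteq> Mstar T0 E" using closedin_subset[OF C] by (simp add: Mstar_topspace)
 let ?T = "{F :: ('v tfun) \<times> (('v * 'v) tfun). cont_per T0 (fst F) & cont_per T0 (snd F)}"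
 let ?H = "%F. {PQ : Mstar T0 E. ev (fst F) (snd F) PQ : {lam (fst F) (snd F) + a<..}}"
 let ?F1 = "(%_ _. 0, %_ _. 1) :: ('v tfun) \<times> (('v * 'v) tfun)"
 let ?K = "{PQ : Mstar T0 E. ev (%_ _. 0) (%_ _. 1) PQ <= lam (%_ _. 0) (%_ _. 1) + a}"
 have "compactin (Mstar_top T0 E) (?K \<inter> C)" by (rule compact_Int_closedin[OF Mstar_compact[OF T0] C])
 moreover have "ALL U:?H ` ?T. openin (Mstar_top T0 E) U"
 proof
  fix U assume "U : ?H ` ?T"
  then obtain F where F: "U = ?H F" "F : ?T" by (rule imageE)
  show "openin (Mstar_top T0 E) U" unfolding F(1) using F(2) by (intro ev_openin) auto
 qed
 moreover have "?K \<inter> C \<subseteq> \<Union>(?H ` ?T)"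
 proof
  fix PQ assume PQ: "PQ : ?K \<inter> C"
  then obtain f g where "cont_per T0 f" "cont_per T0 g" "~ ev f g PQ - lam f g <= a" using a(2)[of PQ] dual[of PQ a] a(1) by auto
  hence "PQ : ?H (f, g)" "(f, g) : ?T" using PQ by auto
  thus "PQ : \<Union>(?H ` ?T)" by blast
 qed
 ultimately obtain FF where FF: "finite FF" "FF \<subseteq> ?H ` ?T" "?K \<inter> C \<subseteq> \<Union>FF" unfolding compactin_def by meson
 from finite_subset_image[OF FF(1,2)] obtain T where T0': "T \<subseteq> ?T" "finite T" "FF = ?H ` T" by blast
 note T = T0'(1,2) FF(3)[unfolded T0'(3)]
 define T' where "T' = insert ?F1 T"
 let ?A = "%n F. {om : space M. real n * (lam (fst F) (snd F) + a) <= psum n (fst F) (snd F) om}"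
 have T': "finite T'" "T' \<subseteq> ?T" using T by (auto simp: T'_def cont_per_def)
 have "ALL F:T'. EX K>0. ALL n>=1. ?A n F : events & prob (?A n F) <= K * exp (- (real n * a))"
 proof
  fix F assume "F : T'"
  hence "cont_per T0 (fst F)" "cont_per T0 (snd F)" using T'(2) by blast+
  thus "EX K>0. ALL n>=1. ?A n F : events & prob (?A n F) <= K * exp (- (real n * a))" by (rule chebyshev)
 qed
 from bchoice[OF this] obtain K where K: "!!F. F : T' ==> K F > 0" "!!F n. F : T' ==> n >= 1 ==> ?A n F : events & prob (?A n F) <= K F * exp (- (real n * a))" by blast
 have sK: "(SUM F:T'. K F) > 0" using K(1) T'(1) by (intro sum_pos) (auto simp: T'_def)
 have "measure M {om : space M. emp n om : C} <= (SUM F:T'. K F) * exp (- (real n * a))" if n: "n >= 1" for n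
 proof (cases "{om : space M. emp n om : C} : events")
  case True
  have "{om : space M. emp n om : C} \<subseteq> (UN F:T'. ?A n F)"
  proof
   fix om assume w: "om : {om : space M. emp n om : C}"
   have "EX F:T'. lam (fst F) (snd F) + a <= ev (fst F) (snd F) (emp n om)"
   proof (cases "emp n om : ?K")
    case True
    hence "emp n om : \<Union>(?H ` T)" using T(3) w by blast
    thus ?thesis by (auto simp: T'_def intro: less_imp_le)
   qed (use w CM in \<open>auto simp: T'_def\<close>)
   then obtain F where F: "F : T'" "lam (fst F) (snd F) + a <= ev (fst F) (snd F) (emp n om)" by blast
   have "ev (fst F) (snd F) (emp n om) = psum n (fst F) (snd F) om / n" using w F(1) T'(2) n by (intro emp_ev) auto
   hence "psum n (fst F) (snd F) om = n * ev (fst F) (snd F) (emp n om)" using n by simp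
   hence "om : ?A n F" using w mult_left_mono[OF F(2), of "real n"] by simp
   thus "om : (UN F:T'. ?A n F)" using F(1) by blast
  qed
  hence "prob {om : space M. emp n om : C} <= prob (UN F:T'. ?A n F)" using K(2) n T'(1) by (intro finite_measure_mono sets.finite_UN) auto
  also have "... <= (SUM F:T'. prob (?A n F))" using K(2) n by (intro finite_measure_subadditive_finite T'(1)) auto
  also have "... <= (SUM F:T'. K F * exp (- (real n * a)))" using K(2) n by (intro sum_mono) auto
  finally show ?thesis by (simp add: sum_distrib_right)
 next
  \<comment> \<open>\<open>measure\<close> assigns 0 to sets that are not measurable.\<close>
  case False
  thus ?thesis using sK by (simp add: measure_notin_sets)
 qed
 thus ?thesis using sK by blast
qed

text \<open>The penalty \<open>et |th|\<^sup>2\<close> confines the almost minimiser \<open>th\<close> to a ball of radius \<open>r\<close>, on which the constants of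
 the second-order bound are uniform. The one-sided slopes \<open>w\<close> of \<open>lam\<close> at \<open>th\<close> then satisfy \<open>w \<approx> v - 2 et th\<close>.\<close>
lemma ldp_lower:
 assumes G: "openin (Mstar_top T0 E) G" and PQ: "PQ : G" and a: "0 <= a" "I PQ <= ennreal a" and de: "de > 0"
 shows "EX k>0. EX N. ALL n>=N. k * exp (- (real n * (a + de))) <= measure M {om : space M. emp n om : G}"
proof -
 have PQM: "PQ : Mstar T0 E" using openin_subset[OF G] PQ by (auto simp: Mstar_topspace)
 obtain S ep where S: "finite S" "ep > 0" "ALL F:S. cont_per T0 (fst F) & cont_per T0 (snd F)"
  "{PQ' : Mstar T0 E. ALL F:S. abs (ev (fst F) (snd F) PQ' - ev (fst F) (snd F) PQ) < ep} \<subseteq> G" by (rule Mstar_nbhd[OF G PQ])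
 define v where "v F = ev (fst F) (snd F) PQ" for F
 define Ff where "Ff th y t = (SUM F:S. th F * fst F y t)" for th y t
 define Fg where "Fg th e t = (SUM F:S. th F * snd F e t)" for th e t
 have Fc: "cont_per T0 (Ff th)" "cont_per T0 (Fg th)" for th
  using S(3) by (auto simp: cont_per_def Ff_def Fg_def intro!: continuous_intros)
 have evF: "ev (Ff th) (Fg th) PQ = (SUM F:S. th F * v F)" for th
 proof -
  have "ev (Ff th) (Fg th) PQ = ev (%y t. SUM F:S. th F * (if F : S then fst F else (%_ _. 0)) y t) (%y t. SUM F:S. th F * (if F : S then snd F else (%_ _. 0)) y t) PQ"
   by (simp add: Ff_def[abs_def] Fg_def[abs_def] cong: sum.cong)
  also have "... = (SUM F:S. th F * ev (if F : S then fst F else (%_ _. 0)) (if F : S then snd F else (%_ _. 0)) PQ)"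
   using S(3) by (intro ev_sum[OF PQM T0]) (auto simp: cont_per_def)
  finally show ?thesis by (simp add: v_def cong: sum.cong)
 qed
 have lam_ge: "(SUM F:S. th F * v F) - a <= lam (Ff th) (Fg th)" for th
  using dual[OF PQM a(1)] a(2) Fc evF by (metis diff_le_eq add.commute)
 \<comment> \<open>At the almost minimiser the penalty is at most \<open>a + 1\<close>. Multiplying
   by \<open>et\<close> gives \<open>(et * th F)\<^sup>2 <= (ep / 8)\<^sup>2\<close>: the radius is
   \<open>r\<close>, and the shift \<open>2 * et * th F\<close> of the slope is at most
   \<open>ep / 4\<close>.\<close>
 define et where "et = (ep / 8)\<^sup>2 / (a + 1)"
 have et: "et > 0" "et * (a + 1) = (ep / 8)\<^sup>2" using S(2) a by (auto simp: et_def)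
 define r where "r = ep / (8 * et)"
 have r: "r > 0" using S(2) et by (simp add: r_def)
 define c1 where "c1 = real (card S) * r"
 have c1: "0 <= c1" using r by (simp add: c1_def)
 have "ALL F:S. EX L>=0. (ALL y t. abs (fst F y t) <= L) & (ALL e t. abs (snd F e t) <= L)"
 proof
  fix F assume F: "F : S"
  obtain K K' where "K >= 0" "!!y t. abs (fst F y t) <= K" "!!e t. abs (snd F e t) <= K'"
   using cont_per_bounded[OF _ T0, of "fst F"] cont_per_bounded[OF _ T0, of "snd F"] S(3) F by metis
  thus "EX L>=0. (ALL y t. abs (fst F y t) <= L) & (ALL e t. abs (snd F e t) <= L)" by (intro exI[of _ "max K K'"]) (auto simp: le_max_iff_disj)
 qed
 from bchoice[OF this] obtain Lf where Lf: "!!F. F : S ==> 0 <= Lf F" "!!F y t. F : S ==> abs (fst F y t) <= Lf F" "!!F e t. F : S ==> abs (snd F e t) <= Lf F" by blast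
 define L where "L = (r + 1) * (SUM F:S. Lf F)"
 have tp: "test_pair L f g" if "cont_per T0 f" "cont_per T0 g" "!!y t. abs (f y t) <= L" "!!e t. abs (g e t) <= L" for f g
  using that unfolding test_pair_def cont_per_def by (auto intro: borel_measurable_continuous_onI)
 have sL: "Lf F <= (SUM F:S. Lf F)" if "F : S" for F using that Lf(1) S(1) by (intro member_le_sum) auto
 have LL: "0 <= (SUM F:S. Lf F)" "(SUM F:S. Lf F) <= L" "r * (SUM F:S. Lf F) <= L" "0 <= L"
  using Lf(1) r by (auto simp: L_def distrib_right intro!: sum_nonneg add_nonneg_nonneg mult_nonneg_nonneg)
 have tpF: "test_pair L (fst F) (snd F)" if "F : S" for F
 proof (rule tp)
  show "abs (fst F y t) <= L" "abs (snd F e t) <= L" for y e t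
   using Lf(2)[OF that, of y t] Lf(3)[OF that, of e t] sL[OF that] LL(2) by linarith+
 qed (use S(3) that in auto)
 have tpth: "test_pair L (Ff th) (Fg th)" if "ALL F:S. abs (th F) <= r" for th
 proof -
  have *: "abs (SUM F:S. th F * u F) <= L" if u: "!!F. F : S ==> abs (u F) <= Lf F" for u
  proof -
   have "abs (SUM F:S. th F * u F) <= (SUM F:S. abs (th F * u F))" by (rule sum_abs)
   also have "... <= (SUM F:S. r * Lf F)" unfolding abs_mult using u \<open>ALL F:S. \<bar>th F\<bar> <= r\<close> r by (intro sum_mono mult_mono) auto
   finally show ?thesis using LL(3) by (simp add: sum_distrib_left)
  qed
  have "abs (Ff th y t) <= L" "abs (Fg th e t) <= L" for y e t
   unfolding Ff_def Fg_def by (rule *, rule Lf(2), assumption) (rule *, rule Lf(3), assumption)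
  thus ?thesis by (intro tp Fc)
 qed
 obtain C2 s0 where C2: "C2 >= 0" "s0 > 0" "s0 <= 1"
  "ALL f g f1 g1. test_pair L f g --> test_pair L f1 g1 --> (EX a. ALL s. abs s <= s0 -->
   lam (%y u. f y u + s * f1 y u) (%e u. g e u + s * g1 e u) <= lam f g + s * a + C2 * s\<^sup>2)"
  by (rule lam_second_order[OF LL(4)]) blast
 define c2 where "c2 = C2 + et + 1"
 have c2: "c2 > 0" using C2(1) et by (simp add: c2_def)
 \<comment> \<open>Step length of the comparison; the minimum is approximated to within its square.
   The slopes are then known up to \<open>c2 * ka\<close>, which must be small against
   \<open>ep\<close> and, multiplied by the l1 norm of \<open>th\<close>, against
   \<open>de\<close>.\<close>
 define ka where "ka = min s0 (min (ep / (4 * c2)) (de / (2 * (c1 + 1) * c2)))"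
 have ka: "ka > 0" "ka <= s0" "c2 * ka <= ep / 4" "c2 * ka * (c1 + 1) <= de / 2"
 proof -
  have ka_le: "ka <= ep / (4 * c2)" "ka <= de / (2 * (c1 + 1) * c2)"
   unfolding ka_def by (rule min.coboundedI2, rule min.cobounded1) (rule min.coboundedI2, rule min.cobounded2)
  show "ka > 0" "ka <= s0" using C2 S(2) c2 de c1 by (auto simp: ka_def)
  have "c2 * ka <= c2 * (ep / (4 * c2))" "c2 * ka * (c1 + 1) <= c2 * (de / (2 * (c1 + 1) * c2)) * (c1 + 1)"
   using c2 c1 ka_le by (intro mult_left_mono mult_right_mono; simp)+
  moreover have "x * (de / (2 * y * x)) * y = de / 2" if "x ~= 0" "y ~= 0" for x y :: real using that by (simp add: field_simps)
  from this[of c2 "c1 + 1"] have "c2 * (de / (2 * (c1 + 1) * c2)) * (c1 + 1) = de / 2" using c2 c1 by simp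
  moreover have "c2 * (ep / (4 * c2)) = ep / 4" using c2 by simp
  ultimately show "c2 * ka <= ep / 4" "c2 * ka * (c1 + 1) <= de / 2" by linarith+
 qed
 define J where "J th = lam (Ff th) (Fg th) - (SUM F:S. th F * v F) + et * (SUM F:S. (th F)\<^sup>2)" for th
 have Jlo: "et * (SUM F:S. (th F)\<^sup>2) - a <= J th" for th using lam_ge[of th] by (simp add: J_def)
 have Jlo': "- a <= J th" for th
 proof -
  have "0 <= et * (SUM F:S. (th F)\<^sup>2)" using et(1) by (intro mult_nonneg_nonneg sum_nonneg) auto
  thus ?thesis using Jlo[of th] by linarith
 qed
 have bb: "bdd_below (range J)" using Jlo' by (intro bdd_belowI[of _ "- a"]) auto
 obtain th where th: "J th < Inf (range J) + ka\<^sup>2" using cInf_lessD[of "range J" "Inf (range J) + ka\<^sup>2"] ka(1) by auto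
 have near: "J th <= J th' + ka\<^sup>2" for th' using th cInf_lower[OF _ bb, of "J th'"] by (auto intro: less_imp_le order_trans)
 have "J (%_. 0) = 0" using lam_time[of "%_. 0"] by (simp add: J_def Ff_def[abs_def] Fg_def[abs_def])
 moreover have "ka\<^sup>2 <= 1" using ka C2 by (intro power_le_one) auto
 ultimately have th1: "et * (SUM F:S. (th F)\<^sup>2) <= a + 1" using near[of "%_. 0"] Jlo[of th] by linarith
 have th2: "et * abs (th F) <= ep / 8" if F: "F : S" for F
 proof (rule power2_le_imp_le)
  have "(th F)\<^sup>2 <= (SUM F:S. (th F)\<^sup>2)" using S(1) F by (intro member_le_sum) auto
  hence "et * (th F)\<^sup>2 <= a + 1" using th1 et(1) by (meson mult_left_mono less_imp_le order_trans)
  hence "et * (et * (th F)\<^sup>2) <= et * (a + 1)" using et(1) by (intro mult_left_mono) auto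
  thus "(et * abs (th F))\<^sup>2 <= (ep / 8)\<^sup>2" by (simp add: et(2) power_mult_distrib power2_eq_square mult_ac)
 qed (use S(2) in simp)
 have thr: "abs (th F) <= r" if "F : S" for F using th2[OF that] et(1) by (simp add: r_def field_simps)
 have ths: "(SUM F:S. abs (th F)) <= c1" unfolding c1_def using thr by (rule sum_bounded_above)
 note tpT = tpth[of th]
 have tpT: "test_pair L (Ff th) (Fg th)" using thr by (intro tpth) auto
 define l where "l = lam (Ff th) (Fg th)"
 define Gf where "Gf d y t = Ff th y t + snd d * fst (fst d) y t" for d :: "(('v tfun) \<times> (('v * 'v) tfun)) * real" and y t
 define Gg where "Gg d e t = Fg th e t + snd d * snd (fst d) e t" for d :: "(('v tfun) \<times> (('v * 'v) tfun)) * real" and e t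
 have "ALL F:S. EX w. ALL s. abs s <= s0 --> lam (Gf (F, s)) (Gg (F, s)) <= l + s * w + C2 * s\<^sup>2"
  using C2(4)[rule_format, OF tpT tpF] unfolding l_def Gf_def[abs_def] Gg_def[abs_def] fst_conv snd_conv by blast
 from bchoice[OF this] obtain w where w: "!!F s. F : S ==> abs s <= s0 ==> lam (Gf (F, s)) (Gg (F, s)) <= l + s * w F + C2 * s\<^sup>2" by blast
 \<comment> \<open>The values of \<open>J\<close> at \<open>th\<close> and at \<open>th\<close>
   moved by \<open>ka\<close> and \<open>- ka\<close> in direction \<open>F\<close> are compared:
   \<open>lam\<close> rises at most by its slope \<open>w F\<close> plus a quadratic term, and the
   tolerance is also quadratic.\<close>
 have vw: "abs (v F - w F - 2 * et * th F) <= c2 * ka" if F: "F : S" for F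
 proof -
  have q: "s * (v F - w F - 2 * et * th F) <= c2 * ka * ka" if s: "abs s = ka" for s
  proof -
   have up: "(SUM F':S. h F' ((th(F := th F + s)) F')) = (SUM F':S. h F' (th F')) + (h F (th F + s) - h F (th F))" for h :: "_ => real => real"
    using S(1) F by (simp add: sum.remove[of S F])
   have "Ff (th(F := th F + s)) = Gf (F, s)" "Fg (th(F := th F + s)) = Gg (F, s)"
    unfolding Ff_def[abs_def] Fg_def[abs_def] Gf_def[abs_def] Gg_def[abs_def]
    using up[of "%F' x. x * fst F' _ _"] up[of "%F' x. x * snd F' _ _"] by (simp_all add: fun_eq_iff distrib_right del: fun_upd_apply)
   hence "J (th(F := th F + s)) = lam (Gf (F, s)) (Gg (F, s)) - ((SUM F:S. th F * v F) + s * v F) + et * ((SUM F:S. (th F)\<^sup>2) + ((th F + s)\<^sup>2 - (th F)\<^sup>2))"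
    using up[of "%F' x. x * v F'"] up[of "%F' x. x\<^sup>2"] by (simp add: J_def distrib_right del: fun_upd_apply)
   with near[of "th(F := th F + s)"] w[OF F, of s] s ka(2)
   have "0 <= s * w F + C2 * s\<^sup>2 - s * v F + et * (2 * th F * s + s\<^sup>2) + ka\<^sup>2"
    by (simp add: J_def l_def[symmetric] power2_sum algebra_simps)
   moreover have "s\<^sup>2 = ka\<^sup>2" using s by (metis power2_abs)
   ultimately show ?thesis by (simp add: c2_def power2_eq_square algebra_simps)
  qed
  have "abs ka = ka" "abs (- ka) = ka" using ka(1) by auto
  note h = q[OF this(1), unfolded mult.commute[of "c2 * ka" ka]] q[OF this(2), unfolded minus_mult_commute mult.commute[of "c2 * ka" ka]]
  show ?thesis by (rule abs_leI) (rule mult_left_le_imp_le[OF h(1) ka(1)], rule mult_left_le_imp_le[OF h(2) ka(1)])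
 qed
 have vw': "abs (v F - w F) <= ep / 2" if "F : S" for F
 proof -
  have "abs (2 * et * th F) <= ep / 4" using th2[OF that] et(1) by (simp add: abs_mult)
  thus ?thesis using vw[OF that] ka(3) by linarith
 qed
 define ep' where "ep' = min (ep / 4) (de / (2 * (c1 + 1)))"
 have ep': "ep' > 0" using S(2) de c1 by (auto simp: ep'_def)
 have ep'4: "ep' <= ep / 4" unfolding ep'_def by (rule min.cobounded1)
 have "ep' * (c1 + 1) <= de / (2 * (c1 + 1)) * (c1 + 1)" using c1 by (intro mult_right_mono) (auto simp: ep'_def)
 also have "de / (2 * y) * y = de / 2" if "y ~= 0" for y :: real using that by simp
 from this[of "c1 + 1"] have "de / (2 * (c1 + 1)) * (c1 + 1) = de / 2" using c1 by simp
 finally have ep'c: "ep' * c1 <= de / 2" using ep' by (simp add: distrib_left)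
 \<comment> \<open>The cost of replacing \<open>v\<close> by \<open>w\<close>. The penalty
   contributes \<open>2 * et * (th F)\<^sup>2\<close> with the favourable sign, so only the errors
   \<open>c2 * ka\<close> and \<open>ep'\<close> are paid, each at most \<open>de / 2\<close> in
   total.\<close>
 have lw: "- (a + de) <= l - (SUM F:S. th F * w F) - ep' * (SUM F:S. abs (th F))"
 proof -
  have "(SUM F:S. - (c2 * ka * abs (th F))) <= (SUM F:S. th F * v F - th F * w F)"
  proof (rule sum_mono)
   fix F assume F: "F : S"
   have "abs (th F * (v F - w F - 2 * et * th F)) <= abs (th F) * (c2 * ka)" unfolding abs_mult by (intro mult_left_mono vw[OF F]) auto
   moreover have "0 <= et * (th F * th F)" using et(1) by simp
   ultimately show "- (c2 * ka * abs (th F)) <= th F * v F - th F * w F" by (simp add: abs_le_iff algebra_simps)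
  qed
  hence "- (c2 * ka * (SUM F:S. abs (th F))) <= (SUM F:S. th F * v F) - (SUM F:S. th F * w F)" by (simp add: sum_negf sum_distrib_left sum_subtractf)
  moreover have "c2 * ka * (SUM F:S. abs (th F)) <= c2 * ka * (c1 + 1)" "ep' * (SUM F:S. abs (th F)) <= ep' * c1"
   using c2 ka(1) ep' ths by (intro mult_left_mono; simp)+
  ultimately show ?thesis using lam_ge[of th] ka(4) ep'c unfolding l_def by linarith
 qed
 \<comment> \<open>Size of the additional tilt that detects deviations of size \<open>ep'\<close>.
   The gain \<open>sg * ep'\<close> exceeds the second-order cost \<open>C2 * sg\<^sup>2\<close> by
   at least \<open>ga\<close>.\<close>
 define sg where "sg = min s0 (ep' / (2 * (C2 + 1)))"
 have sg: "sg > 0" "sg <= s0" using C2 ep' by (auto simp: sg_def)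
 have "C2 * sg <= (C2 + 1) * (ep' / (2 * (C2 + 1)))" using C2(1) sg(1) by (intro mult_mono) (auto simp: sg_def)
 also have "y * (ep' / (2 * y)) = ep' / 2" if "y ~= 0" for y :: real using that by simp
 from this[of "C2 + 1"] have "(C2 + 1) * (ep' / (2 * (C2 + 1))) = ep' / 2" using C2(1) by simp
 finally have "C2 * sg <= ep' / 2" .
 hence sg2: "C2 * sg\<^sup>2 <= sg * (ep' / 2)" using mult_left_mono[of "C2 * sg" "ep' / 2" sg] sg(1) by (simp add: power2_eq_square mult_ac)
 define ga where "ga = sg * (ep' / 2)"
 have ga: "ga > 0" using sg(1) ep' by (simp add: ga_def)
 define D where "D = S \<times> {sg, - sg}"
 have D: "finite D" using S(1) by (simp add: D_def)
 let ?G = "%n d. psum n (Gf d) (Gg d)" and ?l = "%d. lam (Gf d) (Gg d)" and ?c = "%d. snd d * w (fst d) + sg * ep'"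
 have Gc: "cont_per T0 (Gf d)" "cont_per T0 (Gg d)" if "d : D" for d
  using that S(3) unfolding Gf_def[abs_def] Gg_def[abs_def] by (auto simp: D_def intro!: cont_per_add cont_per_cmult Fc)
 have "ALL d:D. EX K>0. ALL n>=1. integrable M (%om. exp (?G n d om)) &
   part_fun n (Gf d) (Gg d) <= K * exp (real n * ?l d)"
  using growthE[OF Gc] by metis
 from bchoice[OF this] obtain K where K: "!!d. d : D ==> K d > 0"
  "!!d n. d : D ==> n >= 1 ==> integrable M (%om. exp (?G n d om)) &
   part_fun n (Gf d) (Gg d) <= K d * exp (real n * ?l d)" by blast
 obtain k1 where k1: "k1 > 0" "!!n. n >= 1 ==> k1 * exp (real n * l) <= part_fun n (Ff th) (Fg th)"
  using test_pair_lam(1)[OF tpT] unfolding growth_def l_def by blast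
 define A where "A n = {om : space M. ALL F:S. abs (psum n (fst F) (snd F) om - n * w F) < n * ep'}" for n :: nat
 define b where "b = (SUM F:S. th F * w F) + ep' * (SUM F:S. abs (th F))"
 have Am: "A n : events" if "n >= 1" for n
 proof -
  have nT: "real n * T0 > 0" using that T0 by simp
  have m: "(%om. psum n (fst F) (snd F) om) : borel_measurable M" if "F : S" for F
   using path_fun_measurable[OF nT test_pair_bdd(1)[OF tpF[OF that]] test_pairD(4)[OF tpF[OF that]]] .
  show ?thesis unfolding A_def using S(1) m by (intro sets.sets_Collect_finite_All) (auto intro!: borel_measurable_less borel_measurable_abs borel_measurable_diff)
 qed
 \<comment> \<open>The exponential moment at \<open>th\<close> is split. On \<open>A n\<close> the
   integrand is at most \<open>exp (n * b)\<close>; off \<open>A n\<close> some functional deviates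
   by \<open>n * ep'\<close> in one direction, so one of the finitely many tilts in \<open>D\<close>
   dominates, with growth rate lower by \<open>ga\<close>. As the whole grows like
   \<open>exp (n * l)\<close>, \<open>A n\<close> must carry it.\<close>
 have main: "(k1 - (SUM d:D. K d) * exp (- (real n * ga))) * exp (real n * l) <= prob (A n) * exp (real n * b)" if n: "n >= 1" for n
 proof -
  let ?S = "%F om. psum n (fst F) (snd F) om"
  let ?e = "%d om. exp (- (n * ?c d)) * exp (?G n d om)"
  have "k1 * exp (real n * l) <= (LINT om|M. exp (psum n (Ff th) (Fg th) om))" using k1(2)[OF n] by (simp add: part_fun_def)
  also have "... <= (LINT om|M. indicator (A n) om * exp (real n * b) + (SUM d:D. ?e d om))"
  proof (intro integral_mono test_pair_lam(2)[OF tpT n] Bochner_Integration.integrable_add Bochner_Integration.integrable_sum integrable_mult_right integrable_mult_left integrable_real_indicator Am n)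
   fix om assume om: "om : space M"
   have bF: "bdd_borel (fst F y)" if "F : S" for F y using test_pair_bdd(1)[OF tpF[OF that]] .
   have SF: "psum n (Ff th) (Fg th) om = (SUM F:S. th F * ?S F om)"
    unfolding Ff_def[abs_def] Fg_def[abs_def] by (rule path_fun_sum[OF X_cadlag[OF om] S(1) bF])
   have SG: "?G n d om = (SUM F:S. th F * ?S F om) + snd d * ?S (fst d) om" if "d : D" for d
    using path_fun_lin[OF X_cadlag[OF om], of "Ff th" "fst (fst d)" "real n * T0" "snd d" "Fg th" "snd (fst d)"] test_pair_bdd(1)[OF tpT] bF that SF
    unfolding Gf_def[abs_def] Gg_def[abs_def] by (auto simp: D_def)
   show "exp (psum n (Ff th) (Fg th) om) <= indicator (A n) om * exp (real n * b) + (SUM d:D. ?e d om)"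
   proof (cases "om : A n")
    case True
    have "(SUM F:S. th F * ?S F om) <= (SUM F:S. n * (th F * w F) + n * (ep' * abs (th F)))"
    proof (rule sum_mono)
     fix F assume "F : S"
     hence "abs (?S F om - n * w F) <= n * ep'" using True by (auto simp: A_def)
     hence "abs (th F * (?S F om - n * w F)) <= abs (th F) * (n * ep')" unfolding abs_mult by (rule mult_left_mono) simp
     thus "th F * ?S F om <= n * (th F * w F) + n * (ep' * abs (th F))" by (simp add: abs_le_iff algebra_simps)
    qed
    also have "... = n * b" by (simp add: b_def sum.distrib sum_distrib_left distrib_left)
    finally have "exp (psum n (Ff th) (Fg th) om) <= indicator (A n) om * exp (real n * b)" using True SF by simp
    thus ?thesis by (rule add_increasing2[OF sum_nonneg, rotated]) simp
   next
    case False
    then obtain F where F: "F : S" "n * ep' <= abs (?S F om - n * w F)" using om by (auto simp: A_def not_less)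
    define s where "s = (if 0 <= ?S F om - n * w F then sg else - sg)"
    have "sg * (n * ep') <= sg * abs (?S F om - n * w F)" using F(2) sg(1) by simp
    also have "... = s * (?S F om - n * w F)" by (simp add: s_def abs_if right_diff_distrib)
    finally have "0 <= - (n * (s * w F + sg * ep')) + s * ?S F om" by (simp add: algebra_simps)
    moreover have d: "(F, s) : D" using F(1) by (simp add: D_def s_def)
    ultimately have "exp (psum n (Ff th) (Fg th) om) <= ?e (F, s) om" by (simp add: SF SG[OF d, simplified] mult_exp_exp)
    also have "... <= (SUM d:D. ?e d om)" using D by (intro member_le_sum[OF d]) auto
    finally show ?thesis using False by simp
   qed
  qed (use K(2) n in \<open>auto simp: emeasure_eq_measure\<close>)
  also have "... = prob (A n) * exp (real n * b) + (SUM d:D. exp (- (n * ?c d)) * part_fun n (Gf d) (Gg d))"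
  proof -
   have "integrable M (?e d)" if "d : D" for d using K(2)[OF that n] by simp
   moreover have "integrable M (%om. indicator (A n) om * exp (real n * b))" using Am[OF n] by (simp add: emeasure_eq_measure)
   moreover have "A n \<inter> space M = A n" using sets.sets_into_space[OF Am[OF n]] by blast
   ultimately show ?thesis by (simp add: part_fun_def)
  qed
  also have "(SUM d:D. exp (- (n * ?c d)) * part_fun n (Gf d) (Gg d)) <= (SUM d:D. K d * exp (n * (l - ga)))"
  proof (rule sum_mono)
   fix d assume d: "d : D"
   hence F: "fst d : S" "abs (snd d) = sg" using sg(1) by (auto simp: D_def)
   have "(snd d)\<^sup>2 = sg\<^sup>2" using F(2) by (metis power2_abs)
   hence "?l d <= l - ga + ?c d"
    using w[OF F(1), of "snd d"] F(2) sg(2) sg2 by (simp add: ga_def mult.commute)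
   hence "n * ?l d <= n * (l - ga + ?c d)" by (intro mult_left_mono) auto
   hence *: "- (n * ?c d) + n * ?l d <= n * (l - ga)" by (simp add: distrib_left)
   have "exp (- (n * ?c d)) * part_fun n (Gf d) (Gg d)
     <= exp (- (n * ?c d)) * (K d * exp (n * ?l d))"
    using K(2)[OF d n] by (intro mult_left_mono) auto
   also have "... = K d * exp (- (n * ?c d) + n * ?l d)" by (simp only: exp_add mult_ac)
   also have "... <= K d * exp (n * (l - ga))" using * K(1)[OF d] by (intro mult_left_mono) auto
   finally show "exp (- (n * ?c d)) * part_fun n (Gf d) (Gg d) <= K d * exp (n * (l - ga))" .
  qed
  finally have "k1 * exp (real n * l) <= prob (A n) * exp (real n * b) + (SUM d:D. K d) * exp (n * (l - ga))" by (simp add: sum_distrib_right)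
  moreover have "exp (n * (l - ga)) = exp (- (real n * ga)) * exp (real n * l)" by (simp add: mult_exp_exp algebra_simps)
  ultimately have "k1 * exp (real n * l) <= prob (A n) * exp (real n * b) + (SUM d:D. K d) * (exp (- (real n * ga)) * exp (real n * l))" by (simp only:)
  thus ?thesis by (simp only: left_diff_distrib mult.assoc diff_le_eq)
 qed
 have "filterlim (%n. ga * real n) at_top sequentially"
  by (rule filterlim_tendsto_pos_mult_at_top[OF tendsto_const ga filterlim_real_sequentially])
 hence gan: "filterlim (%n. real n * ga) at_top sequentially" by (simp only: mult.commute)
 have "(%n. (SUM d:D. K d) * exp (- (real n * ga))) \<longlonglongrightarrow> (SUM d:D. K d) * 0"
  by (intro tendsto_intros filterlim_compose[OF exp_at_bot] filterlim_compose[OF filterlim_uminus_at_bot_at_top] gan)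
 hence "\<forall>\<^sub>F n in sequentially. (SUM d:D. K d) * exp (- (real n * ga)) < k1 / 2" using k1(1) by (intro order_tendstoD) auto
 then obtain N where N: "!!n. n >= N ==> (SUM d:D. K d) * exp (- (real n * ga)) < k1 / 2" by (auto simp: eventually_sequentially)
 have "k1 / 2 * exp (- (real n * (a + de))) <= measure M {om : space M. emp n om : G}" if nN: "n >= max N 1" for n
 proof -
  have n: "n >= 1" "n >= N" using nN by auto
  have "k1 / 2 * exp (real n * l) <= prob (A n) * exp (real n * b)"
  proof -
   have "k1 / 2 <= k1 - (SUM d:D. K d) * exp (- (real n * ga))" using N[OF n(2)] by (simp add: field_simps)
   hence "k1 / 2 * exp (real n * l) <= (k1 - (SUM d:D. K d) * exp (- (real n * ga))) * exp (real n * l)" by (rule mult_right_mono) simp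
   thus ?thesis using main[OF n(1)] by linarith
  qed
  hence "k1 / 2 * exp (real n * l) * exp (- (real n * b)) <= prob (A n) * exp (real n * b) * exp (- (real n * b))" by (rule mult_right_mono) simp
  hence 1: "k1 / 2 * exp (real n * (l - b)) <= prob (A n)" by (simp add: mult.assoc mult_exp_exp right_diff_distrib)
  have "- (a + de) <= l - b" using lw by (simp add: b_def)
  from mult_left_mono[OF this, of "real n"] have "- (real n * (a + de)) <= real n * (l - b)" by (simp only: mult_minus_right of_nat_0_le_iff)
  hence "k1 / 2 * exp (- (real n * (a + de))) <= k1 / 2 * exp (real n * (l - b))" using k1(1) by (intro mult_left_mono) auto
  also have "... <= prob (A n)" by (rule 1)
  also have "... <= prob {om : space M. emp n om : G}"
  proof (rule finite_measure_mono_AE[OF _ emp_open_event[OF G n(1)]])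
   show "AE om in M. om : A n --> om : {om : space M. emp n om : G}"
    using emp_Mstar_AE[OF n(1)]
   proof eventually_elim
    case (elim om)
    show ?case
    proof
     assume om: "om : A n"
     hence ws: "om : space M" by (simp add: A_def)
     have "abs (ev (fst F) (snd F) (emp n om) - ev (fst F) (snd F) PQ) < ep" if F: "F : S" for F
     proof -
      have "abs (psum n (fst F) (snd F) om - n * w F) < n * ep'" using om F by (simp add: A_def)
      moreover have "psum n (fst F) (snd F) om = n * ev (fst F) (snd F) (emp n om)"
       using emp_ev[OF ws n(1), of "fst F" "snd F"] S(3) F n(1) by simp
      ultimately have "n * abs (ev (fst F) (snd F) (emp n om) - w F) < n * ep'" by (simp only: right_diff_distrib[symmetric] abs_mult abs_of_nat)
      hence "abs (ev (fst F) (snd F) (emp n om) - w F) < ep'" using n(1) by simp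
      thus ?thesis using vw'[OF F] ep'4 S(2) unfolding v_def by linarith
     qed
     thus "om : {om : space M. emp n om : G}" using S(4) elim ws by blast
    qed
   qed
  qed
  finally show ?thesis .
 qed
 thus ?thesis using k1(1) by (intro exI[of _ "k1 / 2"] conjI exI[of _ "max N 1"]) auto
qed

end

end

theorem theorem2:
  fixes r :: "'v::finite \<Rightarrow> 'v \<Rightarrow> real \<Rightarrow> real"
    and T0 :: real
    and p :: "real \<Rightarrow> real \<Rightarrow> 'v \<Rightarrow> 'v \<Rightarrow> real"
    and M :: "'w measure" and X :: "'w \<Rightarrow> real \<Rightarrow> 'v" and x :: 'v
  assumes T0_pos: "T0 > 0"
    and r_nonneg: "\<And>y z t. t \<ge> 0 \<Longrightarrow> r y z t \<ge> 0"
    and r_meas: "\<And>y z. r y z \<in> borel_measurable (restrict_space lborel {0..})"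
    and r_locint: "\<And>y z b. set_integrable lborel {0..b} (r y z)"
    and r_per: "\<And>y z t. t \<ge> 0 \<Longrightarrow> r y z (t + T0) = r y z t"
    and r_diag: "\<And>y t. t \<ge> 0 \<Longrightarrow> r y y t = 0"
    and A1: "\<And>y z. (\<exists>t>0. r y z t > 0) \<Longrightarrow> (\<forall>t>0. r y z t > 0)"
    and A2: "\<And>y z. (y, z) \<in> (Edges r)\<^sup>*"
    and A3_sup: "\<exists>B. \<forall>(y, z)\<in>Edges r. \<forall>t\<in>{0..T0}. r y z t \<le> B"
    and A3_inf: "\<exists>c>0. \<forall>(y, z)\<in>Edges r. \<forall>t\<in>{0..T0}. c \<le> r y z t"
    and A4: "{t \<in> {0..<T0}. \<exists>y z. \<not> isCont (\<lambda>s. r y z (pmod s T0)) t} \<in> null_sets lborel"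
    and trans: "kolmogorov_transition r p"
    and chain: "markov_chain M X p x"
  shows
    "(\<forall>a::real. compactin (Mstar_top T0 (Edges r)) {PQ \<in> Mstar T0 (Edges r). rate r T0 PQ \<le> ennreal a})
     \<and> (\<forall>\<mu>1 Q1 \<mu>2 Q2 \<mu> Q (l::real).
          (\<mu>1, Q1) \<in> Mstar T0 (Edges r) \<longrightarrow> (\<mu>2, Q2) \<in> Mstar T0 (Edges r) \<longrightarrow>
          (\<mu>, Q) \<in> Mstar T0 (Edges r) \<longrightarrow> 0 \<le> l \<longrightarrow> l \<le> 1 \<longrightarrow>
          (\<forall>A\<in>sets SpV. emeasure \<mu> A = ennreal l * emeasure \<mu>1 A + ennreal (1 - l) * emeasure \<mu>2 A) \<longrightarrow>
          (\<forall>A\<in>sets SpV. emeasure Q A = ennreal l * emeasure Q1 A + ennreal (1 - l) * emeasure Q2 A) \<longrightarrow>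
          rate r T0 (\<mu>, Q) \<le> ennreal l * rate r T0 (\<mu>1, Q1) + ennreal (1 - l) * rate r T0 (\<mu>2, Q2))
     \<and> (\<forall>C. closedin (Mstar_top T0 (Edges r)) C \<longrightarrow>
          limsup (\<lambda>n. eln (measure M {\<omega> \<in> space M. (emp_meas T0 n (X \<omega>), emp_flow T0 n (X \<omega>)) \<in> C})
                      / ereal (real n))
          \<le> - enn2ereal (INF PQ\<in>C. rate r T0 PQ))
     \<and> (\<forall>G. openin (Mstar_top T0 (Edges r)) G \<longrightarrow>
          liminf (\<lambda>n. eln (measure M {\<omega> \<in> space M. (emp_meas T0 n (X \<omega>), emp_flow T0 n (X \<omega>)) \<in> G})
                      / ereal (real n))
          \<ge> - enn2ereal (INF PQ\<in>G. rate r T0 PQ))"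
proof -
 define E where "E = Edges r"
 define R where "R y z t = r y z (pmod t T0)" for y z t
 obtain B where B: "!!y z t. (y, z) : E ==> t : {0..T0} ==> r y z t <= B" using A3_sup unfolding E_def by fast
 obtain c where c: "c > 0" "!!y z t. (y, z) : E ==> t : {0..T0} ==> c <= r y z t" using A3_inf unfolding E_def by fast
 note pb = pmod_bounds[OF T0_pos]
 have off: "r y z t = 0" if "(y, z) ~: E" "t >= 0" for y z t
 proof (cases "y = z")
  case False
  have pos: "r y z u = 0" if "u > 0" for u
  proof (rule ccontr)
   assume "r y z u ~= 0"
   hence "ALL t>0. r y z t > 0" using A1[of y z] r_nonneg[of u y z] that by force
   thus False using False \<open>(y, z) ~: E\<close> by (simp add: E_def Edges_def)
  qed
  \<comment> \<open>\<open>Edges\<close> speaks of positive times only; periodicity supplies time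
    0.\<close>
  show ?thesis using that(2) pos[of t] pos[of T0] r_per[of 0 y z] T0_pos by (cases "t = 0") auto
 qed (use r_diag that in auto)
 have shift: "r y z (u + real k * T0) = r y z u" if "u >= 0" for y z u k
 proof (induction k)
  case (Suc k)
  have "0 <= u + real k * T0" using that T0_pos by simp
  from r_per[OF this, of y z] Suc show ?case by (simp add: algebra_simps)
 qed simp
 have Rr: "R y z t = r y z t" if "t >= 0" for y z t
 proof -
  have "0 <= \<lfloor>t / T0\<rfloor>" using that T0_pos by simp
  hence "t = pmod t T0 + real (nat \<lfloor>t / T0\<rfloor>) * T0" using pmod_decomp[of t T0] by simp
  thus ?thesis unfolding R_def using shift[of "pmod t T0" y z "nat \<lfloor>t / T0\<rfloor>"] pb(1) by simp
 qed
 have "(%t. pmod t T0) : measurable borel (restrict_space lborel {0..})"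
  using pb by (intro measurable_restrict_space2) auto
 from measurable_compose[OF this r_meas] have Rm: "R y z : borel_measurable borel" for y z by (simp add: R_def[abs_def])
 have R0: "R y z t = 0" if "(y, z) ~: E" for y z t unfolding R_def using off[OF that] pb by simp
 have Rb: "0 <= R y z t" "R y z t <= max B 0" for y z t
 proof -
  show "0 <= R y z t" unfolding R_def using r_nonneg pb(1) by simp
  show "R y z t <= max B 0"
  proof (cases "(y, z) : E")
   case True
   thus ?thesis using B[OF True, of "pmod t T0"] pb[of t] by (simp add: R_def)
  qed (simp add: R0)
 qed
 have gR: "gen R w z u = gen r w z u" if "u >= 0" for w z u using Rr[OF that] by (simp add: gen_def)
 interpret periodic_chain R T0 "max B 0" c E p M X x
 proof
  show "T0 > 0" by (rule T0_pos)
  show "bdd_borel (R y z)" for y z using Rm Rb by (intro bdd_borelI[where K = "max B 0"]) auto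
  show "R y z (t + T0) = R y z t" for y z t using T0_pos by (simp add: R_def)
  show "c <= R y z t" if "(y, z) : E" for y z t unfolding R_def using c(2)[OF that] pb[of t] by simp
  show "(y, y) ~: E" for y by (simp add: E_def Edges_def)
  show "(y, z) : E\<^sup>*" for y z unfolding E_def by (rule A2)
  show "(%u. SUM w:UNIV. p s u y w * gen R w z u) integrable_on {s..t} &
   p s t y z = (if y = z then 1 else 0) + integral {s..t} (%u. SUM w:UNIV. p s u y w * gen R w z u)" if st: "0 <= s" "s <= t" for s t y z
  proof -
   have "(SUM w:UNIV. p s u y w * gen R w z u) = (SUM w:UNIV. p s u y w * gen r w z u)" if "u : {s..t}" for u
    using gR[of u] that st by simp
   hence "(%u. SUM w:UNIV. p s u y w * gen R w z u) integrable_on {s..t} \<longleftrightarrow> (%u. SUM w:UNIV. p s u y w * gen r w z u) integrable_on {s..t}"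
    "integral {s..t} (%u. SUM w:UNIV. p s u y w * gen R w z u) = integral {s..t} (%u. SUM w:UNIV. p s u y w * gen r w z u)"
    by (auto intro!: integrable_cong Henstock_Kurzweil_Integration.integral_cong)
   thus ?thesis using trans st unfolding kolmogorov_transition_def by simp
  qed
 qed (use Rb R0 c(1) chain in auto)
 have ae: "AE t in lborel. t : {0..<T0} --> (ALL y z. isCont (R y z) t)"
  using AE_not_in[OF A4] unfolding R_def[abs_def] by eventually_elim auto
 have ri: "rate_int r T0 E m q = rate_int R T0 E m q" for m q
  unfolding rate_int_def by (rule nn_integral_cong) (simp add: Rr indicator_def)
 have wit: "Lambda_wit T0 E (fst PQ) (snd PQ) (fst mq) (snd mq)"
  if L: "PQ : Lambda T0 E" and mq: "mq = (SOME mq. Lambda_wit T0 E (fst PQ) (snd PQ) (fst mq) (snd mq))" for PQ mq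
 proof -
  obtain m q where "Lambda_wit T0 E (fst PQ) (snd PQ) m q" using L by (cases PQ) (auto simp: Lambda_def)
  hence "EX mq. Lambda_wit T0 E (fst PQ) (snd PQ) (fst mq) (snd mq)" by (intro exI[of _ "(m, q)"]) simp
  thus ?thesis unfolding mq by (rule someI_ex)
 qed
 \<comment> \<open>\<open>rate\<close> evaluates the integral at a chosen pair of densities. Both
   inequalities hold for every pair of densities, so the choice does not matter.\<close>
 have dual: "rate r T0 PQ <= ennreal a \<longleftrightarrow> (ALL f g. cont_per T0 f --> cont_per T0 g --> ev f g PQ - lam f g <= a)"
  if PQ: "PQ : Mstar T0 E" and a: "0 <= a" for PQ a
 proof -
  define mq where "mq = (SOME mq. Lambda_wit T0 E (fst PQ) (snd PQ) (fst mq) (snd mq))"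
  have rt: "rate r T0 PQ = (if PQ : Lambda T0 E then rate_int R T0 E (fst mq) (snd mq) else \<infinity>)"
   unfolding rate_def Let_def mq_def E_def[symmetric] ri ..
  have PQ': "(fst PQ, snd PQ) : Mstar T0 E" using PQ by simp
  show ?thesis
  proof (intro iffI allI impI)
   fix f :: "'v tfun" and g :: "('v * 'v) tfun"
   assume *: "rate r T0 PQ <= ennreal a" "cont_per T0 f" "cont_per T0 g"
   hence L: "PQ : Lambda T0 E" using rt by (auto simp: top_unique split: if_splits)
   from conj_le_rate[OF ae PQ' wit[OF L mq_def] *(2,3)] *(1) rt L
   have "ennreal (ev f g PQ - lam f g) <= ennreal a" by (simp add: order_trans)
   thus "ev f g PQ - lam f g <= a" using a by simp
  next
   assume *: "ALL f g. cont_per T0 f --> cont_per T0 g --> ev f g PQ - lam f g <= a"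
   hence **: "!!f g. cont_per T0 f ==> cont_per T0 g ==> ev f g (fst PQ, snd PQ) - lam f g <= a" by simp
   have L: "PQ : Lambda T0 E" using conj_Lambda[OF PQ' **] by simp
   show "rate r T0 PQ <= ennreal a" using conj_rate_int[OF PQ' ** wit[OF L mq_def]] rt L by simp
  qed
 qed
 have um: "z <= - y" if "y <= - z" for z y :: ereal using ereal_minus_le_minus[of "- y" z] that by simp
 let ?p = "%A n. measure M {om : space M. (emp_meas T0 n (X om), emp_flow T0 n (X om)) : A}"
 have upper: "limsup (%n. eln (?p C n) / ereal (real n)) <= - enn2ereal (INF PQ\<in>C. rate r T0 PQ)"
  if C: "closedin (Mstar_top T0 E) C" for C
 proof -
  let ?L = "limsup (%n. eln (?p C n) / ereal (real n))" and ?m = "INF PQ\<in>C. rate r T0 PQ"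
  have "enn2ereal ?m <= - ?L"
  proof (rule dense_le)
   fix z assume z: "z < enn2ereal ?m"
   show "z <= - ?L"
   proof (cases "z < 0")
    \<comment> \<open>Below 0 it suffices that probabilities are at most 1.\<close>
    case True
    have "?L <= ereal (- 0)" by (rule limsup_eln_le[where K = 1]) auto
    hence "0 <= - ?L" by - (rule um, simp add: zero_ereal_def[symmetric])
    thus ?thesis using True by (meson less_imp_le order_trans)
   next
    case False
    then obtain a where a: "z = ereal a" "0 <= a" using z by (cases z) auto
    have "ennreal a < ?m" using z a by (simp add: less_ennreal.rep_eq enn2ereal_ennreal)
    hence "~ rate r T0 PQ <= ennreal a" if "PQ : C" for PQ using INF_lower[OF that, of "rate r T0"] by (meson leD less_le_trans not_le)
    from ldp_upper[OF dual C a(2) this] obtain K where K: "K > 0" "ALL n>=1. ?p C n <= K * exp (- (real n * a))" by blast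
    have "?L <= ereal (- a)" by (rule limsup_eln_le[of _ K]) (use K in auto)
    thus ?thesis unfolding a(1) by - (rule um, simp)
   qed
  qed
  thus ?thesis by (rule um)
 qed
 have lower: "- enn2ereal (INF PQ\<in>G. rate r T0 PQ) <= liminf (%n. eln (?p G n) / ereal (real n))"
  if G: "openin (Mstar_top T0 E) G" for G
 proof -
  let ?L = "liminf (%n. eln (?p G n) / ereal (real n))"
  \<comment> \<open>The comparison is made in \<open>ennreal\<close>, where the infimum lives. There
    \<open>- ?L\<close>, if negative, becomes 0; truncation only enlarges it, so the way back to
    \<open>ereal\<close> loses nothing.\<close>
  have "e2ennreal (- ?L) <= rate r T0 PQ" if PQ: "PQ : G" for PQ
  proof (cases "rate r T0 PQ")
   case (real a)
   have "ereal (- a) <= ?L"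
   proof (rule ereal_le_epsilon2)
    fix d :: real assume d: "0 < d"
    have "rate r T0 PQ <= ennreal a" using real by simp
    from ldp_lower[OF dual G PQ real(1) this d] obtain k N where "k > 0" "ALL n>=N. k * exp (- (real n * (a + d))) <= ?p G n" by blast
    hence "ereal (- (a + d)) <= ?L" by (intro liminf_eln_ge) auto
    thus "ereal (- a) <= ?L + ereal d" by (cases ?L) auto
   qed
   hence "- ?L <= ereal a" by (simp add: ereal_uminus_le_reorder)
   hence "e2ennreal (- ?L) <= e2ennreal (ereal a)" by (rule e2ennreal_mono)
   thus ?thesis using real by simp
  qed simp
  hence "e2ennreal (- ?L) <= (INF PQ\<in>G. rate r T0 PQ)" by (intro INF_greatest)
  hence "enn2ereal (e2ennreal (- ?L)) <= enn2ereal (INF PQ\<in>G. rate r T0 PQ)" by (simp add: less_eq_ennreal.rep_eq)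
  moreover have "- ?L <= enn2ereal (e2ennreal (- ?L))" by (cases "0 <= - ?L") (auto simp: enn2ereal_e2ennreal e2ennreal_neg zero_ennreal.rep_eq not_le less_imp_le)
  ultimately have "- ?L <= enn2ereal (INF PQ\<in>G. rate r T0 PQ)" by (rule order_trans[rotated])
  thus ?thesis by (simp add: ereal_uminus_le_reorder)
 qed
 show ?thesis
  unfolding E_def[symmetric]
  by (intro conjI allI impI; (rule ldp_good[OF dual] ldp_convex[OF dual] upper lower; assumption))
qed

end
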